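(* Suppose $V\in\widehat K_M$, $\Delta\in S(\mathfrak s_{\mathbb C})^K$ and $\Phi\in\mathrm{Hom}_K(V,C^\infty(\mathfrak s))$. (i) We have $$\partial(\Delta)\circ\Phi\in\mathrm{Hom}_K(V,C^\infty(\mathfrak s)),\quad \mathscr D(\gamma_0(\Delta))\circ\Gamma_0^V(\Phi)\in\mathrm{Hom}_W(V^M,C^\infty(\mathfrak a)),\quad \mathscr D(\gamma_0(\Delta))\circ\tilde\Gamma_0^V(\Phi)\in\mathrm{Hom}_W(V^M_{\mathrm{single}},C^\infty(\mathfrak a)),$$ and $$\tilde\Gamma_0^V(\partial(\Delta)\circ\Phi)=\mathscr D(\gamma_0(\Delta))\circ\tilde\Gamma_0^V(\Phi).$$ (ii) If $\Phi\in\mathrm{Hom}_K^{2\to2}(V,C^\infty(\mathfrak s))$ then $\partial(\Delta)\circ\Phi\in\mathrm{Hom}_K^{2\to2}(V,C^\infty(\mathfrak s))$. Hence for such $\Phi$ $$\Gamma_0^V(\partial(\Delta)\circ\Phi)=\mathscr D(\gamma_0(\Delta))\circ\Gamma_0^V(\Phi).\qquad( * )$$ (iii) If $V\in\widehat K_{\mathrm{sp}}$ then $( * )$ always holds.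
   Context: Setting. $G$ is a real Lie group with semisimple Lie algebra $\mathfrak g$ and fixed Iwasawa decomposition $\mathfrak g=\mathfrak k+\mathfrak a+\mathfrak n$; assume $\mathrm{Ad}(g)$ is an inner automorphism of $\mathfrak g_{\mathbb C}$ for all $g\in G$ and $K:=N_G(\mathfrak k)$ (normalizer) is compact. $\theta$ is the Cartan involution fixing $\mathfrak k$, $\mathfrak s$ its $-1$-eigenspace in $\mathfrak g$, $B$ the Killing form, $A$ the analytic subgroup of $\mathfrak a$, $M$ the centralizer of $A$ in $K$, $W=N_K(\mathfrak a)/M$ the Weyl group. $\Sigma$ is the restricted root system of $(\mathfrak g,\mathfrak a)$ with root spaces $\mathfrak g_\alpha$, $\Sigma^+$ the positive system corresponding to $\mathfrak n$, $s_\alpha\in W$ the reflections, $H_\mu\in\mathfrak a_{\mathbb C}$ is defined by $\mu(H)=B(H_\mu,H)$. Subscript $\mathbb C$ means complexification. $K$-types. $\widehat K$ is the set of irreducible unitary representations of $K$; $\widehat K_M=\{V\in\widehat K: V^M\neq0\}$. For $V\in\widehat K_M$, $V^M$ is a $W$-module. For $\alpha\in\Sigma$ fix $E_\alpha\in\mathfrak g_\alpha$ with $-B(E_\alpha,\theta E_\alpha)=2/B(H_\alpha,H_\alpha)$ and put $Z_\alpha=E_\alpha+\theta E_\alpha\in\mathfrak k$. Put $V^M_{\mathrm{single}}=\{v\in V^M: Z_\alpha(Z_\alpha^2+4)v=0\ \forall\alpha\in\Sigma\}$ and $V^M_{\mathrm{double}}=V^M\cap\sum_{\alpha\in\Sigma,m\in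 M}mZ_\alpha(Z_\alpha^2+4)V$; these are $W$-submodules and $V^M=V^M_{\mathrm{single}}\oplus V^M_{\mathrm{double}}$. $\widehat K_{\mathrm{sp}}=\{V\in\widehat K_M: V^M_{\mathrm{single}}=V^M\}$ (single-petaled $K$-types). Restriction. $\gamma_0:C^\infty(\mathfrak s)\to C^\infty(\mathfrak a)$ is restriction of functions. Via $B$, $S(\mathfrak s_{\mathbb C})$ and $S(\mathfrak a_{\mathbb C})$ are identified with the algebras of polynomial functions on $\mathfrak s$ and $\mathfrak a$, so restriction also gives $\gamma_0:S(\mathfrak s_{\mathbb C})\to S(\mathfrak a_{\mathbb C})$. For $\Phi\in\mathrm{Hom}_K(V,C^\infty(\mathfrak s))$, $\Gamma_0^V(\Phi):=\gamma_0\circ\Phi|_{V^M}\in\mathrm{Hom}_W(V^M,C^\infty(\mathfrak a))$ and $\tilde\Gamma_0^V(\Phi):=\gamma_0\circ\Phi|_{V^M_{\mathrm{single}}}$. $\mathrm{Hom}_K^{2\to2}(V,C^\infty(\mathfrak s))=\{\Phi\in\mathrm{Hom}_K(V,C^\infty(\mathfrak s)):\Gamma_0^V(\Phi)[V^M_{\mathrm{double}}]=\{0\}\}$. Operators. $\partial:S(\mathfrak s_{\mathbb C})\to\mathrm{End}_{\mathbb C}C^\infty(\mathfrak s)$ is the algebra homomorphism sending $X\in\mathfrak s$ to the $X$-directional derivative; similarly $\partial(\xi)$ on $\mathfrak a$. Let $R=2\Sigma$, $R^+=2\Sigma^+$, $R_1=R\setminus2R$, $R_1^+=R_1\cap R^+$,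 and for $\alpha\in R_1$ put $\mathbf m_0(\alpha)=\frac12\dim\mathfrak g_{\alpha/2}$ if $2\alpha\notin R$, $\mathbf m_0(\alpha)=\frac12(\dim\mathfrak g_{\alpha/2}+\dim\mathfrak g_\alpha)$ if $2\alpha\in R$. The Dunkl operators are $\mathscr D(\xi)=\partial(\xi)+\sum_{\alpha\in R_1^+}\mathbf m_0(\alpha)\frac{\alpha(\xi)}{\alpha}(1-s_\alpha)\in\mathrm{End}_{\mathbb C}C^\infty(\mathfrak a)$ for $\xi\in\mathfrak a$; they commute (Dunkl), so $\mathscr D$ extends to an algebra homomorphism $S(\mathfrak a_{\mathbb C})\to\mathrm{End}_{\mathbb C}C^\infty(\mathfrak a)$. *)

theory Defs
  imports
    "HOL-Analysis.Analysis"
    "HOL-Algebra.Coset"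
    "HOL-Algebra.Generated_Groups"
    "HOL-Library.Function_Algebras"
begin

section \<open>Smooth functions on open subsets of a finite-dimensional space\<close>

text \<open>
  A finite-dimensional real vector space is a linear subspace \<open>E\<close> of a Euclidean space, so that
  the zero space is included.  The ambient inner product is used only for its topology.
\<close>

definition dir_deriv :: "'a::real_normed_vector \<Rightarrow> ('a \<Rightarrow> 'b::real_normed_vector) \<Rightarrow> 'a \<Rightarrow> 'b" where
  "dir_deriv X f x = vector_derivative (\<lambda>t::real. f (x + t *\<^sub>R X)) (at 0)"

text \<open>\<open>C_on k E U f\<close>: all iterated directional derivatives of \<open>f\<close> of order at most \<open>k\<close>, along
  directions in \<open>E\<close>, exist and are continuous on the relatively open subset \<open>U\<close> of \<open>E\<close>.\<close>

primrec C_on :: "nat \<Rightarrow> 'a::real_normed_vector set \<Rightarrow> 'a set \<Rightarrow> ('a \<Rightarrow> 'b::real_normed_vector) \<Rightarrow> bool" where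
  "C_on 0 E U f \<longleftrightarrow> continuous_on U f"
| "C_on (Suc k) E U f \<longleftrightarrow> continuous_on U f \<and>
     (\<forall>X\<in>E. (\<forall>x\<in>U. (\<lambda>t::real. f (x + t *\<^sub>R X)) differentiable (at 0)) \<and> C_on k E U (dir_deriv X f))"

definition smooth_on :: "'a::real_normed_vector set \<Rightarrow> 'a set \<Rightarrow> ('a \<Rightarrow> 'b::real_normed_vector) \<Rightarrow> bool" where
  "smooth_on E U f \<longleftrightarrow> (\<forall>k. C_on k E U f)"


section \<open>Smooth manifolds and Lie groups\<close>

type_synonym ('a, 'e) chart = "'a set \<times> ('a \<Rightarrow> 'e)"

text \<open>\<open>smooth_manifold T E A\<close>: \<open>A\<close> is a (not necessarily maximal) smooth atlas, with values in the
  vector space \<open>E\<close>, on the topological space \<open>T\<close>.\<close>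

definition smooth_manifold ::
  "'a topology \<Rightarrow> 'e::real_normed_vector set \<Rightarrow> ('a, 'e) chart set \<Rightarrow> bool" where
  "smooth_manifold T E A \<longleftrightarrow>
     Hausdorff_space T \<and> second_countable T \<and> subspace E \<and>
     (\<Union>(U, \<phi>)\<in>A. U) = topspace T \<and>
     (\<forall>(U, \<phi>)\<in>A. openin T U \<and> openin (top_of_set E) (\<phi> ` U) \<and>
        homeomorphic_map (subtopology T U) (top_of_set (\<phi> ` U)) \<phi>) \<and>
     (\<forall>(U, \<phi>)\<in>A. \<forall>(V, \<psi>)\<in>A. smooth_on E (\<phi> ` (U \<inter> V)) (\<psi> \<circ> inv_into U \<phi>))"

definition smooth_map ::
  "'a topology \<Rightarrow> 'e::real_normed_vector set \<Rightarrow> ('a, 'e) chart set \<Rightarrow>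
   'b topology \<Rightarrow> ('b, 'f::real_normed_vector) chart set \<Rightarrow> ('a \<Rightarrow> 'b) \<Rightarrow> bool" where
  "smooth_map T E A T' A' f \<longleftrightarrow>
     continuous_map T T' f \<and>
     (\<forall>(U, \<phi>)\<in>A. \<forall>(V, \<psi>)\<in>A'. smooth_on E (\<phi> ` (U \<inter> f -` V)) (\<psi> \<circ> f \<circ> inv_into U \<phi>))"

definition prod_atlas ::
  "('a, 'e) chart set \<Rightarrow> ('b, 'f) chart set \<Rightarrow> ('a \<times> 'b, 'e \<times> 'f) chart set" where
  "prod_atlas A A' = {(U \<times> V, map_prod \<phi> \<psi>) | U \<phi> V \<psi>. (U, \<phi>) \<in> A \<and> (V, \<psi>) \<in> A'}"

text \<open>The field \<open>chart1\<close> is a chart around the neutral element.  It identifies the tangent space at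
  the neutral element, and hence the Lie algebra, with the model space \<open>liealg\<close> of the atlas.\<close>

record ('a, 'e) lie_data = "'a monoid" +
  gtop :: "'a topology"
  liealg :: "'e set"
  atlas :: "('a, 'e) chart set"
  chart1 :: "('a, 'e) chart"

definition lie_group :: "('a, 'e::euclidean_space, 'm) lie_data_scheme \<Rightarrow> bool" where
  "lie_group G \<longleftrightarrow>
     group G \<and> topspace (gtop G) = carrier G \<and>
     smooth_manifold (gtop G) (liealg G) (atlas G) \<and>
     smooth_map (prod_topology (gtop G) (gtop G)) (liealg G \<times> liealg G) (prod_atlas (atlas G) (atlas G))
       (gtop G) (atlas G) (\<lambda>(x, y). x \<otimes>\<^bsub>G\<^esub> y) \<and>
     smooth_map (gtop G) (liealg G) (atlas G) (gtop G) (atlas G) (\<lambda>x. inv\<^bsub>G\<^esub> x) \<and>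
     chart1 G \<in> atlas G \<and> \<one>\<^bsub>G\<^esub> \<in> fst (chart1 G)"

text \<open>A curve through the neutral element with velocity \<open>X\<close> there (defined for small \<open>t\<close>).\<close>

definition curve1 :: "('a, 'e::euclidean_space, 'm) lie_data_scheme \<Rightarrow> 'e \<Rightarrow> real \<Rightarrow> 'a" where
  "curve1 G X t = inv_into (fst (chart1 G)) (snd (chart1 G)) (snd (chart1 G) \<one>\<^bsub>G\<^esub> + t *\<^sub>R X)"

text \<open>\<open>Ad g\<close> is the differential at the neutral element of conjugation by \<open>g\<close>, and the bracket is
  \<open>[X, Y] = ad X Y\<close>, where \<open>ad\<close> is the differential of \<open>Ad\<close> at the neutral element.\<close>

definition Ad :: "('a, 'e::euclidean_space, 'm) lie_data_scheme \<Rightarrow> 'a \<Rightarrow> 'e \<Rightarrow> 'e" where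
  "Ad G g Y = vector_derivative
     (\<lambda>t. snd (chart1 G) (g \<otimes>\<^bsub>G\<^esub> curve1 G Y t \<otimes>\<^bsub>G\<^esub> inv\<^bsub>G\<^esub> g)) (at 0)"

definition bracket :: "('a, 'e::euclidean_space, 'm) lie_data_scheme \<Rightarrow> 'e \<Rightarrow> 'e \<Rightarrow> 'e" where
  "bracket G X Y = vector_derivative (\<lambda>t. Ad G (curve1 G X t) Y) (at 0)"

definition one_param_subgroup ::
  "('a, 'e::euclidean_space, 'm) lie_data_scheme \<Rightarrow> 'e \<Rightarrow> (real \<Rightarrow> 'a) \<Rightarrow> bool" where
  "one_param_subgroup G X \<gamma> \<longleftrightarrow>
     (\<forall>s t. \<gamma> (s + t) = \<gamma> s \<otimes>\<^bsub>G\<^esub> \<gamma> t) \<and>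
     smooth_map euclidean (UNIV::real set) {(UNIV, id)} (gtop G) (atlas G) \<gamma> \<and>
     ((\<lambda>t. snd (chart1 G) (\<gamma> t)) has_vector_derivative X) (at 0)"

definition analytic_subgroup :: "('a, 'e::euclidean_space, 'm) lie_data_scheme \<Rightarrow> 'e set \<Rightarrow> 'a set" where
  "analytic_subgroup G \<hh> = generate G {\<gamma> 1 | X \<gamma>. X \<in> \<hh> \<and> one_param_subgroup G X \<gamma>}"

definition trace_on :: "'e::real_vector set \<Rightarrow> ('e \<Rightarrow> 'e) \<Rightarrow> real" where
  "trace_on E T = (let B = SOME B. B \<subseteq> E \<and> independent B \<and> span B = E
                   in \<Sum>b\<in>B. representation B (T b) b)"

definition killing :: "('a, 'e::euclidean_space, 'm) lie_data_scheme \<Rightarrow> 'e \<Rightarrow> 'e \<Rightarrow> real" where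
  "killing G X Y = trace_on (liealg G) (\<lambda>Z. bracket G X (bracket G Y Z))"

definition lie_ideal :: "('a, 'e::euclidean_space, 'm) lie_data_scheme \<Rightarrow> 'e set \<Rightarrow> bool" where
  "lie_ideal G I \<longleftrightarrow> subspace I \<and> I \<subseteq> liealg G \<and> (\<forall>X\<in>liealg G. \<forall>Y\<in>I. bracket G X Y \<in> I)"

definition lie_solvable :: "('a, 'e::euclidean_space, 'm) lie_data_scheme \<Rightarrow> 'e set \<Rightarrow> bool" where
  "lie_solvable G I \<longleftrightarrow> (\<exists>n. ((\<lambda>J. span {bracket G X Y | X Y. X \<in> J \<and> Y \<in> J}) ^^ n) I = {0})"

definition semisimple :: "('a, 'e::euclidean_space, 'm) lie_data_scheme \<Rightarrow> bool" where
  "semisimple G \<longleftrightarrow> (\<forall>I. lie_ideal G I \<and> lie_solvable G I \<longrightarrow> I = {0})"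

text \<open>The complexified Lie algebra is \<open>liealg G \<times> liealg G\<close>, where \<open>(X, Y)\<close> stands for \<open>X + iY\<close>.\<close>

definition cbracket :: "('a, 'e::euclidean_space, 'm) lie_data_scheme \<Rightarrow> 'e \<times> 'e \<Rightarrow> 'e \<times> 'e \<Rightarrow> 'e \<times> 'e" where
  "cbracket G Z W =
     (bracket G (fst Z) (fst W) - bracket G (snd Z) (snd W),
      bracket G (fst Z) (snd W) + bracket G (snd Z) (fst W))"

definition exp_ad :: "('a, 'e::euclidean_space, 'm) lie_data_scheme \<Rightarrow> 'e \<times> 'e \<Rightarrow> 'e \<times> 'e \<Rightarrow> 'e \<times> 'e" where
  "exp_ad G Z W = (\<Sum>n. ((cbracket G Z ^^ n) W) /\<^sub>R fact n)"

text \<open>The group generated by the automorphisms \<open>exp (ad Z)\<close>; inverses need not be added, since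
  \<open>exp (ad Z)\<close> has the inverse \<open>exp (ad (-Z))\<close>.\<close>

inductive_set inner_automorphisms ::
  "('a, 'e::euclidean_space, 'm) lie_data_scheme \<Rightarrow> ('e \<times> 'e \<Rightarrow> 'e \<times> 'e) set"
  for G :: "('a, 'e::euclidean_space, 'm) lie_data_scheme" where
  "id \<in> inner_automorphisms G"
| "h \<in> inner_automorphisms G \<Longrightarrow> Z \<in> liealg G \<times> liealg G \<Longrightarrow> exp_ad G Z \<circ> h \<in> inner_automorphisms G"

definition Ad_inner :: "('a, 'e::euclidean_space, 'm) lie_data_scheme \<Rightarrow> 'a \<Rightarrow> bool" where
  "Ad_inner G g \<longleftrightarrow> (\<exists>h\<in>inner_automorphisms G. \<forall>X\<in>liealg G. \<forall>Y\<in>liealg G. h (X, Y) = (Ad G g X, Ad G g Y))"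

definition lie_normalizer :: "('a, 'e::euclidean_space, 'm) lie_data_scheme \<Rightarrow> 'e set \<Rightarrow> 'a set" where
  "lie_normalizer G \<hh> = {g \<in> carrier G. Ad G g ` \<hh> = \<hh>}"


section \<open>Functions on a subspace\<close>

text \<open>
  Throughout, a function on a subset is represented by its extension by \<open>0\<close> to the whole type.
  The pointwise operations on functions then restrict to those on the represented functions.
  The same convention is used for linear functionals, for operators (which are \<open>0\<close> outside the
  space of smooth functions) and for intertwining maps.
\<close>

definition ext0 :: "'a set \<Rightarrow> ('a \<Rightarrow> 'b::zero) \<Rightarrow> 'a \<Rightarrow> 'b" where
  "ext0 S f = (\<lambda>x. if x \<in> S then f x else 0)"

definition Cinf :: "'e::euclidean_space set \<Rightarrow> ('e \<Rightarrow> complex) set" where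
  "Cinf E = {f. (\<forall>x. x \<notin> E \<longrightarrow> f x = 0) \<and> smooth_on E E f}"

definition dual_space :: "'e::euclidean_space set \<Rightarrow> ('e \<Rightarrow> real) set" where
  "dual_space E = {ext0 E l | l. linear l}"

inductive_set Pol :: "'e::euclidean_space set \<Rightarrow> ('e \<Rightarrow> complex) set" for E :: "'e set" where
  "ext0 E (\<lambda>_. c) \<in> Pol E"
| "l \<in> dual_space E \<Longrightarrow> (\<lambda>x. complex_of_real (l x)) \<in> Pol E"
| "p \<in> Pol E \<Longrightarrow> q \<in> Pol E \<Longrightarrow> p + q \<in> Pol E"
| "p \<in> Pol E \<Longrightarrow> q \<in> Pol E \<Longrightarrow> p * q \<in> Pol E"

definition End_Cinf :: "'e::euclidean_space set \<Rightarrow> (('e \<Rightarrow> complex) \<Rightarrow> ('e \<Rightarrow> complex)) set" where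
  "End_Cinf E = {T. (\<forall>f\<in>Cinf E. T f \<in> Cinf E) \<and> (\<forall>f. f \<notin> Cinf E \<longrightarrow> T f = 0) \<and>
     (\<forall>f\<in>Cinf E. \<forall>g\<in>Cinf E. T (f + g) = T f + T g) \<and>
     (\<forall>c. \<forall>f\<in>Cinf E. T (\<lambda>x. c * f x) = (\<lambda>x. c * T f x))}"

text \<open>Let \<open>B\<close> be a bilinear form, nondegenerate on \<open>E\<close>.  The symmetric algebra of the
  complexification of \<open>E\<close> is identified with \<open>Pol E\<close>, where \<open>X \<in> E\<close> corresponds to the linear
  function \<open>B X\<close>.  Then \<open>sym_hom E B D\<close> is the (unique) extension of the linear map \<open>D\<close> on \<open>E\<close> to a
  homomorphism of unital complex algebras; it exists if the operators \<open>D X\<close> commute.\<close>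

definition sym_hom ::
  "'e::euclidean_space set \<Rightarrow> ('e \<Rightarrow> 'e \<Rightarrow> real) \<Rightarrow> ('e \<Rightarrow> ('e \<Rightarrow> complex) \<Rightarrow> ('e \<Rightarrow> complex)) \<Rightarrow>
   ('e \<Rightarrow> complex) \<Rightarrow> ('e \<Rightarrow> complex) \<Rightarrow> ('e \<Rightarrow> complex)" where
  "sym_hom E B D = (THE h.
     (\<forall>p\<in>Pol E. h p \<in> End_Cinf E) \<and> (\<forall>p. p \<notin> Pol E \<longrightarrow> h p = 0) \<and>
     h (ext0 E (\<lambda>_. 1)) = ext0 (Cinf E) id \<and>
     (\<forall>p\<in>Pol E. \<forall>q\<in>Pol E. h (p + q) = h p + h q) \<and>
     (\<forall>p\<in>Pol E. \<forall>q\<in>Pol E. h (p * q) = h p \<circ> h q) \<and>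
     (\<forall>c. \<forall>p\<in>Pol E. h (\<lambda>x. c * p x) = (\<lambda>f x. c * h p f x)) \<and>
     (\<forall>X\<in>E. h (ext0 E (\<lambda>x. complex_of_real (B X x))) = D X))"

definition deriv_op :: "'e::euclidean_space set \<Rightarrow> 'e \<Rightarrow> ('e \<Rightarrow> complex) \<Rightarrow> ('e \<Rightarrow> complex)" where
  "deriv_op E X = ext0 (Cinf E) (\<lambda>f. ext0 E (dir_deriv X f))"


section \<open>Semisimple Lie groups with a fixed Iwasawa decomposition\<close>

text \<open>\<open>rootvec G \<alpha>\<close> is the chosen root vector \<open>E\<^sub>\<alpha>\<close>.\<close>

record ('a, 'e) iwasawa_data = "('a, 'e) lie_data" +
  kk :: "'e set"
  aa :: "'e set"
  nn :: "'e set"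
  cartan :: "'e \<Rightarrow> 'e"
  rootvec :: "('e \<Rightarrow> real) \<Rightarrow> 'e"

definition cartan_involution ::
  "('a, 'e::euclidean_space, 'm) lie_data_scheme \<Rightarrow> ('e \<Rightarrow> 'e) \<Rightarrow> bool" where
  "cartan_involution G \<theta> \<longleftrightarrow>
     (\<forall>X\<in>liealg G. \<theta> X \<in> liealg G \<and> \<theta> (\<theta> X) = X) \<and>
     (\<forall>X\<in>liealg G. \<forall>Y\<in>liealg G. \<theta> (X + Y) = \<theta> X + \<theta> Y \<and> \<theta> (bracket G X Y) = bracket G (\<theta> X) (\<theta> Y)) \<and>
     (\<forall>c. \<forall>X\<in>liealg G. \<theta> (c *\<^sub>R X) = c *\<^sub>R \<theta> X) \<and>
     (\<forall>X\<in>liealg G. X \<noteq> 0 \<longrightarrow> - killing G X (\<theta> X) > 0)"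

definition ss :: "('a, 'e::euclidean_space) iwasawa_data \<Rightarrow> 'e set" where
  "ss G = {X \<in> liealg G. cartan G X = - X}"

definition abelian_subspace :: "('a, 'e::euclidean_space, 'm) lie_data_scheme \<Rightarrow> 'e set \<Rightarrow> bool" where
  "abelian_subspace G \<bb> \<longleftrightarrow> subspace \<bb> \<and> (\<forall>X\<in>\<bb>. \<forall>Y\<in>\<bb>. bracket G X Y = 0)"

definition root_space :: "('a, 'e::euclidean_space) iwasawa_data \<Rightarrow> ('e \<Rightarrow> real) \<Rightarrow> 'e set" where
  "root_space G \<alpha> = {X \<in> liealg G. \<forall>H\<in>aa G. bracket G H X = \<alpha> H *\<^sub>R X}"

definition roots :: "('a, 'e::euclidean_space) iwasawa_data \<Rightarrow> ('e \<Rightarrow> real) set" where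
  "roots G = {\<alpha> \<in> dual_space (aa G). \<alpha> \<noteq> 0 \<and> root_space G \<alpha> \<noteq> {0}}"

definition positive_system :: "('a, 'e::euclidean_space) iwasawa_data \<Rightarrow> ('e \<Rightarrow> real) set \<Rightarrow> bool" where
  "positive_system G P \<longleftrightarrow>
     (\<exists>H\<in>aa G. (\<forall>\<alpha>\<in>roots G. \<alpha> H \<noteq> 0) \<and> P = {\<alpha> \<in> roots G. \<alpha> H > 0})"

definition pos_roots :: "('a, 'e::euclidean_space) iwasawa_data \<Rightarrow> ('e \<Rightarrow> real) set" where
  "pos_roots G = {\<alpha> \<in> roots G. root_space G \<alpha> \<subseteq> nn G}"

definition iwasawa_decomposition :: "('a, 'e::euclidean_space) iwasawa_data \<Rightarrow> bool" where
  "iwasawa_decomposition G \<longleftrightarrow>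
     cartan_involution G (cartan G) \<and>
     kk G = {X \<in> liealg G. cartan G X = X} \<and>
     abelian_subspace G (aa G) \<and> aa G \<subseteq> ss G \<and>
     (\<forall>\<bb>. abelian_subspace G \<bb> \<and> aa G \<subseteq> \<bb> \<and> \<bb> \<subseteq> ss G \<longrightarrow> \<bb> = aa G) \<and>
     (\<exists>P. positive_system G P \<and> nn G = span (\<Union>\<alpha>\<in>P. root_space G \<alpha>))"

definition Hvec :: "('a, 'e::euclidean_space) iwasawa_data \<Rightarrow> ('e \<Rightarrow> real) \<Rightarrow> 'e" where
  "Hvec G \<mu> = (THE H. H \<in> aa G \<and> (\<forall>H'\<in>aa G. \<mu> H' = killing G H H'))"

definition Kgrp :: "('a, 'e::euclidean_space) iwasawa_data \<Rightarrow> 'a set" where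
  "Kgrp G = lie_normalizer G (kk G)"

definition Agrp :: "('a, 'e::euclidean_space) iwasawa_data \<Rightarrow> 'a set" where
  "Agrp G = analytic_subgroup G (aa G)"

definition Mgrp :: "('a, 'e::euclidean_space) iwasawa_data \<Rightarrow> 'a set" where
  "Mgrp G = {k \<in> Kgrp G. \<forall>a\<in>Agrp G. k \<otimes>\<^bsub>G\<^esub> a = a \<otimes>\<^bsub>G\<^esub> k}"

text \<open>The elements of the Weyl group are the cosets of \<open>M\<close> in the normalizer of \<open>\<aa>\<close> in \<open>K\<close>.\<close>

definition Weyl :: "('a, 'e::euclidean_space) iwasawa_data \<Rightarrow> 'a set set" where
  "Weyl G = carrier ((G\<lparr>carrier := Kgrp G \<inter> lie_normalizer G (aa G)\<rparr>) Mod (Mgrp G))"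

definition setting :: "('a, 'e::euclidean_space) iwasawa_data \<Rightarrow> bool" where
  "setting G \<longleftrightarrow>
     lie_group G \<and> semisimple G \<and> iwasawa_decomposition G \<and>
     (\<forall>g\<in>carrier G. Ad_inner G g) \<and> compactin (gtop G) (Kgrp G) \<and>
     (\<forall>\<alpha>\<in>roots G. rootvec G \<alpha> \<in> root_space G \<alpha> \<and>
        - killing G (rootvec G \<alpha>) (cartan G (rootvec G \<alpha>)) = 2 / killing G (Hvec G \<alpha>) (Hvec G \<alpha>))"

definition Zvec :: "('a, 'e::euclidean_space) iwasawa_data \<Rightarrow> ('e \<Rightarrow> real) \<Rightarrow> 'e" where
  "Zvec G \<alpha> = rootvec G \<alpha> + cartan G (rootvec G \<alpha>)"


section \<open>K-types\<close>

text \<open>Irreducible unitary representations of the compact group \<open>K\<close> are finite-dimensional, hence are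
  realized on \<open>complex^'n\<close> with its standard Hermitian form.\<close>

type_synonym ('a, 'n) rep = "'a \<Rightarrow> complex^'n \<Rightarrow> complex^'n"

definition hermitian :: "complex^'n \<Rightarrow> complex^'n \<Rightarrow> complex" where
  "hermitian v w = (\<Sum>i\<in>UNIV. v $ i * cnj (w $ i))"

definition K_hat :: "('a, 'e::euclidean_space) iwasawa_data \<Rightarrow> ('a, 'n::finite) rep set" where
  "K_hat G = {\<pi>.
     (\<forall>k\<in>Kgrp G. Vector_Spaces.linear (*s) (*s) (\<pi> k)) \<and>
     \<pi> \<one>\<^bsub>G\<^esub> = id \<and> (\<forall>k\<in>Kgrp G. \<forall>l\<in>Kgrp G. \<pi> (k \<otimes>\<^bsub>G\<^esub> l) = \<pi> k \<circ> \<pi> l) \<and>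
     (\<forall>v. continuous_map (subtopology (gtop G) (Kgrp G)) euclidean (\<lambda>k. \<pi> k v)) \<and>
     (\<forall>k\<in>Kgrp G. \<forall>v w. hermitian (\<pi> k v) (\<pi> k w) = hermitian v w) \<and>
     (\<forall>U. vec.subspace U \<and> (\<forall>k\<in>Kgrp G. \<pi> k ` U \<subseteq> U) \<longrightarrow> U = {0} \<or> U = UNIV)}"

text \<open>The action of \<open>Z\<close> in the Lie algebra of \<open>K\<close> by the differentiated representation.\<close>

definition drep ::
  "('a, 'e::euclidean_space) iwasawa_data \<Rightarrow> ('a, 'n::finite) rep \<Rightarrow> 'e \<Rightarrow> complex^'n \<Rightarrow> complex^'n" where
  "drep G \<pi> Z v = (THE w. \<exists>\<gamma>. one_param_subgroup G Z \<gamma> \<and>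
     ((\<lambda>t. \<pi> (\<gamma> t) v) has_vector_derivative w) (at 0))"

definition VM :: "('a, 'e::euclidean_space) iwasawa_data \<Rightarrow> ('a, 'n::finite) rep \<Rightarrow> (complex^'n) set" where
  "VM G \<pi> = {v. \<forall>m\<in>Mgrp G. \<pi> m v = v}"

definition K_hat_M :: "('a, 'e::euclidean_space) iwasawa_data \<Rightarrow> ('a, 'n::finite) rep set" where
  "K_hat_M G = {\<pi> \<in> K_hat G. VM G \<pi> \<noteq> {0}}"

text \<open>The operator \<open>Z\<^sub>\<alpha> (Z\<^sub>\<alpha>\<^sup>2 + 4)\<close>.\<close>

definition Zop ::
  "('a, 'e::euclidean_space) iwasawa_data \<Rightarrow> ('a, 'n::finite) rep \<Rightarrow> ('e \<Rightarrow> real) \<Rightarrow> complex^'n \<Rightarrow> complex^'n" where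
  "Zop G \<pi> \<alpha> v = (let Z = drep G \<pi> (Zvec G \<alpha>) in Z (Z (Z v) + 4 *s v))"

definition VM_single :: "('a, 'e::euclidean_space) iwasawa_data \<Rightarrow> ('a, 'n::finite) rep \<Rightarrow> (complex^'n) set" where
  "VM_single G \<pi> = {v \<in> VM G \<pi>. \<forall>\<alpha>\<in>roots G. Zop G \<pi> \<alpha> v = 0}"

definition VM_double :: "('a, 'e::euclidean_space) iwasawa_data \<Rightarrow> ('a, 'n::finite) rep \<Rightarrow> (complex^'n) set" where
  "VM_double G \<pi> = VM G \<pi> \<inter>
     vec.span {\<pi> m (Zop G \<pi> \<alpha> v) | \<alpha> m v. \<alpha> \<in> roots G \<and> m \<in> Mgrp G}"

definition K_hat_sp :: "('a, 'e::euclidean_space) iwasawa_data \<Rightarrow> ('a, 'n::finite) rep set" where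
  "K_hat_sp G = {\<pi> \<in> K_hat_M G. VM_single G \<pi> = VM G \<pi>}"


section \<open>Intertwining maps and restriction\<close>

text \<open>The action of \<open>k\<close> on functions on a subspace \<open>E\<close> that is stable under \<open>Ad k\<close>.\<close>

definition fun_act :: "('a, 'e::euclidean_space) iwasawa_data \<Rightarrow> 'e set \<Rightarrow> 'a \<Rightarrow> ('e \<Rightarrow> complex) \<Rightarrow> 'e \<Rightarrow> complex" where
  "fun_act G E k f = ext0 E (\<lambda>x. f (Ad G (inv\<^bsub>G\<^esub> k) x))"

definition clinear_Cinf :: "(complex^'n) set \<Rightarrow> 'e::euclidean_space set \<Rightarrow> (complex^'n \<Rightarrow> 'e \<Rightarrow> complex) set" where
  "clinear_Cinf U E = {\<Phi>. (\<forall>v\<in>U. \<Phi> v \<in> Cinf E) \<and> (\<forall>v. v \<notin> U \<longrightarrow> \<Phi> v = 0) \<and>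
     (\<forall>v\<in>U. \<forall>w\<in>U. \<Phi> (v + w) = \<Phi> v + \<Phi> w) \<and>
     (\<forall>c. \<forall>v\<in>U. \<Phi> (c *s v) = (\<lambda>x. c * \<Phi> v x))}"

definition Hom_K ::
  "('a, 'e::euclidean_space) iwasawa_data \<Rightarrow> ('a, 'n::finite) rep \<Rightarrow> (complex^'n \<Rightarrow> 'e \<Rightarrow> complex) set" where
  "Hom_K G \<pi> = {\<Phi> \<in> clinear_Cinf UNIV (ss G).
     \<forall>k\<in>Kgrp G. \<forall>v. \<Phi> (\<pi> k v) = fun_act G (ss G) k (\<Phi> v)}"

text \<open>\<open>Hom_W G \<pi> U\<close> is the space of Weyl group equivariant maps from the submodule \<open>U\<close> of \<open>V\<^sup>M\<close> to the
  smooth functions on \<open>\<aa>\<close>; a coset \<open>w\<close> acts through any of its representatives \<open>k\<close>.\<close>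

definition Hom_W ::
  "('a, 'e::euclidean_space) iwasawa_data \<Rightarrow> ('a, 'n::finite) rep \<Rightarrow> (complex^'n) set \<Rightarrow>
   (complex^'n \<Rightarrow> 'e \<Rightarrow> complex) set" where
  "Hom_W G \<pi> U = {\<Psi> \<in> clinear_Cinf U (aa G).
     \<forall>w\<in>Weyl G. \<forall>k\<in>w. \<forall>v\<in>U. \<Psi> (\<pi> k v) = fun_act G (aa G) k (\<Psi> v)}"

definition gamma0 :: "('a, 'e::euclidean_space) iwasawa_data \<Rightarrow> ('e \<Rightarrow> complex) \<Rightarrow> 'e \<Rightarrow> complex" where
  "gamma0 G f = ext0 (aa G) f"

definition Gamma0 ::
  "('a, 'e::euclidean_space) iwasawa_data \<Rightarrow> ('a, 'n::finite) rep \<Rightarrow> (complex^'n \<Rightarrow> 'e \<Rightarrow> complex) \<Rightarrow>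
   complex^'n \<Rightarrow> 'e \<Rightarrow> complex" where
  "Gamma0 G \<pi> \<Phi> = ext0 (VM G \<pi>) (gamma0 G \<circ> \<Phi>)"

definition Gamma0_tilde ::
  "('a, 'e::euclidean_space) iwasawa_data \<Rightarrow> ('a, 'n::finite) rep \<Rightarrow> (complex^'n \<Rightarrow> 'e \<Rightarrow> complex) \<Rightarrow>
   complex^'n \<Rightarrow> 'e \<Rightarrow> complex" where
  "Gamma0_tilde G \<pi> \<Phi> = ext0 (VM_single G \<pi>) (gamma0 G \<circ> \<Phi>)"

definition Hom_K_22 ::
  "('a, 'e::euclidean_space) iwasawa_data \<Rightarrow> ('a, 'n::finite) rep \<Rightarrow> (complex^'n \<Rightarrow> 'e \<Rightarrow> complex) set" where
  "Hom_K_22 G \<pi> = {\<Phi> \<in> Hom_K G \<pi>. Gamma0 G \<pi> \<Phi> ` VM_double G \<pi> = {0}}"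


section \<open>Constant coefficient differential operators and Dunkl operators\<close>

definition S_s_K :: "('a, 'e::euclidean_space) iwasawa_data \<Rightarrow> ('e \<Rightarrow> complex) set" where
  "S_s_K G = {\<Delta> \<in> Pol (ss G). \<forall>k\<in>Kgrp G. fun_act G (ss G) k \<Delta> = \<Delta>}"

definition partial :: "('a, 'e::euclidean_space) iwasawa_data \<Rightarrow> ('e \<Rightarrow> complex) \<Rightarrow> ('e \<Rightarrow> complex) \<Rightarrow> 'e \<Rightarrow> complex" where
  "partial G = sym_hom (ss G) (killing G) (deriv_op (ss G))"

definition fscale :: "real \<Rightarrow> ('e \<Rightarrow> real) \<Rightarrow> 'e \<Rightarrow> real" where
  "fscale c \<alpha> = (\<lambda>H. c * \<alpha> H)"

definition R_sys :: "('a, 'e::euclidean_space) iwasawa_data \<Rightarrow> ('e \<Rightarrow> real) set" where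
  "R_sys G = fscale 2 ` roots G"

definition R1 :: "('a, 'e::euclidean_space) iwasawa_data \<Rightarrow> ('e \<Rightarrow> real) set" where
  "R1 G = R_sys G - fscale 2 ` R_sys G"

definition R1_pos :: "('a, 'e::euclidean_space) iwasawa_data \<Rightarrow> ('e \<Rightarrow> real) set" where
  "R1_pos G = R1 G \<inter> fscale 2 ` pos_roots G"

definition m0 :: "('a, 'e::euclidean_space) iwasawa_data \<Rightarrow> ('e \<Rightarrow> real) \<Rightarrow> real" where
  "m0 G \<alpha> = (if fscale 2 \<alpha> \<in> R_sys G
     then (real (dim (root_space G (fscale (1/2) \<alpha>))) + real (dim (root_space G \<alpha>))) / 2
     else real (dim (root_space G (fscale (1/2) \<alpha>))) / 2)"

definition refl :: "('a, 'e::euclidean_space) iwasawa_data \<Rightarrow> ('e \<Rightarrow> real) \<Rightarrow> 'e \<Rightarrow> 'e" where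
  "refl G \<alpha> x = x - (2 * \<alpha> x / killing G (Hvec G \<alpha>) (Hvec G \<alpha>)) *\<^sub>R Hvec G \<alpha>"

text \<open>The function \<open>(1/\<alpha>) (1 - s\<^sub>\<alpha>) f\<close>: the numerator vanishes on the hyperplane \<open>\<alpha> = 0\<close>, and the
  quotient extends uniquely to a smooth function on \<open>\<aa>\<close>.\<close>

definition refl_quot ::
  "('a, 'e::euclidean_space) iwasawa_data \<Rightarrow> ('e \<Rightarrow> real) \<Rightarrow> ('e \<Rightarrow> complex) \<Rightarrow> 'e \<Rightarrow> complex" where
  "refl_quot G \<alpha> f = (THE g. g \<in> Cinf (aa G) \<and>
     (\<forall>x\<in>aa G. complex_of_real (\<alpha> x) * g x = f x - f (refl G \<alpha> x)))"

definition dunkl1 ::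
  "('a, 'e::euclidean_space) iwasawa_data \<Rightarrow> 'e \<Rightarrow> ('e \<Rightarrow> complex) \<Rightarrow> 'e \<Rightarrow> complex" where
  "dunkl1 G \<xi> = ext0 (Cinf (aa G)) (\<lambda>f x. deriv_op (aa G) \<xi> f x +
     (\<Sum>\<alpha>\<in>R1_pos G. complex_of_real (m0 G \<alpha> * \<alpha> \<xi>) * refl_quot G \<alpha> f x))"

definition dunkl :: "('a, 'e::euclidean_space) iwasawa_data \<Rightarrow> ('e \<Rightarrow> complex) \<Rightarrow> ('e \<Rightarrow> complex) \<Rightarrow> 'e \<Rightarrow> complex" where
  "dunkl G = sym_hom (aa G) (killing G) (dunkl1 G)"

end

theory Submission
 imports Defs
begin

text \<open>Let \<open>L\<close> be the Laplacian of \<open>B\<close> on \<open>s\<close>, or the Dunkl Laplacian on \<open>a\<close>.  If \<open>q\<close> is homogeneous of degree \<open>d\<close>,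
 then the operator attached to \<open>q\<close> equals \<open>(1/d!) ad(L/2)^d\<close> applied to multiplication by \<open>q\<close>: this follows
 from \<open>ad(L/2) \<xi> = D(\<xi>)\<close> and \<open>[L, D(\<xi>)] = 0\<close>.  Multiplication by an invariant polynomial is compatible with
 the restriction to \<open>a\<close>, so the theorem reduces to the two Laplacians.  The radial part of the Laplacian on
 \<open>s\<close> involves \<open>Z\<^sub>\<alpha>\<^sup>2 v\<close>.  On the single-petaled part the relation \<open>Z\<^sub>\<alpha> (Z\<^sub>\<alpha>\<^sup>2 + 4) v = 0\<close> gives
 \<open>Z\<^sub>\<alpha>\<^sup>2 v = -2 (v - s\<^sub>\<alpha> v)\<close>, which is the difference term of the Dunkl Laplacian.  If \<open>\<Phi>\<close> vanishes on the
 double-petaled part along \<open>a\<close>, then \<open>\<Phi> v H = \<langle>v, y\<rangle>\<close> with \<open>y\<close> single-petaled, and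
 \<open>\<Phi> (Z\<^sub>\<alpha>\<^sup>2 v) H = \<langle>v, Z\<^sub>\<alpha>\<^sup>2 y\<rangle> = 0\<close> for double-petaled \<open>v\<close>.\<close>

text \<open>The single derivatives along \<open>s\<close> are not K-equivariant, so they cannot be
  compared with Dunkl operators one by one; invariant multiplications and the Laplacian can. This is
  why every operator is rebuilt from these two ingredients. The factor 1/2 stems from
  \<open>[L, \<xi>] = 2 D(\<xi>)\<close>. The 1/d! counts the orders in which d commutators hit the
  d linear factors of a monomial, a second hit on the same factor giving zero. The formula also
  constructs both homomorphisms, which are given as definite descriptions and mean nothing before
  existence is known. Two facts on roots carry the comparison of the Laplacians. The group
  \<open>M\<close> acts transitively up to sign on the spheres of a root space, so all unit vectors
  of a root space contribute the same second derivative on \<open>V^M\<close>. And 4\<alpha> is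
  never a root, so the multiplicities, which group \<alpha> with 2\<alpha> only, account for every
  root on a ray. Denominators \<alpha>(H) are handled by working at regular points, which are
  dense.\<close>

notation scaleR (infixr "*R" 75)
notation has_vector_derivative (infix "hvd" 50)
abbreviation "cplx == complex_of_real"
abbreviation "open_in E == openin (top_of_set E)"
abbreviation "der == deriv_op"
type_synonym 'e fn = "'e => complex"

section \<open>Calculus on subspaces\<close>

lemma relopen_line:
 fixes E :: "'a::real_normed_vector set"
 assumes "subspace E" "open_in E U" "x \<in> U" "X \<in> E"
 shows "\<forall>\<^sub>F t in nhds (0::real). x + t *R X \<in> U"
proof -
 obtain S where S: "open S" "U = E \<inter> S" using assms(2) by (meson openin_open)
 have "((%t::real. x + t *R X) \<longlongrightarrow> x + 0 *R X) (nhds 0)"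
  by (intro tendsto_intros filterlim_ident)
 hence "\<forall>\<^sub>F t in nhds 0. x + t *R X \<in> S"
  using S assms(3) by (intro topological_tendstoD) auto
 moreover have "x + t *R X \<in> E" for t
  using S assms by (auto intro!: subspace_add subspace_scale)
 ultimately show ?thesis by (simp add: S)
qed

lemma relopen_curve:
 fixes E :: "'a::real_normed_vector set"
 assumes "open_in E U" "continuous (at t0) c" "c t0 \<in> U" "\<forall>\<^sub>F t in nhds (t0::real). c t \<in> E"
 shows "\<forall>\<^sub>F t in nhds t0. c t \<in> U"
proof -
 obtain S where S: "open S" "U = E \<inter> S" using assms(1) by (meson openin_open)
 have "(c \<longlongrightarrow> c t0) (nhds t0)"
  using assms(2) tendsto_at_iff_tendsto_nhds unfolding continuous_at by blast
 hence "\<forall>\<^sub>F t in nhds t0. c t \<in> S"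
  using S assms(3) by (intro topological_tendstoD) auto
 thus ?thesis using assms(4) by eventually_elim (simp add: S)
qed

lemma C_on_cont: "C_on k E U f ==> continuous_on U f"
 by (cases k) auto

lemma dir_deriv_eqI: "((%t. f (x + t *R X)) hvd d) (at 0) ==> dir_deriv X f x = d"
 unfolding dir_deriv_def by (rule vector_derivative_at)

lemma C_on_SucD:
 assumes "C_on (Suc k) E U f" "X \<in> E" "x \<in> U"
 shows "((%t. f (x + t *R X)) hvd dir_deriv X f x) (at 0)"
 using assms unfolding dir_deriv_def by (auto simp: vector_derivative_works[symmetric])

lemma C_on_dir_deriv: "C_on (Suc k) E U f ==> X \<in> E ==> C_on k E U (dir_deriv X f)"
 by auto

lemma dir_deriv_line_cong:
 fixes E :: "'a::real_normed_vector set" and f :: "'a => 'b::real_normed_vector"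
 assumes "subspace E" "open_in E U" "!!x. x \<in> U ==> f x = g x" "x \<in> U" "X \<in> E"
 shows "((%t. f (x + t *R X)) hvd d) (at 0) \<longleftrightarrow>
     ((%t. g (x + t *R X)) hvd d) (at 0)"
proof (rule has_vector_derivative_cong_ev)
 show "\<forall>\<^sub>F t in nhds 0. t \<in> UNIV --> f (x + t *R X) = g (x + t *R X)"
  using relopen_line[OF assms(1,2,4,5)] by eventually_elim (simp add: assms)
qed (auto simp: assms)

text \<open>Functions are total on the ambient type. Relative openness keeps short segments
  \<open>x + t X\<close> inside \<open>U\<close>, so values outside \<open>U\<close> never enter the
  derivatives.\<close>

lemma C_on_cong:
 fixes E :: "'a::real_normed_vector set"
 assumes "subspace E" "open_in E U" "!!x. x \<in> U ==> f x = g x"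
 shows "C_on k E U f \<longleftrightarrow> C_on k E U g"
 using assms(3)
proof (induction k arbitrary: f g)
 case 0 thus ?case by (auto cong: continuous_on_cong)
next
 case (Suc k)
 have c: "continuous_on U f = continuous_on U g"
  using Suc.prems by (auto cong: continuous_on_cong)
 have e: "((%t. f (x + t *R X)) hvd d) (at 0) \<longleftrightarrow>
     ((%t. g (x + t *R X)) hvd d) (at 0)" if "x \<in> U" "X \<in> E" for x X d
  by (rule dir_deriv_line_cong[OF assms(1,2)]) (use Suc.prems that in auto)
 have "dir_deriv X f x = dir_deriv X g x" if "X \<in> E" "x \<in> U" for X x
  unfolding dir_deriv_def vector_derivative_def by (simp add: e[OF that(2,1)])
 hence "C_on k E U (dir_deriv X f) \<longleftrightarrow> C_on k E U (dir_deriv X g)" if "X \<in> E" for X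
  using Suc.IH that by blast
 moreover have "(%t. f (x + t *R X)) differentiable (at 0) \<longleftrightarrow> (%t. g (x + t *R X)) differentiable (at 0)"
  if "X \<in> E" "x \<in> U" for X x
  using e[OF that(2,1)] by (meson differentiableI_vector vector_derivative_works)
 ultimately show ?case using c by auto
qed

text \<open>Lets an explicit candidate \<open>f'\<close> stand for the derivatives, so that
  \<open>dir_deriv\<close> itself need not be computed.\<close>

lemma C_on_SucI:
 assumes "subspace E" "open_in E U" "continuous_on U f"
  "!!X x. X \<in> E ==> x \<in> U ==> ((%t. f (x + t *R X)) hvd f' X x) (at 0)"
  "!!X. X \<in> E ==> C_on k E U (f' X)"
 shows "C_on (Suc k) E U f"
proof -
 have "C_on k E U (dir_deriv X f)" if "X \<in> E" for X
  using C_on_cong[OF assms(1,2), of "dir_deriv X f" "f' X"] assms(4,5) dir_deriv_eqI that by metis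
 thus ?thesis using assms(3,4) by (auto intro!: differentiableI_vector)
qed

lemma C_on_subset: "C_on k E U f ==> U' <= U ==> C_on k E U' f"
 by (induction k arbitrary: f) (auto intro: continuous_on_subset)

lemma C_on_Suc_imp: "C_on (Suc k) E U f ==> C_on k E U f"
proof (induction k arbitrary: f)
 case (Suc k)
 thus ?case by (metis C_on.simps(2))
qed auto

lemma continuous_on_relopen_local:
 fixes E :: "'a::real_normed_vector set"
 assumes "!!x. x \<in> U ==> \<exists>V. open_in E V & x \<in> V & continuous_on V f" "U <= E"
 shows "continuous_on U f"
proof -
 have "continuous (at x within U) f" if "x \<in> U" for x
 proof -
  obtain V where V: "open_in E V" "x \<in> V" "continuous_on V f" using assms(1) \<open>x \<in> U\<close> by blast
  obtain S where S: "open S" "V = E \<inter> S" using V(1) by (meson openin_open)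
  have "continuous (at x within V) f" using V by (simp add: continuous_on_eq_continuous_within)
  hence "continuous (at x within U \<inter> S) f"
   by (rule continuous_within_subset) (use S assms(2) in auto)
  moreover have "at x within (U \<inter> S) = at x within U"
   by (rule at_within_nhd[of x S]) (use S V(2) in auto)
  ultimately show ?thesis by simp
 qed
 thus ?thesis by (simp add: continuous_on_eq_continuous_within)
qed

text \<open>Smoothness is local; this glues chartwise statements in
  \<open>smooth_map_compose\<close> and \<open>ops_exists\<close>.\<close>

lemma C_on_local:
 assumes "U <= E" "!!x. x \<in> U ==> \<exists>V. open_in E V & x \<in> V & C_on k E V f"
 shows "C_on k E U f"
 using assms(2)
proof (induction k arbitrary: f)
 case 0 thus ?case using continuous_on_relopen_local[OF _ assms(1)] by (metis C_on.simps(1))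
next
 case (Suc k)
 have "continuous_on U f"
  using continuous_on_relopen_local[OF _ assms(1)] Suc.prems C_on_cont by metis
 moreover have "C_on k E U (dir_deriv X f)" if "X \<in> E" for X
  by (rule Suc.IH) (meson C_on_dir_deriv Suc.prems that)
 ultimately show ?case using Suc.prems by (auto; metis)
qed

lemma dir_deriv_line:
 fixes f :: "'a::real_normed_vector => 'b::real_normed_vector"
 assumes "((%t. f ((x + s *R X) + t *R X)) hvd d) (at 0)"
 shows "((%t. f (x + t *R X)) hvd d) (at s)"
proof -
 have "((%t. t - s) hvd 1) (at s)"
  by (auto intro!: derivative_eq_intros)
 from vector_diff_chain_at[OF this, of "%t. f ((x + s *R X) + t *R X)" d]
 have "((%t. f (x + s *R X + (t - s) *R X)) hvd d) (at s)"
  using assms by (simp add: o_def)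
 thus ?thesis by (simp add: algebra_simps)
qed

lemma C_on_line:
 assumes "C_on (Suc k) E U f" "X \<in> E" "x + s *R X \<in> U"
 shows "((%t. f (x + t *R X)) hvd dir_deriv X f (x + s *R X)) (at s)"
 using C_on_SucD[OF assms] by (rule dir_deriv_line)

lemma C_on_const:
 assumes "subspace E" "open_in E U" shows "C_on k E U (%x. c)"
proof (induction k arbitrary: c)
 case (Suc k) show ?case
  by (rule C_on_SucI[OF assms, where f' = "%_ _. 0"]) (auto intro: Suc)
qed auto

lemma C_on_bounded_linear:
 assumes "subspace E" "open_in E U" "bounded_linear h" "C_on k E U f"
 shows "C_on k E U (%x. h (f x))"
 using assms(4)
proof (induction k arbitrary: f)
 case 0 thus ?case by (simp add: bounded_linear.continuous_on[OF assms(3)])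
next
 case (Suc k)
 show ?case
 proof (rule C_on_SucI[OF assms(1,2)])
  show "continuous_on U (%x. h (f x))"
   using Suc.prems by (simp add: bounded_linear.continuous_on[OF assms(3)])
  show "((%t. h (f (x + t *R X))) hvd h (dir_deriv X f x)) (at 0)" if "X \<in> E" "x \<in> U" for X x
   using bounded_linear.has_vector_derivative[OF assms(3) C_on_SucD[OF Suc.prems that]] .
  show "C_on k E U (%x. h (dir_deriv X f x))" if "X \<in> E" for X
   using Suc.IH[OF C_on_dir_deriv[OF Suc.prems that]] .
 qed
qed

lemma C_on_add:
 assumes "subspace E" "open_in E U" "C_on k E U f" "C_on k E U g"
 shows "C_on k E U (%x. f x + g x)"
 using assms(3,4)
proof (induction k arbitrary: f g)
 case 0 thus ?case by (simp add: continuous_on_add)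
next
 case (Suc k)
 show ?case
 proof (rule C_on_SucI[OF assms(1,2)])
  show "((%t. f (x + t *R X) + g (x + t *R X)) hvd dir_deriv X f x + dir_deriv X g x) (at 0)"
   if "X \<in> E" "x \<in> U" for X x
   by (intro has_vector_derivative_add C_on_SucD[OF Suc.prems(1) that] C_on_SucD[OF Suc.prems(2) that])
  show "C_on k E U (%x. dir_deriv X f x + dir_deriv X g x)" if "X \<in> E" for X
   using Suc C_on_dir_deriv that by blast
 qed (use Suc.prems in "auto intro: continuous_on_add")
qed

lemma C_on_bilinear:
 assumes "subspace E" "open_in E U" "bounded_bilinear h" "C_on k E U f" "C_on k E U g"
 shows "C_on k E U (%x. h (f x) (g x))"
 using assms(4,5)
proof (induction k arbitrary: f g)
 case 0 thus ?case by (simp add: bounded_bilinear.continuous_on[OF assms(3)])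
next
 case (Suc k)
 show ?case
 proof (rule C_on_SucI[OF assms(1,2)])
  show "continuous_on U (%x. h (f x) (g x))"
   using Suc.prems by (simp add: bounded_bilinear.continuous_on[OF assms(3)])
  show "((%t. h (f (x + t *R X)) (g (x + t *R X))) hvd
    h (f x) (dir_deriv X g x) + h (dir_deriv X f x) (g x)) (at 0)" if "X \<in> E" "x \<in> U" for X x
   using bounded_bilinear.has_vector_derivative[OF assms(3) C_on_SucD[OF Suc.prems(1) that] C_on_SucD[OF Suc.prems(2) that]]
   by simp
  show "C_on k E U (%x. h (f x) (dir_deriv X g x) + h (dir_deriv X f x) (g x))" if "X \<in> E" for X
   using Suc.prems that by (intro C_on_add[OF assms(1,2)] Suc.IH) (auto intro: C_on_Suc_imp C_on_dir_deriv)
 qed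
qed

lemma C_on_sum:
 assumes "subspace E" "open_in E U" "!!i. i \<in> I ==> C_on k E U (f i)"
 shows "C_on k E U (%x. \<Sum>i\<in>I. f i x)"
 using assms(3)
 by (induction I rule: infinite_finite_induct) (auto intro: C_on_const C_on_add assms(1,2))

lemma C_on_linear:
 fixes h :: "'a::euclidean_space => 'b::real_normed_vector"
 assumes "subspace E" "open_in E U" "linear h"
 shows "C_on k E U h"
proof (cases k)
 case 0 thus ?thesis by (simp add: assms linear_continuous_on linear_conv_bounded_linear[symmetric])
next
 case (Suc j)
 show ?thesis unfolding Suc
 proof (rule C_on_SucI[OF assms(1,2), where f' = "%X x. h X"])
  show "continuous_on U h"
   by (simp add: assms linear_continuous_on linear_conv_bounded_linear[symmetric])
  fix x X
  have "h (x + t *R X) = h x + t *R h X" for t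
   by (simp add: assms linear_add linear_scale)
  thus "((%t. h (x + t *R X)) hvd h X) (at 0)"
   by (auto intro!: derivative_eq_intros)
 qed (auto intro: C_on_const assms)
qed

section \<open>Orthonormal bases, Frechet differentiability and the chain rule\<close>

lemma orthonormal_basis_obtain:
 fixes E :: "'a::euclidean_space set"
 assumes "subspace E"
 obtains B where "B <= E" "finite B" "span B = E" "!!b c. b \<in> B ==> c \<in> B ==> b \<bullet> c = (if b = c then 1 else 0)"
  "!!x. x \<in> E ==> (\<Sum>b\<in>B. (x \<bullet> b) *R b) = x" "independent B"
proof -
 obtain B where B: "B <= E" "pairwise orthogonal B" "!!x. x \<in> B ==> norm x = 1" "independent B" "span B = E"
  using orthonormal_basis_subspace[OF assms] by metis
 have fin: "finite B" using B(4) independent_imp_finite by blast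
 have on: "b \<bullet> c = (if b = c then 1 else 0)" if "b \<in> B" "c \<in> B" for b c
  using B(2,3) that by (auto simp: pairwise_def orthogonal_def dot_square_norm)
 have ex: "(\<Sum>b\<in>B. (x \<bullet> b) *R b) = x" if "x \<in> E" for x
 proof -
  obtain u where u: "x = (\<Sum>b\<in>B. u b *R b)" using \<open>x \<in> E\<close> B(5) unfolding span_finite[OF fin] by blast
  have "x \<bullet> c = u c" if "c \<in> B" for c
  proof -
   have "x \<bullet> c = (\<Sum>b\<in>B. if b = c then u b else 0)"
    unfolding u inner_sum_left by (rule sum.cong) (use on that in auto)
   thus ?thesis using that fin by simp
  qed
  thus ?thesis using u by simp
 qed
 show ?thesis using that B fin on ex by blast
qed

text \<open>Continuous partial derivatives imply differentiability. The increment \<open>z\<close>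
  is split along the orthonormal vectors of \<open>C\<close>; each new vector costs one mean value
  estimate with error e/2, and the other half of e goes to the induction hypothesis.\<close>

lemma C1_strict:
 fixes E :: "'a::euclidean_space set" and f :: "'a => 'b::real_normed_vector"
 assumes E: "subspace E" and U: "open_in E U" and f: "C_on 1 E U f" and x: "x \<in> U"
  and C: "finite C" "C <= E" "!!b c. b \<in> C ==> c \<in> C ==> b \<bullet> c = (if b = c then 1 else 0)"
  and e: "e > 0"
 shows "\<exists>d>0. \<forall>y z. y \<in> E --> norm (y - x) < d --> z \<in> span C --> norm z < d -->
      norm (f (y + z) - f y - (\<Sum>b\<in>C. (z \<bullet> b) *R dir_deriv b f x)) <= e * norm z"
 using C e
proof (induction C arbitrary: e rule: finite_induct)
 case empty
 show ?case by (intro exI[of _ 1]) auto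
next
 case (insert b C)
 obtain S where S: "open S" "U = E \<inter> S" using U by (meson openin_open)
 have f1: "C_on (Suc 0) E U f" using f by simp
 have bE: "b \<in> E" using insert.prems by auto
 have "continuous_on U (dir_deriv b f)" using C_on_dir_deriv[OF f1 bE] by simp
 then obtain d1 where d1: "d1 > 0" "!!y. y \<in> U ==> dist y x < d1 ==> dist (dir_deriv b f y) (dir_deriv b f x) < e/2"
  using x insert.prems unfolding continuous_on_iff by (metis half_gt_zero)
 obtain d2 where d2: "d2 > 0" "ball x d2 <= S" using S x by (metis IntD2 openE)
 have "\<exists>d>0. \<forall>y z. y \<in> E --> norm (y - x) < d --> z \<in> span C --> norm z < d -->
      norm (f (y + z) - f y - (\<Sum>b\<in>C. (z \<bullet> b) *R dir_deriv b f x)) <= e/2 * norm z"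
  by (rule insert.IH) (use insert.prems in auto)
 then obtain d3 where d3: "d3 > 0" "\<forall>y z. y \<in> E --> norm (y - x) < d3 --> z \<in> span C --> norm z < d3 -->
      norm (f (y + z) - f y - (\<Sum>b\<in>C. (z \<bullet> b) *R dir_deriv b f x)) <= e/2 * norm z"
  by (elim exE conjE) (rule that)
 \<comment> \<open>The point under study differs from x by \<open>y - x\<close>, \<open>w\<close>
   and a multiple of b, each of length below d; hence the thirds.\<close>
 define d where "d = min (d1/3) (min (d2/3) d3)"
 have d: "d > 0" "3 * d <= d1" "3 * d <= d2" "d <= d3" using d1 d2 d3 unfolding d_def by auto
 show ?case
 proof (intro exI[of _ d] conjI allI impI)
  show "d > 0" by fact
  fix y z assume y: "y \<in> E" "norm (y - x) < d" and z: "z \<in> span (insert b C)" "norm z < d"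
  define c where "c = z \<bullet> b"
  obtain k where k: "z - k *R b \<in> span C" using z(1) by (auto simp: span_insert)
  have orth: "w \<bullet> b = 0" if "w \<in> span C" for w
  proof -
   have "orthogonal b w"
    by (rule orthogonal_to_span[OF that]) (use insert.prems(2) insert.hyps(2) in "force simp: orthogonal_def")
   thus ?thesis by (simp add: orthogonal_def inner_commute)
  qed
  have bb: "b \<bullet> b = 1" using insert.prems by simp
  hence nb: "norm b = 1" by (simp add: norm_eq_1)
  have kc: "k = c" using orth[OF k] bb by (simp add: c_def inner_diff_left)
  define w where "w = z - c *R b"
  have w: "w \<in> span C" "z = w + c *R b" using k kc by (auto simp: w_def)
  have nz: "norm z ^ 2 = norm w ^ 2 + c ^ 2"
   unfolding w(2) using orth[OF w(1)] bb
   by (simp only: power2_norm_eq_inner) (simp add: inner_add_left inner_add_right inner_commute power2_eq_square)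
  have nw: "norm w <= norm z" using nz by (intro power2_le_imp_le[of "norm w"]) auto
  have nc: "\<bar>c\<bar> <= norm z" using nz by (intro power2_le_imp_le[of "\<bar>c\<bar>"]) auto
  have CE: "span C <= E" using insert.prems(1) E by (simp add: span_minimal)
  have wE: "w \<in> E" using CE w by auto
  have in_U: "y + w + s *R b \<in> U & dist (y + w + s *R b) x < d1" if "\<bar>s\<bar> <= \<bar>c\<bar>" for s
  proof -
   have "norm (y + w + s *R b - x) <= norm (y - x) + norm w + norm (s *R b)"
    by (smt (verit, best) add_diff_eq diff_add_eq norm_triangle_ineq)
   also have "\<dots> < 3 * d" using y z nw nc that nb by simp
   finally have "norm (y + w + s *R b - x) < 3 * d" .
   hence "y + w + s *R b \<in> ball x d2" "dist (y + w + s *R b) x < d1"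
    using d by (auto simp: dist_norm norm_minus_commute)
   moreover have "y + w + s *R b \<in> E" using y wE bE E by (auto intro!: subspace_add subspace_scale)
   ultimately show ?thesis using d2 S by auto
  qed
  have A: "norm (f (y + w) - f y - (\<Sum>b\<in>C. (w \<bullet> b) *R dir_deriv b f x)) <= e/2 * norm w"
   using d3(2)[rule_format, OF y(1) _ w(1)] y z nw d by simp
  have ww: "z \<bullet> a = w \<bullet> a" if "a \<in> C" for a
   using that insert.prems insert.hyps by (auto simp: w(2) inner_add_left)
  \<comment> \<open>With the linear term removed, the derivative of g is a difference of two values
    of \<open>dir_deriv b f\<close>, which continuity makes small.\<close>
  define g where "g t = f (y + w + (t * c) *R b) - (t * c) *R dir_deriv b f x" for t
  have "norm (g 1 - g 0) <= (e/2 * norm z) * norm (1 - 0 :: real)"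
  proof (rule differentiable_bound[where S = "{0..1::real}" and f' = "%t h. h *R (c *R (dir_deriv b f (y + w + (t * c) *R b) - dir_deriv b f x))"])
   fix t :: real assume t: "t \<in> {0..1}"
   have tc: "\<bar>t * c\<bar> <= \<bar>c\<bar>" using t by (simp add: abs_mult mult_left_le_one_le)
   have "((%s. f (y + w + s *R b)) hvd dir_deriv b f (y + w + (t * c) *R b)) (at (t * c))"
    by (rule C_on_line[OF f1 bE]) (use in_U[OF tc] in auto)
   moreover have "((%t. t * c) hvd c) (at t)"
    by (auto intro!: derivative_eq_intros)
   ultimately have "((%t. f (y + w + (t * c) *R b)) hvd c *R dir_deriv b f (y + w + (t * c) *R b)) (at t)"
    using vector_diff_chain_at[of "%t. t * c" c t "%s. f (y + w + s *R b)"] by (simp add: o_def)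
   hence "(g hvd c *R (dir_deriv b f (y + w + (t * c) *R b) - dir_deriv b f x)) (at t)"
    unfolding g_def scaleR_diff_right
    by (rule has_vector_derivative_diff) (auto intro!: derivative_eq_intros)
   thus "(g has_derivative (%h. h *R (c *R (dir_deriv b f (y + w + (t * c) *R b) - dir_deriv b f x)))) (at t within {0..1})"
    unfolding has_vector_derivative_def by (rule has_derivative_at_withinI)
   have "norm (dir_deriv b f (y + w + (t * c) *R b) - dir_deriv b f x) <= e/2"
    using d1(2) in_U[OF tc] by (metis dist_norm less_imp_le)
   hence "\<bar>c\<bar> * norm (dir_deriv b f (y + w + (t * c) *R b) - dir_deriv b f x) <= norm z * (e/2)"
    using nc by (intro mult_mono) auto
   hence H: "norm (h *R (c *R (dir_deriv b f (y + w + (t * c) *R b) - dir_deriv b f x))) <= e/2 * norm z * norm h"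
    for h :: real
    using mult_left_mono[of "\<bar>c\<bar> * norm (dir_deriv b f (y + w + (t * c) *R b) - dir_deriv b f x)" "norm z * (e/2)" "\<bar>h\<bar>"]
    by (simp add: mult_ac abs_mult)
   show "onorm (%h. h *R (c *R (dir_deriv b f (y + w + (t * c) *R b) - dir_deriv b f x))) <= e/2 * norm z"
    using insert.prems(3) by (intro onorm_bound H) auto
  qed auto
  moreover have "g 1 - g 0 = f (y + z) - f (y + w) - c *R dir_deriv b f x"
   by (simp add: g_def w(2) algebra_simps)
  ultimately have Bd: "norm (f (y + z) - f (y + w) - c *R dir_deriv b f x) <= e/2 * norm z"
   by simp
  have "f (y + z) - f y - (\<Sum>b\<in>insert b C. (z \<bullet> b) *R dir_deriv b f x)
    = (f (y + z) - f (y + w) - c *R dir_deriv b f x) + (f (y + w) - f y - (\<Sum>b\<in>C. (w \<bullet> b) *R dir_deriv b f x))"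
   using insert.hyps by (simp add: c_def[symmetric] ww)
  also have "norm \<dots> <= e/2 * norm z + e/2 * norm w"
   by (rule order_trans[OF norm_triangle_ineq add_mono[OF Bd A]])
  also have "\<dots> <= e * norm z" using nw insert.prems(3) by (simp add: field_simps)
  finally show "norm (f (y + z) - f y - (\<Sum>b\<in>insert b C. (z \<bullet> b) *R dir_deriv b f x)) <= e * norm z" .
 qed
qed

text \<open>\<open>C_on\<close> speaks of directional derivatives only, so linearity in the
  direction is not built in; it comes from this Frechet derivative, and so does the chain
  rule.\<close>

lemma C1_frechet:
 fixes E :: "'a::euclidean_space set" and f :: "'a => 'b::real_normed_vector"
 assumes E: "subspace E" and U: "open_in E U" and f: "C_on (Suc k) E U f" and x: "x \<in> U"
 obtains D where "(f has_derivative D) (at x within U)" "!!X. X \<in> E ==> D X = dir_deriv X f x"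
proof -
 obtain C where C: "C <= E" "finite C" "span C = E" "!!b c. b \<in> C ==> c \<in> C ==> b \<bullet> c = (if b = c then 1 else 0)"
  using orthonormal_basis_obtain[OF E] by metis
 have f1: "C_on 1 E U f" using f by (induction k) (auto dest: C_on_Suc_imp)
 define D where "D = (%z. \<Sum>b\<in>C. (z \<bullet> b) *R dir_deriv b f x)"
 have xE: "x \<in> E" using x U openin_imp_subset by blast
 have UE: "U <= E" using U openin_imp_subset by blast
 have bl: "bounded_linear D" unfolding D_def
  by (intro bounded_linear_sum bounded_linear_intros)
 have der: "(f has_derivative D) (at x within U)"
  unfolding has_derivative_within_alt
 proof (intro conjI bl allI impI)
  fix e :: real assume "e > 0"
  have "\<exists>d>0. \<forall>y z. y \<in> E --> norm (y - x) < d --> z \<in> span C --> norm z < d -->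
      norm (f (y + z) - f y - (\<Sum>b\<in>C. (z \<bullet> b) *R dir_deriv b f x)) <= e * norm z"
   by (rule C1_strict[OF E U f1 x C(2,1)]) (use C(4) \<open>e > 0\<close> in auto)
  then obtain d where d: "d > 0"
   "\<forall>y z. y \<in> E --> norm (y - x) < d --> z \<in> span C --> norm z < d -->
      norm (f (y + z) - f y - (\<Sum>b\<in>C. (z \<bullet> b) *R dir_deriv b f x)) <= e * norm z"
   by (elim exE conjE) (rule that)
  show "\<exists>d>0. \<forall>y\<in>U. norm (y - x) < d --> norm (f y - f x - D (y - x)) <= e * norm (y - x)"
  proof (intro exI[of _ d] conjI ballI impI d(1))
   fix y assume y: "y \<in> U" "norm (y - x) < d"
   have "y - x \<in> E" using y UE xE E by (auto intro: subspace_diff)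
   thus "norm (f y - f x - D (y - x)) <= e * norm (y - x)"
    using d(2)[rule_format, of x "y - x"] d(1) xE y C(3) by (simp add: D_def)
  qed
 qed
 have "D X = dir_deriv X f x" if "X \<in> E" for X
 proof -
  let ?S = "{t::real. x + t *R X \<in> U}"
  obtain T where T: "open T" "0 \<in> T" "T <= ?S"
   using relopen_line[OF E U x \<open>X \<in> E\<close>] unfolding eventually_nhds by auto
  have "((%t. x + t *R X) hvd X) (at 0 within T)"
   by (auto intro!: derivative_eq_intros)
  moreover have "(f has_derivative D) (at (x + 0 *R X) within (%t. x + t *R X) ` T)"
   using der T by (auto intro: has_derivative_subset)
  ultimately have "((f o (%t. x + t *R X)) hvd D X) (at 0 within T)"
   by (rule vector_derivative_diff_chain_within)
  hence "((%t. f (x + t *R X)) hvd D X) (at 0)"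
   unfolding at_within_open[OF T(2,1)] o_def .
  thus ?thesis by (simp add: dir_deriv_eqI)
 qed
 thus ?thesis using that der by blast
qed

lemma dir_deriv_linear:
 fixes E :: "'a::euclidean_space set"
 assumes "subspace E" "open_in E U" "C_on (Suc k) E U f" "x \<in> U"
  and "X \<in> E" "Y \<in> E"
 shows "dir_deriv (X + Y) f x = dir_deriv X f x + dir_deriv Y f x"
  and "dir_deriv (c *R X) f x = c *R dir_deriv X f x"
proof -
 obtain D where D: "(f has_derivative D) (at x within U)" "!!X. X \<in> E ==> D X = dir_deriv X f x"
  using C1_frechet[OF assms(1-4)] by metis
 have "linear D" using D(1) has_derivative_linear by blast
 moreover have "X + Y \<in> E" "c *R X \<in> E" using assms subspace_add subspace_scale by auto
 ultimately show "dir_deriv (X + Y) f x = dir_deriv X f x + dir_deriv Y f x"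
  "dir_deriv (c *R X) f x = c *R dir_deriv X f x"
  using D(2) assms by (metis linear_add, metis linear_scale)
qed

lemma dir_deriv_sum:
 fixes E :: "'a::euclidean_space set"
 assumes "subspace E" "open_in E U" "C_on (Suc k) E U f" "x \<in> U"
  and "finite I" "!!i. i \<in> I ==> X i \<in> E"
 shows "dir_deriv (\<Sum>i\<in>I. c i *R X i) f x = (\<Sum>i\<in>I. c i *R dir_deriv (X i) f x)"
proof -
 obtain D where D: "(f has_derivative D) (at x within U)" "!!X. X \<in> E ==> D X = dir_deriv X f x"
  using C1_frechet[OF assms(1-4)] by metis
 have "linear D" using D(1) has_derivative_linear by blast
 moreover have "(\<Sum>i\<in>I. c i *R X i) \<in> E" using assms by (auto intro!: subspace_sum subspace_scale)
 ultimately show ?thesis using D(2) assms(6) by (simp add: D(2)[symmetric] linear_sum linear_scale)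
qed

text \<open>Difference quotients of \<open>c\<close> lie in \<open>E\<close>, and a
  finite-dimensional subspace is closed, so the velocity lies in \<open>E\<close>. This matters
  because \<open>C_on\<close> controls \<open>dir_deriv\<close> only for directions in
  \<open>E\<close>.\<close>

lemma C_on_curve:
 fixes E :: "'a::euclidean_space set"
 assumes "subspace E" "open_in E U" "C_on (Suc k) E U g"
  and c: "(c hvd c') (at t0)" "c t0 \<in> U" "\<forall>\<^sub>F t in nhds t0. c t \<in> E"
 shows "c' \<in> E" "((%t. g (c t)) hvd dir_deriv c' g (c t0)) (at t0)"
proof -
 have cont: "continuous (at t0) c" using c(1) has_vector_derivative_continuous by blast
 have cE: "c t0 \<in> E" using assms(2) c(2) openin_imp_subset by blast
 obtain T where T: "open T" "t0 \<in> T" "!!t. t \<in> T ==> c t \<in> U"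
  using relopen_curve[OF assms(2) cont c(2,3)] unfolding eventually_nhds by auto
 show cp: "c' \<in> E"
 proof -
  have "((%t. (1 / (t - t0)) *R (c t - c t0)) \<longlongrightarrow> c') (at t0)"
   using c(1) unfolding has_vector_derivative_def has_derivative_iff_norm
   apply -
   apply (rule LIM_zero_cancel, rule tendsto_norm_zero_cancel)
   apply (erule conjE)
   subgoal premises p
   proof (rule Lim_transform_eventually[OF p(2)])
    show "\<forall>\<^sub>F x in at t0. norm (c x - c t0 - (x - t0) *R c') / norm (x - t0) =
      norm ((1 / (x - t0)) *R (c x - c t0) - c')"
     using eventually_neq_at_within[of t0 t0 UNIV]
    proof eventually_elim
     case (elim x)
     have eq: "(1 / (x - t0)) *R (c x - c t0) - c' = (1 / (x - t0)) *R (c x - c t0 - (x - t0) *R c')"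
      using elim by (simp add: scaleR_diff_right)
     show ?case unfolding eq by simp
    qed
   qed
   done
  moreover have "\<forall>\<^sub>F t in at t0. (1 / (t - t0)) *R (c t - c t0) \<in> E"
   using c(3) unfolding eventually_at_filter
   by eventually_elim (use cE assms(1) in "auto intro!: subspace_scale subspace_diff")
  ultimately show ?thesis
   by (intro Lim_in_closed_set[OF closed_subspace[OF assms(1)] _ trivial_limit_at])
 qed
 obtain D where D: "(g has_derivative D) (at (c t0) within U)" "!!X. X \<in> E ==> D X = dir_deriv X g (c t0)"
  using C1_frechet[OF assms(1-3) c(2)] by metis
 have "((g o c) hvd D c') (at t0 within T)"
  by (rule vector_derivative_diff_chain_within)
   (use c T D in "auto intro: has_vector_derivative_at_within has_derivative_subset")
 thus "((%t. g (c t)) hvd dir_deriv c' g (c t0)) (at t0)"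
  unfolding at_within_open[OF T(2,1)] o_def D(2)[OF cp] .
qed

text \<open>The chain rule produces a derivative of \<open>g\<close> in a direction that varies with
  the point. Expanding the direction in an orthonormal basis of \<open>F\<close> turns it into a sum
  of products with fixed directions, to which the induction hypothesis applies.\<close>

lemma C_on_compose:
 fixes E :: "'a::euclidean_space set" and F :: "'b::euclidean_space set" and g :: "'b => 'c::real_normed_vector"
 assumes E: "subspace E" "open_in E U" and F: "subspace F" "open_in F V"
  and "C_on k E U f" "C_on k F V g" "f ` U <= V"
 shows "C_on k E U (%x. g (f x))"
 using assms(5-)
proof (induction k arbitrary: g)
 case 0 thus ?case by (auto intro: continuous_on_compose2)
next
 case (Suc k)
 obtain C where C: "C <= F" "finite C" "!!x. x \<in> F ==> (\<Sum>b\<in>C. (x \<bullet> b) *R b) = x"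
  using orthonormal_basis_obtain[OF F(1)] by metis
 have VF: "V <= F" using F openin_imp_subset by blast
 show ?case
 proof (rule C_on_SucI[OF E])
  show "continuous_on U (%x. g (f x))"
   using Suc.prems by (auto intro: continuous_on_compose2)
  fix X assume X: "X \<in> E"
  show "C_on k E U (%x. \<Sum>b\<in>C. (dir_deriv X f x \<bullet> b) *R dir_deriv b g (f x))"
  proof (rule C_on_sum[OF E])
   fix b assume "b \<in> C"
   have "C_on k E U (%x. dir_deriv X f x \<bullet> b)"
    by (rule C_on_bounded_linear[OF E bounded_linear_inner_left C_on_dir_deriv[OF Suc.prems(1) X]])
   moreover have "C_on k E U (%x. dir_deriv b g (f x))"
    using Suc.prems C(1) \<open>b \<in> C\<close> by (intro Suc.IH) (auto intro: C_on_Suc_imp C_on_dir_deriv)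
   ultimately show "C_on k E U (%x. (dir_deriv X f x \<bullet> b) *R dir_deriv b g (f x))"
    by (rule C_on_bilinear[OF E bounded_bilinear_scaleR])
  qed
  fix x assume x: "x \<in> U"
  have "\<forall>\<^sub>F t in nhds 0. f (x + t *R X) \<in> F"
   using relopen_line[OF E x X] by eventually_elim (use Suc.prems(3) VF in auto)
  hence *: "dir_deriv X f x \<in> F"
   "((%t. g (f (x + t *R X))) hvd dir_deriv (dir_deriv X f x) g (f x)) (at 0)"
   using C_on_curve[OF F Suc.prems(2) C_on_SucD[OF Suc.prems(1) X x]] Suc.prems(3) x by auto
  have "dir_deriv (dir_deriv X f x) g (f x) = (\<Sum>b\<in>C. (dir_deriv X f x \<bullet> b) *R dir_deriv b g (f x))"
   using dir_deriv_sum[OF F Suc.prems(2) _ C(2), of "f x" "%b. b" "%b. dir_deriv X f x \<bullet> b"]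
    C(1,3) *(1) Suc.prems(3) x by auto
  thus "((%t. g (f (x + t *R X))) hvd
    (\<Sum>b\<in>C. (dir_deriv X f x \<bullet> b) *R dir_deriv b g (f x))) (at 0)" using *(2) by simp
 qed
qed

lemma relopen_self: "open_in E E" by simp

text \<open>Quotients in Hadamard's lemma and in the division by a root are integrals over segments
  of this kind. Differentiating in x brings out a factor t through \<open>T\<close>, so the power
  \<open>t ^ j\<close> is carried along for the induction.\<close>

lemma C_on_parametric_integral:
 fixes E :: "'a::euclidean_space set" and f :: "'a => 'b::banach"
 assumes E: "subspace E" and p: "continuous_on {0..1} p" "!!t. t \<in> {0..1::real} ==> p t \<in> E"
  and S: "linear S" "!!x. x \<in> E ==> S x \<in> E" and T: "linear T" "!!x. x \<in> E ==> T x \<in> E"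
  and f: "!!k. C_on k E E f"
 shows "C_on k E E (%x. integral {0..1} (%t. t ^ j *R f (p t + S x + t *R T x)))"
proof -
 define A where "A x t = p t + S x + t *R T x" for x t
 note AE_intros = subspace_add[OF E] subspace_scale[OF E] p(2) S(2) T(2)
 have AE: "A x t \<in> E" if "x \<in> E" "t \<in> {0..1}" for x t unfolding A_def using that by (intro AE_intros)
 have "continuous_on (E \<times> {0..1}) (%z. A (fst z) (snd z))" unfolding A_def
  by (intro continuous_intros continuous_on_compose2[OF p(1)] bounded_linear.continuous_on[OF S(1)[unfolded linear_conv_bounded_linear]]
    bounded_linear.continuous_on[OF T(1)[unfolded linear_conv_bounded_linear]]) auto
 hence cA: "continuous_on (E \<times> {0..1}) (%z. snd z ^ j *R h (A (fst z) (snd z)))" if "continuous_on E h" for h :: "'a => 'b" and j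
  by (intro continuous_intros continuous_on_compose2[OF that]) (auto simp: AE)
 have int: "(%t. t ^ j *R h (A x t)) integrable_on {0..1}" if "x \<in> E" "continuous_on E h" for x j and h :: "'a => 'b"
 proof -
  have "continuous_on {0..1} (%t. snd (x, t) ^ j *R h (A (fst (x, t)) (snd (x, t))))"
   by (rule continuous_on_compose2[OF cA[OF that(2)]]) (use that in "auto intro!: continuous_intros")
  thus ?thesis by (simp add: integrable_continuous_real)
 qed
 have cI: "continuous_on E (%x. integral {0..1} (%t. t ^ j *R h (A x t)))" if "continuous_on E h" for j and h :: "'a => 'b"
  using integral_continuous_on_param[of E 0 1 "%x t. t ^ j *R h (A x t)"] cA[OF that, of j] by (simp add: split_beta)
 show ?thesis unfolding A_def[symmetric] using f
 proof (induction k arbitrary: f j)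
  case 0 show ?case unfolding C_on.simps by (rule cI[OF C_on_cont[OF 0]])
 next
  case (Suc k)
  have f1: "C_on (Suc 0) E E f" by (rule Suc)
  have dc: "continuous_on E (dir_deriv Z f)" if "Z \<in> E" for Z using C_on_dir_deriv[OF f1 that] by simp
  show ?case
  proof (rule C_on_SucI[OF E relopen_self cI[OF C_on_cont[OF f1]], where f' = "%X x. integral {0..1} (%t. t ^ j *R dir_deriv (S X) f (A x t)) +
    integral {0..1} (%t. t ^ Suc j *R dir_deriv (T X) f (A x t))"])
   fix X assume X: "X \<in> E"
   show "C_on k E E (%x. integral {0..1} (%t. t ^ j *R dir_deriv (S X) f (A x t)) +
     integral {0..1} (%t. t ^ Suc j *R dir_deriv (T X) f (A x t)))"
    by (intro C_on_add[OF E relopen_self] Suc.IH C_on_dir_deriv Suc.prems S(2) T(2) X)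
   fix x assume x: "x \<in> E"
   define fx where "fx s t = t ^ j *R dir_deriv (S X) f (A (x + s *R X) t) + t ^ Suc j *R dir_deriv (T X) f (A (x + s *R X) t)" for s t
   have xs: "x + s *R X \<in> E" for s using x X E by (auto intro!: subspace_add subspace_scale)
   have "((%s. integral (cbox 0 1) (%t. t ^ j *R f (A (x + s *R X) t))) hvd integral (cbox 0 1) (fx 0)) (at 0 within UNIV)"
   proof (rule leibniz_rule_vector_derivative)
    fix s t :: real assume "t \<in> cbox 0 1"
    hence t: "t \<in> {0..1}" by simp
    let ?W = "S X + t *R T X"
    have W: "?W \<in> E" "t *R T X \<in> E" by (intro AE_intros X)+
    have A: "A (x + s *R X) t = A x t + s *R ?W" for s
     unfolding A_def by (simp add: algebra_simps linear_add[OF S(1)] linear_scale[OF S(1)] linear_add[OF T(1)] linear_scale[OF T(1)])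
    have q: "A x t + s *R ?W \<in> E" using AE[OF xs[of s] t] by (simp add: A)
    have "((%s. f (A x t + s *R ?W)) hvd dir_deriv (S X) f (A x t + s *R ?W) + t *R dir_deriv (T X) f (A x t + s *R ?W)) (at s)"
     using C_on_line[OF f1 W(1) q] dir_deriv_linear(1)[OF E relopen_self f1 q S(2)[OF X] W(2)] dir_deriv_linear(2)[OF E relopen_self f1 q T(2)[OF X] T(2)[OF X]] by simp
    from bounded_linear.has_vector_derivative[OF bounded_linear_scaleR_right this, of "t ^ j", unfolded scaleR_add_right scaleR_scaleR]
    show "((%s. t ^ j *R f (A (x + s *R X) t)) hvd fx s t) (at s within UNIV)"
     unfolding fx_def A power_Suc2 scaleR_add_right scaleR_scaleR by (rule has_vector_derivative_at_within)
   next
    show "(%t. t ^ j *R f (A (x + s *R X) t)) integrable_on cbox 0 1" for s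
     using int[OF xs C_on_cont[OF f1]] by simp
   next
    have "continuous_on (UNIV \<times> {0..1}) (%z. snd (x + fst z *R X, snd z) ^ j *R h (A (fst (x + fst z *R X, snd z)) (snd (x + fst z *R X, snd z))))"
     if "continuous_on E h" for j and h :: "'a => 'b"
     by (rule continuous_on_compose2[OF cA[OF that]]) (auto intro!: continuous_intros xs)
    from continuous_on_add[OF this[OF dc[OF S(2)[OF X]], of j] this[OF dc[OF T(2)[OF X]], of "Suc j"]]
    show "continuous_on (UNIV \<times> cbox 0 1) (%(s, t). fx s t)" by (simp add: fx_def split_beta)
   qed auto
   moreover have "integral (cbox 0 1) (fx 0) = integral {0..1} (%t. t ^ j *R dir_deriv (S X) f (A x t)) +
     integral {0..1} (%t. t ^ Suc j *R dir_deriv (T X) f (A x t))"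
    unfolding fx_def using integral_add[OF int[OF x dc[OF S(2)[OF X]], of j] int[OF x dc[OF T(2)[OF X]], of "Suc j"]] by simp
   ultimately show "((%s. integral {0..1} (%t. t ^ j *R f (A (x + s *R X) t))) hvd
     integral {0..1} (%t. t ^ j *R dir_deriv (S X) f (A x t)) + integral {0..1} (%t. t ^ Suc j *R dir_deriv (T X) f (A x t))) (at 0)"
    by simp
  qed
 qed
qed

section \<open>The algebra of smooth functions\<close>

text \<open>The bracket, \<open>Ad\<close> and the roots are meaningful only on a subspace, whereas
  \<open>linear\<close> speaks about the whole type.\<close>

definition lin_on :: "'a::real_vector set => ('a => 'b::real_vector) => bool" where
 "lin_on E T \<longleftrightarrow> (\<forall>x\<in>E. \<forall>y\<in>E. T (x + y) = T x + T y) & (\<forall>c. \<forall>x\<in>E. T (c *R x) = c *R T x)"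

lemma lin_onI: "(!!x y. x \<in> E ==> y \<in> E ==> T (x + y) = T x + T y) ==>
  (!!c x. x \<in> E ==> T (c *R x) = c *R T x) ==> lin_on E T"
 by (auto simp: lin_on_def)

lemma lin_on_add: "lin_on E T ==> x \<in> E ==> y \<in> E ==> T (x + y) = T x + T y"
 and lin_on_scale: "lin_on E T ==> x \<in> E ==> T (c *R x) = c *R T x"
 by (auto simp: lin_on_def)

lemma lin_onI': assumes "subspace E" "!!x y r. x \<in> E ==> y \<in> E ==> T (x + r *R y) = T x + r *R T y" shows "lin_on E T"
proof (rule lin_onI)
 have 0: "0 \<in> E" by (rule subspace_0[OF assms(1)])
 fix x r assume x: "x \<in> E"
 show "T (x + y) = T x + T y" if "y \<in> E" for y using assms(2)[of x y 1] x that by simp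
 show "T (r *R x) = r *R T x" using assms(2)[OF 0 x, of r] assms(2)[OF 0 0, of 1] by simp
qed

lemma lin_on_0: "lin_on E T ==> subspace E ==> T 0 = 0"
 using lin_on_scale[of E T 0 0] subspace_0 by auto

lemma lin_on_neg: "lin_on E T ==> x \<in> E ==> T (- x) = - T x"
 using lin_on_scale[of E T x "-1"] by simp

lemma lin_on_diff: "lin_on E T ==> subspace E ==> x \<in> E ==> y \<in> E ==> T (x - y) = T x - T y"
 using lin_on_add[of E T x "- y"] lin_on_neg[of E T y] subspace_neg by fastforce

lemma lin_on_sum:
 assumes "lin_on E T" "subspace E" "!!i. i \<in> I ==> x i \<in> E"
 shows "T (\<Sum>i\<in>I. x i) = (\<Sum>i\<in>I. T (x i))"
 using assms(3)
 by (induction I rule: infinite_finite_induct) (auto simp: lin_on_0[OF assms(1,2)] lin_on_add[OF assms(1)] subspace_sum[OF assms(2)])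

lemma lin_on_subset: "lin_on E T ==> S <= E ==> lin_on S T"
 unfolding lin_on_def by blast

text \<open>Composition with the orthogonal projection onto \<open>E\<close>. The last conclusion
  makes the extension of the identity a projection with values in \<open>E\<close>.\<close>

lemma lin_on_extend:
 fixes E :: "'a::euclidean_space set"
 assumes "lin_on E T" "subspace E"
 obtains T' where "linear T'" "!!x. x \<in> E ==> T' x = T x" "!!x. T' x \<in> span (T ` E)"
proof -
 obtain C where C: "C <= E" "finite C" "!!x. x \<in> E ==> (\<Sum>b\<in>C. (x \<bullet> b) *R b) = x"
  using orthonormal_basis_obtain[OF assms(2)] by metis
 define T' where "T' x = (\<Sum>b\<in>C. (x \<bullet> b) *R T b)" for x
 have "linear T'"
  by (rule linearI) (auto simp: T'_def inner_add_left scaleR_add_left sum.distrib scaleR_sum_right)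
 moreover have "T' x \<in> span (T ` E)" for x
  unfolding T'_def by (intro span_sum span_scale span_base) (use C(1) in auto)
 moreover have "T' x = T x" if "x \<in> E" for x
 proof -
  have "T x = T (\<Sum>b\<in>C. (x \<bullet> b) *R b)" using C(3)[OF that] by simp
  also have "\<dots> = T' x"
   unfolding T'_def by (subst lin_on_sum[OF assms]) (use C(1) assms in "auto intro!: subspace_scale sum.cong lin_on_scale")
  finally show ?thesis by simp
 qed
 ultimately show ?thesis using that by blast
qed

lemma C_on_lin_on:
 fixes E :: "'a::euclidean_space set" and T :: "'a => 'b::real_normed_vector"
 assumes "lin_on E T" "subspace E" shows "C_on k E E T"
proof -
 obtain T' where T': "linear T'" "!!x. x \<in> E ==> T' x = T x" by (rule lin_on_extend[OF assms], rule that)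
 show ?thesis using C_on_cong[OF assms(2) relopen_self, of T' T] C_on_linear[OF assms(2) relopen_self T'(1)] T'(2) by blast
qed

lemma ext0_in [simp]: "x \<in> E ==> ext0 E f x = f x" and ext0_out [simp]: "x \<notin> E ==> ext0 E f x = 0"
 by (auto simp: ext0_def)

lemma Cinf_out: "f \<in> Cinf E ==> x \<notin> E ==> f x = 0"
 and Cinf_C: "f \<in> Cinf E ==> C_on k E E f"
 by (auto simp: Cinf_def smooth_on_def)

lemma Cinf_ext0:
 assumes "subspace E" "!!k. C_on k E E f" shows "ext0 E f \<in> Cinf E"
proof -
 have "C_on k E E (ext0 E f)" for k
  using C_on_cong[OF assms(1) relopen_self, of "ext0 E f" f] assms(2) by simp
 thus ?thesis by (auto simp: Cinf_def smooth_on_def)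
qed

lemma CinfI:
 assumes "subspace E" "!!k. C_on k E E f" "!!x. x \<notin> E ==> f x = 0" shows "f \<in> Cinf E"
 using assms by (auto simp: Cinf_def smooth_on_def)

lemma Cinf_eqI: "f \<in> Cinf E ==> g \<in> Cinf E ==> (!!x. x \<in> E ==> f x = g x) ==> f = g"
 by (rule ext) (metis Cinf_out)

section \<open>Directional derivatives as operators on smooth functions\<close>

context
 fixes E :: "'e::euclidean_space set"
 assumes sub: "subspace E"
begin

lemma Cinf_const: "ext0 E (%_. c) \<in> Cinf E"
 by (rule Cinf_ext0[OF sub]) (rule C_on_const[OF sub relopen_self])

lemma Cinf_add: "f \<in> Cinf E ==> g \<in> Cinf E ==> (%x. f x + g x) \<in> Cinf E"
 by (rule CinfI[OF sub]) (auto intro: C_on_add[OF sub relopen_self] Cinf_C simp: Cinf_out)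

lemma Cinf_mult: "f \<in> Cinf E ==> g \<in> Cinf E ==> (%x. f x * g x) \<in> Cinf E"
 by (rule CinfI[OF sub]) (auto intro: C_on_bilinear[OF sub relopen_self bounded_bilinear_mult] Cinf_C simp: Cinf_out)

lemma Cinf_scale: "f \<in> Cinf E ==> (%x. c * f x) \<in> Cinf E"
 by (rule CinfI[OF sub]) (auto intro: C_on_bounded_linear[OF sub relopen_self bounded_linear_mult_right] Cinf_C simp: Cinf_out)

lemma Cinf_zero: "(%x. 0) \<in> Cinf E"
 by (rule CinfI[OF sub]) (auto intro: C_on_const[OF sub relopen_self])

lemma Cinf_sum: "(!!i. i \<in> I ==> f i \<in> Cinf E) ==> (%x. \<Sum>i\<in>I. f i x) \<in> Cinf E"
 by (induction I rule: infinite_finite_induct) (auto intro: Cinf_zero Cinf_add)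

lemma Cinf_lin: "lin_on E l ==> ext0 E (%x. cplx (l x)) \<in> Cinf E"
 by (rule Cinf_ext0[OF sub]) (rule C_on_bounded_linear[OF sub relopen_self bounded_linear_of_real C_on_lin_on[OF _ sub]])

lemma Cinf_comp:
 assumes "lin_on E T" "!!x. x \<in> E ==> T x \<in> E" "f \<in> Cinf E"
 shows "ext0 E (%x. f (T x)) \<in> Cinf E"
 by (rule Cinf_ext0[OF sub])
  (rule C_on_compose[OF sub relopen_self sub relopen_self C_on_lin_on[OF assms(1) sub] Cinf_C[OF assms(3)]], use assms in auto)

lemma deriv_op_in: "f \<in> Cinf E ==> x \<in> E ==> der E X f x = dir_deriv X f x"
 by (simp add: deriv_op_def)

lemma deriv_op_Cinf: "f \<in> Cinf E ==> X \<in> E ==> der E X f \<in> Cinf E"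
 unfolding deriv_op_def by (simp add: Cinf_ext0[OF sub] C_on_dir_deriv[OF Cinf_C])

lemma deriv_op_hvd:
 assumes "f \<in> Cinf E" "X \<in> E" "x \<in> E"
 shows "((%t. f (x + t *R X)) hvd der E X f x) (at 0)"
 unfolding deriv_op_in[OF assms(1,3)] by (rule C_on_SucD[OF Cinf_C]) (use assms in auto)

lemma deriv_op_hvd_line:
 assumes "f \<in> Cinf E" "X \<in> E" "x + s *R X \<in> E"
 shows "((%t. f (x + t *R X)) hvd der E X f (x + s *R X)) (at s)"
 unfolding deriv_op_in[OF assms(1,3)] by (rule C_on_line[OF Cinf_C]) (use assms in auto)

lemma deriv_op_eqI:
 assumes "f \<in> Cinf E" "x \<in> E" "((%t. f (x + t *R X)) hvd d) (at 0)"
 shows "der E X f x = d"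
 unfolding deriv_op_in[OF assms(1,2)] by (rule dir_deriv_eqI) fact

lemma deriv_op_curve:
 assumes "f \<in> Cinf E" "(c hvd c') (at t0)" "!!t. c t \<in> E"
 shows "c' \<in> E" "((%t. f (c t)) hvd der E c' f (c t0)) (at t0)"
proof -
 have e: "\<forall>\<^sub>F t in nhds t0. c t \<in> E" using assms(3) by simp
 show "c' \<in> E" "((%t. f (c t)) hvd der E c' f (c t0)) (at t0)"
  using C_on_curve[OF sub relopen_self Cinf_C[OF assms(1)] assms(2) assms(3) e]
  by (auto simp: deriv_op_in[OF assms(1,3)])
qed

lemma deriv_op_add:
 assumes "f \<in> Cinf E" "g \<in> Cinf E" "X \<in> E" "x \<in> E"
 shows "der E X (%x. f x + g x) x = der E X f x + der E X g x"
 by (intro deriv_op_eqI Cinf_add has_vector_derivative_add deriv_op_hvd assms)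

lemma deriv_op_scale:
 assumes "f \<in> Cinf E" "X \<in> E" "x \<in> E"
 shows "der E X (%x. c * f x) x = c * der E X f x"
 by (intro deriv_op_eqI Cinf_scale has_vector_derivative_mult_right deriv_op_hvd assms)

lemma deriv_op_mult:
 assumes "f \<in> Cinf E" "g \<in> Cinf E" "X \<in> E" "x \<in> E"
 shows "der E X (%x. f x * g x) x = f x * der E X g x + der E X f x * g x"
 using has_vector_derivative_mult[OF deriv_op_hvd[OF assms(1,3,4)] deriv_op_hvd[OF assms(2,3,4)]]
 by (intro deriv_op_eqI Cinf_mult assms) simp

lemma deriv_op_const: "X \<in> E ==> der E X (ext0 E (%_. c)) = (%x. 0)"
proof (rule Cinf_eqI[OF deriv_op_Cinf[OF Cinf_const] Cinf_zero])
 fix x assume x: "x \<in> E" "X \<in> E"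
 hence "x + t *R X \<in> E" for t using sub by (auto intro!: subspace_add subspace_scale)
 thus "der E X (ext0 E (%_. c)) x = 0"
  using x by (intro deriv_op_eqI[OF Cinf_const]) auto
qed auto

lemma deriv_op_lin:
 assumes "lin_on E l" "X \<in> E" "x \<in> E"
 shows "der E X (ext0 E (%x. cplx (l x))) x = cplx (l X)"
proof (rule deriv_op_eqI[OF Cinf_lin[OF assms(1)] assms(3)])
 have "x + t *R X \<in> E" "t *R X \<in> E" for t using sub assms by (auto intro!: subspace_add subspace_scale)
 hence "(%t. ext0 E (%x. cplx (l x)) (x + t *R X)) = (%t. cplx (l x) + of_real t * cplx (l X))"
  using assms by (auto simp: lin_on_add[OF assms(1)] lin_on_scale[OF assms(1)])
 thus "((%t. ext0 E (%x. cplx (l x)) (x + t *R X)) hvd cplx (l X)) (at 0)"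
  by (auto intro!: derivative_eq_intros)
qed

lemma deriv_op_dir_linear:
 assumes "f \<in> Cinf E" "X \<in> E" "Y \<in> E"
 shows "der E (X + Y) f x = der E X f x + der E Y f x"
  "der E (c *R X) f x = of_real c * der E X f x"
 using dir_deriv_linear(1)[where E=E and U=E and f=f and k=0 and x=x and X=X and Y=Y, OF sub relopen_self Cinf_C[OF assms(1)]]
  dir_deriv_linear(2)[where E=E and U=E and f=f and k=0 and x=x and X=X and Y=X and c=c, OF sub relopen_self Cinf_C[OF assms(1)]] assms
 by (cases "x \<in> E"; simp add: deriv_op_def scaleR_conv_of_real)+

lemma deriv_op_dir_sum:
 assumes "f \<in> Cinf E" "finite I" "!!i. i \<in> I ==> X i \<in> E"
 shows "der E (\<Sum>i\<in>I. c i *R X i) f x = (\<Sum>i\<in>I. of_real (c i) * der E (X i) f x)"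
 using dir_deriv_sum[where E=E and U=E and f=f and k=0 and x=x and X=X and I=I and c=c, OF sub relopen_self Cinf_C[OF assms(1)]] assms
 by (cases "x \<in> E"; simp add: deriv_op_def scaleR_conv_of_real)

lemma deriv_op_comp:
 assumes "lin_on E T" "!!x. x \<in> E ==> T x \<in> E" "f \<in> Cinf E" "X \<in> E" "x \<in> E"
 shows "der E X (ext0 E (%x. f (T x))) x = der E (T X) f (T x)"
proof (rule deriv_op_eqI[OF Cinf_comp[OF assms(1-3)] assms(5)])
 have "x + t *R X \<in> E" "t *R X \<in> E" for t using sub assms by (auto intro!: subspace_add subspace_scale)
 hence "(%t. ext0 E (%x. f (T x)) (x + t *R X)) = (%t. f (T x + t *R T X))"
  using assms by (auto simp: lin_on_add[OF assms(1)] lin_on_scale[OF assms(1)])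
 thus "((%t. ext0 E (%x. f (T x)) (x + t *R X)) hvd der E (T X) f (T x)) (at 0)"
  using deriv_op_hvd[OF assms(3), of "T X" "T x"] assms by simp
qed

lemma deriv_op_segment:
 assumes "f \<in> Cinf E" "x \<in> E" "X \<in> E"
 shows "f (x + X) - f x = integral {0..1} (%t. der E X f (x + t *R X))"
proof -
 have "((%t. der E X f (x + t *R X)) has_integral (f (x + 1 *R X) - f (x + 0 *R X))) {0..1}"
 proof (rule fundamental_theorem_of_calculus)
  fix t :: real
  have "x + t *R X \<in> E" using assms sub by (auto intro!: subspace_add subspace_scale)
  thus "((%t. f (x + t *R X)) hvd der E X f (x + t *R X)) (at t within {0..1})"
   by (rule has_vector_derivative_at_within[OF deriv_op_hvd_line[OF assms(1,3)]])
 qed simp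
 thus ?thesis by (simp add: integral_unique)
qed

end

section \<open>Subspaces with an inner product\<close>

lemma fun_plus_conv: "(f::'a => 'b::plus) + g = (%x. f x + g x)" by (rule plus_fun_def)

lemma End_CinfD:
 assumes "T \<in> End_Cinf E"
 shows "f \<in> Cinf E ==> T f \<in> Cinf E" "f \<notin> Cinf E ==> T f = 0"
  "f \<in> Cinf E ==> g \<in> Cinf E ==> T (%x. f x + g x) = (%x. T f x + T g x)"
  "f \<in> Cinf E ==> T (%x. c * f x) = (%x. c * T f x)"
 using assms unfolding End_Cinf_def fun_plus_conv by auto

lemma End_CinfI:
 assumes "!!f. f \<in> Cinf E ==> T f \<in> Cinf E" "!!f. f \<notin> Cinf E ==> T f = 0"
  "!!f g. f \<in> Cinf E ==> g \<in> Cinf E ==> T (%x. f x + g x) = (%x. T f x + T g x)"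
  "!!f c. f \<in> Cinf E ==> T (%x. c * f x) = (%x. c * T f x)"
 shows "T \<in> End_Cinf E"
 using assms unfolding End_Cinf_def fun_plus_conv by auto

text \<open>Evaluating an operator at a point gives such a functional;
  \<open>hadamard_functional\<close> is the test for its vanishing.\<close>

definition functional :: "'e::euclidean_space set => ('e fn => complex) => bool" where
 "functional E \<Lambda> \<longleftrightarrow> (\<forall>f\<in>Cinf E. (\<forall>g\<in>Cinf E. \<Lambda> (%x. f x + g x) = \<Lambda> f + \<Lambda> g) & (\<forall>c. \<Lambda> (%x. c * f x) = c * \<Lambda> f))"

lemma functionalD:
 assumes "functional E \<Lambda>"
 shows "f \<in> Cinf E ==> g \<in> Cinf E ==> \<Lambda> (%x. f x + g x) = \<Lambda> f + \<Lambda> g" "f \<in> Cinf E ==> \<Lambda> (%x. c * f x) = c * \<Lambda> f"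
 using assms by (auto simp: functional_def)

lemma functional_sum:
 assumes "subspace E" "functional E \<Lambda>" "!!i. i \<in> I ==> h i \<in> Cinf E" shows "\<Lambda> (%x. \<Sum>i\<in>I. h i x) = (\<Sum>i\<in>I. \<Lambda> (h i))"
 using assms(3)
proof (induction I rule: infinite_finite_induct)
 case (insert i I)
 thus ?case using functionalD(1)[OF assms(2), of "h i" "%x. \<Sum>i\<in>I. h i x"] Cinf_sum[OF assms(1), of I h] by simp
qed (use functionalD(2)[OF assms(2) Cinf_zero[OF assms(1)], of 0] in auto)

lemma functional_intros:
 "functional E (%f. f x)"
 "functional E \<Lambda> ==> functional E \<Lambda>' ==> functional E (%f. \<Lambda> f + \<Lambda>' f)" "functional E \<Lambda> ==> functional E \<Lambda>' ==> functional E (%f. \<Lambda> f - \<Lambda>' f)"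
 "functional E \<Lambda> ==> functional E (%f. a * \<Lambda> f)" "functional E \<Lambda> ==> functional E (%f. \<Lambda> f / a)"
 "(!!i. i \<in> I ==> functional E (\<Lambda>i i)) ==> functional E (%f. \<Sum>i\<in>I. \<Lambda>i i f)"
 by (auto simp: functional_def End_CinfD sum.distrib sum_distrib_left algebra_simps add_divide_distrib)

lemma functional_End:
 "T \<in> End_Cinf E ==> functional E (%f. T f x)" "S \<in> End_Cinf E ==> T \<in> End_Cinf E ==> functional E (%f. S (T f) x)"
 by (auto simp: functional_def End_CinfD)

text \<open>Three instances occur: the Killing form on \<open>s\<close>, the Killing form on
  \<open>a\<close>, and the form \<open>Bt\<close> on the whole Lie algebra.\<close>

locale inner_subspace =
 fixes E :: "'e::euclidean_space set" and B :: "'e => 'e => real"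
 assumes sub: "subspace E"
  and B_lin1: "!!y. y \<in> E ==> lin_on E (%x. B x y)"
  and B_sym: "!!x y. x \<in> E ==> y \<in> E ==> B x y = B y x"
  and B_pos: "!!x. x \<in> E ==> x ~= 0 ==> B x x > 0"
begin

lemma in_E [simp, intro]:
 "x \<in> E ==> y \<in> E ==> x + y \<in> E" "x \<in> E ==> y \<in> E ==> x - y \<in> E" "x \<in> E ==> c *R x \<in> E"
 "x \<in> E ==> - x \<in> E" "0 \<in> E"
 using sub by (auto intro: subspace_add subspace_diff subspace_scale subspace_neg subspace_0)

lemma B_lin2: "x \<in> E ==> lin_on E (B x)"
 using B_lin1[of x] B_sym unfolding lin_on_def by (metis in_E(1,3))

lemma B_simps:
 shows "x \<in> E ==> y \<in> E ==> z \<in> E ==> B (x + y) z = B x z + B y z"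
  and "x \<in> E ==> z \<in> E ==> B (c *R x) z = c * B x z"
  and "x \<in> E ==> y \<in> E ==> z \<in> E ==> B (x - y) z = B x z - B y z"
  and "x \<in> E ==> z \<in> E ==> B (- x) z = - B x z"
  and "x \<in> E ==> y \<in> E ==> z \<in> E ==> B z (x + y) = B z x + B z y"
  and "x \<in> E ==> z \<in> E ==> B z (c *R x) = c * B z x"
  and "x \<in> E ==> y \<in> E ==> z \<in> E ==> B z (x - y) = B z x - B z y"
  and "x \<in> E ==> z \<in> E ==> B z (- x) = - B z x"
  and "z \<in> E ==> B 0 z = 0" and "z \<in> E ==> B z 0 = 0"
 using lin_on_add[OF B_lin1] lin_on_scale[OF B_lin1] lin_on_diff[OF B_lin1 sub] lin_on_neg[OF B_lin1]
  lin_on_add[OF B_lin2] lin_on_scale[OF B_lin2] lin_on_diff[OF B_lin2 sub] lin_on_neg[OF B_lin2]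
  lin_on_0[OF B_lin1 sub] lin_on_0[OF B_lin2 sub]
 by simp_all

lemma B_sum:
 assumes "!!i. i \<in> I ==> x i \<in> E" "z \<in> E"
 shows "B (\<Sum>i\<in>I. x i) z = (\<Sum>i\<in>I. B (x i) z)" "B z (\<Sum>i\<in>I. x i) = (\<Sum>i\<in>I. B z (x i))"
 using lin_on_sum[OF B_lin1[OF assms(2)] sub, of I x] lin_on_sum[OF B_lin2[OF assms(2)] sub, of I x] assms by auto

lemma B_nondeg: "x \<in> E ==> (!!y. y \<in> E ==> B x y = 0) ==> x = 0"
 using B_pos[of x] by force

definition onb :: "'e set => 'e set => bool" where
 "onb S C \<longleftrightarrow> C <= S & finite C & (\<forall>b\<in>C. \<forall>c\<in>C. B b c = (if b = c then 1 else 0)) \<and>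
   (\<forall>x\<in>S. (\<Sum>c\<in>C. B x c *R c) = x)"

lemma onbD:
 assumes "onb S C"
 shows "C <= S" "finite C" "b \<in> C ==> c \<in> C ==> B b c = (if b = c then 1 else 0)"
  "x \<in> S ==> (\<Sum>c\<in>C. B x c *R c) = x"
 using assms unfolding onb_def by auto

lemma orthonormal_coeff:
 assumes "finite C" "C <= E" "!!b c. b \<in> C ==> c \<in> C ==> B b c = (if b = c then 1 else 0)" "c \<in> C"
 shows "B (\<Sum>b\<in>C. u b *R b) c = u c"
proof -
 have "B (\<Sum>b\<in>C. u b *R b) c = (\<Sum>b\<in>C. B (u b *R b) c)"
  using assms by (intro B_sum) auto
 also have "\<dots> = (\<Sum>b\<in>C. if b = c then u b else 0)"
  by (rule sum.cong) (use assms in "auto simp: B_simps subset_iff")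
 finally show ?thesis using assms by simp
qed

lemma orthonormal_onb:
 assumes "finite C" "C <= E" "!!b c. b \<in> C ==> c \<in> C ==> B b c = (if b = c then 1 else 0)"
 shows "onb (span C) C"
proof -
 have "(\<Sum>c\<in>C. B x c *R c) = x" if "x \<in> span C" for x
 proof -
  obtain u where u: "x = (\<Sum>b\<in>C. u b *R b)" using \<open>x \<in> span C\<close> unfolding span_finite[OF assms(1)] by blast
  have "B x c = u c" if "c \<in> C" for c unfolding u by (rule orthonormal_coeff[OF assms that])
  thus ?thesis using u by simp
 qed
 thus ?thesis unfolding onb_def using assms by (auto simp: span_base)
qed

lemma orthonormal_independent:
 assumes "finite C" "C <= E" "!!b c. b \<in> C ==> c \<in> C ==> B b c = (if b = c then 1 else 0)"
 shows "independent C"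
proof (rule independent_if_scalars_zero[OF assms(1)])
 fix u c assume "(\<Sum>b\<in>C. u b *R b) = 0" "c \<in> C"
 thus "u c = 0" using orthonormal_coeff[OF assms, of c u] B_simps(9) assms(2) by auto
qed

lemma onb_card: "onb S C ==> subspace S ==> S <= E ==> card C = dim S"
proof -
 assume S: "onb S C" "subspace S" "S <= E"
 have "independent C" by (rule orthonormal_independent) (use onbD[OF S(1)] S in auto)
 moreover have "span C = S"
 proof
  show "span C <= S" using onbD(1)[OF S(1)] S(2) by (simp add: span_minimal)
  show "S <= span C"
  proof
   fix x assume "x \<in> S"
   have "(\<Sum>c\<in>C. B x c *R c) \<in> span C" by (intro span_sum span_scale span_base)
   thus "x \<in> span C" using onbD(4)[OF S(1) \<open>x \<in> S\<close>] by simp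
  qed
 qed
 ultimately show ?thesis using dim_span_eq_card_independent[of C] by simp
qed

lemma gram_schmidt:
 assumes "finite A" "A <= E"
 shows "\<exists>C. finite C & C <= E & (\<forall>b\<in>C. \<forall>c\<in>C. B b c = (if b = c then 1 else 0)) & span C = span A"
 using assms
proof (induction A rule: finite_induct)
 case empty show ?case by (intro exI[of _ "{}"]) auto
next
 case (insert a A)
 then obtain C where C: "finite C" "C <= E" "\<forall>b\<in>C. \<forall>c\<in>C. B b c = (if b = c then 1 else 0)" "span C = span A"
  by blast
 have a: "a \<in> E" using insert by auto
 define p where "p = (\<Sum>c\<in>C. B a c *R c)"
 define w where "w = a - p"
 have pE: "p \<in> E" unfolding p_def using C(2) sub by (auto intro!: subspace_sum)
 have pC: "p \<in> span C" unfolding p_def by (intro span_sum span_scale span_base)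
 have wE: "w \<in> E" using a pE w_def by auto
 have w0: "B w c = 0" if "c \<in> C" for c
 proof -
  have "B p c = B a c" unfolding p_def by (rule orthonormal_coeff) (use C that in auto)
  thus ?thesis using a pE C(2) that by (auto simp: w_def B_simps)
 qed
 show ?case
 proof (cases "w = 0")
  case True
  hence "a \<in> span C" using pC w_def by simp
  hence "span (insert a A) = span C" using C(4) by (simp add: span_redundant)
  thus ?thesis using C by metis
 next
  case False
  define v where "v = (1 / sqrt (B w w)) *R w"
  have Bw: "B w w > 0" using B_pos wE False by auto
  have vE: "v \<in> E" using wE v_def by auto
  have vv: "B v v = 1" using Bw wE by (simp add: v_def B_simps)
  have vc: "B v c = 0" "B c v = 0" if "c \<in> C" for c
   using w0[OF that] B_sym[OF wE, of c] wE C(2) that by (auto simp: v_def B_simps subset_iff)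
  have "span (insert v C) = span (insert a A)"
  proof -
   have 1: "v \<in> span (insert a A)"
   proof -
    have "p \<in> span (insert a A)" using pC C(4) span_mono[of A "insert a A"] by auto
    thus ?thesis unfolding v_def w_def by (intro span_scale span_diff) (auto intro: span_base)
   qed
   have 2: "a \<in> span (insert v C)"
   proof -
    have "a = sqrt (B w w) *R v + p" using Bw by (simp add: v_def w_def)
    moreover have "p \<in> span (insert v C)" using pC span_mono[of C "insert v C"] by auto
    ultimately show ?thesis by (metis insertI1 span_add span_base span_scale)
   qed
   have "A <= span C" "C <= span A" using C(4) span_base by auto
   hence 3: "A <= span (insert v C)" "C <= span (insert a A)"
    using span_mono[of C "insert v C"] span_mono[of A "insert a A"] by auto
   show ?thesis using 1 2 3 by (intro subset_antisym span_minimal) auto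
  qed
  thus ?thesis using C vE vv vc
   by (intro exI[of _ "insert v C"]) (auto split: if_splits)
 qed
qed

lemma onb_exists:
 assumes "subspace S" "S <= E" obtains C where "onb S C"
proof -
 obtain A where A: "A <= S" "finite A" "span A = S"
  using orthonormal_basis_obtain[OF assms(1)] by metis
 obtain C where C: "finite C" "C <= E" "\<forall>b\<in>C. \<forall>c\<in>C. B b c = (if b = c then 1 else 0)" "span C = span A"
  using gram_schmidt[of A] A assms by blast
 have "onb (span C) C" by (rule orthonormal_onb) (use C in auto)
 thus ?thesis using that C(4) A(3) by simp
qed

lemma riesz:
 assumes "lin_on E l" obtains X where "X \<in> E" "!!y. y \<in> E ==> l y = B X y"
proof -
 obtain C where C: "onb E C" by (rule onb_exists[OF sub order_refl])
 note C' = onbD[OF C]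
 define X where "X = (\<Sum>c\<in>C. l c *R c)"
 have "X \<in> E" unfolding X_def using C'(1) by (auto intro!: subspace_sum[OF sub])
 moreover have "l y = B X y" if y: "y \<in> E" for y
 proof -
  have "l y = l (\<Sum>c\<in>C. B y c *R c)" using C'(4)[OF y] by simp
  also have "\<dots> = (\<Sum>c\<in>C. l (B y c *R c))" using C'(1) by (intro lin_on_sum[OF assms sub]) auto
  also have "\<dots> = (\<Sum>c\<in>C. B y c * l c)" using C'(1) by (intro sum.cong) (auto simp: lin_on_scale[OF assms] subset_iff)
  also have "\<dots> = (\<Sum>c\<in>C. B (l c *R c) y)" using C'(1) y by (intro sum.cong) (auto simp: B_simps B_sym subset_iff)
  also have "\<dots> = B X y" unfolding X_def using C'(1) y by (intro B_sum(1)[symmetric]) auto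
  finally show ?thesis .
 qed
 ultimately show ?thesis using that by blast
qed

text \<open>The polynomial that represents \<zeta> when the symmetric algebra of \<open>E\<close> is
  identified with \<open>Pol E\<close>.\<close>

definition xf :: "'e => 'e fn" where "xf \<zeta> = ext0 E (%x. cplx (B \<zeta> x))"
abbreviation (input) "mx \<zeta> f \<equiv> %x. xf \<zeta> x * f x"

lemma xf_in [simp]: "x \<in> E ==> xf \<zeta> x = cplx (B \<zeta> x)" by (simp add: xf_def)

lemma xf_Cinf: "\<zeta> \<in> E ==> xf \<zeta> \<in> Cinf E"
 unfolding xf_def by (rule Cinf_lin[OF sub B_lin2])

lemma xf_mult_Cinf: "\<zeta> \<in> E ==> f \<in> Cinf E ==> (mx \<zeta> f) \<in> Cinf E"
 by (rule Cinf_mult[OF sub xf_Cinf])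

lemma deriv_op_xf: "\<zeta> \<in> E ==> X \<in> E ==> x \<in> E ==> der E X (xf \<zeta>) x = cplx (B \<zeta> X)"
 unfolding xf_def by (rule deriv_op_lin[OF sub B_lin2])

lemma deriv_op_xf_mult:
 "\<zeta> \<in> E ==> X \<in> E ==> x \<in> E ==> f \<in> Cinf E ==>
  der E X (mx \<zeta> f) x = xf \<zeta> x * der E X f x + cplx (B \<zeta> X) * f x"
 by (simp add: deriv_op_mult[OF sub xf_Cinf] deriv_op_xf)

text \<open>By Hadamard's lemma \<open>f - f x0\<close> lies in the ideal generated by the coordinates vanishing at
 \<open>x0\<close>.  Operator identities are therefore checked on constants and on commutators with coordinates.\<close>

lemma hadamard_functional:
 fixes \<Lambda> :: "'e fn => complex"
 assumes x0: "x0 \<in> E" and \<Lambda>: "functional E \<Lambda>"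
  and mult: "!!\<zeta> f. f \<in> Cinf E ==> \<zeta> \<in> E ==> \<Lambda> (mx \<zeta> f) = of_real (B \<zeta> x0) * \<Lambda> f"
  and one: "\<Lambda> (ext0 E (%_. 1)) = 0"
  and f: "f \<in> Cinf E"
 shows "\<Lambda> f = 0"
proof -
 obtain C where C: "onb E C" by (rule onb_exists[OF sub order_refl])
 note C' = onbD[OF C] and add = functionalD(1)[OF \<Lambda>] and scale = functionalD(2)[OF \<Lambda>]
 \<comment> \<open>The Hadamard coefficient for the coordinate \<open>c\<close>: the mean of the
   partial derivative over the segment from x0 to x.\<close>
 define g where "g c = ext0 E (%x. integral {0..1} (%t. der E c f (x0 + t *R (x - x0))))" for c
 have gC: "g c \<in> Cinf E" if "c \<in> C" for c
  unfolding g_def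
 proof (rule Cinf_ext0[OF sub])
  fix k
  have "C_on k E E (%x. integral {0..1} (%t. t ^ 0 *R der E c f ((1 - t) *R x0 + 0 + t *R x)))"
   by (rule C_on_parametric_integral[OF sub _ _ linear_zero _ linear_ident])
    (use x0 that C'(1) in "auto intro!: continuous_intros Cinf_C deriv_op_Cinf[OF sub f]")
  thus "C_on k E E (%x. integral {0..1} (%t. der E c f (x0 + t *R (x - x0))))"
   by (simp add: algebra_simps)
 qed
 have feq: "f x = f x0 + (\<Sum>c\<in>C. (xf c x - of_real (B c x0)) * g c x)" if x: "x \<in> E" for x
 proof -
  have "f (x0 + (x - x0)) - f x0 = integral {0..1} (%t. der E (x - x0) f (x0 + t *R (x - x0)))"
   using x x0 by (intro deriv_op_segment[OF sub f]) auto
  also have "\<dots> = integral {0..1} (%t. \<Sum>c\<in>C. of_real (B (x - x0) c) * der E c f (x0 + t *R (x - x0)))"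
  proof -
   have "der E (x - x0) f y = (\<Sum>c\<in>C. of_real (B (x - x0) c) * der E c f y)" for y
    using deriv_op_dir_sum[OF sub f C'(2), of "%c. c" "%c. B (x - x0) c" y] C'(1,4) x x0 by (auto simp: subset_iff)
   thus ?thesis by simp
  qed
  also have "\<dots> = (\<Sum>c\<in>C. integral {0..1} (%t. of_real (B (x - x0) c) * der E c f (x0 + t *R (x - x0))))"
  proof (rule integral_sum[OF C'(2)])
   fix c assume c: "c \<in> C"
   have "continuous_on E (der E c f)"
    using C_on_cont[OF Cinf_C[OF deriv_op_Cinf[OF sub f]]] c C'(1) by blast
   hence "continuous_on {0..1} (%t. der E c f (x0 + t *R (x - x0)))"
    by (rule continuous_on_compose2) (use x x0 in "auto intro!: continuous_intros")
   thus "(%t. of_real (B (x - x0) c) * der E c f (x0 + t *R (x - x0))) integrable_on {0..1}"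
    by (intro integrable_continuous_real continuous_intros)
  qed
  also have "\<dots> = (\<Sum>c\<in>C. (xf c x - of_real (B c x0)) * g c x)"
  proof (rule sum.cong[OF refl])
   fix c assume c: "c \<in> C"
   hence "B (x - x0) c = B c x - B c x0" using C'(1) x x0 B_sym by (auto simp: B_simps subset_iff)
   thus "integral {0..1} (%t. of_real (B (x - x0) c) * der E c f (x0 + t *R (x - x0))) = (xf c x - of_real (B c x0)) * g c x"
    using x by (simp add: g_def)
  qed
  finally show ?thesis by (simp add: algebra_simps)
 qed
 have tm: "(%x. xf c x * g c x + (- of_real (B c x0)) * g c x) \<in> Cinf E" "\<Lambda> (%x. xf c x * g c x + (- of_real (B c x0)) * g c x) = 0"
  if "c \<in> C" for c
 proof -
  have cE: "c \<in> E" using that C'(1) by auto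
  note 1 = xf_mult_Cinf[OF cE gC[OF that]] Cinf_scale[OF sub gC[OF that], of "- of_real (B c x0)"]
  show "(%x. xf c x * g c x + (- of_real (B c x0)) * g c x) \<in> Cinf E" by (rule Cinf_add[OF sub 1])
  show "\<Lambda> (%x. xf c x * g c x + (- of_real (B c x0)) * g c x) = 0"
   unfolding add[OF 1] mult[OF gC[OF that] cE] scale[OF gC[OF that]] by simp
 qed
 have "f = (%x. f x0 * ext0 E (%_. 1) x + (\<Sum>c\<in>C. xf c x * g c x + (- of_real (B c x0)) * g c x))"
  by (rule Cinf_eqI[OF f], intro Cinf_add[OF sub] Cinf_scale[OF sub] Cinf_const[OF sub] Cinf_sum[OF sub] tm(1))
   (use feq in "simp_all add: left_diff_distrib")
 hence "\<Lambda> f = \<Lambda> (%x. f x0 * ext0 E (%_. 1) x + (\<Sum>c\<in>C. xf c x * g c x + (- of_real (B c x0)) * g c x))"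
  by (rule arg_cong)
 also have "\<dots> = 0"
  using one tm(2) by (simp only: add[OF Cinf_scale[OF sub Cinf_const[OF sub]] Cinf_sum[OF sub tm(1)]] scale[OF Cinf_const[OF sub]]
    functional_sum[OF sub \<Lambda> tm(1)]) simp
 finally show ?thesis .
qed

text \<open>Along the direction r every \<alpha> in P varies with nonzero slope, so each x is a
  limit of points \<open>x + t r\<close> that avoid all the hyperplanes.\<close>

lemma agree_dense:
 assumes P: "finite P" "!!\<alpha>. \<alpha> \<in> P ==> lin_on E \<alpha>" and r: "r \<in> E" "!!\<alpha>. \<alpha> \<in> P ==> \<alpha> r ~= (0::real)"
  and fg: "f \<in> Cinf E" "g \<in> Cinf E" and eq: "!!x. x \<in> E ==> (!!\<alpha>. \<alpha> \<in> P ==> \<alpha> x ~= 0) ==> f x = g x"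
 shows "f = g"
proof (rule Cinf_eqI[OF fg])
 fix x assume x: "x \<in> E"
 define h where "h t = f (x + t *R r) - g (x + t *R r)" for t :: real
 have xE: "x + t *R r \<in> E" for t using x r by auto
 have "continuous_on E f" "continuous_on E g" using C_on_cont[OF Cinf_C] fg by blast+
 hence "continuous_on UNIV h" unfolding h_def
  by (intro continuous_on_diff; elim continuous_on_compose2) (auto intro!: continuous_intros simp: xE)
 hence "(h \<longlongrightarrow> h 0) (at 0)" by (simp add: continuous_on_def)
 moreover have "\<forall>\<^sub>F t in at 0. h t = 0"
 proof -
  have "\<forall>\<^sub>F t in at 0. \<alpha> (x + t *R r) ~= 0" if "\<alpha> \<in> P" for \<alpha>
  proof -
   have e: "\<alpha> (x + t *R r) = \<alpha> x + t * \<alpha> r" for t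
    using lin_on_add[OF P(2)[OF that]] lin_on_scale[OF P(2)[OF that]] x r by auto
   have "\<forall>\<^sub>F t in at 0. t ~= - \<alpha> x / \<alpha> r"
    by (rule eventually_neq_at_within)
   thus ?thesis by eventually_elim (use r(2)[OF that] in "auto simp: e field_simps")
  qed
  hence "\<forall>\<^sub>F t in at 0. \<forall>\<alpha>\<in>P. \<alpha> (x + t *R r) ~= 0"
   using P(1) by (simp add: eventually_ball_finite)
  thus ?thesis by eventually_elim (use eq xE in "auto simp: h_def")
 qed
 hence "(h \<longlongrightarrow> 0) (at 0)" by (rule tendsto_eventually)
 ultimately have "h 0 = 0" by (rule LIM_unique)
 thus "f x = g x" by (simp add: h_def)
qed

end

section \<open>Linear operators on smooth functions\<close>

lemma End_sum1:
 assumes T: "T \<in> End_Cinf E" and "subspace E" "!!i. i \<in> I ==> f i \<in> Cinf E"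
 shows "T (%x. \<Sum>i\<in>I. f i x) = (%x. \<Sum>i\<in>I. T (f i) x)"
 by (rule ext) (rule functional_sum[OF assms(2) functional_End(1)[OF T] assms(3)])

lemma End_sum:
 assumes "T \<in> End_Cinf E" "subspace E" "!!i. i \<in> I ==> f i \<in> Cinf E"
 shows "T (%x. \<Sum>i\<in>I. c i * f i x) = (%x. \<Sum>i\<in>I. c i * T (f i) x)"
 using End_sum1[OF assms(1,2), of I "%i x. c i * f i x"] End_CinfD(4)[OF assms(1) assms(3)] Cinf_scale[OF assms(2) assms(3)] by simp

lemma End_comp:
 assumes "S \<in> End_Cinf E" "T \<in> End_Cinf E" "subspace E" shows "S o T \<in> End_Cinf E"
proof (rule End_CinfI)
 fix f assume "f \<notin> Cinf E"
 hence "T f = (%x. 0)" using End_CinfD(2)[OF assms(2)] by (simp add: zero_fun_def)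
 thus "(S o T) f = 0" using End_CinfD(4)[OF assms(1) Cinf_zero[OF assms(3)], of 0] by (simp add: zero_fun_def)
qed (simp_all add: End_CinfD[OF assms(1)] End_CinfD[OF assms(2)])

lemma deriv_op_End: assumes "subspace E" "X \<in> E" shows "der E X \<in> End_Cinf E"
proof (rule End_CinfI)
 fix f g :: "'a => complex" and c assume f: "f \<in> Cinf E"
 show 1: "der E X f \<in> Cinf E" by (rule deriv_op_Cinf[OF assms(1) f assms(2)])
 show "der E X (%x. c * f x) = (%x. c * der E X f x)"
  by (rule Cinf_eqI[OF deriv_op_Cinf[OF assms(1) Cinf_scale[OF assms(1) f] assms(2)] Cinf_scale[OF assms(1) 1]])
   (rule deriv_op_scale[OF assms(1) f assms(2)])
 assume g: "g \<in> Cinf E"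
 show "der E X (%x. f x + g x) = (%x. der E X f x + der E X g x)"
  by (rule Cinf_eqI[OF deriv_op_Cinf[OF assms(1) Cinf_add[OF assms(1) f g] assms(2)]
     Cinf_add[OF assms(1) 1 deriv_op_Cinf[OF assms(1) g assms(2)]]])
   (rule deriv_op_add[OF assms(1) f g assms(2)])
qed (simp add: deriv_op_def)

section \<open>Dunkl operators\<close>

text \<open>With P empty the operators \<open>D\<close> are the directional derivatives, so that
  \<open>s\<close> and \<open>a\<close> fall under one theory. The vector \<open>H \<alpha>\<close>
  represents \<alpha> with respect to B.\<close>

locale dunkl_data = inner_subspace E B
 for E :: "'e::euclidean_space set" and B +
 fixes P :: "('e => real) set" and k :: "('e => real) => real" and H :: "('e => real) => 'e"
 assumes finP: "finite P" and H_in: "!!\<alpha>. \<alpha> \<in> P ==> H \<alpha> \<in> E" and H_ne: "!!\<alpha>. \<alpha> \<in> P ==> H \<alpha> ~= 0"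
  and H_eq: "!!\<alpha> x. \<alpha> \<in> P ==> x \<in> E ==> \<alpha> x = B (H \<alpha>) x"
begin

abbreviation N :: "('e => real) => real" where "N \<alpha> \<equiv> B (H \<alpha>) (H \<alpha>)"

definition rf :: "('e => real) => 'e => 'e" where "rf \<alpha> x = x - (2 * \<alpha> x / N \<alpha>) *R H \<alpha>"

definition rho :: "('e => real) => 'e fn => 'e fn" where "rho \<alpha> f = ext0 E (%x. f (rf \<alpha> x))"

definition qt :: "('e => real) => 'e fn => 'e fn" where
 "qt \<alpha> f = (THE g. g \<in> Cinf E & (\<forall>x\<in>E. cplx (\<alpha> x) * g x = f x - f (rf \<alpha> x)))"

definition D :: "'e => 'e fn => 'e fn" where
 "D \<xi> = ext0 (Cinf E) (%f x. der E \<xi> f x + (\<Sum>\<alpha>\<in>P. cplx (k \<alpha> * \<alpha> \<xi>) * qt \<alpha> f x))"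

lemma N_pos: "\<alpha> \<in> P ==> N \<alpha> > 0" using B_pos H_in H_ne by blast

lemma P_lin: "\<alpha> \<in> P ==> lin_on E \<alpha>"
 using B_lin2[OF H_in, of \<alpha>] H_eq[of \<alpha>] unfolding lin_on_def by (simp add: sub subspace_add subspace_scale)

lemma rf_in [simp]: "\<alpha> \<in> P ==> x \<in> E ==> rf \<alpha> x \<in> E" unfolding rf_def using H_in by auto

lemma rf_lin: "\<alpha> \<in> P ==> lin_on E (rf \<alpha>)"
 by (rule lin_onI) (simp_all add: rf_def lin_on_add[OF P_lin] lin_on_scale[OF P_lin] algebra_simps add_divide_distrib)

lemma P_rf: "\<alpha> \<in> P ==> x \<in> E ==> \<alpha> (rf \<alpha> x) = - \<alpha> x"
 using N_pos[of \<alpha>] unfolding rf_def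
 by (simp add: lin_on_diff[OF P_lin sub] lin_on_scale[OF P_lin] H_in) (simp add: H_eq H_in)

lemma rf_rf: "\<alpha> \<in> P ==> x \<in> E ==> rf \<alpha> (rf \<alpha> x) = x"
 using P_rf[of \<alpha> x] by (simp add: rf_def)

lemma B_rf: "\<alpha> \<in> P ==> x \<in> E ==> \<zeta> \<in> E ==> B \<zeta> (rf \<alpha> x) = B \<zeta> x - 2 * \<alpha> x * \<alpha> \<zeta> / N \<alpha>"
 unfolding rf_def by (simp add: B_simps H_in H_eq B_sym[of "H \<alpha>" \<zeta>])

lemma rho_Cinf: "\<alpha> \<in> P ==> f \<in> Cinf E ==> rho \<alpha> f \<in> Cinf E"
 unfolding rho_def by (rule Cinf_comp[OF sub rf_lin]) auto

lemma rho_in: "x \<in> E ==> rho \<alpha> f x = f (rf \<alpha> x)" by (simp add: rho_def)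

lemma qt_unique:
 assumes "\<alpha> \<in> P" "g \<in> Cinf E" "g' \<in> Cinf E"
  "!!x. x \<in> E ==> cplx (\<alpha> x) * g x = cplx (\<alpha> x) * g' x"
 shows "g = g'"
 using N_pos[OF assms(1)] H_eq[OF assms(1) H_in[OF assms(1)]] assms
 by (intro agree_dense[of "{\<alpha>}" "H \<alpha>"]) (auto simp: P_lin H_in)

text \<open>The segment from x to its reflection has direction -(2 \<alpha> x / N \<alpha>) H
  \<alpha>. Integrating the derivative of f along it puts the factor \<alpha> x in front, and the
  remaining integral is smooth in x.\<close>

lemma qt_exists:
 assumes "\<alpha> \<in> P" "f \<in> Cinf E"
 shows "\<exists>g. g \<in> Cinf E & (\<forall>x\<in>E. cplx (\<alpha> x) * g x = f x - f (rf \<alpha> x))"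
proof -
 obtain \<alpha>' where \<alpha>': "linear \<alpha>'" "!!x. x \<in> E ==> \<alpha>' x = \<alpha> x" by (rule lin_on_extend[OF P_lin[OF assms(1)] sub], rule that)
 define T where "T x = (- 2 * \<alpha>' x / N \<alpha>) *R H \<alpha>" for x
 let ?h = "%x. integral {0..1} (%t. der E (H \<alpha>) f (x + t *R T x))"
 have H: "H \<alpha> \<in> E" by (rule H_in) fact
 have T: "linear T" "!!x. x \<in> E ==> T x \<in> E"
  using H by (auto intro!: linearI simp: T_def linear_add[OF \<alpha>'(1)] linear_scale[OF \<alpha>'(1)] add_divide_distrib diff_divide_distrib algebra_simps)
 have "C_on j E E (%x. integral {0..1} (%t. t ^ 0 *R der E (H \<alpha>) f (0 + x + t *R T x)))" for j
  by (rule C_on_parametric_integral[OF sub _ _ linear_ident _ T])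
   (use H in "auto intro!: Cinf_C deriv_op_Cinf[OF sub assms(2)]")
 hence h: "ext0 E ?h \<in> Cinf E" by (intro Cinf_ext0[OF sub]) simp
 have "f x - f (rf \<alpha> x) = cplx (\<alpha> x) * (of_real (2 / N \<alpha>) * ext0 E ?h x)" if x: "x \<in> E" for x
 proof -
  have "f (x + T x) - f x = integral {0..1} (%t. der E (T x) f (x + t *R T x))"
   by (rule deriv_op_segment[OF sub assms(2) x T(2)[OF x]])
  also have "\<dots> = cplx (- 2 * \<alpha> x / N \<alpha>) * ext0 E ?h x"
   unfolding T_def deriv_op_dir_linear(2)[OF sub assms(2) H H] using x by (simp add: \<alpha>'(2) flip: T_def)
  finally show ?thesis using x by (simp add: rf_def T_def \<alpha>'(2) algebra_simps)
 qed
 thus ?thesis using Cinf_scale[OF sub h, of "of_real (2 / N \<alpha>)"] by (intro exI conjI) auto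
qed

lemma qt_props:
 assumes "\<alpha> \<in> P" "f \<in> Cinf E"
 shows "qt \<alpha> f \<in> Cinf E" "x \<in> E ==> cplx (\<alpha> x) * qt \<alpha> f x = f x - f (rf \<alpha> x)"
proof -
 have "\<exists>!g. g \<in> Cinf E & (\<forall>x\<in>E. cplx (\<alpha> x) * g x = f x - f (rf \<alpha> x))"
  using qt_exists[OF assms] qt_unique[OF assms(1)] by (metis (no_types, lifting))
 from theI'[OF this] show "qt \<alpha> f \<in> Cinf E" "x \<in> E ==> cplx (\<alpha> x) * qt \<alpha> f x = f x - f (rf \<alpha> x)"
  unfolding qt_def by auto
qed

lemma qt_eqI:
 assumes "\<alpha> \<in> P" "f \<in> Cinf E" "g \<in> Cinf E" "!!x. x \<in> E ==> cplx (\<alpha> x) * g x = f x - f (rf \<alpha> x)"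
 shows "qt \<alpha> f = g"
 by (rule qt_unique[OF assms(1) qt_props(1)[OF assms(1,2)] assms(3)]) (simp add: qt_props(2)[OF assms(1,2)] assms(4))

lemma qt_add: "\<alpha> \<in> P ==> f \<in> Cinf E ==> g \<in> Cinf E ==> qt \<alpha> (%x. f x + g x) = (%x. qt \<alpha> f x + qt \<alpha> g x)"
 by (rule qt_eqI) (auto intro!: Cinf_add[OF sub] qt_props simp: distrib_left qt_props(2))

lemma qt_scale: "\<alpha> \<in> P ==> f \<in> Cinf E ==> qt \<alpha> (%x. c * f x) = (%x. c * qt \<alpha> f x)"
 by (rule qt_eqI) (auto intro!: Cinf_scale[OF sub] qt_props simp: mult.left_commute[of _ c] qt_props(2) right_diff_distrib)

lemma qt_const: "\<alpha> \<in> P ==> qt \<alpha> (ext0 E (%_. c)) = (%x. 0)"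
 by (rule qt_eqI) (auto intro!: Cinf_const[OF sub] Cinf_zero[OF sub])

text \<open>A twisted Leibniz rule: a coordinate drops by 2 \<alpha>(x) \<alpha>(\<zeta>) / N
  \<alpha> under the reflection, and dividing this by \<alpha>(x) leaves a constant times the
  reflected function.\<close>

lemma qt_xf:
 assumes "\<alpha> \<in> P" "f \<in> Cinf E" "\<zeta> \<in> E"
 shows "qt \<alpha> (mx \<zeta> f) = (%x. xf \<zeta> x * qt \<alpha> f x + of_real (2 * \<alpha> \<zeta> / N \<alpha>) * rho \<alpha> f x)"
proof (rule qt_eqI[OF assms(1)])
 show "(mx \<zeta> f) \<in> Cinf E" by (rule xf_mult_Cinf[OF assms(3,2)])
 show "(%x. xf \<zeta> x * qt \<alpha> f x + of_real (2 * \<alpha> \<zeta> / N \<alpha>) * rho \<alpha> f x) \<in> Cinf E"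
  by (intro Cinf_add[OF sub] xf_mult_Cinf assms qt_props Cinf_scale[OF sub] rho_Cinf)
 fix x assume x: "x \<in> E"
 have "cplx (\<alpha> x) * (xf \<zeta> x * qt \<alpha> f x + of_real (2 * \<alpha> \<zeta> / N \<alpha>) * rho \<alpha> f x)
   = xf \<zeta> x * (cplx (\<alpha> x) * qt \<alpha> f x) + of_real (2 * \<alpha> x * \<alpha> \<zeta> / N \<alpha>) * f (rf \<alpha> x)"
  using x by (simp add: rho_in algebra_simps)
 also have "\<dots> = xf \<zeta> x * f x - of_real (B \<zeta> x - 2 * \<alpha> x * \<alpha> \<zeta> / N \<alpha>) * f (rf \<alpha> x)"
  unfolding qt_props(2)[OF assms(1,2) x] using x by (simp add: algebra_simps)
 also have "of_real (B \<zeta> x - 2 * \<alpha> x * \<alpha> \<zeta> / N \<alpha>) = xf \<zeta> (rf \<alpha> x)"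
  using x assms by (simp add: B_rf)
 finally show "cplx (\<alpha> x) * (xf \<zeta> x * qt \<alpha> f x + of_real (2 * \<alpha> \<zeta> / N \<alpha>) * rho \<alpha> f x) =
   xf \<zeta> x * f x - xf \<zeta> (rf \<alpha> x) * f (rf \<alpha> x)" .
qed

lemma D_in: "f \<in> Cinf E ==> D \<xi> f x = der E \<xi> f x + (\<Sum>\<alpha>\<in>P. cplx (k \<alpha> * \<alpha> \<xi>) * qt \<alpha> f x)"
 by (simp add: D_def)

lemma D_Cinf: "\<xi> \<in> E ==> f \<in> Cinf E ==> D \<xi> f \<in> Cinf E"
 by (simp add: D_def, intro Cinf_add[OF sub] deriv_op_Cinf[OF sub] Cinf_sum[OF sub] Cinf_scale[OF sub] qt_props)

lemma D_End: assumes "\<xi> \<in> E" shows "D \<xi> \<in> End_Cinf E"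
proof (rule End_CinfI)
 fix f g :: "'e => complex" and c assume f: "f \<in> Cinf E"
 show "D \<xi> f \<in> Cinf E" by (rule D_Cinf[OF assms f])
 show "D \<xi> (%x. c * f x) = (%x. c * D \<xi> f x)"
 proof (rule Cinf_eqI[OF D_Cinf[OF assms Cinf_scale[OF sub f]] Cinf_scale[OF sub D_Cinf[OF assms f]]])
  fix x assume "x \<in> E"
  thus "D \<xi> (%x. c * f x) x = c * D \<xi> f x"
   by (simp add: D_in f Cinf_scale[OF sub f] deriv_op_scale[OF sub f assms] qt_scale[OF _ f] distrib_left sum_distrib_left mult.left_commute[of c])
 qed
 assume g: "g \<in> Cinf E"
 show "D \<xi> (%x. f x + g x) = (%x. D \<xi> f x + D \<xi> g x)"
 proof (rule Cinf_eqI[OF D_Cinf[OF assms Cinf_add[OF sub f g]] Cinf_add[OF sub D_Cinf[OF assms f] D_Cinf[OF assms g]]])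
  fix x assume "x \<in> E"
  thus "D \<xi> (%x. f x + g x) x = D \<xi> f x + D \<xi> g x"
   by (simp add: D_in f g Cinf_add[OF sub f g] deriv_op_add[OF sub f g assms] qt_add[OF _ f g] distrib_left sum.distrib)
 qed
qed (simp add: D_def)

lemma D_const: "\<xi> \<in> E ==> D \<xi> (ext0 E (%_. c)) = (%x. 0)"
 by (rule ext) (simp add: D_in Cinf_const[OF sub] deriv_op_const[OF sub] qt_const)

text \<open>The commutator of \<open>D \<xi>\<close> with the coordinate \<zeta> turns out symmetric
  in \<xi> and \<zeta>, a symmetry on which \<open>D_commute\<close> rests.\<close>

lemma D_xf:
 assumes "\<xi> \<in> E" "\<zeta> \<in> E" "f \<in> Cinf E"
 shows "D \<xi> (mx \<zeta> f) =
   (%x. (xf \<zeta> x * D \<xi> f x + of_real (B \<zeta> \<xi>) * f x) + (\<Sum>\<alpha>\<in>P. of_real (2 * k \<alpha> * \<alpha> \<xi> * \<alpha> \<zeta> / N \<alpha>) * rho \<alpha> f x))"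
proof (rule Cinf_eqI)
 show "D \<xi> (mx \<zeta> f) \<in> Cinf E" by (rule D_Cinf[OF assms(1) xf_mult_Cinf[OF assms(2,3)]])
 show "(%x. (xf \<zeta> x * D \<xi> f x + of_real (B \<zeta> \<xi>) * f x) + (\<Sum>\<alpha>\<in>P. of_real (2 * k \<alpha> * \<alpha> \<xi> * \<alpha> \<zeta> / N \<alpha>) * rho \<alpha> f x)) \<in> Cinf E"
  by (intro Cinf_add[OF sub] xf_mult_Cinf D_Cinf assms Cinf_scale[OF sub] Cinf_sum[OF sub] rho_Cinf)
 fix x assume x: "x \<in> E"
 have "(\<Sum>\<alpha>\<in>P. cplx (k \<alpha> * \<alpha> \<xi>) * qt \<alpha> (mx \<zeta> f) x) =
   (\<Sum>\<alpha>\<in>P. xf \<zeta> x * (cplx (k \<alpha> * \<alpha> \<xi>) * qt \<alpha> f x) + of_real (2 * k \<alpha> * \<alpha> \<xi> * \<alpha> \<zeta> / N \<alpha>) * rho \<alpha> f x)"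
  by (rule sum.cong[OF refl], subst qt_xf[OF _ assms(3,2)]) (simp_all add: algebra_simps)
 thus "D \<xi> (mx \<zeta> f) x =
   (xf \<zeta> x * D \<xi> f x + of_real (B \<zeta> \<xi>) * f x) + (\<Sum>\<alpha>\<in>P. of_real (2 * k \<alpha> * \<alpha> \<xi> * \<alpha> \<zeta> / N \<alpha>) * rho \<alpha> f x)"
  using x by (simp add: D_in assms xf_mult_Cinf deriv_op_xf_mult sum.distrib sum_distrib_left distrib_left)
qed

lemma D_dir_sum:
 assumes "f \<in> Cinf E" "finite I" "!!i. i \<in> I ==> X i \<in> E"
 shows "D (\<Sum>i\<in>I. c i *R X i) f x = (\<Sum>i\<in>I. of_real (c i) * D (X i) f x)"
proof -
 have "\<alpha> (\<Sum>i\<in>I. c i *R X i) = (\<Sum>i\<in>I. c i * \<alpha> (X i))" if "\<alpha> \<in> P" for \<alpha>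
  using lin_on_sum[OF P_lin[OF that] sub, of I "%i. c i *R X i"] lin_on_scale[OF P_lin[OF that]] assms(3) by simp
 hence "(\<Sum>\<alpha>\<in>P. cplx (k \<alpha> * \<alpha> (\<Sum>i\<in>I. c i *R X i)) * qt \<alpha> f x)
   = (\<Sum>\<alpha>\<in>P. \<Sum>i\<in>I. of_real (c i) * (cplx (k \<alpha> * \<alpha> (X i)) * qt \<alpha> f x))"
 proof (intro sum.cong[OF refl])
  fix \<alpha> assume "\<alpha> \<in> P"
  from this[THEN \<open>!!\<alpha>. \<alpha> \<in> P ==> \<alpha> (\<Sum>i\<in>I. c i *R X i) = (\<Sum>i\<in>I. c i * \<alpha> (X i))\<close>]
  show "cplx (k \<alpha> * \<alpha> (\<Sum>i\<in>I. c i *R X i)) * qt \<alpha> f x =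
   (\<Sum>i\<in>I. of_real (c i) * (cplx (k \<alpha> * \<alpha> (X i)) * qt \<alpha> f x))"
   by (simp add: sum_distrib_left sum_distrib_right mult_ac)
 qed
 also have "\<dots> = (\<Sum>i\<in>I. \<Sum>\<alpha>\<in>P. of_real (c i) * (cplx (k \<alpha> * \<alpha> (X i)) * qt \<alpha> f x))"
  by (rule sum.swap)
 finally show ?thesis
  by (simp add: D_in assms deriv_op_dir_sum[OF sub assms] sum.distrib distrib_left sum_distrib_left)
qed

lemma D_dir_linear:
 assumes "f \<in> Cinf E" "X \<in> E" "Y \<in> E"
 shows "D (X - c *R Y) f x = D X f x - of_real c * D Y f x"
 using D_dir_sum[OF assms(1), of "{0::nat,1}" "%i. if i = 0 then X else Y" "%i. if i = 0 then 1 else - c" x] assms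
 by simp

lemma D_onb:
 assumes "onb E C" "f \<in> Cinf E" "X \<in> E"
 shows "(\<Sum>b\<in>C. of_real (B X b) * D b f x) = D X f x"
 using D_dir_sum[OF assms(2) onbD(2)[OF assms(1)], of "%b. b" "%b. B X b" x]
  subsetD[OF onbD(1)[OF assms(1)]] onbD(4)[OF assms(1,3)] by simp

end

text \<open>Equivariance under the reflections of P is the only input from the geometry of root
  systems. It is trivial for P empty, and for \<open>a\<close> it follows from
  \<open>dunkl_equiv\<close>.\<close>

locale dunkl_space = dunkl_data E B P k H
 for E :: "'e::euclidean_space set" and B P k H +
 assumes equiv: "!!\<alpha> \<xi> f. \<alpha> \<in> P ==> \<xi> \<in> E ==> f \<in> Cinf E ==> D (rf \<alpha> \<xi>) (rho \<alpha> f) = rho \<alpha> (D \<xi> f)"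
begin

lemma D_rho:
 assumes "\<alpha> \<in> P" "\<xi> \<in> E" "f \<in> Cinf E"
 shows "rho \<alpha> (D \<xi> f) x = D \<xi> (rho \<alpha> f) x - of_real (2 * \<alpha> \<xi> / N \<alpha>) * D (H \<alpha>) (rho \<alpha> f) x"
 using equiv[OF assms] D_dir_linear[OF rho_Cinf[OF assms(1,3)] assms(2) H_in[OF assms(1)], of "2 * \<alpha> \<xi> / N \<alpha>" x]
 unfolding rf_def by metis

lemma rho_D_H:
 assumes "\<alpha> \<in> P" "f \<in> Cinf E"
 shows "rho \<alpha> (D (H \<alpha>) f) x = - D (H \<alpha>) (rho \<alpha> f) x"
 using D_rho[OF assms(1) H_in[OF assms(1)] assms(2), of x] H_eq[OF assms(1) H_in[OF assms(1)]] N_pos[OF assms(1)] by simp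

lemma D_D_xf:
 assumes "\<xi> \<in> E" "\<eta> \<in> E" "\<zeta> \<in> E" "f \<in> Cinf E"
 shows "D \<xi> (D \<eta> (mx \<zeta> f)) x =
  xf \<zeta> x * D \<xi> (D \<eta> f) x + of_real (B \<zeta> \<xi>) * D \<eta> f x + of_real (B \<zeta> \<eta>) * D \<xi> f x
  + (\<Sum>\<alpha>\<in>P. of_real (2 * k \<alpha> * \<alpha> \<xi> * \<alpha> \<zeta> / N \<alpha>) * rho \<alpha> (D \<eta> f) x)
  + (\<Sum>\<alpha>\<in>P. of_real (2 * k \<alpha> * \<alpha> \<eta> * \<alpha> \<zeta> / N \<alpha>) * D \<xi> (rho \<alpha> f) x)"
proof -
 note DE = D_End[OF assms(1)]
 have C: "(%x. xf \<zeta> x * D \<eta> f x) \<in> Cinf E" "(%x. of_real (B \<zeta> \<eta>) * f x) \<in> Cinf E"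
  "(%x. \<Sum>\<alpha>\<in>P. of_real (2 * k \<alpha> * \<alpha> \<eta> * \<alpha> \<zeta> / N \<alpha>) * rho \<alpha> f x) \<in> Cinf E"
  by (intro Cinf_add[OF sub] xf_mult_Cinf D_Cinf assms Cinf_scale[OF sub] Cinf_sum[OF sub] rho_Cinf)+
 have "D \<xi> (D \<eta> (mx \<zeta> f)) =
   (%x. D \<xi> (%x. xf \<zeta> x * D \<eta> f x) x + D \<xi> (%x. of_real (B \<zeta> \<eta>) * f x) x
   + D \<xi> (%x. \<Sum>\<alpha>\<in>P. of_real (2 * k \<alpha> * \<alpha> \<eta> * \<alpha> \<zeta> / N \<alpha>) * rho \<alpha> f x) x)"
  unfolding D_xf[OF assms(2-4)] by (simp only: End_CinfD(3)[OF DE Cinf_add[OF sub C(1,2)] C(3)] End_CinfD(3)[OF DE C(1,2)])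
 also have "\<dots> = (%x. D \<xi> (%x. xf \<zeta> x * D \<eta> f x) x + of_real (B \<zeta> \<eta>) * D \<xi> f x
   + (\<Sum>\<alpha>\<in>P. of_real (2 * k \<alpha> * \<alpha> \<eta> * \<alpha> \<zeta> / N \<alpha>) * D \<xi> (rho \<alpha> f) x))"
 proof -
  have "D \<xi> (%x. \<Sum>\<alpha>\<in>P. of_real (2 * k \<alpha> * \<alpha> \<eta> * \<alpha> \<zeta> / N \<alpha>) * rho \<alpha> f x) =
    (%x. \<Sum>\<alpha>\<in>P. of_real (2 * k \<alpha> * \<alpha> \<eta> * \<alpha> \<zeta> / N \<alpha>) * D \<xi> (rho \<alpha> f) x)"
   by (rule End_sum[OF DE sub]) (rule rho_Cinf[OF _ assms(4)])
  thus ?thesis by (simp only: End_CinfD(4)[OF DE assms(4)])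
 qed
 finally show ?thesis by (simp add: D_xf[OF assms(1,3) D_Cinf[OF assms(2,4)]])
qed

text \<open>The commutator of two Dunkl operators commutes with all coordinates and kills constants,
  so its value at any point vanishes by \<open>hadamard_functional\<close>.\<close>

lemma D_commute:
 assumes "\<xi> \<in> E" "\<eta> \<in> E" "f \<in> Cinf E"
 shows "D \<xi> (D \<eta> f) = D \<eta> (D \<xi> f)"
proof (rule Cinf_eqI)
 show "D \<xi> (D \<eta> f) \<in> Cinf E" "D \<eta> (D \<xi> f) \<in> Cinf E" by (intro D_Cinf assms)+
 fix x assume x: "x \<in> E"
 have "D \<xi> (D \<eta> f) x - D \<eta> (D \<xi> f) x = 0"
 proof (rule hadamard_functional[OF x _ _ _ assms(3)])
  show "functional E (%f. D \<xi> (D \<eta> f) x - D \<eta> (D \<xi> f) x)" by (intro functional_intros(3) functional_End(2) D_End assms)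
  fix \<zeta> f assume f: "f \<in> Cinf E" and \<zeta>: "\<zeta> \<in> E"
  show "D \<xi> (D \<eta> (mx \<zeta> f)) x - D \<eta> (D \<xi> (mx \<zeta> f)) x = of_real (B \<zeta> x) * (D \<xi> (D \<eta> f) x - D \<eta> (D \<xi> f) x)"
  proof -
   \<comment> \<open>Moving the reflection across \<open>D\<close> by \<open>D_rho\<close> creates
     on either side a correction by \<open>D (H \<alpha>)\<close> with coefficient proportional to
     \<alpha>(\<xi>) \<alpha>(\<eta>), so the two corrections agree.\<close>
   have "(\<Sum>\<alpha>\<in>P. of_real (2 * k \<alpha> * \<alpha> \<xi> * \<alpha> \<zeta> / N \<alpha>) * rho \<alpha> (D \<eta> f) x)
     + (\<Sum>\<alpha>\<in>P. of_real (2 * k \<alpha> * \<alpha> \<eta> * \<alpha> \<zeta> / N \<alpha>) * D \<xi> (rho \<alpha> f) x)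
     = (\<Sum>\<alpha>\<in>P. of_real (2 * k \<alpha> * \<alpha> \<eta> * \<alpha> \<zeta> / N \<alpha>) * rho \<alpha> (D \<xi> f) x)
     + (\<Sum>\<alpha>\<in>P. of_real (2 * k \<alpha> * \<alpha> \<xi> * \<alpha> \<zeta> / N \<alpha>) * D \<eta> (rho \<alpha> f) x)"
    unfolding sum.distrib[symmetric]
    by (rule sum.cong) (auto simp: D_rho f assms algebra_simps)
   moreover have "z * A + p + q + s1 + s2 - (z * A' + q + p + s3 + s4) = z * (A - A')" if "s1 + s2 = s3 + s4"
    for z A A' p q s1 s2 s3 s4 :: complex
    using that by (simp add: algebra_simps)
   ultimately show ?thesis unfolding D_D_xf[OF assms(1,2) \<zeta> f] D_D_xf[OF assms(2,1) \<zeta> f] xf_in[OF x] by blast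
  qed
 next
  have "D X (%x. 0) = (%x. 0)" if "X \<in> E" for X
   using End_CinfD(4)[OF D_End[OF that] Cinf_zero[OF sub], of 0] by simp
  thus "D \<xi> (D \<eta> (ext0 E (%_. 1))) x - D \<eta> (D \<xi> (ext0 E (%_. 1))) x = 0"
   by (simp add: D_const assms)
 qed
 thus "D \<xi> (D \<eta> f) x = D \<eta> (D \<xi> f) x" by simp
qed

definition Lap :: "'e set => 'e fn => 'e fn" where
 "Lap C = ext0 (Cinf E) (%f x. \<Sum>b\<in>C. D b (D b f) x)"

lemma Lap_in: "f \<in> Cinf E ==> Lap C f = (%x. \<Sum>b\<in>C. D b (D b f) x)" by (simp add: Lap_def)

lemma Lap_End:
 assumes "C <= E" shows "Lap C \<in> End_Cinf E"
proof (rule End_CinfI)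
 fix f g :: "'e => complex" and c assume f: "f \<in> Cinf E"
 have bE: "b \<in> E" if "b \<in> C" for b using assms that by auto
 show "Lap C f \<in> Cinf E" unfolding Lap_in[OF f] by (intro Cinf_sum[OF sub] D_Cinf f bE)
 show "Lap C (%x. c * f x) = (%x. c * Lap C f x)"
  by (simp add: Lap_in f Cinf_scale[OF sub] End_CinfD(4)[OF D_End[OF bE]] D_Cinf bE sum_distrib_left)
 assume g: "g \<in> Cinf E"
 show "Lap C (%x. f x + g x) = (%x. Lap C f x + Lap C g x)"
  by (simp add: Lap_in f g Cinf_add[OF sub] End_CinfD(3)[OF D_End[OF bE]] D_Cinf bE sum.distrib)
qed (simp add: Lap_def)

text \<open>The reflection terms cancel: summed over the basis they become \<open>rho\<close>
  composed with \<open>D (H \<alpha>)\<close> in both orders, and the reflection changes the sign of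
  \<open>H \<alpha>\<close>.\<close>

lemma Lap_xf:
 assumes C: "onb E C" and "\<zeta> \<in> E" "f \<in> Cinf E"
 shows "Lap C (mx \<zeta> f) x = xf \<zeta> x * Lap C f x + 2 * D \<zeta> f x"
proof -
 let ?t = "%\<alpha> b. of_real (2 * k \<alpha> * \<alpha> \<zeta> / N \<alpha>) * (of_real (\<alpha> b) * (rho \<alpha> (D b f) x + D b (rho \<alpha> f) x))"
 note C' = onbD[OF C]
 have bE: "b \<in> E" if "b \<in> C" for b using C' that by auto
 have "Lap C (mx \<zeta> f) x = (\<Sum>b\<in>C. xf \<zeta> x * D b (D b f) x + 2 * (of_real (B \<zeta> b) * D b f x)
   + (\<Sum>\<alpha>\<in>P. ?t \<alpha> b))"
  unfolding Lap_in[OF xf_mult_Cinf[OF assms(2,3)]]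
 proof (rule sum.cong[OF refl])
  fix b assume b: "b \<in> C"
  have "(\<Sum>\<alpha>\<in>P. cplx (2 * k \<alpha> * \<alpha> b * \<alpha> \<zeta> / N \<alpha>) * rho \<alpha> (D b f) x) + (\<Sum>\<alpha>\<in>P. cplx (2 * k \<alpha> * \<alpha> b * \<alpha> \<zeta> / N \<alpha>) * D b (rho \<alpha> f) x)
   = (\<Sum>\<alpha>\<in>P. ?t \<alpha> b)"
   unfolding sum.distrib[symmetric] by (rule sum.cong) (auto simp: algebra_simps)
  thus "D b (D b (mx \<zeta> f)) x = xf \<zeta> x * D b (D b f) x + 2 * (of_real (B \<zeta> b) * D b f x)
   + (\<Sum>\<alpha>\<in>P. ?t \<alpha> b)"
   unfolding D_D_xf[OF bE[OF b] bE[OF b] assms(2,3)] by simp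
 qed
 also have "\<dots> = xf \<zeta> x * Lap C f x + 2 * (\<Sum>b\<in>C. of_real (B \<zeta> b) * D b f x)
  + (\<Sum>b\<in>C. \<Sum>\<alpha>\<in>P. ?t \<alpha> b)"
  by (simp add: Lap_in assms sum.distrib sum_distrib_left)
 also have "(\<Sum>b\<in>C. \<Sum>\<alpha>\<in>P. ?t \<alpha> b)
  = (\<Sum>\<alpha>\<in>P. \<Sum>b\<in>C. ?t \<alpha> b)"
  by (rule sum.swap)
 also have "\<dots> = (\<Sum>\<alpha>\<in>P. 0)"
 proof (rule sum.cong[OF refl])
  fix \<alpha> assume \<alpha>: "\<alpha> \<in> P"
  have 1: "(\<Sum>b\<in>C. of_real (\<alpha> b) * D b (rho \<alpha> f) x) = D (H \<alpha>) (rho \<alpha> f) x"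
   using D_onb[OF C rho_Cinf[OF \<alpha> assms(3)] H_in[OF \<alpha>], of x] bE H_eq[OF \<alpha>] by simp
  have 2: "(\<Sum>b\<in>C. of_real (\<alpha> b) * rho \<alpha> (D b f) x) = rho \<alpha> (D (H \<alpha>) f) x"
   using D_onb[OF C assms(3) H_in[OF \<alpha>], of "rf \<alpha> x"] bE H_eq[OF \<alpha>] by (cases "x \<in> E") (simp_all add: rho_def)
  have "(\<Sum>b\<in>C. of_real (\<alpha> b) * (rho \<alpha> (D b f) x + D b (rho \<alpha> f) x)) = 0"
   using 1 2 rho_D_H[OF \<alpha> assms(3), of x] by (simp add: distrib_left sum.distrib)
  thus "(\<Sum>b\<in>C. ?t \<alpha> b) = 0"
   by (simp only: sum_distrib_left[symmetric]) simp
 qed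
 finally show ?thesis using D_onb[OF C assms(3,2), of x] by simp
qed

lemma Lap_D:
 assumes C: "onb E C" and "\<zeta> \<in> E" "f \<in> Cinf E"
 shows "Lap C (D \<zeta> f) = D \<zeta> (Lap C f)"
proof -
 have bE: "b \<in> E" if "b \<in> C" for b using onbD(1)[OF C] that by auto
 have "D b (D b (D \<zeta> f)) = D \<zeta> (D b (D b f))" if "b \<in> C" for b
  using bE[OF that] assms by (simp add: D_commute[of b \<zeta>] D_Cinf)
 thus ?thesis
  using End_sum1[OF D_End[OF assms(2)] sub, of C "%b. D b (D b f)"] assms bE by (simp add: Lap_in D_Cinf)
qed

text \<open>The formula is verified instead of derived: at a point off the hyperplanes both sides
  have the same commutators with coordinates, and both kill constants.\<close>

lemma Lap_explicit:
 assumes C: "onb E C" and x: "x \<in> E" and reg: "!!\<alpha>. \<alpha> \<in> P ==> \<alpha> x ~= 0" and f: "f \<in> Cinf E"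
 shows "Lap C f x = (\<Sum>b\<in>C. der E b (der E b f) x) +
   (\<Sum>\<alpha>\<in>P. of_real (2 * k \<alpha>) * (der E (H \<alpha>) f x / of_real (\<alpha> x) - of_real (N \<alpha> / 2) * (f x - f (rf \<alpha> x)) / of_real ((\<alpha> x)\<^sup>2)))"
proof -
 note C' = onbD[OF C]
 have bE: "b \<in> E" if "b \<in> C" for b using C' that by auto
 let ?S1 = "%f. \<Sum>b\<in>C. der E b (der E b f) x"
 let ?S2 = "%f. \<Sum>\<alpha>\<in>P. of_real (2 * k \<alpha>) * (der E (H \<alpha>) f x / of_real (\<alpha> x) - of_real (N \<alpha> / 2) * (f x - f (rf \<alpha> x)) / of_real ((\<alpha> x)\<^sup>2))"
 let ?R = "%f. ?S1 f + ?S2 f"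
 have zero: "der E b (%x. 0) x = 0" if "b \<in> E" for b
  using deriv_op_scale[OF sub Cinf_zero[OF sub] that x, of 0] by simp
 have "Lap C f x - ?R f = 0"
 proof (rule hadamard_functional[OF x _ _ _ f])
  show "functional E (%f. Lap C f x - ?R f)"
   by (intro functional_intros functional_End(1)[of "Lap C"] functional_End(1)[of "der E _"] functional_End(2)[of "der E _" E "der E _"]
     Lap_End C'(1) deriv_op_End sub bE H_in)
  fix \<zeta> f assume f: "f \<in> Cinf E" and \<zeta>: "\<zeta> \<in> E"
  have dC: "der E b f \<in> Cinf E" if "b \<in> C" for b by (rule deriv_op_Cinf[OF sub f bE[OF that]])
  show "Lap C (mx \<zeta> f) x - ?R (mx \<zeta> f) = of_real (B \<zeta> x) * (Lap C f x - ?R f)"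
  proof -
   have 1: "der E b (der E b (mx \<zeta> f)) x = of_real (B \<zeta> x) * der E b (der E b f) x + 2 * (of_real (B \<zeta> b) * der E b f x)"
    if "b \<in> C" for b
   proof -
    have e: "der E b (mx \<zeta> f) = (%x. xf \<zeta> x * der E b f x + of_real (B \<zeta> b) * f x)"
    proof (rule Cinf_eqI)
     show "der E b (mx \<zeta> f) \<in> Cinf E" by (intro deriv_op_Cinf[OF sub] xf_mult_Cinf \<zeta> f bE that)
     show "(%x. xf \<zeta> x * der E b f x + of_real (B \<zeta> b) * f x) \<in> Cinf E"
      by (intro Cinf_add[OF sub] xf_mult_Cinf dC that \<zeta> Cinf_scale[OF sub] f)
    qed (simp only: deriv_op_xf_mult[OF \<zeta> bE[OF that] _ f])
    have "der E b (%x. xf \<zeta> x * der E b f x + of_real (B \<zeta> b) * f x) x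
     = der E b (%x. xf \<zeta> x * der E b f x) x + der E b (%x. of_real (B \<zeta> b) * f x) x"
     by (intro deriv_op_add[OF sub] xf_mult_Cinf dC that \<zeta> Cinf_scale[OF sub] f bE x)
    thus ?thesis unfolding e
     using x by (simp add: deriv_op_xf_mult[OF \<zeta> bE[OF that] x dC[OF that]] deriv_op_scale[OF sub f bE[OF that] x])
   qed
   have 2: "of_real (2 * k \<alpha>) * (der E (H \<alpha>) (mx \<zeta> f) x / of_real (\<alpha> x) - of_real (N \<alpha> / 2) * (xf \<zeta> x * f x - xf \<zeta> (rf \<alpha> x) * f (rf \<alpha> x)) / of_real ((\<alpha> x)\<^sup>2))
    = of_real (B \<zeta> x) * (of_real (2 * k \<alpha>) * (der E (H \<alpha>) f x / of_real (\<alpha> x) - of_real (N \<alpha> / 2) * (f x - f (rf \<alpha> x)) / of_real ((\<alpha> x)\<^sup>2)))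
     + 2 * (cplx (k \<alpha> * \<alpha> \<zeta>) * qt \<alpha> f x)"
    if \<alpha>: "\<alpha> \<in> P" for \<alpha>
   proof -
    have q: "qt \<alpha> f x = (f x - f (rf \<alpha> x)) / of_real (\<alpha> x)"
     using qt_props(2)[OF \<alpha> f x] reg[OF \<alpha>] by (simp add: field_simps)
    have h: "der E (H \<alpha>) (mx \<zeta> f) x = of_real (B \<zeta> x) * der E (H \<alpha>) f x + of_real (\<alpha> \<zeta>) * f x"
     using x H_eq[OF \<alpha> \<zeta>] B_sym[OF \<zeta> H_in[OF \<alpha>]] by (simp add: deriv_op_xf_mult[OF \<zeta> H_in[OF \<alpha>] x f])
    have r: "xf \<zeta> (rf \<alpha> x) = of_real (B \<zeta> x) - of_real (2 * \<alpha> x * \<alpha> \<zeta> / N \<alpha>)"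
     using x by (simp add: B_rf \<alpha> \<zeta>)
    define a where "a = cplx (\<alpha> x)"
    define n where "n = cplx (N \<alpha>)"
    define z where "z = cplx (\<alpha> \<zeta>)"
    have nz: "a ~= 0" "n ~= 0" using reg[OF \<alpha>] N_pos[OF \<alpha>] unfolding a_def n_def by auto
    have x': "xf \<zeta> x = of_real (B \<zeta> x)" using x by simp
    have o: "cplx (2 * \<alpha> x * \<alpha> \<zeta> / N \<alpha>) = 2 * a * z / n" "cplx ((\<alpha> x)\<^sup>2) = a\<^sup>2" "cplx (N \<alpha> / 2) = n / 2"
     by (simp_all add: a_def z_def n_def)
    show ?thesis unfolding h q r x' o of_real_mult a_def[symmetric] z_def[symmetric]
     using nz by (simp add: field_simps power2_eq_square)
   qed
   let ?T1 = "\<Sum>b\<in>C. of_real (B \<zeta> b) * der E b f x" and ?T2 = "\<Sum>\<alpha>\<in>P. cplx (k \<alpha> * \<alpha> \<zeta>) * qt \<alpha> f x"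
   have R: "?R (mx \<zeta> f) = (of_real (B \<zeta> x) * ?S1 f + 2 * ?T1) + (of_real (B \<zeta> x) * ?S2 f + 2 * ?T2)"
    unfolding sum_distrib_left sum.distrib[symmetric] by (intro arg_cong2[of _ _ _ _ "(+)"] sum.cong[OF refl] 1 2)
   have "D \<zeta> f x = ?T1 + ?T2"
    using deriv_op_dir_sum[OF sub f C'(2), of "%b. b" "%b. B \<zeta> b" x] C'(1,4) \<zeta> by (auto simp: D_in f)
   thus ?thesis
    unfolding R unfolding Lap_xf[OF C \<zeta> f] xf_in[OF x] by (simp only: algebra_simps)
  qed
 next
  have o: "D b (%x. 0) = (%x. 0)" if "b \<in> E" for b
   using End_CinfD(4)[OF D_End[OF that] Cinf_zero[OF sub], of 0] by simp
  have "Lap C (ext0 E (%_. 1)) x = 0"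
   by (simp add: Lap_in Cinf_const[OF sub] D_const bE o)
  thus "Lap C (ext0 E (%_. 1)) x - ?R (ext0 E (%_. 1)) = 0"
   using x by (simp add: deriv_op_const[OF sub] bE H_in zero)
 qed
 thus ?thesis by simp
qed

end

section \<open>Polynomials and the symmetric algebra\<close>

text \<open>Homogeneous polynomial functions of degree d. Building them one linear factor at a time
  gives the induction that \<open>polh_ad\<close> requires.\<close>

inductive polh :: "'e::euclidean_space set => nat => 'e fn => bool" for E where
 polh_const: "polh E 0 (ext0 E (%_. c))"
| polh_mult: "polh E d p ==> lin_on E l ==> polh E (Suc d) (%x. p x * ext0 E (%x. cplx (l x)) x)"
| polh_add: "polh E d p ==> polh E d q ==> polh E d (%x. p x + q x)"

lemma ext0_zero [simp]: "ext0 E (%_. 0) = (%x. 0)" by (auto simp: ext0_def)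

lemma polh_out: "polh E d p ==> x \<notin> E ==> p x = 0"
 by (induction rule: polh.induct) auto

lemma polh_scale: "polh E d p ==> polh E d (%x. c * p x)"
proof (induction rule: polh.induct)
 case (polh_const a)
 have "(%x. c * ext0 E (%_. a) x) = ext0 E (%_. c * a)" by (auto simp: ext0_def)
 thus ?case by (simp add: polh.polh_const)
next
 case (polh_mult d p l) thus ?case using polh.polh_mult[of E d "%x. c * p x" l] by (simp add: mult.assoc)
next
 case (polh_add d p q) thus ?case using polh.polh_add[of E d "%x. c * p x" "%x. c * q x"] by (simp add: distrib_left)
qed

lemma polh_zero: "polh E d (%x. 0)"
proof (induction d)
 case 0 show ?case using polh_const[of E 0] by simp
next
 case (Suc d)
 have "lin_on E (%_. 0::real)" by (simp add: lin_on_def)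
 from polh_mult[OF Suc this] show ?case by simp
qed

lemma polh_sum: "(!!i. i \<in> I ==> polh E d (p i)) ==> polh E d (%x. \<Sum>i\<in>I. p i x)"
 by (induction I rule: infinite_finite_induct) (auto intro: polh_zero polh_add)

lemma polh_prod: "polh E e q ==> polh E d p ==> polh E (d + e) (%x. p x * q x)"
proof (induction rule: polh.induct)
 case (polh_const a)
 have "(%x. p x * ext0 E (%_. a) x) = (%x. a * p x)" using polh_out[OF polh_const] by (auto simp: ext0_def)
 thus ?case using polh_scale[OF polh_const, of a] by simp
next
 case (polh_mult e q l)
 thus ?case using polh.polh_mult[of E "d + e" "%x. p x * q x" l] by (simp add: mult.assoc)
next
 case (polh_add e q r)
 thus ?case using polh.polh_add[of E "d + e" "%x. p x * q x" "%x. p x * r x"] by (simp add: distrib_left)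
qed

lemma polh_homog: "polh E d p ==> subspace E ==> x \<in> E ==> p (c *R x) = of_real c ^ d * p x"
 by (induction rule: polh.induct) (auto simp: subspace_scale lin_on_scale algebra_simps)

lemma polh_Cinf: "polh E d p ==> subspace E ==> p \<in> Cinf E"
 by (induction rule: polh.induct) (auto intro: Cinf_const Cinf_mult Cinf_add Cinf_lin)

lemma polh_comp:
 assumes "polh E d p" "!!x. x \<in> E' ==> T x \<in> E" "lin_on E' T"
 shows "polh E' d (ext0 E' (%x. p (T x)))"
 using assms(1)
proof (induction rule: polh.induct)
 case (polh_const a)
 have "ext0 E' (%x. ext0 E (%_. a) (T x)) = ext0 E' (%_. a)" using assms(2) by (auto simp: ext0_def)
 thus ?case by (simp add: polh.polh_const)
next
 case (polh_mult d p l)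
 have "lin_on E' (%x. l (T x))" using polh_mult.hyps(2) assms(2,3) by (auto simp: lin_on_def)
 from polh.polh_mult[OF polh_mult.IH this]
 have "polh E' (Suc d) (%x. ext0 E' (%x. p (T x)) x * ext0 E' (%x. cplx (l (T x))) x)" .
 moreover have "(%x. ext0 E' (%x. p (T x)) x * ext0 E' (%x. cplx (l (T x))) x)
   = ext0 E' (%x. p (T x) * ext0 E (%x. cplx (l x)) (T x))"
  using assms(2) by (auto simp: ext0_def)
 ultimately show ?case by simp
next
 case (polh_add d p q)
 have "ext0 E' (%x. p (T x) + q (T x)) = (%x. ext0 E' (%x. p (T x)) x + ext0 E' (%x. q (T x)) x)"
  by (auto simp: ext0_def)
 thus ?case using polh.polh_add[OF polh_add.IH] by simp
qed

text \<open>\<open>q d\<close> is the homogeneous component of degree d. Demanding zero components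
  beyond N makes \<open>q\<close> independent of the bound.\<close>

definition hdec :: "'e::euclidean_space set => 'e fn => (nat => 'e fn) => nat => bool" where
 "hdec E p q N \<longleftrightarrow> (\<forall>d. polh E d (q d)) & (\<forall>d>N. q d = (%x. 0)) & p = (%x. \<Sum>d\<le>N. q d x)"

lemma dual_lin_on: "l \<in> dual_space E ==> lin_on E l & (%x. cplx (l x)) = ext0 E (%x. cplx (l x))"
 if "subspace E"
 using that by (auto simp: dual_space_def lin_on_def linear_add linear_scale subspace_add subspace_scale ext0_def)

lemma lin_on_dual: assumes "lin_on E l" "subspace E" shows "ext0 E l \<in> dual_space E"
proof -
 obtain l' where l': "linear l'" "!!x. x \<in> E ==> l' x = l x" by (rule lin_on_extend[OF assms], rule that)
 hence "ext0 E l = ext0 E l'" by (auto simp: ext0_def)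
 thus ?thesis using l'(1) by (auto simp: dual_space_def)
qed

lemma lin_on_Pol:
 assumes "lin_on E l" "subspace E" shows "ext0 E (%x. cplx (l x)) \<in> Pol E"
proof -
 have "(%x. cplx (ext0 E l x)) = ext0 E (%x. cplx (l x))" by (auto simp: ext0_def)
 thus ?thesis using Pol.intros(2)[OF lin_on_dual[OF assms]] by simp
qed

lemma hdec_mono:
 assumes "hdec E p q N" "N <= N'" shows "hdec E p q N'"
proof -
 have "(\<Sum>d\<le>N'. q d x) = (\<Sum>d\<le>N. q d x)" for x
  by (rule sum.mono_neutral_right) (use assms in "auto simp: hdec_def")
 thus ?thesis using assms by (auto simp: hdec_def)
qed

lemma hdec_polh: assumes "polh E d p" shows "hdec E p (%i. if i = d then p else (%x. 0)) d"
proof -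
 have "(\<Sum>i\<le>d. (if i = d then p else (%x. 0)) x) = p x" for x
  by (subst sum.remove[of _ d]) auto
 thus ?thesis using assms polh_zero by (auto simp: hdec_def)
qed

lemma hdec_add:
 assumes "hdec E p q N" "hdec E p' q' N"
 shows "hdec E (%x. p x + p' x) (%d x. q d x + q' d x) N"
 using assms by (auto simp: hdec_def sum.distrib polh_add)

lemma hdec_scale: "hdec E p q N ==> hdec E (%x. c * p x) (%d x. c * q d x) N"
 by (auto simp: hdec_def sum_distrib_left polh_scale)

lemma hdec_mult:
 assumes "hdec E p q N" "hdec E p' q' N'"
 shows "hdec E (%x. p x * p' x) (%d x. \<Sum>i\<le>d. q i x * q' (d - i) x) (N + N')"
 unfolding hdec_def
proof (intro conjI allI impI ext)
 fix d
 have "polh E (i + (d - i)) (%x. q i x * q' (d - i) x)" for i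
  by (rule polh_prod) (use assms in "auto simp: hdec_def")
 thus "polh E d (%x. \<Sum>i\<le>d. q i x * q' (d - i) x)"
  by (intro polh_sum) (metis atMost_iff le_add_diff_inverse)
next
 fix d x assume d: "N + N' < d"
 show "(\<Sum>i\<le>d. q i x * q' (d - i) x) = 0"
 proof (rule sum.neutral, rule ballI)
  fix i
  have "i > N \<or> d - i > N'" using d by arith
  thus "q i x * q' (d - i) x = 0" using assms by (auto simp: hdec_def)
 qed
next
 fix x
 \<comment> \<open>The Cauchy product of two finite sums, obtained as a product of polynomials
   evaluated at 1.\<close>
 have "(\<Sum>i\<le>N. q i x * 1 ^ i) * (\<Sum>j\<le>N'. q' j x * 1 ^ j) = (\<Sum>r\<le>N + N'. (\<Sum>k\<le>r. q k x * q' (r - k) x) * 1 ^ r)"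
  by (rule polynomial_product) (use assms in "auto simp: hdec_def")
 thus "p x * p' x = (\<Sum>d\<le>N + N'. \<Sum>i\<le>d. q i x * q' (d - i) x)"
  using assms by (simp add: hdec_def)
qed

lemma hdec_exists:
 assumes "subspace E" "p \<in> Pol E" shows "\<exists>q N. hdec E p q N"
 using assms(2)
proof (induction rule: Pol.induct)
 case (1 c) show ?case using hdec_polh[OF polh_const] by blast
next
 case (2 l)
 have l: "lin_on E l" "(%x. cplx (l x)) = ext0 E (%x. cplx (l x))"
  using dual_lin_on[OF assms(1) 2] by auto
 have "(%x. ext0 E (%_. 1) x * ext0 E (%x. cplx (l x)) x) = ext0 E (%x. cplx (l x))"
  by (auto simp: ext0_def)
 hence "polh E (Suc 0) (%x. cplx (l x))"
  using polh_mult[OF polh_const l(1), of 1] by (subst l(2)) simp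
 thus ?case using hdec_polh by blast
next
 case (3 p p')
 then obtain q N q' N' where "hdec E p q N" "hdec E p' q' N'" by blast
 hence "hdec E p q (max N N')" "hdec E p' q' (max N N')" by (auto intro: hdec_mono)
 thus ?case using hdec_add unfolding fun_plus_conv by blast
next
 case (4 p p')
 thus ?case using hdec_mult unfolding times_fun_def by blast
qed

text \<open>On the ray through x the function is a polynomial in the scale c with coefficients
  \<open>q d x\<close>. The difference of two such polynomials has all real numbers as
  roots.\<close>

lemma hdec_unique:
 assumes E: "subspace E" and "hdec E p q N" "hdec E p q' N'"
 shows "q = q'"
proof (intro ext)
 fix d x
 define K where "K = max d (max N N')"
 have h: "hdec E p q K" "hdec E p q' K" using assms hdec_mono K_def by (metis max.cobounded1 max.cobounded2 order_trans)+
 show "q d x = q' d x"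
 proof (cases "x \<in> E")
  case False
  thus ?thesis using polh_out assms unfolding hdec_def by metis
 next
  case x: True
  have s: "(\<Sum>d\<le>K. (q d x - q' d x) * of_real c ^ d) = 0" for c
  proof -
   have *: "p (c *R x) = (\<Sum>d\<le>K. r d x * of_real c ^ d)" if r: "hdec E p r K" for r
   proof -
    have P: "p = (%x. \<Sum>d\<le>K. r d x)" and d: "polh E d (r d)" for d using r unfolding hdec_def by blast+
    have "p (c *R x) = (\<Sum>d\<le>K. r d (c *R x))" by (rule fun_cong[OF P])
    thus ?thesis by (simp only: polh_homog[OF d E x] mult.commute[of "of_real c ^ _"])
   qed
   show ?thesis using *[OF h(1)] *[OF h(2)] by (simp add: left_diff_distrib sum_subtractf)
  qed
  let ?Z = "{z. (\<Sum>d\<le>K. (q d x - q' d x) * z ^ d) = 0}"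
  have "range cplx <= ?Z" using s by auto
  moreover have "infinite (range cplx)" using finite_imageD[of cplx UNIV] inj_of_real infinite_UNIV_char_0 by blast
  ultimately have "infinite ?Z" using finite_subset by blast
  thus ?thesis using polyfun_finite_roots[of "%d. q d x - q' d x" K] by (auto simp: K_def)
 qed
qed

lemma hdec_comp:
 assumes "hdec E p q N" "!!x. x \<in> E' ==> T x \<in> E" "lin_on E' T"
 shows "hdec E' (ext0 E' (%x. p (T x))) (%d. ext0 E' (%x. q d (T x))) N"
 using assms(1) polh_comp[OF _ assms(2,3)] by (auto simp: hdec_def ext0_def)

lemma End_eqI: "S \<in> End_Cinf E ==> T \<in> End_Cinf E ==> (!!f. f \<in> Cinf E ==> S f = T f) ==> S = T"
 by (rule ext) (metis End_CinfD(2))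

text \<open>The property inside the definite description of \<open>sym_hom\<close>, named so that
  existence and uniqueness can be treated separately.\<close>

definition sym_char ::
 "'e::euclidean_space set => ('e => 'e => real) => ('e => 'e fn => 'e fn) \<Rightarrow>
  ('e fn => 'e fn => 'e fn) => bool" where
 "sym_char E B D h \<longleftrightarrow>
   (\<forall>p\<in>Pol E. h p \<in> End_Cinf E) & (\<forall>p. p \<notin> Pol E --> h p = 0) \<and>
   h (ext0 E (%_. 1)) = ext0 (Cinf E) id \<and>
   (\<forall>p\<in>Pol E. \<forall>q\<in>Pol E. h (p + q) = h p + h q) \<and>
   (\<forall>p\<in>Pol E. \<forall>q\<in>Pol E. h (p * q) = h p o h q) \<and>
   (\<forall>c. \<forall>p\<in>Pol E. h (%x. c * p x) = (%f x. c * h p f x)) \<and>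
   (\<forall>X\<in>E. h (ext0 E (%x. cplx (B X x))) = D X)"

lemma sym_hom_char: "sym_hom E B D = (THE h. sym_char E B D h)"
 unfolding sym_hom_def sym_char_def ..

section \<open>Uniqueness and equivariance of homomorphisms from the symmetric algebra\<close>

context inner_subspace
begin

lemma dual_xf: assumes "l \<in> dual_space E" obtains X where "X \<in> E" "(%x. cplx (l x)) = xf X"
proof -
 have l: "lin_on E l" "(%x. cplx (l x)) = ext0 E (%x. cplx (l x))"
  using dual_lin_on[OF sub assms] by auto
 obtain X where X: "X \<in> E" "!!y. y \<in> E ==> l y = B X y" by (rule riesz[OF l(1)], rule that)
 have "ext0 E (%x. cplx (l x)) = xf X" using X(2) by (auto simp: xf_def ext0_def)
 thus ?thesis using that X(1) l(2) by simp
qed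

lemma xf_Pol: "X \<in> E ==> xf X \<in> Pol E"
 unfolding xf_def by (rule lin_on_Pol[OF B_lin2 sub])

lemma Pol_Cinf: "p \<in> Pol E ==> p \<in> Cinf E"
proof (induction rule: Pol.induct)
 case (2 l) thus ?case using dual_xf xf_Cinf by metis
qed (auto intro: Cinf_const[OF sub] Cinf_add[OF sub] Cinf_mult[OF sub])

lemma ext0_const_scale: "ext0 E (%_. c) = (%x. c * ext0 E (%_. 1::complex) x)"
 by (auto simp: ext0_def)

lemma sym_charD:
 assumes "sym_char E B D h"
 shows "p \<in> Pol E ==> h p \<in> End_Cinf E" "p \<notin> Pol E ==> h p = 0"
  "f \<in> Cinf E ==> h (ext0 E (%_. c)) f = (%x. c * f x)"
  "p \<in> Pol E ==> q \<in> Pol E ==> h (p + q) f = (%x. h p f x + h q f x)"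
  "p \<in> Pol E ==> q \<in> Pol E ==> h (p * q) f = h p (h q f)"
  "X \<in> E ==> h (xf X) = D X"
proof -
 note a = assms[unfolded sym_char_def]
 show "p \<in> Pol E ==> h p \<in> End_Cinf E" "p \<notin> Pol E ==> h p = 0"
  "p \<in> Pol E ==> q \<in> Pol E ==> h (p * q) f = h p (h q f)" "X \<in> E ==> h (xf X) = D X"
  using a by (auto simp: xf_def)
 show "p \<in> Pol E ==> q \<in> Pol E ==> h (p + q) f = (%x. h p f x + h q f x)"
  using a by (simp add: fun_plus_conv)
 assume f: "f \<in> Cinf E"
 have "h (%x. c * ext0 E (%_. 1) x) = (%f x. c * h (ext0 E (%_. 1)) f x)"
  using a Pol.intros(1)[of E 1] by blast
 thus "h (ext0 E (%_. c)) f = (%x. c * f x)" unfolding ext0_const_scale[of c] using a f by simp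
qed

lemma sym_char_unique:
 assumes "sym_char E B D h" "sym_char E B D h'" shows "h = h'"
proof
 fix p
 show "h p = h' p"
 proof (cases "p \<in> Pol E")
  case True
  thus ?thesis
  proof (induction rule: Pol.induct)
   case (1 c)
   show ?case
    by (rule End_eqI[OF sym_charD(1)[OF assms(1) Pol.intros(1)] sym_charD(1)[OF assms(2) Pol.intros(1)]])
     (simp add: sym_charD(3)[OF assms(1)] sym_charD(3)[OF assms(2)])
  next
   case (2 l)
   obtain X where X: "X \<in> E" "(%x. cplx (l x)) = xf X" by (rule dual_xf[OF 2], rule that)
   thus ?case by (simp add: sym_charD(6)[OF assms(1)] sym_charD(6)[OF assms(2)])
  next
   case (3 p q) show ?case
    by (rule ext) (simp only: sym_charD(4)[OF assms(1) 3(1,2)] sym_charD(4)[OF assms(2) 3(1,2)] 3(3,4))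
  next
   case (4 p q) show ?case
    by (rule ext) (simp only: sym_charD(5)[OF assms(1) 4(1,2)] sym_charD(5)[OF assms(2) 4(1,2)] 4(3,4))
  qed
 next
  case False
  show ?thesis by (simp add: sym_charD(2)[OF assms(1) False] sym_charD(2)[OF assms(2) False])
 qed
qed

text \<open>Equivariance of the generators under an isometry passes to the whole algebra. It is
  applied to \<open>Ad\<close> on \<open>a\<close> and on \<open>s\<close>, where it yields the
  compatibility of \<open>dunkl\<close> and \<open>partial\<close> with the group.\<close>

lemma sym_char_equiv:
 assumes h: "sym_char E B D h"
  and T: "lin_on E T" "!!x. x \<in> E ==> T x \<in> E" "!!y. y \<in> E ==> \<exists>x\<in>E. T x = y"
   "!!x y. x \<in> E ==> y \<in> E ==> B (T x) (T y) = B x y"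
  and D: "!!X f. X \<in> E ==> f \<in> Cinf E ==> D X (ext0 E (%x. f (T x))) = ext0 E (%x. D (T X) f (T x))"
  and p: "p \<in> Pol E"
 shows "ext0 E (%x. p (T x)) \<in> Pol E \<and>
  (\<forall>f\<in>Cinf E. h (ext0 E (%x. p (T x))) (ext0 E (%x. f (T x))) = ext0 E (%x. h p f (T x)))"
 using p
proof (induction rule: Pol.induct)
 case (1 c)
 have e: "ext0 E (%x. ext0 E (%_. c) (T x)) = ext0 E (%_. c)" using T(2) by (auto simp: ext0_def)
 show ?case unfolding e
 proof (intro conjI ballI Pol.intros(1))
  fix f assume f: "f \<in> Cinf E"
  have fT: "ext0 E (%x. f (T x)) \<in> Cinf E" by (rule Cinf_comp[OF sub T(1) _ f]) (rule T(2))
  show "h (ext0 E (%_. c)) (ext0 E (%x. f (T x))) = ext0 E (%x. h (ext0 E (%_. c)) f (T x))"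
   unfolding sym_charD(3)[OF h f] sym_charD(3)[OF h fT] by (auto simp: ext0_def)
 qed
next
 case (2 l)
 obtain Y where Y: "Y \<in> E" "(%x. cplx (l x)) = xf Y" by (rule dual_xf[OF 2], rule that)
 \<comment> \<open>Since T is a surjective isometry, composing the linear form of Y with T gives the
   linear form of the preimage X.\<close>
 obtain X where X: "X \<in> E" "T X = Y" using T(3)[OF Y(1)] by blast
 have e: "ext0 E (%x. xf Y (T x)) = xf X" using T(2,4) X by (auto simp: ext0_def xf_def fun_eq_iff)
 have "ext0 E (%x. cplx (l (T x))) = ext0 E (%x. xf Y (T x))" using fun_cong[OF Y(2)] by simp
 thus ?case unfolding e Y(2) using D X T(2) by (auto simp: xf_Pol sym_charD(6)[OF h X(1)] sym_charD(6)[OF h, of "T X"])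
next
 case (3 p q)
 have e: "ext0 E (%x. (p + q) (T x)) = ext0 E (%x. p (T x)) + ext0 E (%x. q (T x))" by (auto simp: ext0_def)
 show ?case unfolding e
 proof (intro conjI ballI)
  have P: "ext0 E (%x. p (T x)) \<in> Pol E" "ext0 E (%x. q (T x)) \<in> Pol E" using 3 by blast+
  show "ext0 E (%x. p (T x)) + ext0 E (%x. q (T x)) \<in> Pol E" by (rule Pol.intros(3)[OF P])
  fix f assume f: "f \<in> Cinf E"
  show "h (ext0 E (%x. p (T x)) + ext0 E (%x. q (T x))) (ext0 E (%x. f (T x))) = ext0 E (%x. h (p + q) f (T x))"
   unfolding sym_charD(4)[OF h P] sym_charD(4)[OF h 3(1,2)] 3(3)[THEN conjunct2, rule_format, OF f] 3(4)[THEN conjunct2, rule_format, OF f]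
   by (auto simp: ext0_def)
 qed
next
 case (4 p q)
 have e: "ext0 E (%x. (p * q) (T x)) = ext0 E (%x. p (T x)) * ext0 E (%x. q (T x))" by (auto simp: ext0_def)
 show ?case unfolding e
 proof (intro conjI ballI)
  have P: "ext0 E (%x. p (T x)) \<in> Pol E" "ext0 E (%x. q (T x)) \<in> Pol E" using 4 by blast+
  show "ext0 E (%x. p (T x)) * ext0 E (%x. q (T x)) \<in> Pol E" by (rule Pol.intros(4)[OF P])
  fix f assume f: "f \<in> Cinf E"
  have hq: "h q f \<in> Cinf E" by (rule End_CinfD(1)[OF sym_charD(1)[OF h 4(2)] f])
  show "h (ext0 E (%x. p (T x)) * ext0 E (%x. q (T x))) (ext0 E (%x. f (T x))) = ext0 E (%x. h (p * q) f (T x))"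
   unfolding sym_charD(5)[OF h P] sym_charD(5)[OF h 4(1,2)] 4(4)[THEN conjunct2, rule_format, OF f]
    4(3)[THEN conjunct2, rule_format, OF hq] ..
 qed
qed

end

section \<open>Multiplication operators and commutators\<close>

lemma End_add:
 assumes "S \<in> End_Cinf E" "T \<in> End_Cinf E" "subspace E" shows "(%f x. S f x + T f x) \<in> End_Cinf E"
 by (rule End_CinfI) (auto simp: End_CinfD[OF assms(1)] End_CinfD[OF assms(2)] Cinf_add[OF assms(3)] zero_fun_def algebra_simps)

lemma End_scale:
 assumes "S \<in> End_Cinf E" "subspace E" shows "(%f x. c * S f x) \<in> End_Cinf E"
 by (rule End_CinfI) (auto simp: End_CinfD[OF assms(1)] Cinf_scale[OF assms(2)] zero_fun_def algebra_simps)

lemma End_zero: "subspace E ==> (%f x. 0) \<in> End_Cinf E"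
 by (rule End_CinfI) (auto simp: Cinf_zero zero_fun_def)

lemma End_Sum: "subspace E ==> (!!i. i \<in> I ==> T i \<in> End_Cinf E) ==> (%f x. \<Sum>i\<in>I. T i f x) \<in> End_Cinf E"
 by (induction I rule: infinite_finite_induct) (auto intro: End_zero End_add)

definition mop :: "'e::euclidean_space set => 'e fn => 'e fn => 'e fn" where
 "mop E p = ext0 (Cinf E) (%f x. p x * f x)"

text \<open>The factor 1/2 is chosen so that multiplication by the coordinate \<zeta> goes to
  \<open>D \<zeta>\<close> when L is the Laplacian, as \<open>Lap_xf\<close> shows.\<close>

definition adop :: "'e::euclidean_space set => ('e fn => 'e fn) =>
  ('e fn => 'e fn) => 'e fn => 'e fn" where
 "adop E L T = ext0 (Cinf E) (%f x. (1/2) * L (T f) x + (-1/2) * T (L f) x)"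

lemma mop_in [simp]: "f \<in> Cinf E ==> mop E p f = (%x. p x * f x)" by (simp add: mop_def)

lemma adop_in [simp]: "f \<in> Cinf E ==> adop E L T f = (%x. (1/2) * L (T f) x + (-1/2) * T (L f) x)" by (simp add: adop_def)

lemma mop_End: "subspace E ==> p \<in> Cinf E ==> mop E p \<in> End_Cinf E"
 by (rule End_CinfI) (auto simp: Cinf_mult Cinf_add Cinf_scale algebra_simps, simp add: mop_def)

lemma adop_End:
 assumes "subspace E" "L \<in> End_Cinf E" "T \<in> End_Cinf E" shows "adop E L T \<in> End_Cinf E"
proof -
 have "(%f x. (1/2) * (L o T) f x + (-1/2) * (T o L) f x) \<in> End_Cinf E"
  by (intro End_add End_scale End_comp assms)
 moreover have "adop E L T = (%f x. (1/2) * (L o T) f x + (-1/2) * (T o L) f x)"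
 proof
  fix f
  show "adop E L T f = (%x. (1/2) * (L o T) f x + (-1/2) * (T o L) f x)"
   using End_CinfD(2)[OF calculation, of f] by (cases "f \<in> Cinf E") (simp_all add: adop_def)
 qed
 ultimately show ?thesis by simp
qed

lemma adop_pow_End: "subspace E ==> L \<in> End_Cinf E ==> T \<in> End_Cinf E ==> (adop E L ^^ n) T \<in> End_Cinf E"
 by (induction n) (auto intro: adop_End)

lemma adop_add:
 assumes "subspace E" "L \<in> End_Cinf E" "S \<in> End_Cinf E" "T \<in> End_Cinf E"
 shows "adop E L (%f x. S f x + T f x) = (%f x. adop E L S f x + adop E L T f x)"
 by (rule End_eqI[of _ E]) (auto intro!: adop_End End_add assms
   simp: End_CinfD(1)[OF assms(3)] End_CinfD(1)[OF assms(4)] End_CinfD(3)[OF assms(2)] algebra_simps)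

lemma adop_scale:
 assumes "subspace E" "L \<in> End_Cinf E" "S \<in> End_Cinf E"
 shows "adop E L (%f x. c * S f x) = (%f x. c * adop E L S f x)"
 by (rule End_eqI[of _ E]) (auto intro!: adop_End End_scale assms
   simp: End_CinfD(1)[OF assms(3)] End_CinfD(4)[OF assms(2)] algebra_simps)

lemma adop_pow_add:
 assumes "subspace E" "L \<in> End_Cinf E" "S \<in> End_Cinf E" "T \<in> End_Cinf E"
 shows "(adop E L ^^ n) (%f x. S f x + T f x) = (%f x. (adop E L ^^ n) S f x + (adop E L ^^ n) T f x)"
 by (induction n) (simp_all add: adop_add adop_pow_End assms)

lemma adop_pow_scale:
 assumes "subspace E" "L \<in> End_Cinf E" "S \<in> End_Cinf E"
 shows "(adop E L ^^ n) (%f x. c * S f x) = (%f x. c * (adop E L ^^ n) S f x)"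
 by (induction n) (simp_all add: adop_scale adop_pow_End assms)

lemma adop_pow_zero:
 assumes "subspace E" "L \<in> End_Cinf E" shows "(adop E L ^^ n) (%f x. 0) = (%f x. 0)"
 using adop_pow_scale[OF assms End_zero[OF assms(1)], of n 0] by simp

section \<open>Construction of the homomorphism from iterated commutators\<close>

context dunkl_space
begin

context
 fixes C assumes C: "onb E C"
begin

abbreviation (input) "L \<equiv> Lap C"
abbreviation (input) "ad \<equiv> adop E (Lap C)"

lemma L_End: "Lap C \<in> End_Cinf E" by (rule Lap_End[OF onbD(1)[OF C]])

lemma ad_comp_M:
 assumes "S \<in> End_Cinf E" "\<zeta> \<in> E"
 shows "ad (S o mop E (xf \<zeta>)) = (%f x. (ad S o mop E (xf \<zeta>)) f x + (S o D \<zeta>) f x)"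
proof (rule End_eqI[of _ E])
 note M = mop_End[OF sub xf_Cinf[OF assms(2)]]
 show "ad (S o mop E (xf \<zeta>)) \<in> End_Cinf E" "(%f x. (ad S o mop E (xf \<zeta>)) f x + (S o D \<zeta>) f x) \<in> End_Cinf E"
  by (intro adop_End End_comp End_add sub L_End M assms D_End)+
 fix f assume f: "f \<in> Cinf E"
 have Lf: "Lap C f \<in> Cinf E" by (rule End_CinfD(1)[OF L_End f])
 have "S (Lap C (mx \<zeta> f)) = S (%x. xf \<zeta> x * Lap C f x + 2 * D \<zeta> f x)"
  by (rule arg_cong[of _ _ S], rule ext) (rule Lap_xf[OF C assms(2) f])
 also have "\<dots> = (%x. S (%x. xf \<zeta> x * Lap C f x) x + 2 * S (D \<zeta> f) x)"
  using End_CinfD(3)[OF assms(1) xf_mult_Cinf[OF assms(2) Lf] Cinf_scale[OF sub D_Cinf[OF assms(2) f]], of 2]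
   End_CinfD(4)[OF assms(1) D_Cinf[OF assms(2) f], of 2] by simp
 finally have e: "S (Lap C (mx \<zeta> f)) = (%x. S (%x. xf \<zeta> x * Lap C f x) x + 2 * S (D \<zeta> f) x)" .
 show "ad (S o mop E (xf \<zeta>)) f = (%x. (ad S o mop E (xf \<zeta>)) f x + (S o D \<zeta>) f x)"
  by (rule ext, simp only: o_apply mop_in[OF f] mop_in[OF Lf] adop_in[OF f] adop_in[OF xf_mult_Cinf[OF assms(2) f]] e)
   (simp add: algebra_simps)
qed

lemma ad_comp_D:
 assumes "S \<in> End_Cinf E" "\<zeta> \<in> E"
 shows "ad (S o D \<zeta>) = ad S o D \<zeta>"
proof (rule End_eqI[of _ E])
 show "ad (S o D \<zeta>) \<in> End_Cinf E" "ad S o D \<zeta> \<in> End_Cinf E"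
  by (intro adop_End End_comp sub L_End assms D_End)+
 fix f assume f: "f \<in> Cinf E"
 show "ad (S o D \<zeta>) f = (ad S o D \<zeta>) f"
  by (simp add: f D_Cinf[OF assms(2) f] Lap_D[OF C assms(2) f])
qed

text \<open>\<open>ad\<close> is a derivation that takes the coordinate to \<open>D \<zeta>\<close>
  and kills \<open>D \<zeta>\<close>, so only two terms of the binomial expansion survive. For n = 0
  the truncated n - 1 is harmless because of the factor n.\<close>

lemma ad_leibniz:
 assumes "S \<in> End_Cinf E" "\<zeta> \<in> E"
 shows "(ad ^^ n) (S o mop E (xf \<zeta>)) = (%f x. ((ad ^^ n) S o mop E (xf \<zeta>)) f x + of_nat n * ((ad ^^ (n - 1)) S o D \<zeta>) f x)"
proof (induction n)
 case 0 thus ?case by simp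
next
 case (Suc n)
 note M = mop_End[OF sub xf_Cinf[OF assms(2)]]
 note P = adop_pow_End[OF sub L_End assms(1)]
 have "(ad ^^ Suc n) (S o mop E (xf \<zeta>)) =
   ad (%f x. ((ad ^^ n) S o mop E (xf \<zeta>)) f x + of_nat n * ((ad ^^ (n - 1)) S o D \<zeta>) f x)"
  by (simp only: funpow.simps o_apply Suc)
 also have "\<dots> = (%f x. ad ((ad ^^ n) S o mop E (xf \<zeta>)) f x + of_nat n * ad ((ad ^^ (n - 1)) S o D \<zeta>) f x)"
  by (subst adop_add, rule sub, rule L_End, rule End_comp[OF P M sub], rule End_scale[OF End_comp[OF P D_End[OF assms(2)] sub] sub])
   (subst adop_scale[OF sub L_End End_comp[OF P D_End[OF assms(2)] sub]], rule refl)
 also have "\<dots> = (%f x. ((ad ^^ Suc n) S o mop E (xf \<zeta>)) f x + of_nat (Suc n) * ((ad ^^ n) S o D \<zeta>) f x)"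
 proof -
  have "of_nat n * ad ((ad ^^ (n - 1)) S o D \<zeta>) f x = of_nat n * ((ad ^^ n) S o D \<zeta>) f x" for f x
   by (cases n) (simp_all add: ad_comp_D[OF P assms(2)])
  thus ?thesis by (simp only: ad_comp_M[OF P assms(2)]) (simp add: algebra_simps)
 qed
 finally show ?case unfolding diff_Suc_1 .
qed

lemma mop_mult: "p \<in> Cinf E ==> q \<in> Cinf E ==> mop E (%x. p x * q x) = mop E p o mop E q"
 by (rule End_eqI[of _ E]) (auto intro!: mop_End sub Cinf_mult[OF sub] End_comp simp: mult.assoc Cinf_mult[OF sub])

lemma mop_add: "p \<in> Cinf E ==> q \<in> Cinf E ==> mop E (%x. p x + q x) = (%f x. mop E p f x + mop E q f x)"
 by (rule End_eqI[of _ E]) (auto intro!: mop_End sub Cinf_add[OF sub] End_add simp: distrib_right)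

lemma mop_scale: "p \<in> Cinf E ==> mop E (%x. c * p x) = (%f x. c * mop E p f x)"
 by (rule End_eqI[of _ E]) (auto intro!: mop_End sub Cinf_scale[OF sub] End_scale)

lemma mop_zero: "mop E (%x. 0) = (%f x. 0)"
 by (rule End_eqI[of _ E]) (auto intro!: mop_End sub Cinf_zero[OF sub] End_zero)

lemma mop_const: "mop E (ext0 E (%_. c)) = (%f x. c * mop E (ext0 E (%_. 1)) f x)"
 unfolding ext0_const_scale[of c] by (rule mop_scale[OF Cinf_const[OF sub]])

lemma mop_one: "mop E (ext0 E (%_. 1)) = ext0 (Cinf E) id"
proof
 fix f
 show "mop E (ext0 E (%_. 1)) f = ext0 (Cinf E) id f"
 proof (cases "f \<in> Cinf E")
  case True
  thus ?thesis using Cinf_out[OF True] by (auto simp: ext0_def fun_eq_iff)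
 qed (simp add: mop_def)
qed

lemma id_End: "ext0 (Cinf E) id \<in> End_Cinf E"
 using mop_End[OF sub Cinf_const[OF sub, of 1]] by (simp add: mop_one)

lemma ad_id: "ad (ext0 (Cinf E) id) = (%f x. 0)"
 by (rule End_eqI[of _ E]) (auto intro!: adop_End sub L_End id_End End_zero simp: End_CinfD(1)[OF L_End])

text \<open>Each linear factor tolerates one application of \<open>ad\<close>, which turns it into
  an operator commuting with L; after d applications nothing is left to differentiate.\<close>

lemma polh_ad: "polh E d p ==> (ad ^^ Suc d) (mop E p) = (%f x. 0)"
proof (induction rule: polh.induct)
 case (polh_const c)
 show ?case by (simp add: mop_const[of c] mop_one adop_scale[OF sub L_End id_End] ad_id)
next
 case (polh_mult d p l)
 obtain X where X: "X \<in> E" "!!y. y \<in> E ==> l y = B X y" by (rule riesz[OF polh_mult.hyps(2)], rule that)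
 have e: "ext0 E (%x. cplx (l x)) = xf X" using X(2) by (auto simp: xf_def ext0_def)
 have p: "p \<in> Cinf E" by (rule polh_Cinf[OF polh_mult.hyps(1) sub])
 have z: "ad (%f x. 0) = (%f x. 0)" using adop_pow_zero[OF sub L_End, of 1] by simp
 show ?case unfolding e mop_mult[OF p xf_Cinf[OF X(1)]] ad_leibniz[OF mop_End[OF sub p] X(1)]
  using polh_mult.IH z by simp
next
 case (polh_add d p q)
 thus ?case
  by (simp only: mop_add[OF polh_Cinf[OF _ sub] polh_Cinf[OF _ sub]] adop_pow_add[OF sub L_End] mop_End[OF sub polh_Cinf[OF _ sub]]) simp
qed

definition hs :: "(nat => 'e fn) => nat => 'e fn => 'e fn" where
 "hs q n = (%f x. \<Sum>d\<le>n. (1 / fact d) * (ad ^^ d) (mop E (q d)) f x)"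

lemma hdec_Cinf: "hdec E p q n ==> q d \<in> Cinf E"
 using polh_Cinf sub unfolding hdec_def by blast

lemma hs_End: "hdec E p q n ==> hs q n \<in> End_Cinf E"
 unfolding hs_def by (intro End_Sum End_scale adop_pow_End sub L_End mop_End hdec_Cinf)

lemma hs_mono: assumes "hdec E p q n" "n <= n'" shows "hs q n' = hs q n"
 unfolding hs_def
proof (intro ext sum.mono_neutral_right)
 fix f x
 show "\<forall>d\<in>{..n'} - {..n}. 1 / fact d * (ad ^^ d) (mop E (q d)) f x = 0"
  using assms by (auto simp: hdec_def mop_zero adop_pow_zero[OF sub L_End])
qed (use assms in auto)

definition hh :: "'e fn => 'e fn => 'e fn" where
 "hh p = (if p \<in> Pol E then (case SOME qn. hdec E p (fst qn) (snd qn) of (q, n) => hs q n) else 0)"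

text \<open>The choice inside \<open>hh\<close> is immaterial: the components are unique, and
  enlarging the bound adds only zero terms.\<close>

lemma hh_eq: assumes "p \<in> Pol E" "hdec E p q n" shows "hh p = hs q n"
proof -
 let ?s = "SOME qn. hdec E p (fst qn) (snd qn)"
 have "hdec E p (fst (q, n)) (snd (q, n))" using assms(2) by simp
 hence s: "hdec E p (fst ?s) (snd ?s)" by (rule someI)
 have "fst ?s = q" by (rule hdec_unique[OF sub s assms(2)])
 hence "hs (fst ?s) (snd ?s) = hs q n"
  using hs_mono[OF s, of "max n (snd ?s)"] hs_mono[OF assms(2), of "max n (snd ?s)"] by simp
 thus ?thesis using assms(1) by (simp add: hh_def case_prod_beta)
qed

lemma hh_End: "p \<in> Pol E ==> hh p \<in> End_Cinf E"
 using hdec_exists[OF sub] hh_eq hs_End by metis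

lemma hh_add: assumes "p \<in> Pol E" "p' \<in> Pol E" shows "hh (p + p') = (%f x. hh p f x + hh p' f x)"
proof -
 obtain q n q' n' where q0: "hdec E p q n" "hdec E p' q' n'" using hdec_exists[OF sub] assms by metis
 define m where "m = max n n'"
 have q: "hdec E p q m" "hdec E p' q' m" using q0 by (auto simp: m_def intro: hdec_mono)
 have e: "hdec E (p + p') (%d x. q d x + q' d x) m" using hdec_add[OF q] by (simp add: fun_plus_conv)
 have "hs (%d x. q d x + q' d x) m = (%f x. hs q m f x + hs q' m f x)"
  unfolding hs_def
  by (simp add: mop_add[OF hdec_Cinf[OF q(1)] hdec_Cinf[OF q(2)]] adop_pow_add[OF sub L_End]
    mop_End[OF sub hdec_Cinf[OF q(1)]] mop_End[OF sub hdec_Cinf[OF q(2)]] sum.distrib add_divide_distrib)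
 thus ?thesis
  using hh_eq[OF Pol.intros(3)[OF assms] e] hh_eq[OF assms(1) q(1)] hh_eq[OF assms(2) q(2)] by simp
qed

lemma Pol_scale: assumes "p \<in> Pol E" shows "(%x. c * p x) \<in> Pol E"
proof -
 have "(%x. c * p x) = ext0 E (%_. c) * p"
  using Cinf_out[OF Pol_Cinf[OF assms]] by (auto simp: ext0_def)
 thus ?thesis using Pol.intros(1,4) assms by metis
qed

lemma hh_scale: assumes "p \<in> Pol E" shows "hh (%x. c * p x) = (%f x. c * hh p f x)"
proof -
 obtain q n where q: "hdec E p q n" using hdec_exists[OF sub] assms by metis
 have "hs (%d x. c * q d x) n = (%f x. c * hs q n f x)"
  unfolding hs_def
  by (simp add: mop_scale[OF hdec_Cinf[OF q(1)]] adop_pow_scale[OF sub L_End] mop_End[OF sub hdec_Cinf[OF q(1)]] sum_distrib_left mult.left_commute)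
 thus ?thesis
  using hh_eq[OF Pol_scale[OF assms] hdec_scale[OF q]] hh_eq[OF assms(1) q(1)] by simp
qed

lemma hh_one: "hh (ext0 E (%_. 1)) = ext0 (Cinf E) id"
 using hh_eq[OF Pol.intros(1) hdec_polh[OF polh_const], of 1] by (simp add: hs_def mop_one)

text \<open>In degree d + 1 the first Leibniz term dies by \<open>polh_ad\<close>, and the factor d
  + 1 of the second one turns 1/(d+1)! into 1/d!.\<close>

lemma hh_xf: assumes "p \<in> Pol E" "X \<in> E" shows "hh (p * xf X) = hh p o D X"
proof -
 obtain q n where q: "hdec E p q n" using hdec_exists[OF sub] assms by metis
 \<comment> \<open>Multiplication by a linear form shifts the homogeneous components up by one
   degree and leaves none in degree 0.\<close>
 define r where "r d = (case d of 0 => (%x. 0) | Suc d => (%x. q d x * xf X x))" for d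
 have r: "hdec E (p * xf X) r (Suc n)"
  unfolding hdec_def
 proof (intro conjI allI impI)
  fix d show "polh E d (r d)"
   using q polh_mult[OF _ B_lin2[OF assms(2)]] by (cases d) (auto simp: r_def polh_zero hdec_def xf_def)
  show "r d = (%x. 0)" if "Suc n < d" using that q by (cases d) (auto simp: r_def hdec_def)
  show "p * xf X = (%x. \<Sum>d\<le>Suc n. r d x)"
   using q by (simp add: sum.atMost_Suc_shift r_def hdec_def times_fun_def sum_distrib_right del: sum.atMost_Suc)
 qed
 have t: "(1 / fact (Suc d)) * (ad ^^ Suc d) (mop E (r (Suc d))) f x = (1 / fact d) * ((ad ^^ d) (mop E (q d)) o D X) f x" for d f x
 proof -
  have "(ad ^^ Suc d) (mop E (r (Suc d))) f x = of_nat (Suc d) * ((ad ^^ d) (mop E (q d)) o D X) f x"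
   unfolding r_def nat.case mop_mult[OF hdec_Cinf[OF q] xf_Cinf[OF assms(2)]]
    ad_leibniz[OF mop_End[OF sub hdec_Cinf[OF q]] assms(2)]
   using polh_ad[of d "q d"] q by (simp add: hdec_def)
  thus ?thesis by (simp del: of_nat_Suc funpow.simps)
 qed
 have r0: "(ad ^^ 0) (mop E (r 0)) = (%f x. 0)" by (simp add: r_def mop_zero)
 have "hs r (Suc n) = (%f x. \<Sum>d\<le>n. (1 / fact d) * ((ad ^^ d) (mop E (q d)) o D X) f x)"
  unfolding hs_def sum.atMost_Suc_shift r0 t by simp
 hence "hs r (Suc n) = hs q n o D X" by (simp add: hs_def fun_eq_iff)
 thus ?thesis
  using hh_eq[OF Pol.intros(4)[OF assms(1) xf_Pol[OF assms(2)]] r] hh_eq[OF assms(1) q(1)] by simp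
qed

lemma hh_lin: assumes "X \<in> E" shows "hh (xf X) = D X"
proof -
 have "ext0 E (%_. 1) * xf X = xf X" by (auto simp: ext0_def xf_def)
 hence "hh (xf X) = ext0 (Cinf E) id o D X" using hh_xf[OF Pol.intros(1) assms, of 1] by (simp add: hh_one)
 moreover have "D X f \<in> Cinf E" for f
  using End_CinfD(1,2)[OF D_End[OF assms]] Cinf_zero[OF sub] by (cases "f \<in> Cinf E") (auto simp: zero_fun_def)
 ultimately show ?thesis by (simp add: fun_eq_iff)
qed

text \<open>The induction runs over the right factor with the left one arbitrary, so that the linear
  case is \<open>hh_xf\<close> and products are handled by reassociation.\<close>

lemma hh_mult:
 assumes "p' \<in> Pol E" shows "p \<in> Pol E ==> hh (p * p') = hh p o hh p'"
 using assms
proof (induction arbitrary: p rule: Pol.induct)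
 case (1 c)
 have "p * ext0 E (%_. c) = (%x. c * p x)" using Cinf_out[OF Pol_Cinf[OF 1]] by (auto simp: ext0_def)
 hence a: "hh (p * ext0 E (%_. c)) = (%f x. c * hh p f x)" using hh_scale[OF 1] by simp
 have b: "hh (ext0 E (%_. c)) = (%f x. c * ext0 (Cinf E) id f x)"
  unfolding ext0_const_scale[of c] by (simp add: hh_scale[OF Pol.intros(1)] hh_one)
 have "hh p (%x. c * ext0 (Cinf E) id f x) x = c * hh p f x" for f x
  using End_CinfD(2,4)[OF hh_End[OF 1]] End_CinfD(4)[OF hh_End[OF 1] Cinf_zero[OF sub], of 0]
  by (cases "f \<in> Cinf E") auto
 thus ?case unfolding a b by (intro ext) (simp only: o_apply)
next
 case (2 l)
 obtain X where X: "X \<in> E" "(%x. cplx (l x)) = xf X" by (rule dual_xf[OF 2(1)], rule that)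
 show ?case unfolding X(2) hh_lin[OF X(1)] by (rule hh_xf[OF 2(2) X(1)])
next
 case (3 q r)
 have "p * (q + r) = p * q + p * r" by (simp add: distrib_left)
 hence "hh (p * (q + r)) = (%f x. hh p (hh q f) x + hh p (hh r f) x)"
  by (simp only: hh_add[OF Pol.intros(4)[OF 3(5,1)] Pol.intros(4)[OF 3(5,2)]] 3(3)[OF 3(5)] 3(4)[OF 3(5)] o_apply)
 moreover have "hh p (%x. hh q f x + hh r f x) = (%x. hh p (hh q f) x + hh p (hh r f) x)" for f
  using End_CinfD(3)[OF hh_End[OF 3(5)]] End_CinfD(1,2)[OF hh_End[OF 3(1)]] End_CinfD(1,2)[OF hh_End[OF 3(2)]] Cinf_zero[OF sub]
   End_CinfD(4)[OF hh_End[OF 3(5)] Cinf_zero[OF sub], of 0]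
  by (cases "f \<in> Cinf E") (simp_all add: zero_fun_def)
 ultimately show ?case by (intro ext) (simp only: o_apply hh_add[OF 3(1,2)])
next
 case (4 q r)
 have "hh (p * (q * r)) = hh ((p * q) * r)" by (simp add: mult.assoc)
 also have "\<dots> = hh (p * q) o hh r" by (rule 4(4)[OF Pol.intros(4)[OF 4(5,1)]])
 also have "\<dots> = hh p o hh (q * r)" by (simp only: 4(3)[OF 4(5)] 4(4)[OF 4(1)] comp_assoc)
 finally show ?case .
qed

lemma hh_char: "sym_char E B D hh"
 unfolding sym_char_def
proof (intro conjI allI ballI impI)
 fix p q assume "p \<in> Pol E" "q \<in> Pol E"
 thus "hh (p + q) = hh p + hh q" by (simp add: hh_add fun_eq_iff)
qed (auto simp: hh_End hh_one hh_mult hh_scale hh_lin xf_def[symmetric], simp add: hh_def)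

text \<open>From here on the definite description denotes, and the commutator formula becomes
  available for \<open>sym_hom\<close>.\<close>

lemma sym_hom_eq: "sym_hom E B D = hh"
 unfolding sym_hom_char by (rule the_equality[where P = "sym_char E B D", OF hh_char sym_char_unique[OF _ hh_char]])

lemma sym_hom_formula:
 assumes "p \<in> Pol E" "hdec E p q n"
 shows "sym_hom E B D p = (%f x. \<Sum>d\<le>n. (1 / fact d) * (adop E (Lap C) ^^ d) (mop E (q d)) f x)"
 using hh_eq[OF assms] unfolding sym_hom_eq hs_def .

end

lemma sym_hom_is_char: "sym_char E B D (sym_hom E B D)"
proof -
 obtain C where C: "onb E C" by (rule onb_exists[OF sub order_refl])
 show ?thesis unfolding sym_hom_eq[OF C] by (rule hh_char[OF C])
qed

end

section \<open>Ordinary differential equations\<close>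

lemma hvd_lipschitz:
 fixes g :: "real => 'a::real_normed_vector"
 assumes "!!t. t \<in> {a..b} ==> (g hvd g' t) (at t within {a..b})"
  and "!!t. t \<in> {a..b} ==> norm (g' t) <= M" and "x \<in> {a..b}" "y \<in> {a..b}"
 shows "norm (g x - g y) <= M * \<bar>x - y\<bar>"
proof -
 have M: "0 <= M" using assms(2)[OF assms(3)] norm_ge_zero order_trans by blast
 have "norm (g x - g y) <= M * norm (x - y)"
 proof (rule differentiable_bound[where S = "{a..b}" and f' = "%t h. h *R g' t"])
  fix t assume t: "t \<in> {a..b}"
  show "(g has_derivative (%h. h *R g' t)) (at t within {a..b})"
   using assms(1)[OF t] by (simp add: has_vector_derivative_def)
  show "onorm (%h. h *R g' t) <= M"
   using assms(2)[OF t] M by (intro onorm_bound) (auto simp: mult.commute[of M] intro!: mult_left_mono)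
 qed (use assms in auto)
 thus ?thesis by simp
qed

lemma C1_lipschitz:
 fixes E :: "'a::euclidean_space set" and F :: "'a => 'b::real_normed_vector"
 assumes E: "subspace E" and N: "open_in E N" and F: "C_on (Suc 0) E N F"
  and S: "convex S" "compact S" "S <= N"
 obtains L where "0 <= L" "!!x y. x \<in> S ==> y \<in> S ==> norm (F x - F y) <= L * norm (x - y)"
proof -
 obtain C where C: "C <= E" "finite C" "!!x. x \<in> E ==> (\<Sum>b\<in>C. (x \<bullet> b) *R b) = x"
  "!!b c. b \<in> C ==> c \<in> C ==> b \<bullet> c = (if b = c then 1 else 0)"
  using orthonormal_basis_obtain[OF E] by metis
 have NE: "N <= E" using N openin_imp_subset by blast
 have "\<exists>K. \<forall>x\<in>S. norm (dir_deriv b F x) <= K" if "b \<in> C" for b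
 proof -
  have "continuous_on S (dir_deriv b F)"
   using C_on_dir_deriv[OF F, of b] C(1) that S(3) by (auto intro: continuous_on_subset)
  hence "bounded (dir_deriv b F ` S)" using S(2) compact_continuous_image compact_imp_bounded by blast
  thus ?thesis unfolding bounded_iff by auto
 qed
 then obtain K where K: "!!b x. b \<in> C ==> x \<in> S ==> norm (dir_deriv b F x) <= K b" by metis
 define L where "L = (\<Sum>b\<in>C. \<bar>K b\<bar>)"
 have L0: "0 <= L" unfolding L_def by (auto intro: sum_nonneg)
 have "norm (F x - F y) <= L * norm (x - y)" if x: "x \<in> S" and y: "y \<in> S" for x y
 proof -
  define X where "X = x - y"
  have XE: "X \<in> E" using x y S NE E by (auto simp: X_def intro: subspace_diff)
  have seg: "y + t *R X \<in> S" if "t \<in> {0..1}" for t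
  proof -
   have "y + t *R X = (1 - t) *R y + t *R x" by (simp add: X_def algebra_simps)
   thus ?thesis using convexD_alt[OF S(1) y x] that by auto
  qed
  have dX: "norm (dir_deriv X F z) <= L * norm X" if z: "z \<in> S" for z
  proof -
   have "dir_deriv X F z = dir_deriv (\<Sum>b\<in>C. (X \<bullet> b) *R b) F z" using C(3)[OF XE] by simp
   also have "\<dots> = (\<Sum>b\<in>C. (X \<bullet> b) *R dir_deriv b F z)"
    by (rule dir_deriv_sum[OF E N F]) (use z S C in auto)
   also have "norm \<dots> <= (\<Sum>b\<in>C. \<bar>K b\<bar> * norm X)"
   proof (rule sum_norm_le)
    fix b assume b: "b \<in> C"
    have "\<bar>X \<bullet> b\<bar> <= norm X * norm b" by (rule Cauchy_Schwarz_ineq2)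
    also have "norm b = 1" using C(4)[OF b b] by (simp add: norm_eq_1)
    finally have "\<bar>X \<bullet> b\<bar> <= norm X" by simp
    hence "\<bar>X \<bullet> b\<bar> * norm (dir_deriv b F z) <= norm X * \<bar>K b\<bar>"
     using K[OF b z] by (intro mult_mono) auto
    thus "norm ((X \<bullet> b) *R dir_deriv b F z) <= \<bar>K b\<bar> * norm X" by (simp add: mult.commute)
   qed
   finally show ?thesis by (simp add: L_def sum_distrib_right)
  qed
  have hv: "((%t. F (y + t *R X)) hvd dir_deriv X F (y + t *R X)) (at t within {0..1})"
   if "t \<in> {0..1}" for t
   by (rule has_vector_derivative_at_within[OF C_on_line[OF F XE]]) (use seg[OF that] S(3) in auto)
  have "norm (F (y + 1 *R X) - F (y + 0 *R X)) <= (L * norm X) * \<bar>1 - 0\<bar>"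
   by (rule hvd_lipschitz[where a = 0 and b = 1 and g = "%t. F (y + t *R X)" and g' = "%t. dir_deriv X F (y + t *R X)"])
    (use hv seg dX in auto)
  thus ?thesis by (simp add: X_def)
 qed
 thus ?thesis using that L0 by blast
qed

lemma integral_subspace:
 fixes E :: "'a::euclidean_space set" and f :: "real => 'a"
 assumes "subspace E" "continuous_on {a..b} f" "!!x. x \<in> {a..b} ==> f x \<in> E"
 shows "integral {a..b} f \<in> E"
proof -
 obtain pr where pr: "linear pr" "!!x. x \<in> E ==> pr x = x" "!!x. pr x \<in> span ((%x. x) ` E)"
  by (rule lin_on_extend[OF lin_onI assms(1), of "%x. x"]) (auto intro: that)
 have "integral {a..b} f = integral {a..b} (pr o f)" by (rule integral_cong) (use assms(3) pr(2) in auto)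
 also have "\<dots> = pr (integral {a..b} f)"
  by (rule integral_linear[OF integrable_continuous_real[OF assms(2)]]) (use pr(1) in "simp add: linear_conv_bounded_linear")
 also have "\<dots> \<in> E" using pr(3) span_eq_iff[THEN iffD2, OF assms(1)] by simp
 finally show ?thesis .
qed

text \<open>The field lives only on a relatively open set. Composing it with the closest point map
  onto a compact convex neighbourhood S gives a bounded Lipschitz field on the whole space; its
  solution stays in S for short times, where the two fields agree.\<close>

lemma picard_local:
 fixes E :: "'a::euclidean_space set"
 assumes E: "subspace E" and N: "open_in E N" and F: "C_on (Suc 0) E N F"
  and FE: "!!x. x \<in> N ==> F x \<in> E" and e: "e \<in> N"
 obtains \<epsilon> u where "\<epsilon> > 0" "u 0 = e" "!!t. \<bar>t\<bar> < \<epsilon> ==> u t \<in> N" "!!t. \<bar>t\<bar> < \<epsilon> ==> (u hvd F (u t)) (at t)"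
proof -
 have NE: "N <= E" using N openin_imp_subset by blast
 have eE: "e \<in> E" using e NE by auto
 obtain S0 where S0: "open S0" "N = E \<inter> S0" using N by (meson openin_open)
 obtain r where r: "r > 0" "cball e r <= S0" using S0 e by (metis IntD2 open_contains_cball)
 define S where "S = cball e r \<inter> E"
 have S: "convex S" "compact S" "S <= N" "e \<in> S"
  using r S0 eE closed_subspace[OF E] subspace_imp_convex[OF E]
  by (auto simp: S_def intro: convex_Int compact_Int_closed)
 have Sc: "closed S" "S ~= {}" using S compact_imp_closed by auto
 obtain L where L: "0 <= L" "!!x y. x \<in> S ==> y \<in> S ==> norm (F x - F y) <= L * norm (x - y)"
  by (rule C1_lipschitz[OF E N F S(1-3)], rule that)
 obtain K where K: "!!x. x \<in> S ==> norm (F x) <= K"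
 proof -
  have "continuous_on S F" using C_on_cont[OF F] S(3) continuous_on_subset by blast
  hence "bounded (F ` S)" using S(2) compact_continuous_image compact_imp_bounded by blast
  then obtain K where "\<forall>x\<in>F ` S. norm x <= K" unfolding bounded_iff by blast
  thus thesis using that by blast
 qed
 have K0: "0 <= K" using K[OF S(4)] norm_ge_zero order_trans by blast
 define c where "c = closest_point S"
 have cS: "c x \<in> S" for x unfolding c_def by (rule closest_point_in_set[OF Sc])
 have c_id: "c x = x" if "x \<in> S" for x unfolding c_def by (rule closest_point_self[OF that])
 have c_lip: "norm (c x - c y) <= norm (x - y)" for x y
  using closest_point_lipschitz[OF S(1) Sc, of x y] by (simp add: c_def dist_norm)
 define G where "G x = F (c x)" for x
 have G_lip: "norm (G x - G y) <= L * norm (x - y)" for x y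
  using L(2)[OF cS cS, of x y] mult_left_mono[OF c_lip L(1), of x y] by (simp add: G_def)
 have G_bd: "norm (G x) <= K" for x by (simp add: G_def K cS)
 have GE: "G x \<in> E" for x using FE cS S(3) by (auto simp: G_def)
 have G_cont: "continuous_on UNIV G"
 proof (rule continuous_onI)
  fix \<epsilon>' :: real and x :: 'a assume "\<epsilon>' > 0"
  thus "\<exists>d>0. \<forall>x'\<in>UNIV. dist x' x < d --> dist (G x') (G x) <= \<epsilon>'"
  proof (intro exI[of _ "\<epsilon>' / (L + 1)"] conjI ballI impI)
   fix x' assume "dist x' x < \<epsilon>' / (L + 1)"
   hence "(L + 1) * dist x' x < \<epsilon>'" using L(1) by (simp add: field_simps)
   moreover have "dist (G x') (G x) <= L * dist x' x" using G_lip by (simp add: dist_norm)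
   ultimately show "dist (G x') (G x) <= \<epsilon>'"
    unfolding distrib_right using zero_le_dist[of x' x] by linarith
  qed (use L(1) in auto)
 qed
 \<comment> \<open>The first bound makes the integral operator contract by 1/2, the second keeps the
   solution within distance r of e. Adding 1 avoids division by zero.\<close>
 define \<epsilon> where "\<epsilon> = min (1 / (2 * (L + 1))) (r / (K + 1))"
 have eps: "\<epsilon> > 0" "\<epsilon> * L <= 1/2" "\<epsilon> * K <= r"
 proof -
  show "\<epsilon> > 0" using r L K0 by (simp add: \<epsilon>_def)
  have "\<epsilon> * L <= 1 / (2 * (L + 1)) * L" using L(1) by (intro mult_right_mono) (auto simp: \<epsilon>_def)
  also have "\<dots> <= 1/2" using L(1) by (simp add: field_simps)
  finally show "\<epsilon> * L <= 1/2" .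
  have "\<epsilon> * K <= r / (K + 1) * K" using K0 by (intro mult_right_mono) (auto simp: \<epsilon>_def)
  also have "\<dots> <= r" using K0 r by (simp add: field_simps)
  finally show "\<epsilon> * K <= r" .
 qed
 define I where "I h t = integral {-\<epsilon>..t} h - integral {-\<epsilon>..0} h" for h :: "real => 'a" and t
 have I_der: "(I h hvd h t) (at t within {-\<epsilon>..\<epsilon>})" if "continuous_on UNIV h" "t \<in> {-\<epsilon>..\<epsilon>}" for h t
 proof -
  have "((%t. integral {-\<epsilon>..t} h - integral {-\<epsilon>..0} h) hvd h t - 0) (at t within {-\<epsilon>..\<epsilon>})"
   by (intro has_vector_derivative_diff integral_has_vector_derivative has_vector_derivative_const)
    (use that continuous_on_subset in blast)+
  thus ?thesis by (simp add: I_def[abs_def])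
 qed
 have I_bd: "norm (I h t - I h s) <= M * \<bar>t - s\<bar>"
  if "continuous_on UNIV h" "!!t. norm (h t) <= M" "t \<in> {-\<epsilon>..\<epsilon>}" "s \<in> {-\<epsilon>..\<epsilon>}" for h M t s
  by (rule hvd_lipschitz[OF I_der[OF that(1)]]) (use that in auto)
 have I0: "I h 0 = 0" for h by (simp add: I_def)
 have I_bd0: "norm (I h t) <= M * \<epsilon>" if "continuous_on UNIV h" "!!t. norm (h t) <= M" "t \<in> {-\<epsilon>..\<epsilon>}" for h M t
 proof -
  have "norm (I h t - I h 0) <= M * \<bar>t - 0\<bar>" by (rule I_bd[OF that(1,2,3)]) (use eps in auto)
  also have "\<dots> <= M * \<epsilon>" using that(3) order_trans[OF norm_ge_zero that(2)[of 0]] by (intro mult_left_mono) auto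
  finally show ?thesis by (simp add: I0)
 qed
 \<comment> \<open>Clamping the time to the interval lets the fixed point be sought among bounded
   continuous functions on the whole line, a complete metric type.\<close>
 define \<kappa> where "\<kappa> t = max (-\<epsilon>) (min \<epsilon> t)" for t
 have k: "\<kappa> t \<in> {-\<epsilon>..\<epsilon>}" for t using eps by (auto simp: \<kappa>_def)
 have k_id: "\<kappa> t = t" if "t \<in> {-\<epsilon>..\<epsilon>}" for t using that by (auto simp: \<kappa>_def)
 have k_cont: "continuous_on UNIV \<kappa>" unfolding \<kappa>_def by (intro continuous_intros)
 have Gu: "continuous_on UNIV (%t. G (u t))" for u :: "real \<Rightarrow>\<^sub>C 'a"
  by (rule continuous_on_compose2[OF G_cont]) auto
 define P where "P u t = e + I (%t. G (u t)) (\<kappa> t)" for u :: "real \<Rightarrow>\<^sub>C 'a" and t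
 have P_in: "P u \<in> bcontfun" for u
 proof (rule bcontfun_normI)
  have "continuous_on {-\<epsilon>..\<epsilon>} (I (%t. G (u t)))"
   using I_der[OF Gu] has_vector_derivative_continuous continuous_on_eq_continuous_within by blast
  thus "continuous_on UNIV (P u)" unfolding P_def
   by (intro continuous_on_add continuous_on_const) (rule continuous_on_compose2[OF _ k_cont], use k in auto)
  show "norm (P u t) <= norm e + K * \<epsilon>" for t
   unfolding P_def using I_bd0[OF Gu G_bd k] by (meson add_left_mono norm_triangle_le order_refl)
 qed
 define T where "T u = Bcontfun (P u)" for u
 have T: "apply_bcontfun (T u) = P u" for u unfolding T_def by (rule Bcontfun_inverse[OF P_in])
 have contr: "dist (T u) (T v) <= (1/2) * dist u v" for u v
 proof (rule dist_bound)
  fix t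
  have cd: "continuous_on UNIV (%t. G (u t) - G (v t))"
   by (intro continuous_on_diff Gu)
  have bd: "norm (G (u t) - G (v t)) <= L * dist u v" for t
   using G_lip[of "u t" "v t"] mult_left_mono[OF dist_bounded[of u t v] L(1)]
   by (simp add: dist_norm)
  have int: "(%t. G (u t)) integrable_on {a..b}" for u :: "real \<Rightarrow>\<^sub>C 'a" and a b
   by (rule integrable_continuous_real[OF continuous_on_subset[OF Gu]]) simp
  have "P u t - P v t = I (%t. G (u t) - G (v t)) (\<kappa> t)"
   unfolding P_def I_def by (simp add: integral_diff[OF int int])
  also have "norm \<dots> <= L * dist u v * \<epsilon>" by (rule I_bd0[OF cd bd k])
  also have "\<dots> <= (1/2) * dist u v" using mult_right_mono[OF eps(2), of "dist u v"] by (simp add: mult_ac)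
  finally show "dist (apply_bcontfun (T u) t) (apply_bcontfun (T v) t) <= (1/2) * dist u v"
   by (simp add: T dist_norm)
 qed
 obtain u where "T u = u" using banach_fix_type[of "1/2" T] contr by auto
 hence u: "u t = P u t" for t using T[of u] by simp
 define w where "w = apply_bcontfun u"
 have wI: "w t = e + I (%t. G (w t)) t" if "t \<in> {-\<epsilon>..\<epsilon>}" for t
  using u[of t] that by (simp add: P_def k_id w_def)
 have Gw: "continuous_on UNIV (%t. G (w t))" unfolding w_def by (rule Gu)
 have wS: "w t \<in> S" if t: "t \<in> {-\<epsilon>..\<epsilon>}" for t
 proof -
  have "norm (I (%t. G (w t)) t) <= K * \<epsilon>" by (rule I_bd0[OF Gw G_bd t])
  also have "\<dots> <= r" using eps(3) by (simp add: mult.commute)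
  finally have "w t \<in> cball e r" unfolding wI[OF t] by (simp add: dist_norm)
  moreover have "I (%t. G (w t)) t \<in> E" unfolding I_def
   by (intro subspace_diff[OF E] integral_subspace[OF E] continuous_on_subset[OF Gw] GE) auto
  ultimately show ?thesis unfolding S_def wI[OF t] using eE E by (auto intro: subspace_add)
 qed
 show ?thesis
 proof (rule that[of \<epsilon> w])
  show "\<epsilon> > 0" by (rule eps)
  show "w 0 = e" using wI[of 0] eps I0 by simp
  fix t :: real assume t: "\<bar>t\<bar> < \<epsilon>"
  hence t': "t \<in> {-\<epsilon>..\<epsilon>}" by auto
  show "w t \<in> N" using wS[OF t'] S by auto
  have "((%t. e + I (%t. G (w t)) t) hvd 0 + G (w t)) (at t within {-\<epsilon>..\<epsilon>})"
   by (intro has_vector_derivative_add has_vector_derivative_const I_der[OF Gw t'])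
  hence "(w hvd F (w t)) (at t within {-\<epsilon>..\<epsilon>})"
   using wI t' c_id[OF wS[OF t']]
   by (subst has_vector_derivative_cong_ev[where g = "%t. e + I (%t. G (w t)) t"]) (auto simp: G_def)
  moreover have "at t within {-\<epsilon>..\<epsilon>} = at t" by (rule at_within_interior) (use t in auto)
  ultimately show "(w hvd F (w t)) (at t)" by simp
 qed
qed

text \<open>Gronwall's argument: \<open>exp (- 2 C t)\<close> times the squared norm is
  nonincreasing. Negative times follow by reversing the curve.\<close>

lemma linear_ode_unique:
 fixes u :: "real => 'a::real_inner"
 assumes "!!t. (u hvd u' t) (at t)" "!!t. norm (u' t) <= C * norm (u t)" "u 0 = 0"
 shows "u t = 0"
proof -
 have pos: "v t = 0" if v: "!!t. (v hvd v' t) (at t)" "!!t. norm (v' t) <= C * norm (v t)" "v 0 = 0" and "t >= 0"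
  for v v' :: "real => 'a" and t
 proof -
  define q where "q t = v t \<bullet> v t" for t
  have q': "(q has_field_derivative 2 * (v t \<bullet> v' t)) (at t)" for t
   unfolding q_def has_field_derivative_def
   by (rule has_derivative_eq_rhs[OF has_derivative_inner[OF v(1)[unfolded has_vector_derivative_def] v(1)[unfolded has_vector_derivative_def]]])
    (auto simp: fun_eq_iff inner_commute algebra_simps)
  have bd: "\<bar>2 * (v t \<bullet> v' t)\<bar> <= (2 * C) * q t" for t
  proof -
   have "\<bar>v t \<bullet> v' t\<bar> <= norm (v t) * norm (v' t)" by (rule Cauchy_Schwarz_ineq2)
   also have "\<dots> <= norm (v t) * (C * norm (v t))" by (intro mult_left_mono v) auto
   also have "\<dots> = C * q t" by (simp add: q_def power2_norm_eq_inner[symmetric] power2_eq_square)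
   finally show ?thesis by simp
  qed
  have "exp (- (2 * C) * t) * q t <= exp (- (2 * C) * 0) * q 0"
  proof (rule DERIV_nonpos_imp_nonincreasing[OF \<open>t >= 0\<close>], intro exI conjI)
   fix x
   show "((%t. exp (- (2 * C) * t) * q t) has_real_derivative exp (- (2 * C) * x) * (2 * (v x \<bullet> v' x) - 2 * C * q x)) (at x)"
    by (auto intro!: derivative_eq_intros q' simp: algebra_simps)
   show "exp (- (2 * C) * x) * (2 * (v x \<bullet> v' x) - 2 * C * q x) <= 0"
    using bd[of x] by (intro mult_nonneg_nonpos) auto
  qed
  hence "q t <= 0" using v(3) by (simp add: q_def mult_le_0_iff)
  thus ?thesis unfolding q_def by (metis inner_eq_zero_iff inner_ge_zero order_antisym)
 qed
 have n: "((%t. u (- t)) hvd - u' (- t)) (at t)" for t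
  using vector_diff_chain_at[of uminus "-1" t u "u' (- t)"] assms(1) has_vector_derivative_minus[OF has_vector_derivative_id, of "at t"]
  by (simp add: o_def)
 show ?thesis using pos[OF assms] pos[OF n, of "- t"] assms(2,3) by (cases "t >= 0") auto
qed

lemma C_on_Pair:
 assumes "subspace E" "open_in E U" "C_on k E U f" "C_on k E U g"
 shows "C_on k E U (%x. (f x, g x))"
proof -
 have "C_on k E U (%x. (f x, 0) + (0, g x))"
  by (intro C_on_add[OF assms(1,2)] C_on_bounded_linear[OF assms(1,2), where h = "%x. (x, 0)"]
    C_on_bounded_linear[OF assms(1,2), where h = "%x. (0, x)"] assms bounded_linear_Pair bounded_linear_ident bounded_linear_zero)
 thus ?thesis by simp
qed

section \<open>Manifolds and Lie groups\<close>

text \<open>The part of a smooth atlas that involves only open images, injectivity and transition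
  maps; in this form it passes directly to products.\<close>

definition charts :: "'a topology => 'e::euclidean_space set => ('a, 'e) chart set => bool" where
 "charts T E A \<longleftrightarrow> subspace E & (\<Union>(U, \<phi>)\<in>A. U) = topspace T \<and>
   (\<forall>(U, \<phi>)\<in>A. openin T U & inj_on \<phi> U & (\<forall>W. openin T W --> open_in E (\<phi> ` (U \<inter> W)))) \<and>
   (\<forall>(U, \<phi>)\<in>A. \<forall>(V, \<psi>)\<in>A. smooth_on E (\<phi> ` (U \<inter> V)) (\<psi> o inv_into U \<phi>))"

lemma chartsD:
 assumes "charts T E A"
 shows "subspace E" "x \<in> topspace T ==> \<exists>U \<phi>. (U, \<phi>) \<in> A & x \<in> U"
  "(U, \<phi>) \<in> A ==> openin T U" "(U, \<phi>) \<in> A ==> inj_on \<phi> U"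
  "(U, \<phi>) \<in> A ==> openin T W ==> open_in E (\<phi> ` (U \<inter> W))"
  "(U, \<phi>) \<in> A ==> open_in E (\<phi> ` U)"
  "(U, \<phi>) \<in> A ==> (V, \<psi>) \<in> A ==> C_on k E (\<phi> ` (U \<inter> V)) (\<psi> o inv_into U \<phi>)"
  "(U, \<phi>) \<in> A ==> U <= topspace T"
proof -
 note a = assms[unfolded charts_def]
 show "subspace E" using a by blast
 show "x \<in> topspace T ==> \<exists>U \<phi>. (U, \<phi>) \<in> A & x \<in> U" using a by blast
 show o: "(U, \<phi>) \<in> A ==> openin T U" "(U, \<phi>) \<in> A ==> inj_on \<phi> U"
  "(U, \<phi>) \<in> A ==> openin T W ==> open_in E (\<phi> ` (U \<inter> W))" for W using a by blast+
 show "(U, \<phi>) \<in> A ==> open_in E (\<phi> ` U)" using o(1) o(3)[of U] by simp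
 show "(U, \<phi>) \<in> A ==> U <= topspace T" using o(1) openin_subset by blast
 show "(U, \<phi>) \<in> A ==> (V, \<psi>) \<in> A ==> C_on k E (\<phi> ` (U \<inter> V)) (\<psi> o inv_into U \<phi>)"
  using a unfolding smooth_on_def by fastforce
qed

lemma smooth_manifold_charts:
 assumes "smooth_manifold T E A" shows "charts T E A"
proof -
 note a = assms[unfolded smooth_manifold_def]
 have *: "openin T U & inj_on \<phi> U & (\<forall>W. openin T W --> open_in E (\<phi> ` (U \<inter> W)))" if "(U, \<phi>) \<in> A" for U \<phi>
 proof -
  have u: "openin T U" "open_in E (\<phi> ` U)" "homeomorphic_map (subtopology T U) (top_of_set (\<phi> ` U)) \<phi>"
   using a that by blast+
  have ts: "topspace (subtopology T U) = U" using u(1) openin_subset by fastforce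
  have "inj_on \<phi> U" using u(3) ts unfolding homeomorphic_eq_everything_map by simp
  moreover have "open_in E (\<phi> ` (U \<inter> W))" if "openin T W" for W
  proof -
   have "openin (subtopology T U) (U \<inter> W)" using that by (simp add: openin_subtopology_Int2)
   hence "openin (top_of_set (\<phi> ` U)) (\<phi> ` (U \<inter> W))"
    using homeomorphic_map_openness[OF u(3), of "U \<inter> W"] ts by auto
   thus ?thesis using u(2) openin_trans by blast
  qed
  ultimately show ?thesis using u(1) by blast
 qed
 show ?thesis unfolding charts_def using a * by blast
qed

lemma inv_map_prod:
 assumes "inj_on \<phi> U" "inj_on \<psi> V" "a \<in> \<phi> ` U" "b \<in> \<psi> ` V"
 shows "inv_into (U \<times> V) (map_prod \<phi> \<psi>) (a, b) = (inv_into U \<phi> a, inv_into V \<psi> b)"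
proof (rule inv_into_f_eq)
 show "inj_on (map_prod \<phi> \<psi>) (U \<times> V)" using assms by (auto simp: inj_on_def)
qed (use assms in "auto simp: inv_into_into f_inv_into_f")

lemma prod_chart_smooth:
 assumes c: "charts T E A" "charts T' E' A'" and U: "(U, \<phi>) \<in> A" "(V, \<psi>) \<in> A'"
 shows "(U', \<phi>') \<in> A ==> C_on k (E \<times> E') (map_prod \<phi> \<psi> ` (U \<times> V \<inter> fst -` U')) (\<phi>' o fst o inv_into (U \<times> V) (map_prod \<phi> \<psi>))"
  and "(V', \<psi>') \<in> A' ==> C_on k (E \<times> E') (map_prod \<phi> \<psi> ` (U \<times> V \<inter> snd -` V')) (\<psi>' o snd o inv_into (U \<times> V) (map_prod \<phi> \<psi>))"
proof -
 note a = chartsD[OF c(1)] and b = chartsD[OF c(2)]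
 note sub = subspace_Times[OF a(1) b(1)] and inv = inv_map_prod[OF a(4)[OF U(1)] b(4)[OF U(2)]]
 { assume U': "(U', \<phi>') \<in> A"
  have eq: "map_prod \<phi> \<psi> ` (U \<times> V \<inter> fst -` U') = \<phi> ` (U \<inter> U') \<times> \<psi> ` V" by force
  have o: "openin (top_of_set (E \<times> E')) (\<phi> ` (U \<inter> U') \<times> \<psi> ` V)"
   using a(5)[OF U(1) a(3)[OF U']] b(6)[OF U(2)] by (simp add: openin_Times)
  have "C_on k (E \<times> E') (\<phi> ` (U \<inter> U') \<times> \<psi> ` V) (%z. (\<phi>' o inv_into U \<phi>) (fst z))"
   by (rule C_on_compose[OF sub o a(1) a(5)[OF U(1) a(3)[OF U']] C_on_linear[OF sub o linear_fst] a(7)[OF U(1) U']]) auto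
  thus "C_on k (E \<times> E') (map_prod \<phi> \<psi> ` (U \<times> V \<inter> fst -` U')) (\<phi>' o fst o inv_into (U \<times> V) (map_prod \<phi> \<psi>))"
   unfolding eq by (subst C_on_cong[OF sub o, where g = "%z. (\<phi>' o inv_into U \<phi>) (fst z)"]) (auto simp: inv) }
 { assume V': "(V', \<psi>') \<in> A'"
  have eq: "map_prod \<phi> \<psi> ` (U \<times> V \<inter> snd -` V') = \<phi> ` U \<times> \<psi> ` (V \<inter> V')" by force
  have o: "openin (top_of_set (E \<times> E')) (\<phi> ` U \<times> \<psi> ` (V \<inter> V'))"
   using b(5)[OF U(2) b(3)[OF V']] a(6)[OF U(1)] by (simp add: openin_Times)
  have "C_on k (E \<times> E') (\<phi> ` U \<times> \<psi> ` (V \<inter> V')) (%z. (\<psi>' o inv_into V \<psi>) (snd z))"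
   by (rule C_on_compose[OF sub o b(1) b(5)[OF U(2) b(3)[OF V']] C_on_linear[OF sub o linear_snd] b(7)[OF U(2) V']]) auto
  thus "C_on k (E \<times> E') (map_prod \<phi> \<psi> ` (U \<times> V \<inter> snd -` V')) (\<psi>' o snd o inv_into (U \<times> V) (map_prod \<phi> \<psi>))"
   unfolding eq by (subst C_on_cong[OF sub o, where g = "%z. (\<psi>' o inv_into V \<psi>) (snd z)"]) (auto simp: inv) }
qed

lemma charts_prod:
 assumes "charts T E A" "charts T' E' A'"
 shows "charts (prod_topology T T') (E \<times> E') (prod_atlas A A')"
proof -
 note a = chartsD[OF assms(1)] and b = chartsD[OF assms(2)]
 have sub: "subspace (E \<times> E')" using a(1) b(1) by (rule subspace_Times)
 have cover: "(\<Union>(U, \<phi>)\<in>prod_atlas A A'. U) = topspace (prod_topology T T')"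
 proof
  show "(\<Union>(U, \<phi>)\<in>prod_atlas A A'. U) <= topspace (prod_topology T T')"
   using a(8) b(8) by (fastforce simp: prod_atlas_def)
  show "topspace (prod_topology T T') <= (\<Union>(U, \<phi>)\<in>prod_atlas A A'. U)"
  proof
   fix z assume "z \<in> topspace (prod_topology T T')"
   then obtain U \<phi> V \<psi> where "(U, \<phi>) \<in> A" "fst z \<in> U" "(V, \<psi>) \<in> A'" "snd z \<in> V"
    using a(2)[of "fst z"] b(2)[of "snd z"] by auto
   hence "(U \<times> V, map_prod \<phi> \<psi>) \<in> prod_atlas A A'" "z \<in> U \<times> V"
    by (auto simp: prod_atlas_def mem_Times_iff)
   thus "z \<in> (\<Union>(U, \<phi>)\<in>prod_atlas A A'. U)" by blast
  qed
 qed
 have op: "openin (top_of_set (E \<times> E')) (map_prod \<phi> \<psi> ` (U \<times> V \<inter> W))"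
  if c: "(U, \<phi>) \<in> A" "(V, \<psi>) \<in> A'" and W: "openin (prod_topology T T') W" for U \<phi> V \<psi> W
 proof (subst openin_subopen, rule ballI)
  fix z assume "z \<in> map_prod \<phi> \<psi> ` (U \<times> V \<inter> W)"
  then obtain x y where xy: "x \<in> U" "y \<in> V" "(x, y) \<in> W" "z = (\<phi> x, \<psi> y)" by auto
  have "\<exists>W1 W2. openin T W1 & openin T' W2 & x \<in> W1 & y \<in> W2 & W1 \<times> W2 <= W"
   using W[unfolded openin_prod_topology_alt, rule_format, OF xy(3)] .
  then obtain W1 W2 where w: "openin T W1" "openin T' W2" "x \<in> W1" "y \<in> W2" "W1 \<times> W2 <= W"
   by (elim exE conjE) (rule that)
  have "openin (top_of_set (E \<times> E')) (\<phi> ` (U \<inter> W1) \<times> \<psi> ` (V \<inter> W2))"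
   using a(5)[OF c(1) w(1)] b(5)[OF c(2) w(2)] by (simp add: openin_Times)
  moreover have "z \<in> \<phi> ` (U \<inter> W1) \<times> \<psi> ` (V \<inter> W2)" using xy w by auto
  moreover have "\<phi> ` (U \<inter> W1) \<times> \<psi> ` (V \<inter> W2) <= map_prod \<phi> \<psi> ` (U \<times> V \<inter> W)" using w(5) by force
  ultimately show "\<exists>T. openin (top_of_set (E \<times> E')) T & z \<in> T & T <= map_prod \<phi> \<psi> ` (U \<times> V \<inter> W)" by blast
 qed
 have sm: "C_on k (E \<times> E') (map_prod \<phi> \<psi> ` (U \<times> V \<inter> U' \<times> V')) (map_prod \<phi>' \<psi>' o inv_into (U \<times> V) (map_prod \<phi> \<psi>))"
  if c: "(U, \<phi>) \<in> A" "(V, \<psi>) \<in> A'" "(U', \<phi>') \<in> A" "(V', \<psi>') \<in> A'" for U \<phi> V \<psi> U' \<phi>' V' \<psi>' k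
 proof -
  have o: "openin (top_of_set (E \<times> E')) (map_prod \<phi> \<psi> ` (U \<times> V \<inter> U' \<times> V'))"
   by (rule op[OF c(1,2)]) (simp add: openin_prod_Times_iff a(3)[OF c(3)] b(3)[OF c(4)])
  have "C_on k (E \<times> E') (map_prod \<phi> \<psi> ` (U \<times> V \<inter> U' \<times> V')) (%z. ((\<phi>' o fst o inv_into (U \<times> V) (map_prod \<phi> \<psi>)) z,
    (\<psi>' o snd o inv_into (U \<times> V) (map_prod \<phi> \<psi>)) z))"
   by (rule C_on_Pair[OF sub o C_on_subset[OF prod_chart_smooth(1)[OF assms c(1-3)]] C_on_subset[OF prod_chart_smooth(2)[OF assms c(1,2,4)]]]) auto
  thus ?thesis by (simp add: o_def map_prod_def split_beta)
 qed
 have inj: "inj_on (map_prod \<phi> \<psi>) (U \<times> V)" if "(U, \<phi>) \<in> A" "(V, \<psi>) \<in> A'" for U \<phi> V \<psi>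
  using a(4)[OF that(1)] b(4)[OF that(2)] by (auto simp: inj_on_def)
 show ?thesis unfolding charts_def
 proof (intro conjI sub cover)
  show "\<forall>(W, \<eta>)\<in>prod_atlas A A'. openin (prod_topology T T') W & inj_on \<eta> W \<and>
    (\<forall>O'. openin (prod_topology T T') O' --> openin (top_of_set (E \<times> E')) (\<eta> ` (W \<inter> O')))"
   using op inj a(3) b(3) by (auto simp: prod_atlas_def openin_prod_Times_iff)
  show "\<forall>(W, \<eta>)\<in>prod_atlas A A'. \<forall>(W', \<eta>')\<in>prod_atlas A A'. smooth_on (E \<times> E') (\<eta> ` (W \<inter> W')) (\<eta>' o inv_into W \<eta>)"
   using sm by (auto simp: prod_atlas_def smooth_on_def)
 qed
qed

section \<open>Smooth maps between manifolds\<close>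

lemma smooth_mapD:
 assumes "smooth_map T E A T' A' f"
 shows "continuous_map T T' f" "(U, \<phi>) \<in> A ==> (V, \<psi>) \<in> A' ==> C_on k E (\<phi> ` (U \<inter> f -` V)) (\<psi> o f o inv_into U \<phi>)"
 using assms unfolding smooth_map_def smooth_on_def by (blast, fastforce)

lemma smooth_mapI:
 assumes "continuous_map T T' f"
  "!!U \<phi> V \<psi> k. (U, \<phi>) \<in> A ==> (V, \<psi>) \<in> A' ==> C_on k E (\<phi> ` (U \<inter> f -` V)) (\<psi> o f o inv_into U \<phi>)"
 shows "smooth_map T E A T' A' f"
 using assms unfolding smooth_map_def smooth_on_def by auto

lemma charts_preimage_open:
 assumes "charts T E A" "continuous_map T T' f" "openin T' W" "(U, \<phi>) \<in> A"
 shows "open_in E (\<phi> ` (U \<inter> f -` W))"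
proof -
 have "U \<inter> f -` W = U \<inter> {x \<in> topspace T. f x \<in> W}" using chartsD(8)[OF assms(1,4)] by auto
 thus ?thesis
  using chartsD(5)[OF assms(1,4) openin_continuous_map_preimage[OF assms(2,3)]] by simp
qed

text \<open>A middle chart is available only near each image point, so smoothness is first shown on
  a small neighbourhood and then glued by \<open>C_on_local\<close>.\<close>

lemma smooth_map_compose:
 assumes c: "charts T E A" "charts T' E' A'" "charts T'' E'' A''"
  and f: "smooth_map T E A T' A' f" and h: "smooth_map T' E' A' T'' A'' h"
 shows "smooth_map T E A T'' A'' (%x. h (f x))"
proof (rule smooth_mapI)
 have hf: "continuous_map T T'' (h o f)"
  using continuous_map_compose[OF smooth_mapD(1)[OF f] smooth_mapD(1)[OF h]] .
 thus "continuous_map T T'' (%x. h (f x))" by (simp add: o_def)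
 fix U \<phi> W \<psi> k assume U: "(U, \<phi>) \<in> A" and W: "(W, \<psi>) \<in> A''"
 note a = chartsD[OF c(1)] and b = chartsD[OF c(2)]
 show "C_on k E (\<phi> ` (U \<inter> (%x. h (f x)) -` W)) (\<psi> o (%x. h (f x)) o inv_into U \<phi>)"
 proof (rule C_on_local)
  show "\<phi> ` (U \<inter> (%x. h (f x)) -` W) <= E"
   using a(6)[OF U] openin_imp_subset by blast
  fix y assume "y \<in> \<phi> ` (U \<inter> (%x. h (f x)) -` W)"
  then obtain x where x: "x \<in> U" "h (f x) \<in> W" "y = \<phi> x" by auto
  have "f x \<in> topspace T'" using x a(8)[OF U] smooth_mapD(1)[OF f] unfolding continuous_map_def by auto
  then obtain V \<eta> where V: "(V, \<eta>) \<in> A'" "f x \<in> V" using b(2) by blast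
  let ?N = "\<phi> ` (U \<inter> f -` V) \<inter> \<phi> ` (U \<inter> (h o f) -` W)"
  have oN: "open_in E ?N"
   using charts_preimage_open[OF c(1) smooth_mapD(1)[OF f] b(3)[OF V(1)] U] charts_preimage_open[OF c(1) hf chartsD(3)[OF c(3) W] U]
   by blast
  have N: "\<exists>x\<in>U. z = \<phi> x & f x \<in> V & h (f x) \<in> W" if "z \<in> ?N" for z
   using that inj_onD[OF a(4)[OF U]] by fastforce
  have "C_on k E ?N (%z. (\<psi> o h o inv_into V \<eta>) ((\<eta> o f o inv_into U \<phi>) z))"
  proof (rule C_on_compose[OF a(1) oN b(1)])
   show "open_in E' (\<eta> ` (V \<inter> h -` W))"
    by (rule charts_preimage_open[OF c(2) smooth_mapD(1)[OF h] chartsD(3)[OF c(3) W] V(1)])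
   show "C_on k E ?N (\<eta> o f o inv_into U \<phi>)"
    by (rule C_on_subset[OF smooth_mapD(2)[OF f U V(1)]]) auto
   show "C_on k E' (\<eta> ` (V \<inter> h -` W)) (\<psi> o h o inv_into V \<eta>)"
    by (rule smooth_mapD(2)[OF h V(1) W])
   show "(\<eta> o f o inv_into U \<phi>) ` ?N <= \<eta> ` (V \<inter> h -` W)"
   proof (rule image_subsetI)
    fix z assume "z \<in> ?N"
    then obtain x where "x \<in> U" "z = \<phi> x" "f x \<in> V" "h (f x) \<in> W" using N by blast
    thus "(\<eta> o f o inv_into U \<phi>) z \<in> \<eta> ` (V \<inter> h -` W)"
     using inv_into_f_f[OF a(4)[OF U]] by auto
   qed
  qed
  moreover have "(\<psi> o h o inv_into V \<eta>) ((\<eta> o f o inv_into U \<phi>) z) = (\<psi> o (%x. h (f x)) o inv_into U \<phi>) z" if "z \<in> ?N" for z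
   using N[OF that] inv_into_f_f[OF a(4)[OF U]] inv_into_f_f[OF b(4)[OF V(1)]] by auto
  ultimately have "C_on k E ?N (\<psi> o (%x. h (f x)) o inv_into U \<phi>)"
   using C_on_cong[OF a(1) oN, of "%z. (\<psi> o h o inv_into V \<eta>) ((\<eta> o f o inv_into U \<phi>) z)"] by blast
  thus "\<exists>V. open_in E V & y \<in> V & C_on k E V (\<psi> o (%x. h (f x)) o inv_into U \<phi>)"
   using oN x V by (intro exI[of _ ?N]) auto
 qed
qed

lemma smooth_map_Pair:
 assumes c: "charts T E A" "charts T' E' A'" "charts T'' E'' A''"
  and f: "smooth_map T E A T' A' f" and h: "smooth_map T E A T'' A'' h"
 shows "smooth_map T E A (prod_topology T' T'') (prod_atlas A' A'') (%x. (f x, h x))"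
proof (rule smooth_mapI)
 show "continuous_map T (prod_topology T' T'') (%x. (f x, h x))"
  using smooth_mapD(1)[OF f] smooth_mapD(1)[OF h] by (rule continuous_map_pairedI)
 fix U \<phi> W \<eta> k assume U: "(U, \<phi>) \<in> A" and "(W, \<eta>) \<in> prod_atlas A' A''"
 then obtain V \<psi> V' \<psi>' where W: "W = V \<times> V'" "\<eta> = map_prod \<psi> \<psi>'" and V: "(V, \<psi>) \<in> A'" "(V', \<psi>') \<in> A''"
  by (auto simp: prod_atlas_def)
 note a = chartsD[OF c(1)]
 let ?N = "\<phi> ` (U \<inter> f -` V) \<inter> \<phi> ` (U \<inter> h -` V')"
 have eq: "\<phi> ` (U \<inter> (%x. (f x, h x)) -` W) = ?N"
  unfolding W using inj_onD[OF a(4)[OF U]] by fastforce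
 have oN: "open_in E ?N"
  using charts_preimage_open[OF c(1) smooth_mapD(1)[OF f] chartsD(3)[OF c(2) V(1)] U]
   charts_preimage_open[OF c(1) smooth_mapD(1)[OF h] chartsD(3)[OF c(3) V(2)] U] by blast
 have "C_on k E ?N (%x. ((\<psi> o f o inv_into U \<phi>) x, (\<psi>' o h o inv_into U \<phi>) x))"
  by (rule C_on_Pair[OF a(1) oN C_on_subset[OF smooth_mapD(2)[OF f U V(1)]] C_on_subset[OF smooth_mapD(2)[OF h U V(2)]]]) auto
 moreover have "(%x. ((\<psi> o f o inv_into U \<phi>) x, (\<psi>' o h o inv_into U \<phi>) x)) = \<eta> o (%x. (f x, h x)) o inv_into U \<phi>"
  by (auto simp: W)
 ultimately show "C_on k E (\<phi> ` (U \<inter> (%x. (f x, h x)) -` W)) (\<eta> o (%x. (f x, h x)) o inv_into U \<phi>)"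
  unfolding eq by simp
qed

lemma smooth_map_const:
 assumes "charts T E A" "charts T' E' A'" "c \<in> topspace T'"
 shows "smooth_map T E A T' A' (%_. c)"
proof (rule smooth_mapI)
 show cm: "continuous_map T T' (%_. c)" using assms(3) by simp
 fix U \<phi> V \<psi> k assume "(U, \<phi>) \<in> A" "(V, \<psi>) \<in> A'"
 hence "open_in E (\<phi> ` (U \<inter> (%_. c) -` V))"
  by (intro charts_preimage_open[OF assms(1) cm] chartsD(3)[OF assms(2)])
 from C_on_const[OF chartsD(1)[OF assms(1)] this, of k "\<psi> c"]
 show "C_on k E (\<phi> ` (U \<inter> (%_. c) -` V)) (\<psi> o (%_. c) o inv_into U \<phi>)" by (simp add: o_def)
qed

lemma smooth_map_fst_snd:
 assumes c: "charts T E A" "charts T' E' A'"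
 shows "smooth_map (prod_topology T T') (E \<times> E') (prod_atlas A A') T A fst"
  and "smooth_map (prod_topology T T') (E \<times> E') (prod_atlas A A') T' A' snd"
 by (rule smooth_mapI[OF continuous_map_fst], use prod_chart_smooth(1)[OF c] in "auto simp: prod_atlas_def")
  (rule smooth_mapI[OF continuous_map_snd], use prod_chart_smooth(2)[OF c] in "auto simp: prod_atlas_def")

lemma hvd_cong:
 assumes "\<forall>\<^sub>F s in nhds t. f s = g s" "(f hvd D) (at t)"
 shows "(g hvd D) (at t)"
proof -
 have "f t = g t" using assms(1) by (rule eventually_nhds_x_imp_x)
 thus ?thesis
  using has_vector_derivative_cong_ev[of UNIV f g t D] assms by simp
qed

section \<open>Lie groups: velocities, the adjoint action and the bracket\<close>

locale lie =
 fixes G :: "('a, 'e::euclidean_space, 'm) lie_data_scheme" (structure)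
 assumes lie: "lie_group G"
begin

sublocale group G using lie by (simp add: lie_group_def)

abbreviation "L \<equiv> liealg G"
abbreviation "c1 \<equiv> chart1 G"
abbreviation "U1 \<equiv> fst (chart1 G)"
abbreviation "ph \<equiv> snd (chart1 G)"
abbreviation "TG \<equiv> gtop G"
abbreviation "AG \<equiv> atlas G"

lemma ch: "charts TG L AG"
 using lie smooth_manifold_charts unfolding lie_group_def by blast

lemma top_carrier: "topspace TG = carrier G" using lie by (simp add: lie_group_def)

lemma subL: "subspace L" by (rule chartsD(1)[OF ch])

lemma ch2: "charts (prod_topology TG TG) (L \<times> L) (prod_atlas AG AG)"
 by (rule charts_prod[OF ch ch])

lemma c1_in: "c1 \<in> AG" "one G \<in> U1" using lie by (auto simp: lie_group_def)

lemma chart_carrier: "c \<in> AG ==> fst c <= carrier G"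
 using chartsD(8)[OF ch, of "fst c" "snd c"] top_carrier by simp

lemma chart_inj: "c \<in> AG ==> inj_on (snd c) (fst c)"
 using chartsD(4)[OF ch, of "fst c" "snd c"] by simp

lemma chart_open: "c \<in> AG ==> open_in L (snd c ` fst c)"
 using chartsD(6)[OF ch, of "fst c" "snd c"] by simp

lemma chart_inv: "c \<in> AG ==> x \<in> fst c ==> inv_into (fst c) (snd c) (snd c x) = x"
 by (simp add: chart_inj)

lemma chart_L: "c \<in> AG ==> x \<in> fst c ==> snd c x \<in> L"
 using openin_imp_subset[OF chart_open] by blast

lemma chart_exists: "x \<in> carrier G ==> \<exists>c\<in>AG. x \<in> fst c"
 using chartsD(2)[OF ch, of x] top_carrier by force

text \<open>Group words in two variables. A word in one variable is treated as one that ignores its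
  second argument, so this single class, closed under products and inverses, is enough.\<close>

definition sm2 :: "('a \<times> 'a => 'a) => bool" where
 "sm2 f \<longleftrightarrow> smooth_map (prod_topology TG TG) (L \<times> L) (prod_atlas AG AG) TG AG f"

lemma sm2_fst: "sm2 fst" and sm2_snd: "sm2 snd"
 unfolding sm2_def by (rule smooth_map_fst_snd[OF ch ch])+

lemma sm2_const: "c \<in> carrier G ==> sm2 (%_. c)"
 unfolding sm2_def by (rule smooth_map_const[OF ch2 ch]) (simp add: top_carrier)

lemma sm2_mult: "sm2 f ==> sm2 g ==> sm2 (%z. f z \<otimes> g z)"
 unfolding sm2_def
 using smooth_map_compose[OF ch2 ch2 ch smooth_map_Pair[OF ch2 ch ch], of f g "%(x, y). x \<otimes> y"] lie
 by (simp add: lie_group_def)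

lemma sm2_inv: "sm2 f ==> sm2 (%z. inv (f z))"
 unfolding sm2_def using smooth_map_compose[OF ch2 ch ch, of f "%x. inv x"] lie
 by (simp add: lie_group_def)

lemmas sm2_intros = sm2_fst sm2_snd sm2_const sm2_mult sm2_inv

text \<open>X is the velocity of \<gamma> at time t as seen in the chart \<open>c\<close>.
  Membership in the chart is required only near t, so that merely locally meaningful curves such as
  \<open>curve1\<close> qualify.\<close>

definition vel :: "('a, 'e) chart => (real => 'a) => real => 'e => bool" where
 "vel c \<gamma> t X \<longleftrightarrow> \<gamma> t \<in> fst c & (\<forall>\<^sub>F s in nhds t. \<gamma> s \<in> fst c) & ((%s. snd c (\<gamma> s)) hvd X) (at t)"

lemma vel_in: "c \<in> AG ==> vel c \<gamma> t X ==> X \<in> L"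
proof -
 assume c: "c \<in> AG" "vel c \<gamma> t X"
 have "\<forall>\<^sub>F s in nhds t. snd c (\<gamma> s) \<in> L"
  using c(2) unfolding vel_def by (auto elim!: eventually_mono intro: chart_L[OF c(1)])
 thus "X \<in> L"
  using C_on_curve(1)[OF subL relopen_self C_on_linear[OF subL relopen_self linear_id]] c chart_L[OF c(1)]
  unfolding vel_def by blast
qed

lemma vel_unique: "vel c \<gamma> t X ==> vel c \<gamma> t Y ==> X = Y"
 unfolding vel_def using vector_derivative_unique_at by blast

lemma vel_cong: "vel c \<gamma> t X ==> \<forall>\<^sub>F s in nhds t. \<gamma> s = \<gamma>' s ==> vel c \<gamma>' t X"
proof -
 assume v: "vel c \<gamma> t X" and e: "\<forall>\<^sub>F s in nhds t. \<gamma> s = \<gamma>' s"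
 have t: "\<gamma> t = \<gamma>' t" using e by (rule eventually_nhds_x_imp_x)
 have "\<forall>\<^sub>F s in nhds t. \<gamma>' s \<in> fst c"
  using v e unfolding vel_def by (auto elim: eventually_elim2)
 moreover have "((%s. snd c (\<gamma>' s)) hvd X) (at t)"
  by (rule hvd_cong[where f = "%s. snd c (\<gamma> s)"]) (use v e in "auto simp: vel_def elim: eventually_mono")
 ultimately show ?thesis using v t by (simp add: vel_def)
qed

lemma vel_const: "x \<in> fst c ==> vel c (%_. x) t 0"
 by (auto simp: vel_def)

text \<open>The word \<open>f\<close> in coordinates: charts \<open>c\<close> and \<open>c'\<close>
  for the arguments, \<open>d\<close> for the value. Its domain is \<open>cdom\<close>.\<close>

definition cmap :: "('a \<times> 'a => 'a) => ('a, 'e) chart => ('a, 'e) chart => ('a, 'e) chart => 'e \<times> 'e => 'e" where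
 "cmap f c c' d = snd d o f o inv_into (fst c \<times> fst c') (map_prod (snd c) (snd c'))"

definition cdom :: "('a \<times> 'a => 'a) => ('a, 'e) chart => ('a, 'e) chart => ('a, 'e) chart => ('e \<times> 'e) set" where
 "cdom f c c' d = map_prod (snd c) (snd c') ` ((fst c \<times> fst c') \<inter> f -` fst d)"

lemma cmap_props:
 assumes f: "sm2 f" and c: "c \<in> AG" "c' \<in> AG" "d \<in> AG"
 shows "openin (top_of_set (L \<times> L)) (cdom f c c' d)" "C_on k (L \<times> L) (cdom f c c' d) (cmap f c c' d)"
  "x \<in> fst c ==> y \<in> fst c' ==> cmap f c c' d (snd c x, snd c' y) = snd d (f (x, y))"
  "x \<in> fst c ==> y \<in> fst c' ==> (snd c x, snd c' y) \<in> cdom f c c' d \<longleftrightarrow> f (x, y) \<in> fst d"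
proof -
 have p: "(fst c \<times> fst c', map_prod (snd c) (snd c')) \<in> prod_atlas AG AG"
  unfolding prod_atlas_def mem_Collect_eq by (intro exI conjI) (rule refl, use c in auto)
 have d: "(fst d, snd d) \<in> AG" using c by simp
 show "openin (top_of_set (L \<times> L)) (cdom f c c' d)" unfolding cdom_def
  by (rule charts_preimage_open[OF ch2 smooth_mapD(1)[OF f[unfolded sm2_def]] chartsD(3)[OF ch d] p])
 show "C_on k (L \<times> L) (cdom f c c' d) (cmap f c c' d)" unfolding cdom_def cmap_def
  by (rule smooth_mapD(2)[OF f[unfolded sm2_def] p d])
 note i = chart_inj[OF c(1)] chart_inj[OF c(2)]
 show "x \<in> fst c ==> y \<in> fst c' ==> cmap f c c' d (snd c x, snd c' y) = snd d (f (x, y))"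
  by (simp add: cmap_def inv_map_prod[OF i] i)
 show "x \<in> fst c ==> y \<in> fst c' ==> (snd c x, snd c' y) \<in> cdom f c c' d \<longleftrightarrow> f (x, y) \<in> fst d"
  using inj_onD[OF i(1)] inj_onD[OF i(2)] by (fastforce simp: cdom_def)
qed

text \<open>The velocity of a word depends on its argument curves only through their positions and
  velocities. Later proofs exploit this by replacing a given curve with one for which the word can
  be evaluated.\<close>

lemma word_vel:
 assumes f: "sm2 f" and c: "c \<in> AG" "c' \<in> AG" "d \<in> AG"
  and a: "vel c a t X" and b: "vel c' b t Y" and ab: "f (a t, b t) \<in> fst d"
 shows "vel d (%s. f (a s, b s)) t (dir_deriv (X, Y) (cmap f c c' d) (snd c (a t), snd c' (b t)))"
proof -
 note m = cmap_props[OF f c]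
 have sL: "subspace (L \<times> L)" by (rule chartsD(1)[OF ch2])
 have ain: "a t \<in> fst c" "b t \<in> fst c'" using a b by (auto simp: vel_def)
 have ev: "\<forall>\<^sub>F s in nhds t. a s \<in> fst c & b s \<in> fst c'" using a b by (auto simp: vel_def eventually_conj)
 let ?z = "%s. (snd c (a s), snd c' (b s))"
 have z': "(?z hvd (X, Y)) (at t)"
  using a b by (auto simp: vel_def intro: has_vector_derivative_Pair)
 have z0: "?z t \<in> cdom f c c' d" using m(4)[OF ain] ab by simp
 have zL: "\<forall>\<^sub>F s in nhds t. ?z s \<in> L \<times> L"
  using ev by eventually_elim (auto intro: chart_L c)
 have "\<forall>\<^sub>F s in nhds t. ?z s \<in> cdom f c c' d"
  by (rule relopen_curve[OF m(1) _ z0 zL]) (rule has_vector_derivative_continuous[OF z'])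
 with ev have 1: "\<forall>\<^sub>F s in nhds t. f (a s, b s) \<in> fst d"
  by eventually_elim (use m(4) in blast)
 have "((%s. cmap f c c' d (?z s)) hvd dir_deriv (X, Y) (cmap f c c' d) (?z t)) (at t)"
  by (rule C_on_curve(2)[OF sL m(1) m(2)[of "Suc 0"] z' z0 zL])
 moreover have "\<forall>\<^sub>F s in nhds t. cmap f c c' d (?z s) = snd d (f (a s, b s))"
  using ev by eventually_elim (use m(3) in blast)
 ultimately have "((%s. snd d (f (a s, b s))) hvd dir_deriv (X, Y) (cmap f c c' d) (?z t)) (at t)"
  by (rule hvd_cong[rotated])
 thus ?thesis using 1 ab by (simp add: vel_def)
qed

abbreviation "e1 \<equiv> ph (one G)"

lemma curve1_ph: "e1 + t *R X \<in> ph ` U1 ==> ph (curve1 G X t) = e1 + t *R X & curve1 G X t \<in> U1"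
 unfolding curve1_def by (simp add: f_inv_into_f inv_into_into)

lemma e1_in: "e1 \<in> ph ` U1" "e1 \<in> L" using c1_in chart_L by auto

lemma curve1_ev: "X \<in> L ==> \<forall>\<^sub>F t in nhds 0. e1 + t *R X \<in> ph ` U1"
 by (rule relopen_line[OF subL chart_open[OF c1_in(1)] e1_in(1)])

lemma curve1_0: "curve1 G X 0 = \<one>"
 by (simp add: curve1_def chart_inv c1_in)

lemma curve1_vel:
 assumes "X \<in> L" shows "vel c1 (curve1 G X) 0 X"
proof -
 have ev: "\<forall>\<^sub>F t in nhds 0. ph (curve1 G X t) = e1 + t *R X & curve1 G X t \<in> U1"
  using curve1_ev[OF assms] by eventually_elim (rule curve1_ph)
 have "((%s. ph (curve1 G X s)) hvd X) (at 0)"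
  by (rule hvd_cong[where f = "%t. e1 + t *R X"]) (use ev in "auto elim: eventually_mono intro!: derivative_eq_intros")
 thus ?thesis using ev by (auto simp: vel_def curve1_0 c1_in elim: eventually_mono)
qed

lemma vel_carrier_ev: "c \<in> AG ==> vel c a t X ==> \<forall>\<^sub>F s in nhds t. a s \<in> carrier G"
 unfolding vel_def using chart_carrier[of c] by (blast intro: eventually_mono)

text \<open>\<open>Ad\<close> is defined with the special curve \<open>curve1\<close>; by
  \<open>word_vel\<close> any curve with the same velocity computes it.\<close>

lemma Ad_vel:
 assumes g: "g \<in> carrier G" and a: "vel c1 a 0 X" "a 0 = \<one>"
 shows "vel c1 (%s. g \<otimes> a s \<otimes> inv g) 0 (Ad G g X)"
proof -
 let ?f = "%z. g \<otimes> fst z \<otimes> inv g"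
 have f: "sm2 ?f" by (intro sm2_intros) (use g in auto)
 have "vel c1 (%s. ?f (b s, \<one>)) 0 (dir_deriv (X, 0) (cmap ?f c1 c1 c1) (e1, e1))" if "vel c1 b 0 X" "b 0 = \<one>" for b
  using word_vel[OF f c1_in(1) c1_in(1) c1_in(1) that(1) vel_const[OF c1_in(2), of 0]] that(2) g c1_in by simp
 note w = this[OF a] this[OF curve1_vel[OF vel_in[OF c1_in(1) a(1)]] curve1_0]
 hence "Ad G g X = dir_deriv (X, 0) (cmap ?f c1 c1 c1) (e1, e1)"
  unfolding Ad_def vel_def by (simp add: vector_derivative_at)
 thus ?thesis using w(1) by simp
qed

lemma Ad_eqI:
 assumes "g \<in> carrier G" "vel c1 a 0 X" "a 0 = \<one>" "vel c1 (%s. g \<otimes> a s \<otimes> inv g) 0 Y"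
 shows "Ad G g X = Y"
 using Ad_vel[OF assms(1-3)] assms(4) vel_unique by blast

lemma Ad_in: "g \<in> carrier G ==> X \<in> L ==> Ad G g X \<in> L"
 using Ad_vel[OF _ curve1_vel curve1_0] vel_in[OF c1_in(1)] by blast

lemma Ad_lin:
 assumes g: "g \<in> carrier G" shows "lin_on L (Ad G g)"
proof -
 let ?f = "%z. g \<otimes> fst z \<otimes> inv g"
 have f: "sm2 ?f" by (intro sm2_intros) (use g in auto)
 note m = cmap_props[OF f c1_in(1) c1_in(1) c1_in(1)]
 have z: "(e1, e1) \<in> cdom ?f c1 c1 c1" using m(4)[OF c1_in(2) c1_in(2)] g c1_in by simp
 have sL: "subspace (L \<times> L)" by (rule chartsD(1)[OF ch2])
 have A: "Ad G g X = dir_deriv (X, 0) (cmap ?f c1 c1 c1) (e1, e1)" if "X \<in> L" for X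
  by (rule Ad_eqI[OF g curve1_vel[OF that] curve1_0])
   (use word_vel[OF f c1_in(1) c1_in(1) c1_in(1) curve1_vel[OF that] vel_const[OF c1_in(2), of 0]] g c1_in curve1_0 in simp)
 have 0: "0 \<in> L" using subspace_0[OF subL] .
 show ?thesis
 proof (rule lin_onI)
  fix X Y assume "X \<in> L" "Y \<in> L"
  thus "Ad G g (X + Y) = Ad G g X + Ad G g Y"
   using dir_deriv_linear(1)[OF sL m(1) m(2)[of "Suc 0"] z, of "(X, 0)" "(Y, 0)"] 0 subspace_add[OF subL]
   by (simp add: A)
 next
  fix r X assume "X \<in> L"
  thus "Ad G g (r *R X) = r *R Ad G g X"
   using dir_deriv_linear(2)[OF sL m(1) m(2)[of "Suc 0"] z, of "(X, 0)" "(X, 0)" r] 0 subspace_scale[OF subL]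
   by (simp add: A)
 qed
qed

lemma Ad_mult:
 assumes g: "g \<in> carrier G" "h \<in> carrier G" and X: "X \<in> L"
 shows "Ad G (g \<otimes> h) X = Ad G g (Ad G h X)"
proof (rule Ad_eqI[OF _ curve1_vel[OF X] curve1_0])
 have "vel c1 (%s. g \<otimes> (h \<otimes> curve1 G X s \<otimes> inv h) \<otimes> inv g) 0 (Ad G g (Ad G h X))"
  by (rule Ad_vel[OF g(1) Ad_vel[OF g(2) curve1_vel[OF X] curve1_0]]) (use g in "simp add: curve1_0")
 thus "vel c1 (%s. g \<otimes> h \<otimes> curve1 G X s \<otimes> inv (g \<otimes> h)) 0 (Ad G g (Ad G h X))"
 proof (rule vel_cong)
  show "\<forall>\<^sub>F s in nhds 0. g \<otimes> (h \<otimes> curve1 G X s \<otimes> inv h) \<otimes> inv g = g \<otimes> h \<otimes> curve1 G X s \<otimes> inv (g \<otimes> h)"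
   using vel_carrier_ev[OF c1_in(1) curve1_vel[OF X]]
   by eventually_elim (use g in "simp add: m_assoc inv_mult_group")
 qed
qed (use g in auto)

lemma Ad_one: "X \<in> L ==> Ad G \<one> X = X"
proof (rule Ad_eqI[OF one_closed curve1_vel curve1_0])
 assume X: "X \<in> L"
 show "vel c1 (%s. \<one> \<otimes> curve1 G X s \<otimes> inv \<one>) 0 X"
  by (rule vel_cong[OF curve1_vel[OF X]])
   (use vel_carrier_ev[OF c1_in(1) curve1_vel[OF X]] in "eventually_elim, simp")
qed auto

lemma Ad_inv:
 assumes "g \<in> carrier G" "X \<in> L"
 shows "Ad G (inv g) (Ad G g X) = X" "Ad G g (Ad G (inv g) X) = X"
 using Ad_mult[of "inv g" g X] Ad_mult[of g "inv g" X] assms Ad_one by auto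

abbreviation "conjw \<equiv> %z. fst z \<otimes> snd z \<otimes> inv (fst z)"

lemma conjw_sm: "sm2 conjw" by (intro sm2_intros)

text \<open>As a partial derivative of the conjugation word, \<open>Ad\<close> is seen to depend
  smoothly on the group element.\<close>

lemma Ad_cmap:
 assumes c: "c \<in> AG" and x: "x \<in> fst c" and Y: "Y \<in> L"
 shows "Ad G x Y = dir_deriv (0, Y) (cmap conjw c c1 c1) (snd c x, e1)" "(snd c x, e1) \<in> cdom conjw c c1 c1"
proof -
 note m = cmap_props[OF conjw_sm c c1_in(1) c1_in(1)]
 have xc: "x \<in> carrier G" using x chart_carrier[OF c] by blast
 show "(snd c x, e1) \<in> cdom conjw c c1 c1" using m(4)[OF x c1_in(2)] xc c1_in by simp
 have "\<forall>\<^sub>F t in nhds 0. t \<in> UNIV --> ph (x \<otimes> curve1 G Y t \<otimes> inv x) = cmap conjw c c1 c1 ((snd c x, e1) + t *R (0, Y))"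
  using curve1_ev[OF Y]
 proof eventually_elim
  case (elim t)
  note c = curve1_ph[OF elim]
  thus ?case using m(3)[OF x, of "curve1 G Y t"] by simp
 qed
 thus "Ad G x Y = dir_deriv (0, Y) (cmap conjw c c1 c1) (snd c x, e1)"
  unfolding Ad_def dir_deriv_def by (rule vector_derivative_cong_eq) auto
qed

text \<open>The bracket is a mixed second derivative of conjugation at the identity. Linearity in X
  and independence of the chosen curve can be read off from this form.\<close>

lemma bracket_cmap:
 assumes a: "vel c1 a 0 X" "a 0 = \<one>" and Y: "Y \<in> L"
 shows "((%s. Ad G (a s) Y) hvd dir_deriv (X, 0) (dir_deriv (0, Y) (cmap conjw c1 c1 c1)) (e1, e1)) (at 0)"
proof -
 note m = cmap_props[OF conjw_sm c1_in(1) c1_in(1) c1_in(1)]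
 have sL: "subspace (L \<times> L)" by (rule chartsD(1)[OF ch2])
 have Y0: "(0, Y) \<in> L \<times> L" using Y subspace_0[OF subL] by simp
 let ?z = "%s. (ph (a s), e1)"
 have ev: "\<forall>\<^sub>F s in nhds 0. a s \<in> U1" using a by (simp add: vel_def)
 have "((%s. dir_deriv (0, Y) (cmap conjw c1 c1 c1) (?z s)) hvd
   dir_deriv (X, 0) (dir_deriv (0, Y) (cmap conjw c1 c1 c1)) (?z 0)) (at 0)"
 proof (rule C_on_curve(2)[OF sL m(1) C_on_dir_deriv[OF m(2)[of "Suc (Suc 0)"] Y0]])
  show "(?z hvd (X, 0)) (at 0)"
   using a by (auto simp: vel_def intro!: has_vector_derivative_Pair)
  show "?z 0 \<in> cdom conjw c1 c1 c1" using Ad_cmap(2)[OF c1_in(1) _ Y] a c1_in by simp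
  show "\<forall>\<^sub>F t in nhds 0. ?z t \<in> L \<times> L" using ev by eventually_elim (use chart_L[OF c1_in(1)] e1_in in auto)
 qed
 moreover have "\<forall>\<^sub>F s in nhds 0. dir_deriv (0, Y) (cmap conjw c1 c1 c1) (?z s) = Ad G (a s) Y"
  using ev by eventually_elim (use Ad_cmap(1)[OF c1_in(1) _ Y] in simp)
 ultimately show ?thesis using hvd_cong a(2) by force
qed

lemma bracket_eq:
 assumes "X \<in> L" "Y \<in> L"
 shows "bracket G X Y = dir_deriv (X, 0) (dir_deriv (0, Y) (cmap conjw c1 c1 c1)) (e1, e1)"
 unfolding bracket_def by (rule vector_derivative_at[OF bracket_cmap[OF curve1_vel[OF assms(1)] curve1_0 assms(2)]])

lemma bracket_vel:
 assumes "vel c1 a 0 X" "a 0 = \<one>" "Y \<in> L"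
 shows "((%s. Ad G (a s) Y) hvd bracket G X Y) (at 0)"
 using bracket_cmap[OF assms] bracket_eq[OF vel_in[OF c1_in(1) assms(1)] assms(3)] by simp

lemma bracket_in: assumes "X \<in> L" "Y \<in> L" shows "bracket G X Y \<in> L"
proof -
 have "\<forall>\<^sub>F s in nhds 0. Ad G (curve1 G X s) Y \<in> L"
  using vel_carrier_ev[OF c1_in(1) curve1_vel[OF assms(1)]] by eventually_elim (rule Ad_in[OF _ assms(2)])
 thus ?thesis
  using C_on_curve(1)[OF subL relopen_self C_on_linear[OF subL relopen_self linear_id] bracket_vel[OF curve1_vel[OF assms(1)] curve1_0 assms(2)]]
   Ad_in[OF _ assms(2)] curve1_0 by simp
qed

lemma bracket_lin1: assumes "Y \<in> L" shows "lin_on L (%X. bracket G X Y)"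
proof -
 note m = cmap_props[OF conjw_sm c1_in(1) c1_in(1) c1_in(1)]
 have sL: "subspace (L \<times> L)" by (rule chartsD(1)[OF ch2])
 have 0: "0 \<in> L" using subspace_0[OF subL] .
 have Y0: "(0, Y) \<in> L \<times> L" using assms 0 by simp
 note d = C_on_dir_deriv[OF m(2)[of "Suc (Suc 0)"] Y0]
 note z = Ad_cmap(2)[OF c1_in assms]
 show ?thesis
 proof (rule lin_onI)
  fix X Z assume "X \<in> L" "Z \<in> L"
  thus "bracket G (X + Z) Y = bracket G X Y + bracket G Z Y"
   using dir_deriv_linear(1)[OF sL m(1) d z, of "(X, 0)" "(Z, 0)"] 0 subspace_add[OF subL] assms
   by (simp add: bracket_eq)
 next
  fix r X assume "X \<in> L"
  thus "bracket G (r *R X) Y = r *R bracket G X Y"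
   using dir_deriv_linear(2)[OF sL m(1) d z, of "(X, 0)" "(X, 0)" r] 0 subspace_scale[OF subL] assms
   by (simp add: bracket_eq)
 qed
qed

lemma bracket_lin2: assumes "X \<in> L" shows "lin_on L (bracket G X)"
proof (rule lin_onI'[OF subL])
 note bv = bracket_vel[OF curve1_vel[OF assms] curve1_0]
 fix Y Z r assume YZ: "Y \<in> L" "Z \<in> L"
 have rZ: "r *R Z \<in> L" "Y + r *R Z \<in> L" using YZ subL by (auto intro: subspace_add subspace_scale)
 have "((%s. Ad G (curve1 G X s) Y + r *R Ad G (curve1 G X s) Z) hvd bracket G X Y + r *R bracket G X Z) (at 0)"
  by (intro has_vector_derivative_add bounded_linear.has_vector_derivative[OF bounded_linear_scaleR_right] bv YZ)
 moreover have "\<forall>\<^sub>F s in nhds 0. Ad G (curve1 G X s) Y + r *R Ad G (curve1 G X s) Z = Ad G (curve1 G X s) (Y + r *R Z)"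
  using vel_carrier_ev[OF c1_in(1) curve1_vel[OF assms]]
  by eventually_elim (use lin_on_add[OF Ad_lin] lin_on_scale[OF Ad_lin] YZ rZ in simp)
 ultimately have "((%s. Ad G (curve1 G X s) (Y + r *R Z)) hvd bracket G X Y + r *R bracket G X Z) (at 0)"
  by (rule hvd_cong[rotated])
 thus "bracket G X (Y + r *R Z) = bracket G X Y + r *R bracket G X Z"
  using bv[OF rZ(2)] vector_derivative_unique_at by blast
qed

lemma Ad_bracket:
 assumes "g \<in> carrier G" "X \<in> L" "Y \<in> L"
 shows "Ad G g (bracket G X Y) = bracket G (Ad G g X) (Ad G g Y)"
proof -
 obtain T where T: "linear T" "!!x. x \<in> L ==> T x = Ad G g x" by (rule lin_on_extend[OF Ad_lin[OF assms(1)] subL], rule that)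
 note cv = curve1_vel[OF assms(2)]
 have "((%s. T (Ad G (curve1 G X s) Y)) hvd T (bracket G X Y)) (at 0)"
  by (rule bounded_linear.has_vector_derivative[OF _ bracket_vel[OF cv curve1_0 assms(3)]])
   (use T(1) in "simp add: linear_conv_bounded_linear")
 moreover have "\<forall>\<^sub>F s in nhds 0. T (Ad G (curve1 G X s) Y) = Ad G (g \<otimes> curve1 G X s \<otimes> inv g) (Ad G g Y)"
  using vel_carrier_ev[OF c1_in(1) cv]
 proof eventually_elim
  case (elim s)
  show ?case using elim assms by (simp add: T(2) Ad_in Ad_mult Ad_inv)
 qed
 ultimately have "((%s. Ad G (g \<otimes> curve1 G X s \<otimes> inv g) (Ad G g Y)) hvd T (bracket G X Y)) (at 0)"
  by (rule hvd_cong[rotated])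
 moreover have "((%s. Ad G (g \<otimes> curve1 G X s \<otimes> inv g) (Ad G g Y)) hvd bracket G (Ad G g X) (Ad G g Y)) (at 0)"
  by (rule bracket_vel[OF Ad_vel[OF assms(1) cv curve1_0]]) (use assms in "auto simp: curve1_0 Ad_in")
 ultimately show ?thesis using vector_derivative_unique_at T(2) bracket_in[OF assms(2,3)] by metis
qed

text \<open>At time t the curve follows the left invariant vector field of X, expressed by
  translating it back to the identity.\<close>

definition LI :: "'e => (real => 'a) => real => bool" where
 "LI X c t \<longleftrightarrow> vel c1 (%s. inv (c t) \<otimes> c (t + s)) 0 X"

lemma eventually_shift: "(\<forall>\<^sub>F s in nhds (0::real). P (t + s)) \<longleftrightarrow> (\<forall>\<^sub>F s in nhds t. P s)"
 unfolding eventually_nhds_metric by (auto simp: dist_real_def) (metis add_diff_cancel_left' add.commute diff_add_cancel)+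

lemma hvd_shift: "((%s. f (t + s)) hvd D) (at 0) \<longleftrightarrow> (f hvd D) (at (t::real))"
proof
 assume "((%s. f (t + s)) hvd D) (at 0)"
 moreover have "((%s. s - t) hvd 1) (at t)" by (auto intro!: derivative_eq_intros)
 ultimately show "(f hvd D) (at t)"
  using vector_diff_chain_at[of "%s. s - t" 1 t "%s. f (t + s)" D] by (simp add: o_def)
next
 assume "(f hvd D) (at t)"
 moreover have "((%s. t + s) hvd 1) (at 0)" by (auto intro!: derivative_eq_intros)
 ultimately show "((%s. f (t + s)) hvd D) (at 0)"
  using vector_diff_chain_at[of "%s. t + s" 1 0 f D] by (simp add: o_def)
qed

text \<open>The quotient q of the two curves has velocity zero in every chart around its value, so
  it is locally constant, hence constant on the connected set I.\<close>

lemma LI_unique: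
 assumes I: "open I" "connected I" "t0 \<in> I"
  and c: "!!t. c t \<in> carrier G" "!!t. d t \<in> carrier G" "!!t. t \<in> I ==> LI X c t" "!!t. t \<in> I ==> LI X d t"
  and eq: "c t0 = d t0" and t: "t \<in> I"
 shows "c t = d t"
proof -
 define q where "q t = c t \<otimes> inv (d t)" for t
 have qc: "q t \<in> carrier G" for t using c by (simp add: q_def)
 have der: "vel k (%s. q (t + s)) 0 0" if t: "t \<in> I" and k: "k \<in> AG" "q t \<in> fst k" for t k
 proof -
  let ?f = "%z. c t \<otimes> fst z \<otimes> inv (snd z) \<otimes> inv (d t)"
  have f: "sm2 ?f" by (intro sm2_intros) (use c in auto)
  let ?a = "%s. inv (c t) \<otimes> c (t + s)" and ?b = "%s. inv (d t) \<otimes> d (t + s)"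
  have ab: "vel c1 ?a 0 X" "vel c1 ?b 0 X" using c t by (auto simp: LI_def)
  have X: "X \<in> L" by (rule vel_in[OF c1_in(1) ab(1)])
  have q0: "?f (\<one>, \<one>) = q t" using c by (simp add: q_def m_assoc)
  have "vel k (%s. ?f (a s, b s)) 0 (dir_deriv (X, X) (cmap ?f c1 c1 k) (e1, e1))"
   if "vel c1 a 0 X" "a 0 = \<one>" "vel c1 b 0 X" "b 0 = \<one>" for a b
   using word_vel[OF f c1_in(1) c1_in(1) k(1) that(1,3)] that q0 k by simp
  note w = this[OF ab(1) _ ab(2)] this[OF curve1_vel[OF X] curve1_0 curve1_vel[OF X] curve1_0]
  \<comment> \<open>With the same curve in both arguments the word is constant. As both arguments of
    the actual word have velocity X, \<open>word_vel\<close> transfers the velocity zero to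
    it.\<close>
  have "vel k (%s. ?f (curve1 G X s, curve1 G X s)) 0 0"
  proof (rule vel_cong[OF vel_const[OF k(2), of 0]])
   show "\<forall>\<^sub>F s in nhds 0. q t = ?f (curve1 G X s, curve1 G X s)"
    using vel_carrier_ev[OF c1_in(1) curve1_vel[OF X]]
    by eventually_elim (use c in "simp add: q_def m_assoc")
  qed
  hence "dir_deriv (X, X) (cmap ?f c1 c1 k) (e1, e1) = 0" using w(2) vel_unique by blast
  moreover have "?f (?a s, ?b s) = q (t + s)" for s
   using c by (simp add: q_def m_assoc inv_mult_group) (simp add: m_assoc[symmetric])
  ultimately show ?thesis using w(1) c by simp
 qed
 have "q constant_on I"
 proof (rule locally_constant_imp_constant[OF I(2)])
  fix t assume t: "t \<in> I"
  obtain k where k: "k \<in> AG" "q t \<in> fst k" using chart_exists[OF qc] by blast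
  have "\<forall>\<^sub>F s in nhds t. q s \<in> fst k" using der[OF t k] eventually_shift[of "%s. q s \<in> fst k" t] by (simp add: vel_def)
  moreover have "\<forall>\<^sub>F s in nhds t. s \<in> I" using I(1) t by (rule eventually_nhds_in_open)
  ultimately have "\<forall>\<^sub>F s in nhds t. s \<in> I & q s \<in> fst k" by eventually_elim simp
  then obtain \<epsilon> where e: "\<epsilon> > 0" "!!s. dist s t < \<epsilon> ==> s \<in> I & q s \<in> fst k"
   unfolding eventually_nhds_metric by blast
  have cst: "snd k (q s) = snd k (q t)" if s: "s \<in> ball t \<epsilon>" for s
  proof -
   have hv: "((%s. snd k (q s)) hvd 0) (at s within ball t \<epsilon>)" if "s \<in> ball t \<epsilon>" for s
   proof (rule has_vector_derivative_at_within)
    have s: "s \<in> I" "q s \<in> fst k" using e(2)[of s] that by (auto simp: dist_commute)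
    show "((%s. snd k (q s)) hvd 0) (at s)"
     using der[OF s(1) k(1) s(2)] hvd_shift[of "%s. snd k (q s)" s 0] by (simp add: vel_def)
   qed
   obtain C where "!!s. s \<in> ball t \<epsilon> ==> snd k (q s) = C"
    by (rule has_vector_derivative_zero_constant[OF convex_ball hv]) (assumption | rule that)+
   thus ?thesis using s e(1) by simp
  qed
  have cq: "\<forall>s\<in>ball t \<epsilon>. q s = q t"
  proof
   fix s assume s: "s \<in> ball t \<epsilon>"
   show "q s = q t"
    by (rule inj_onD[OF chart_inj[OF k(1)] cst[OF s]]) (use s e(2) k(2) in "auto simp: dist_commute")
  qed
  have sub: "ball t \<epsilon> <= I"
  proof
   fix s assume "s \<in> ball t \<epsilon>"
   hence "dist s t < \<epsilon>" by (simp add: dist_commute)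
   thus "s \<in> I" using e(2) by blast
  qed
  show "\<exists>T. open_in I T & t \<in> T & (\<forall>x\<in>T. q x = q t)"
  proof (intro exI conjI)
   show "open_in I (ball t \<epsilon>)" by (rule open_subset[OF sub open_ball])
   show "t \<in> ball t \<epsilon>" using e(1) by simp
  qed (rule cq)
 qed
 hence "q t = q t0" using I(3) t unfolding constant_on_def by metis
 also have "q t0 = \<one>" using eq c by (simp add: q_def)
 finally show ?thesis using c inv_equality[of "c t" "inv (d t)"] by (simp add: q_def)
qed

lemma ops_props:
 assumes "one_param_subgroup G X \<gamma>"
 shows "\<gamma> t \<in> carrier G" "\<gamma> (s + t) = \<gamma> s \<otimes> \<gamma> t" "\<gamma> 0 = \<one>" "vel c1 \<gamma> 0 X" "X \<in> L" "LI X \<gamma> t" "\<gamma> (- t) = inv (\<gamma> t)"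
  "continuous_map euclidean TG \<gamma>"
proof -
 note a = assms[unfolded one_param_subgroup_def]
 show cm: "continuous_map euclidean TG \<gamma>" using a smooth_mapD(1) by blast
 thus car: "\<gamma> t \<in> carrier G" for t by (auto simp: continuous_map_def top_carrier)
 show hom: "\<gamma> (s + t) = \<gamma> s \<otimes> \<gamma> t" for s t using a by blast
 have "\<gamma> 0 = \<gamma> 0 \<otimes> \<gamma> 0" using hom[of 0 0] by simp
 thus zero: "\<gamma> 0 = \<one>" using car by (metis l_cancel_one)
 have "openin euclidean {t \<in> topspace euclidean. \<gamma> t \<in> U1}"
  by (rule openin_continuous_map_preimage[OF cm chartsD(3)[OF ch, of U1 ph]]) (use c1_in in simp)
 hence "open {t. \<gamma> t \<in> U1}" by simp
 from eventually_nhds_in_open[OF this, of 0] have "\<forall>\<^sub>F t in nhds 0. \<gamma> t \<in> U1" using zero c1_in by simp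
 thus v: "vel c1 \<gamma> 0 X" using a zero c1_in by (simp add: vel_def)
 thus "X \<in> L" by (rule vel_in[OF c1_in(1)])
 have "inv (\<gamma> t) \<otimes> \<gamma> (t + s) = \<gamma> s" for s t using car by (simp add: hom m_assoc[symmetric])
 thus "LI X \<gamma> t" using v by (simp add: LI_def)
 have "\<gamma> (- t) \<otimes> \<gamma> t = \<one>" using hom[of "- t" t] zero by simp
 thus "\<gamma> (- t) = inv (\<gamma> t)" using car inv_equality by metis
qed

lemma ops_unique:
 assumes "one_param_subgroup G X \<gamma>" "one_param_subgroup G X \<gamma>'" shows "\<gamma> = \<gamma>'"
proof
 fix t
 show "\<gamma> t = \<gamma>' t"
  by (rule LI_unique[of UNIV 0 \<gamma> \<gamma>' X]) (use ops_props[OF assms(1)] ops_props[OF assms(2)] in auto)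
qed

lemma Ad_ops_deriv:
 assumes "one_param_subgroup G X \<gamma>" "Y \<in> L"
 shows "((%t. Ad G (\<gamma> t) Y) hvd bracket G X (Ad G (\<gamma> t) Y)) (at t)"
proof -
 note o = ops_props[OF assms(1)]
 have "((%s. Ad G (\<gamma> s) (Ad G (\<gamma> t) Y)) hvd bracket G X (Ad G (\<gamma> t) Y)) (at 0)"
  by (rule bracket_vel[OF o(4,3) Ad_in[OF o(1) assms(2)]])
 moreover have "Ad G (\<gamma> s) (Ad G (\<gamma> t) Y) = Ad G (\<gamma> (t + s)) Y" for s
  using Ad_mult[OF o(1) o(1) assms(2), of s t] by (simp add: o(2)[symmetric] add.commute)
 ultimately show ?thesis using hvd_shift[of "%t. Ad G (\<gamma> t) Y" t] by simp
qed

end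

section \<open>One-parameter subgroups\<close>

context lie
begin

abbreviation "multw \<equiv> %z. fst z \<otimes> snd z"

lemma multw_sm: "sm2 multw" by (intro sm2_intros)

text \<open>The left invariant vector field of X in the chart around the identity.\<close>

definition lfield :: "'e => 'e => 'e" where
 "lfield X x = dir_deriv (0, X) (cmap multw c1 c1 c1) (x, e1)"

lemma lfield_vel:
 assumes "X \<in> L" "g \<in> U1"
 shows "vel c1 (%s. g \<otimes> curve1 G X s) 0 (lfield X (ph g))"
proof -
 have g: "g \<in> carrier G" using assms(2) chart_carrier[OF c1_in(1)] by blast
 show ?thesis
  using word_vel[OF multw_sm c1_in(1) c1_in(1) c1_in(1) vel_const[OF assms(2), of 0] curve1_vel[OF assms(1)]] g assms(2)
  by (simp add: curve1_0 lfield_def)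
qed

lemma lfield_in: "X \<in> L ==> x \<in> ph ` U1 ==> lfield X x \<in> L"
 using lfield_vel vel_in[OF c1_in(1)] by blast

lemma C_on_id_pair:
 assumes "open_in L N" "v \<in> L"
 shows "C_on k L N (%x. (x, v))"
 using C_on_Pair[OF subL assms(1) C_on_linear[OF subL assms(1) linear_id] C_on_const[OF subL assms(1)]] by (simp add: id_def)

lemma lfield_smooth:
 assumes "X \<in> L" shows "C_on k L (ph ` U1) (lfield X)"
proof -
 note m = cmap_props[OF multw_sm c1_in(1) c1_in(1) c1_in(1)]
 have sL: "subspace (L \<times> L)" by (rule chartsD(1)[OF ch2])
 have X0: "(0, X) \<in> L \<times> L" using assms subspace_0[OF subL] by simp
 have N: "open_in L (ph ` U1)" by (rule chart_open[OF c1_in(1)])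
 have "(%x. (x, e1)) ` (ph ` U1) <= cdom multw c1 c1 c1"
  using m(4)[OF _ c1_in(2)] chart_carrier[OF c1_in(1)] by auto
 from C_on_compose[OF subL N sL m(1) C_on_id_pair[OF N e1_in(2)] C_on_dir_deriv[OF m(2)[of "Suc k"] X0] this]
 show ?thesis by (simp add: lfield_def[abs_def])
qed

text \<open>An integral curve of \<open>lfield X\<close>, from \<open>picard_local\<close>. The
  value one outside the interval only makes the curve a total function into the group.\<close>

lemma local_ops:
 assumes X: "X \<in> L"
 obtains \<epsilon> u where "\<epsilon> > 0" "u 0 = e1" "!!t. \<bar>t\<bar> < \<epsilon> ==> u t \<in> ph ` U1"
  "!!t k. C_on k UNIV {-\<epsilon><..<\<epsilon>} u" "!!t. \<bar>t\<bar> < \<epsilon> ==> LI X (%t. if \<bar>t\<bar> < \<epsilon> then inv_into U1 ph (u t) else \<one>) t"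
  "(u hvd X) (at 0)"
proof -
 have N: "open_in L (ph ` U1)" by (rule chart_open[OF c1_in(1)])
 obtain \<epsilon> u where u: "\<epsilon> > 0" "u 0 = e1" "!!t. \<bar>t\<bar> < \<epsilon> ==> u t \<in> ph ` U1"
  "!!t. \<bar>t\<bar> < \<epsilon> ==> (u hvd lfield X (u t)) (at t)"
  by (rule picard_local[OF subL N lfield_smooth[OF X] lfield_in[OF X] e1_in(1)]) (assumption | rule that)+
 let ?I = "{-\<epsilon><..<\<epsilon>}"
 have oI: "open_in UNIV ?I" by simp
 have Ieq: "t \<in> ?I \<longleftrightarrow> \<bar>t\<bar> < \<epsilon>" for t by auto
 \<comment> \<open>Bootstrapping: the derivative is \<open>lfield X\<close> along u, hence as smooth
   as u itself, and each order gives the next.\<close>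
 have sm: "C_on k UNIV ?I u" for k
 proof (induction k)
  case 0
  have "continuous (at t within ?I) u" if "t \<in> ?I" for t
   using u(4) that Ieq has_vector_derivative_continuous continuous_at_imp_continuous_at_within by blast
  thus ?case by (simp add: continuous_on_eq_continuous_within)
 next
  case (Suc k)
  show ?case
  proof (rule C_on_SucI[OF subspace_UNIV oI C_on_cont[OF Suc], where f' = "%h x. h *R lfield X (u x)"])
   fix h x :: real assume x: "x \<in> ?I"
   have "((%t. x + t *R h) hvd h) (at 0)" by (auto intro!: derivative_eq_intros)
   thus "((%t. u (x + t *R h)) hvd h *R lfield X (u x)) (at 0)"
    using vector_diff_chain_at[of "%t. x + t *R h" h 0 u "lfield X (u x)"] u(4)[of x] x by (auto simp: o_def)
  next
   fix h :: real
   show "C_on k UNIV ?I (%x. h *R lfield X (u x))"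
    by (rule C_on_bounded_linear[OF subspace_UNIV oI bounded_linear_scaleR_right
       C_on_compose[OF subspace_UNIV oI subL N Suc lfield_smooth[OF X]]])
     (use u(3) in auto)
  qed
 qed
 let ?c = "%t. if \<bar>t\<bar> < \<epsilon> then inv_into U1 ph (u t) else \<one>"
 have cU: "?c t \<in> U1" for t using u(3)[of t] c1_in by (simp add: inv_into_into)
 have phc: "ph (?c t) = u t" if "\<bar>t\<bar> < \<epsilon>" for t using u(3)[OF that] that by (simp add: f_inv_into_f)
 have LI: "LI X ?c t" if t: "\<bar>t\<bar> < \<epsilon>" for t
 proof -
  define g where "g = ?c t"
  have gU: "g \<in> U1" using cU unfolding g_def .
  have gc: "g \<in> carrier G" using gU chart_carrier[OF c1_in(1)] by blast
  have v1: "vel c1 (%s. ?c (t + s)) 0 (lfield X (ph g))"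
   unfolding vel_def
  proof (intro conjI)
   have "((%s. ph (?c s)) hvd lfield X (u t)) (at t)"
   proof (rule hvd_cong[OF _ u(4)[OF t]])
    have "\<forall>\<^sub>F s in nhds t. s \<in> ?I" by (rule eventually_nhds_in_open) (use t in auto)
    thus "\<forall>\<^sub>F s in nhds t. u s = ph (?c s)" by eventually_elim (use phc Ieq in auto)
   qed
   thus "((%s. ph (?c (t + s))) hvd lfield X (ph g)) (at 0)"
    using hvd_shift[of "%s. ph (?c s)" t] phc[OF t] by (simp add: g_def)
   show "?c (t + 0) \<in> U1" by (rule cU)
   show "\<forall>\<^sub>F s in nhds 0. ?c (t + s) \<in> U1" by (rule always_eventually) (rule allI, rule cU)
  qed
  let ?f = "%z. inv g \<otimes> fst z"
  have f: "sm2 ?f" by (intro sm2_intros) (use gc in auto)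
  have *: "vel c1 (%s. inv g \<otimes> a s) 0 (dir_deriv (lfield X (ph g), 0) (cmap ?f c1 c1 c1) (ph g, e1))"
   if "vel c1 a 0 (lfield X (ph g))" "a 0 = g" for a
   using word_vel[OF f c1_in(1) c1_in(1) c1_in(1) that(1) vel_const[OF c1_in(2), of 0]] that(2) gc c1_in by simp
  have "vel c1 (%s. inv g \<otimes> (g \<otimes> curve1 G X s)) 0 (dir_deriv (lfield X (ph g), 0) (cmap ?f c1 c1 c1) (ph g, e1))"
   by (rule *[OF lfield_vel[OF X gU]]) (use gc in "simp add: curve1_0")
  moreover have "vel c1 (%s. inv g \<otimes> (g \<otimes> curve1 G X s)) 0 X"
  proof (rule vel_cong[OF curve1_vel[OF X]])
   show "\<forall>\<^sub>F s in nhds 0. curve1 G X s = inv g \<otimes> (g \<otimes> curve1 G X s)"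
    using vel_carrier_ev[OF c1_in(1) curve1_vel[OF X]]
    by eventually_elim (use gc in "simp add: m_assoc[symmetric]")
  qed
  ultimately have "dir_deriv (lfield X (ph g), 0) (cmap ?f c1 c1 c1) (ph g, e1) = X" using vel_unique by blast
  thus ?thesis using *[OF v1] unfolding LI_def g_def by simp
 qed
 have "lfield X e1 = X"
 proof -
  have "vel c1 (curve1 G X) 0 (lfield X (ph \<one>))"
   by (rule vel_cong[OF lfield_vel[OF X c1_in(2)]])
    (use vel_carrier_ev[OF c1_in(1) curve1_vel[OF X]] in "eventually_elim, simp")
  thus ?thesis using curve1_vel[OF X] vel_unique by blast
 qed
 hence "(u hvd X) (at 0)" using u(4)[of 0] u(1,2) by simp
 thus ?thesis using that[OF u(1,2,3) sm LI] by blast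
qed

text \<open>The local solution \<open>c\<close> is a local homomorphism by uniqueness of integral
  curves. It extends to all times as the n-th power of \<open>c (t / n)\<close>, which does not
  depend on n once t / n is small.\<close>

lemma ops_exists:
 assumes X: "X \<in> L" shows "\<exists>\<gamma>. one_param_subgroup G X \<gamma>"
proof -
 obtain \<epsilon> u where u: "\<epsilon> > 0" "u 0 = e1" "!!t. \<bar>t\<bar> < \<epsilon> ==> u t \<in> ph ` U1"
  "!!k. C_on k UNIV {-\<epsilon><..<\<epsilon>} u" "!!t. \<bar>t\<bar> < \<epsilon> ==> LI X (%t. if \<bar>t\<bar> < \<epsilon> then inv_into U1 ph (u t) else \<one>) t"
  "(u hvd X) (at 0)"
  by (rule local_ops[OF X]) (rule that)
 define c where "c t = (if \<bar>t\<bar> < \<epsilon> then inv_into U1 ph (u t) else \<one>)" for t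
 have LI: "LI X c t" if "\<bar>t\<bar> < \<epsilon>" for t using u(5)[OF that] by (simp add: c_def[abs_def])
 have cU: "c t \<in> U1" for t using u(3)[of t] c1_in by (simp add: inv_into_into c_def)
 have cc: "c t \<in> carrier G" for t using cU chart_carrier[OF c1_in(1)] by blast
 have phc: "ph (c t) = u t" if "\<bar>t\<bar> < \<epsilon>" for t using u(3)[OF that] that by (simp add: f_inv_into_f c_def)
 have c0: "c 0 = \<one>" using u(1,2) by (simp add: c_def chart_inv c1_in)
 have evI: "\<forall>\<^sub>F s in nhds 0. \<bar>s\<bar> < r" if "r > 0" for r :: real
 proof -
  have "\<forall>\<^sub>F s in nhds 0. s \<in> {-r<..<r}" by (rule eventually_nhds_in_open) (use that in auto)
  thus ?thesis by eventually_elim auto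
 qed
 have cvel: "vel c1 c 0 X"
 proof -
  have "((%s. ph (c s)) hvd X) (at 0)"
   by (rule hvd_cong[OF _ u(6)]) (use evI[OF u(1)] in "eventually_elim, simp add: phc")
  thus ?thesis by (simp add: vel_def cU)
 qed
 \<comment> \<open>Two times below \<delta> have a sum below \<epsilon>, where \<open>c\<close> is
   still an integral curve.\<close>
 define \<delta> where "\<delta> = \<epsilon> / 2"
 have d: "\<delta> > 0" "\<delta> < \<epsilon>" using u(1) by (auto simp: \<delta>_def)
 have lh: "c (s + t) = c s \<otimes> c t" if s: "\<bar>s\<bar> < \<delta>" and t: "\<bar>t\<bar> < \<delta>" for s t
 proof (rule LI_unique[of "{-\<delta><..<\<delta>}" 0 "%t. c (s + t)" "%t. c s \<otimes> c t" X])
  show "c (s + 0) = c s \<otimes> c 0" using cc by (simp add: c0)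
  fix r assume "r \<in> {-\<delta><..<\<delta>}"
  hence r: "\<bar>s + r\<bar> < \<epsilon>" "\<bar>r\<bar> < \<epsilon>" using s d by (auto simp: \<delta>_def)
  show "LI X (%t. c (s + t)) r" using LI[OF r(1)] by (simp add: LI_def add.assoc)
  have "inv (c s \<otimes> c r) \<otimes> (c s \<otimes> c (r + x)) = inv (c r) \<otimes> c (r + x)" for x
   using cc by (simp add: inv_mult_group m_assoc) (simp add: m_assoc[symmetric])
  thus "LI X (%t. c s \<otimes> c t) r" using LI[OF r(2)] by (simp add: LI_def)
 qed (use cc t d in auto)
 have pw: "c (real m * r) = c r [^] m" if "\<bar>real m * r\<bar> < \<delta>" for m r
  using that
 proof (induction m)
  case 0 thus ?case by (simp add: c0)
 next
  case (Suc m)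
  have "\<bar>real m * r\<bar> <= \<bar>real (Suc m) * r\<bar>" "\<bar>r\<bar> <= \<bar>real (Suc m) * r\<bar>"
   by (auto simp: abs_mult intro: mult_right_mono) (simp add: distrib_right)
  hence "\<bar>real m * r\<bar> < \<delta>" "\<bar>r\<bar> < \<delta>" using Suc.prems by auto
  thus ?case using lh[of "real m * r" r] Suc.IH by (simp add: distrib_right add.commute)
 qed
 \<comment> \<open>The added 1 makes the number positive and the inequality |t| / n < \<delta>
   strict.\<close>
 define nn where "nn t = nat \<lceil>\<bar>t\<bar> / \<delta>\<rceil> + 1" for t :: real
 have nn: "\<bar>t\<bar> / real (nn t) < \<delta>" "nn t > 0" for t
 proof -
  have "\<bar>t\<bar> / \<delta> < real (nn t)" unfolding nn_def using real_nat_ceiling_ge[of "\<bar>t\<bar> / \<delta>"] by simp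
  hence "\<bar>t\<bar> < real (nn t) * \<delta>" using d(1) by (simp add: pos_divide_less_eq)
  moreover show n: "nn t > 0" by (simp add: nn_def)
  ultimately show "\<bar>t\<bar> / real (nn t) < \<delta>" by (simp add: pos_divide_less_eq mult.commute)
 qed
 define \<Gamma> where "\<Gamma> t = c (t / real (nn t)) [^] nn t" for t
 have pow_eq: "c (t / real n) [^] n = c (t / real N) [^] N"
  if n: "\<bar>t\<bar> / real n < \<delta>" "n > 0" and N: "\<bar>t\<bar> / real N < \<delta>" "N > 0" for t n N
 proof -
  have "c (t / real n) = c (t / real (n * N)) [^] N"
   using pw[of N "t / real (n * N)"] n N by (simp add: abs_mult)
  moreover have "c (t / real N) = c (t / real (n * N)) [^] n"
   using pw[of n "t / real (n * N)"] n N by (simp add: abs_mult)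
  ultimately show ?thesis using cc by (simp add: nat_pow_pow mult.commute)
 qed
 have G_eq: "\<Gamma> t = c (t / real N) [^] N" if "\<bar>t\<bar> / real N < \<delta>" "N > 0" for t N
  unfolding \<Gamma>_def by (rule pow_eq[OF nn that])
 have Gc: "\<Gamma> t \<in> carrier G" for t using cc by (simp add: \<Gamma>_def)
 have G_small: "\<Gamma> t = c t" if "\<bar>t\<bar> < \<delta>" for t using G_eq[of t 1] that cc by simp
 have hom: "\<Gamma> (s + t) = \<Gamma> s \<otimes> \<Gamma> t" for s t
 proof -
  \<comment> \<open>One subdivision fine enough for s, t and s + t simultaneously.\<close>
  define N where "N = nn (2 * (\<bar>s\<bar> + \<bar>t\<bar>))"
  have N: "2 * (\<bar>s\<bar> + \<bar>t\<bar>) / real N < \<delta>" "N > 0" using nn[of "2 * (\<bar>s\<bar> + \<bar>t\<bar>)"] by (auto simp: N_def)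
  have b: "\<bar>s / real N\<bar> < \<delta>" "\<bar>t / real N\<bar> < \<delta>" "\<bar>s + t\<bar> / real N < \<delta>"
   using N by (auto simp: field_simps)
  have e: "\<Gamma> s = c (s / real N) [^] N" "\<Gamma> t = c (t / real N) [^] N" "\<Gamma> (s + t) = c ((s + t) / real N) [^] N"
   using G_eq b N by auto
  have 1: "c ((s + t) / real N) = c (s / real N) \<otimes> c (t / real N)"
   using lh[OF b(1,2)] by (simp add: add_divide_distrib)
  have 2: "c (s / real N) \<otimes> c (t / real N) = c (t / real N) \<otimes> c (s / real N)"
   using lh[OF b(1,2)] lh[OF b(2,1)] by (simp add: add.commute)
  show ?thesis unfolding e 1 by (rule pow_mult_distrib[OF 2 cc cc])
 qed
 have Gvel: "\<exists>Y. vel k \<Gamma> t Y" if k: "k \<in> AG" "\<Gamma> t \<in> fst k" for k t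
 proof -
  let ?f = "%z. \<Gamma> t \<otimes> fst z"
  have f: "sm2 ?f" by (intro sm2_intros) (use Gc in auto)
  have "vel k (%s. \<Gamma> t \<otimes> c s) 0 (dir_deriv (X, 0) (cmap ?f c1 c1 k) (ph (c 0), e1))"
   using word_vel[OF f c1_in(1) c1_in(1) k(1) cvel vel_const[OF c1_in(2), of 0]] k(2) Gc c0 by simp
  hence "vel k (%s. \<Gamma> (t + s)) 0 (dir_deriv (X, 0) (cmap ?f c1 c1 k) (ph (c 0), e1))"
  proof (rule vel_cong)
   show "\<forall>\<^sub>F s in nhds 0. \<Gamma> t \<otimes> c s = \<Gamma> (t + s)"
    using evI[OF d(1)] by eventually_elim (simp add: hom G_small)
  qed
  hence "vel k \<Gamma> t (dir_deriv (X, 0) (cmap ?f c1 c1 k) (ph (c 0), e1))"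
   unfolding vel_def using eventually_shift[of "%s. \<Gamma> s \<in> fst k" t] hvd_shift[of "%s. snd k (\<Gamma> s)" t] by simp
  thus ?thesis by blast
 qed
 have Gcont: "continuous_map euclidean TG \<Gamma>"
  unfolding continuous_map_def
 proof (intro conjI allI impI)
  fix W assume W: "openin TG W"
  have "open {t. \<Gamma> t \<in> W}"
  proof (subst open_subopen, rule ballI)
   fix t assume t: "t \<in> {t. \<Gamma> t \<in> W}"
   obtain k where k: "k \<in> AG" "\<Gamma> t \<in> fst k" using chart_exists[OF Gc] by blast
   obtain Y where Y: "vel k \<Gamma> t Y" using Gvel[OF k] by blast
   have o: "open_in L (snd k ` (fst k \<inter> W))"
    using chartsD(5)[OF ch, of "fst k" "snd k" W] k W by simp
   have ev: "\<forall>\<^sub>F s in nhds t. \<Gamma> s \<in> fst k" using Y by (simp add: vel_def)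
   have "\<forall>\<^sub>F s in nhds t. snd k (\<Gamma> s) \<in> snd k ` (fst k \<inter> W)"
   proof (rule relopen_curve[OF o])
    show "continuous (at t) (%s. snd k (\<Gamma> s))" using Y has_vector_derivative_continuous unfolding vel_def by blast
    show "\<forall>\<^sub>F s in nhds t. snd k (\<Gamma> s) \<in> L" using ev by eventually_elim (rule chart_L[OF k(1)])
   qed (use t k in auto)
   with ev have "\<forall>\<^sub>F s in nhds t. \<Gamma> s \<in> W"
    by eventually_elim (use inj_onD[OF chart_inj[OF k(1)]] in auto)
   thus "\<exists>T. open T & t \<in> T & T <= {t. \<Gamma> t \<in> W}" unfolding eventually_nhds by auto
  qed
  thus "openin euclidean {x \<in> topspace euclidean. \<Gamma> x \<in> W}" by simp
 qed (simp add: top_carrier Gc)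
 have smooth: "smooth_map euclidean UNIV {(UNIV, id)} TG AG \<Gamma>"
 proof (rule smooth_mapI[OF Gcont])
  fix U :: "real set" and \<phi> :: "real => real" and V \<psi> k assume "(U, \<phi>) \<in> {(UNIV, id)}" and V: "(V, \<psi>) \<in> AG"
  hence U: "U = UNIV" "\<phi> = id" by auto
  have eq: "\<phi> ` (U \<inter> \<Gamma> -` V) = {t. \<Gamma> t \<in> V}" "\<psi> o \<Gamma> o inv_into U \<phi> = (%t. \<psi> (\<Gamma> t))"
   unfolding U by (auto simp: o_def)
  show "C_on k UNIV (\<phi> ` (U \<inter> \<Gamma> -` V)) (\<psi> o \<Gamma> o inv_into U \<phi>)"
   unfolding eq
  proof (rule C_on_local[OF subset_UNIV])
   fix t0 assume "t0 \<in> {t. \<Gamma> t \<in> V}"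
   hence t0: "\<Gamma> t0 \<in> V" by simp
   let ?f = "%z. \<Gamma> t0 \<otimes> fst z"
   have f: "sm2 ?f" by (intro sm2_intros) (use Gc in auto)
   note m = cmap_props[OF f c1_in(1) c1_in(1) V, simplified]
   have sL: "subspace (L \<times> L)" by (rule chartsD(1)[OF ch2])
   define W where "W = {t. t - t0 \<in> {-\<delta><..<\<delta>} & \<Gamma> t \<in> V}"
   have oV: "open {t. \<Gamma> t \<in> V}"
    using openin_continuous_map_preimage[OF Gcont chartsD(3)[OF ch V]] by simp
   have oW: "open W"
   proof -
    have "open ((%t. t - t0) -` {-\<delta><..<\<delta>})" by (intro open_vimage continuous_intros)
    hence "open ((%t. t - t0) -` {-\<delta><..<\<delta>} \<inter> {t. \<Gamma> t \<in> V})" using oV by (rule open_Int)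
    thus ?thesis by (simp add: W_def vimage_def Int_def)
   qed
   hence oW': "open_in UNIV W" by simp
   have oI: "open_in UNIV {-\<epsilon><..<\<epsilon>}" by simp
   \<comment> \<open>Near t0 the curve is a left translate of the smooth local solution, so
     smoothness near 0 spreads to all times.\<close>
   have cs: "\<Gamma> t = \<Gamma> t0 \<otimes> c (t - t0)" if "t \<in> W" for t
    using hom[of t0 "t - t0"] G_small[of "t - t0"] that by (auto simp: W_def)
   have aff: "C_on k UNIV W (%t. t + (- t0))"
    by (intro C_on_add[OF subspace_UNIV oW'] C_on_const[OF subspace_UNIV oW'])
     (use C_on_linear[OF subspace_UNIV oW' linear_id] in "simp add: id_def")
   have "C_on k UNIV W (%t. u (t + (- t0)))"
    by (rule C_on_compose[OF subspace_UNIV oW' subspace_UNIV oI aff u(4)]) (use d in "auto simp: W_def")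
   hence uu: "C_on k UNIV W (%t. (u (t - t0), e1))"
    using C_on_Pair[OF subspace_UNIV oW' _ C_on_const[OF subspace_UNIV oW'], of k "%t. u (t - t0)" e1] by simp
   have in_dom: "(u (t - t0), e1) \<in> cdom ?f c1 c1 (V, \<psi>)" "cmap ?f c1 c1 (V, \<psi>) (u (t - t0), e1) = \<psi> (\<Gamma> t)" if "t \<in> W" for t
   proof -
    have "\<bar>t - t0\<bar> < \<epsilon>" using that d by (auto simp: W_def)
    hence p: "u (t - t0) = ph (c (t - t0))" by (simp add: phc)
    show "(u (t - t0), e1) \<in> cdom ?f c1 c1 (V, \<psi>)" "cmap ?f c1 c1 (V, \<psi>) (u (t - t0), e1) = \<psi> (\<Gamma> t)"
     unfolding p using m(3,4)[OF cU c1_in(2)] cs[OF that] that by (auto simp: W_def)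
   qed
   have "C_on k UNIV W (%t. cmap ?f c1 c1 (V, \<psi>) (u (t - t0), e1))"
    by (rule C_on_compose[OF subspace_UNIV oW' sL m(1) uu m(2)]) (use in_dom(1) in auto)
   moreover have "C_on k UNIV W (%t. cmap ?f c1 c1 (V, \<psi>) (u (t - t0), e1)) = C_on k UNIV W (%t. \<psi> (\<Gamma> t))"
    by (rule C_on_cong[OF subspace_UNIV oW']) (rule in_dom(2))
   ultimately have "C_on k UNIV W (%t. \<psi> (\<Gamma> t))" by (rule iffD1[rotated])
   moreover have "t0 \<in> W" using d t0 by (simp add: W_def)
   ultimately show "\<exists>W. open_in UNIV W & t0 \<in> W & C_on k UNIV W (%t. \<psi> (\<Gamma> t))"
    using oW' by blast
  qed
 qed
 have "((%t. ph (\<Gamma> t)) hvd X) (at 0)"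
 proof (rule hvd_cong)
  show "\<forall>\<^sub>F s in nhds 0. ph (c s) = ph (\<Gamma> s)" using evI[OF d(1)] by eventually_elim (simp add: G_small)
  show "((%s. ph (c s)) hvd X) (at 0)" using cvel by (simp add: vel_def)
 qed
 hence "one_param_subgroup G X \<Gamma>" unfolding one_param_subgroup_def using hom smooth by blast
 thus ?thesis by blast
qed

definition ex :: "'e => real => 'a" where "ex X = (SOME \<gamma>. one_param_subgroup G X \<gamma>)"

lemma ex_ops: "X \<in> L ==> one_param_subgroup G X (ex X)"
 unfolding ex_def by (rule someI_ex[OF ops_exists])

lemma ex_eqI: "one_param_subgroup G X \<gamma> ==> ex X = \<gamma>"
 using ops_unique ex_ops ops_props(5) by blast

lemmas ex_props = ops_props[OF ex_ops]

lemma ex_LI_eq: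
 assumes "X \<in> L" "!!t. c t \<in> carrier G" "!!t. LI X c t" "c 0 = \<one>"
 shows "c t = ex X t"
 by (rule LI_unique[of UNIV 0 c "ex X" X]) (use assms ex_props in auto)

lemma ex_conj:
 assumes X: "X \<in> L" and g: "g \<in> carrier G"
 shows "g \<otimes> ex X t \<otimes> inv g = ex (Ad G g X) t"
proof (rule ex_LI_eq[OF Ad_in[OF g X]])
 note p = ex_props[OF X]
 show "g \<otimes> ex X t \<otimes> inv g \<in> carrier G" for t using p(1) g by simp
 show "g \<otimes> ex X 0 \<otimes> inv g = \<one>" using p(3) g by simp
 have e: "inv (g \<otimes> ex X t \<otimes> inv g) \<otimes> (g \<otimes> ex X (t + s) \<otimes> inv g) = g \<otimes> ex X s \<otimes> inv g" for t s
  using p(1) g by (simp add: p(2) inv_mult_group m_assoc) (simp add: m_assoc[symmetric])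
 show "LI (Ad G g X) (%t. g \<otimes> ex X t \<otimes> inv g) t" for t
  unfolding LI_def e by (rule Ad_vel[OF g p(4,3)])
qed

lemma ex_scale:
 assumes X: "X \<in> L" shows "ex (r *R X) t = ex X (r * t)"
proof (rule ex_LI_eq[OF subspace_scale[OF subL X], symmetric])
 note p = ex_props[OF X]
 show "ex X (r * t) \<in> carrier G" for t by (rule p)
 have e: "inv (ex X (r * t)) \<otimes> ex X (r * (t + s)) = ex X (r * s)" for t s
 proof -
  have "ex X (r * (t + s)) = ex X (r * t) \<otimes> ex X (r * s)" by (simp add: p(2)[symmetric] distrib_left)
  thus ?thesis using p(1) by (simp add: m_assoc[symmetric])
 qed
 have "vel c1 (%s. ex X (r * s)) 0 (r *R X)"
  unfolding vel_def
 proof (intro conjI)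
  have d: "((%s. r * s) hvd r) (at (0::real))" by (auto intro!: derivative_eq_intros)
  have "((%s. ph (ex X s)) hvd X) (at (r * 0))" using p(4) by (simp add: vel_def)
  from vector_diff_chain_at[OF d this]
  show "((%s. ph (ex X (r * s))) hvd r *R X) (at 0)" by (simp add: o_def)
  have "\<forall>\<^sub>F s in nhds (r * 0). ex X s \<in> U1" using p(4) by (simp add: vel_def)
  moreover have "((%s. r * s) \<longlongrightarrow> r * 0) (nhds 0)" by (intro tendsto_intros filterlim_ident)
  ultimately show "\<forall>\<^sub>F s in nhds 0. ex X (r * s) \<in> U1" by (rule eventually_compose_filterlim)
 qed (use p(3) c1_in in simp)
 thus "LI (r *R X) (%t. ex X (r * t)) t" for t unfolding LI_def e .
 show "ex X (r * 0) = \<one>" using p(3) by simp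
qed

lemma Ad_ex_self: assumes "X \<in> L" shows "Ad G (ex X t) X = X"
proof (rule Ad_eqI[OF ex_props(1)[OF assms] ex_props(4)[OF assms] ex_props(3)[OF assms]])
 note p = ex_props[OF assms]
 have "ex X t \<otimes> ex X s \<otimes> inv (ex X t) = ex X s" for s
 proof -
  have "ex X t \<otimes> ex X s = ex X s \<otimes> ex X t" by (simp add: p(2)[symmetric] add.commute)
  thus ?thesis using p(1) by (simp add: m_assoc)
 qed
 thus "vel c1 (%s. ex X t \<otimes> ex X s \<otimes> inv (ex X t)) 0 X" using p(4) by simp
qed

text \<open>X is fixed by \<open>Ad\<close> along its own one-parameter subgroup, so the derivative
  of that constant curve vanishes.\<close>

lemma bracket_self: assumes "X \<in> L" shows "bracket G X X = 0"
proof -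
 have "((%t. Ad G (ex X t) X) hvd bracket G X (Ad G (ex X 0) X)) (at 0)"
  by (rule Ad_ops_deriv[OF ex_ops[OF assms] assms])
 thus ?thesis using Ad_ex_self[OF assms] by (simp add: vector_derivative_unique_at)
qed

lemma bracket_anti: assumes "X \<in> L" "Y \<in> L" shows "bracket G X Y = - bracket G Y X"
proof -
 have "bracket G (X + Y) (X + Y) = (bracket G X X + bracket G X Y) + (bracket G Y X + bracket G Y Y)"
  using assms by (simp add: lin_on_add[OF bracket_lin1] lin_on_add[OF bracket_lin2] subspace_add[OF subL] )
 thus ?thesis
  using bracket_self[OF subspace_add[OF subL assms]] bracket_self[OF assms(1)] bracket_self[OF assms(2)]
  by (simp add: eq_neg_iff_add_eq_0)
qed

text \<open>The derivative at 0 of the statement that \<open>Ad (ex X t)\<close> preserves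
  brackets.\<close>

lemma jacobi:
 assumes X: "X \<in> L" and Y: "Y \<in> L" and Z: "Z \<in> L"
 shows "bracket G X (bracket G Y Z) = bracket G (bracket G X Y) Z + bracket G Y (bracket G X Z)"
proof -
 note p = ex_props[OF X]
 obtain pr where pr: "linear pr" "!!x. x \<in> L ==> pr x = x" "!!x. pr x \<in> span ((%x. x) ` L)"
  by (rule lin_on_extend[OF lin_onI subL, of "%x. x"]) (auto intro: that)
 have prL: "pr x \<in> L" for x using pr(3) span_eq_iff[THEN iffD2, OF subL] by simp
 \<comment> \<open>The bracket is bilinear on \<open>L\<close> only; the projection onto
   \<open>L\<close> makes it a bounded bilinear map on the whole type, as the product rule
   requires.\<close>
 define h where "h A B = bracket G (pr A) (pr B)" for A B
 have "bilinear h"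
  unfolding bilinear_def h_def using prL
  by (auto intro!: linearI simp: linear_add[OF pr(1)] linear_scale[OF pr(1)]
    lin_on_add[OF bracket_lin1] lin_on_scale[OF bracket_lin1] lin_on_add[OF bracket_lin2] lin_on_scale[OF bracket_lin2])
 hence bb: "bounded_bilinear h" by (simp add: bilinear_conv_bounded_bilinear)
 have hL: "h A B = bracket G A B" if "A \<in> L" "B \<in> L" for A B using that by (simp add: h_def pr(2))
 have d: "((%t. Ad G (ex X t) W) hvd bracket G X W) (at 0)" if "W \<in> L" for W
  using Ad_ops_deriv[OF ex_ops[OF X] that, of 0] by (simp add: p(3) Ad_one that)
 have "h (Ad G (ex X t) Y) (Ad G (ex X t) Z) = Ad G (ex X t) (bracket G Y Z)" for t
  using Ad_bracket[OF p(1) Y Z] by (simp add: hL Ad_in p(1) Y Z)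
 hence "((%t. Ad G (ex X t) (bracket G Y Z)) hvd
   h (Ad G (ex X 0) Y) (bracket G X Z) + h (bracket G X Y) (Ad G (ex X 0) Z)) (at 0)"
  using bounded_bilinear.has_vector_derivative[OF bb d[OF Y] d[OF Z]] by simp
 with d[OF bracket_in[OF Y Z]] have "bracket G X (bracket G Y Z) = h (Ad G (ex X 0) Y) (bracket G X Z) + h (bracket G X Y) (Ad G (ex X 0) Z)"
  by (rule vector_derivative_unique_at)
 thus ?thesis by (simp add: hL p(3) Ad_one X Y Z bracket_in)
qed

lemma Ad_continuous:
 assumes Y: "Y \<in> L" shows "continuous_map TG euclidean (%g. Ad G g Y)"
proof (rule pasting_lemma[where I = AG and T = fst and f = "%_ g. Ad G g Y"])
 fix c assume c: "c \<in> AG"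
 show "openin TG (fst c)" using chartsD(3)[OF ch, of "fst c" "snd c"] c by simp
 let ?A = "%x. dir_deriv (0, Y) (cmap conjw c c1 c1) (x, e1)"
 note m = cmap_props[OF conjw_sm c c1_in(1) c1_in(1)]
 have Y0: "(0, Y) \<in> L \<times> L" using Y subspace_0[OF subL] by simp
 have "continuous_on (snd c ` fst c) ?A"
  by (rule continuous_on_compose2[OF C_on_cont[OF C_on_dir_deriv[OF m(2)[of "Suc 0"] Y0]]])
   (use Ad_cmap(2)[OF c _ Y] in "auto intro!: continuous_intros")
 moreover have "homeomorphic_map (subtopology TG (fst c)) (top_of_set (snd c ` fst c)) (snd c)"
  using lie c unfolding lie_group_def smooth_manifold_def by (metis (mono_tags, lifting) case_prodD prod.collapse)
 ultimately have "continuous_map (subtopology TG (fst c)) euclidean (?A o snd c)"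
  by (intro continuous_map_compose[OF homeomorphic_imp_continuous_map]) auto
 thus "continuous_map (subtopology TG (fst c)) euclidean (%g. Ad G g Y)"
  by (rule continuous_map_eq) (use Ad_cmap(1)[OF c _ Y] in auto)
qed (use chart_exists top_carrier in "auto simp del: split_paired_Ex")

end

section \<open>Traces and joint eigenvectors\<close>

text \<open>Replaces the arbitrarily chosen basis in \<open>trace_on\<close> by a family that
  expands vectors through inner products, in which linearity and cyclicity of the trace are
  immediate.\<close>

lemma trace_on_eq:
 fixes E :: "'e::euclidean_space set"
 assumes E: "subspace E" and T: "lin_on E T" "T ` E <= E"
  and C: "finite C" "C <= E" "\<forall>x\<in>E. (\<Sum>c\<in>C. (x \<bullet> c) *R c) = x"
 shows "trace_on E T = (\<Sum>c\<in>C. T c \<bullet> c)"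
proof -
 define B where "B = (SOME B. B <= E & independent B & span B = E)"
 obtain B' where "B' <= E" "span B' = E" "independent B'" using orthonormal_basis_obtain[OF E] by metis
 hence "B <= E & independent B & span B = E" unfolding B_def by (intro someI) blast
 hence B: "B <= E" "independent B" "span B = E" by auto
 have finB: "finite B" using B(2) independent_imp_finite by blast
 let ?r = "representation B"
 have TC: "T c \<in> E" "c \<in> E" if "c \<in> C" for c using T(2) C(2) that by auto
 have rs: "?r (\<Sum>i\<in>I. u i *R w i) b = (\<Sum>i\<in>I. u i * ?r (w i) b)" if "!!i. i \<in> I ==> w i \<in> E" for I b and u :: "'e => real" and w :: "'e => 'e"
 proof -
  have w: "w i \<in> span B" if "i \<in> I" for i using \<open>!!i. i \<in> I ==> w i \<in> E\<close> that B(3) by simp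
  have "?r (\<Sum>i\<in>I. u i *R w i) b = (\<Sum>i\<in>I. ?r (u i *R w i) b)"
   using representation_sum[OF B(2), of I "%i. u i *R w i"] w by (simp add: span_scale)
  thus ?thesis using w by (simp add: representation_scale[OF B(2)])
 qed
 have "trace_on E T = (\<Sum>b\<in>B. ?r (T b) b)" by (simp add: trace_on_def B_def Let_def)
 also have "\<dots> = (\<Sum>b\<in>B. \<Sum>c\<in>C. (b \<bullet> c) * (\<Sum>d\<in>C. (T c \<bullet> d) * ?r d b))"
 proof (rule sum.cong[OF refl])
  fix b assume "b \<in> B"
  hence b: "b \<in> E" using B by auto
  have "T b = T (\<Sum>c\<in>C. (b \<bullet> c) *R c)" using C(3) b by simp
  also have "\<dots> = (\<Sum>c\<in>C. T ((b \<bullet> c) *R c))" by (rule lin_on_sum[OF T(1) E]) (use TC E in "auto intro: subspace_scale")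
  also have "\<dots> = (\<Sum>c\<in>C. (b \<bullet> c) *R T c)" by (rule sum.cong[OF refl]) (simp add: lin_on_scale[OF T(1)] TC)
  finally have "?r (T b) b = (\<Sum>c\<in>C. (b \<bullet> c) * ?r (T c) b)" using rs[of C T] TC by simp
  also have "\<dots> = (\<Sum>c\<in>C. (b \<bullet> c) * (\<Sum>d\<in>C. (T c \<bullet> d) * ?r d b))"
  proof (rule sum.cong[OF refl])
   fix c assume "c \<in> C"
   hence "?r (\<Sum>d\<in>C. (T c \<bullet> d) *R d) b = (\<Sum>d\<in>C. (T c \<bullet> d) * ?r d b)" using rs[of C "%d. d"] TC by simp
   thus "(b \<bullet> c) * ?r (T c) b = (b \<bullet> c) * (\<Sum>d\<in>C. (T c \<bullet> d) * ?r d b)" using C(3) TC(1)[OF \<open>c \<in> C\<close>] by simp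
  qed
  finally show "?r (T b) b = (\<Sum>c\<in>C. (b \<bullet> c) * (\<Sum>d\<in>C. (T c \<bullet> d) * ?r d b))" .
 qed
 also have "\<dots> = (\<Sum>c\<in>C. \<Sum>d\<in>C. \<Sum>b\<in>B. (T c \<bullet> d) * ((b \<bullet> c) * ?r d b))"
  by (subst sum.swap, rule sum.cong[OF refl], simp only: sum_distrib_left, subst sum.swap) (simp add: mult_ac)
 also have "\<dots> = (\<Sum>c\<in>C. \<Sum>d\<in>C. (T c \<bullet> d) * (d \<bullet> c))"
 proof (intro sum.cong refl)
  fix c d assume "d \<in> C"
  hence "d = (\<Sum>b\<in>B. ?r d b *R b)" using sum_representation_eq[OF B(2) _ finB order_refl, of d] B(3) TC by simp
  hence "d \<bullet> c = (\<Sum>b\<in>B. ?r d b *R b) \<bullet> c" by (rule arg_cong)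
  also have "\<dots> = (\<Sum>b\<in>B. (b \<bullet> c) * ?r d b)" by (simp add: inner_sum_left mult.commute)
  finally show "(\<Sum>b\<in>B. (T c \<bullet> d) * ((b \<bullet> c) * ?r d b)) = (T c \<bullet> d) * (d \<bullet> c)" by (simp add: sum_distrib_left)
 qed
 also have "\<dots> = (\<Sum>c\<in>C. T c \<bullet> c)"
 proof (rule sum.cong[OF refl])
  fix c assume "c \<in> C"
  have "T c \<bullet> c = (\<Sum>d\<in>C. (T c \<bullet> d) *R d) \<bullet> c" using C(3) TC(1)[OF \<open>c \<in> C\<close>] by simp
  thus "(\<Sum>d\<in>C. (T c \<bullet> d) * (d \<bullet> c)) = T c \<bullet> c" by (simp add: inner_sum_left)
 qed
 finally show ?thesis .
qed

lemma trace_on_cong: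
 fixes E :: "'e::euclidean_space set"
 assumes "subspace E" "!!x. x \<in> E ==> S x = T x" shows "trace_on E S = trace_on E T"
proof -
 define B where "B = (SOME B. B <= E & independent B & span B = E)"
 obtain B' where "B' <= E" "span B' = E" "independent B'" using orthonormal_basis_obtain[OF assms(1)] by metis
 hence "B <= E & independent B & span B = E" unfolding B_def by (intro someI) blast
 thus ?thesis using assms(2) unfolding trace_on_def B_def[symmetric] by (auto intro!: sum.cong simp: Let_def)
qed

lemma trace_on_lincomb:
 fixes E :: "'e::euclidean_space set"
 assumes E: "subspace E" and S: "lin_on E S" "S ` E <= E" and T: "lin_on E T" "T ` E <= E"
 shows "trace_on E (%x. S x + r *R T x) = trace_on E S + r * trace_on E T"
proof -
 obtain C where C: "finite C" "C <= E" "\<forall>x\<in>E. (\<Sum>c\<in>C. (x \<bullet> c) *R c) = x"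
  using orthonormal_basis_obtain[OF E] by metis
 have l: "lin_on E (%x. S x + r *R T x)"
  by (rule lin_onI) (simp_all add: lin_on_add[OF S(1)] lin_on_add[OF T(1)] lin_on_scale[OF S(1)] lin_on_scale[OF T(1)] algebra_simps)
 have m: "(%x. S x + r *R T x) ` E <= E" using S T E by (auto intro!: subspace_add subspace_scale)
 show ?thesis
  unfolding trace_on_eq[OF E l m C] trace_on_eq[OF E S C] trace_on_eq[OF E T C]
  by (simp add: inner_add_left sum.distrib sum_distrib_left)
qed

lemma trace_on_commute:
 fixes E :: "'e::euclidean_space set"
 assumes E: "subspace E" and S: "lin_on E S" "S ` E <= E" and T: "lin_on E T" "T ` E <= E"
 shows "trace_on E (%x. S (T x)) = trace_on E (%x. T (S x))"
proof -
 obtain C where C: "finite C" "C <= E" "\<forall>x\<in>E. (\<Sum>c\<in>C. (x \<bullet> c) *R c) = x"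
  using orthonormal_basis_obtain[OF E] by metis
 have *: "trace_on E (%x. S (T x)) = (\<Sum>c\<in>C. \<Sum>d\<in>C. (T c \<bullet> d) * (S d \<bullet> c))"
  if S: "lin_on E S" "S ` E <= E" and T: "lin_on E T" "T ` E <= E" for S T
 proof -
  have TE: "T x \<in> E" "S x \<in> E" if "x \<in> E" for x using S T that by auto
  have "lin_on E (%x. S (T x))"
   by (rule lin_onI) (simp_all add: TE lin_on_add[OF T(1)] lin_on_add[OF S(1)] lin_on_scale[OF T(1)] lin_on_scale[OF S(1)])
  hence "trace_on E (%x. S (T x)) = (\<Sum>c\<in>C. S (T c) \<bullet> c)"
   by (rule trace_on_eq[OF E _ _ C]) (auto simp: TE)
  also have "\<dots> = (\<Sum>c\<in>C. \<Sum>d\<in>C. (T c \<bullet> d) * (S d \<bullet> c))"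
  proof (rule sum.cong[OF refl])
   fix c assume c: "c \<in> C"
   have "S (T c) = S (\<Sum>d\<in>C. (T c \<bullet> d) *R d)" using C T c by (simp add: subset_iff image_subset_iff)
   also have "\<dots> = (\<Sum>d\<in>C. S ((T c \<bullet> d) *R d))" by (rule lin_on_sum[OF S(1) E]) (use C E in "auto intro: subspace_scale")
   also have "\<dots> = (\<Sum>d\<in>C. (T c \<bullet> d) *R S d)" by (rule sum.cong[OF refl], rule lin_on_scale[OF S(1)]) (use C in auto)
   finally show "S (T c) \<bullet> c = (\<Sum>d\<in>C. (T c \<bullet> d) * (S d \<bullet> c))" by (simp add: inner_sum_left)
  qed
  finally show ?thesis .
 qed
 show ?thesis unfolding *[OF S T] *[OF T S] by (subst sum.swap) (simp add: mult.commute)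
qed

section \<open>Joint eigenvectors of commuting symmetric operators\<close>

context inner_subspace
begin

text \<open>The Rayleigh quotient attains its maximum q on the compact unit sphere of V. Vanishing
  of the first variation at a maximizer x says that \<open>T x - q x\<close> is orthogonal to
  V.\<close>

lemma quad_max_eigen:
 assumes V: "subspace V" "V <= E" "V ~= {0}" and T: "lin_on E T" "!!x. x \<in> V ==> T x \<in> V"
  and sym: "!!x y. x \<in> V ==> y \<in> V ==> B (T x) y = B x (T y)"
 shows "\<exists>x\<in>V. \<exists>q. x ~= 0 & T x = q *R x"
proof -
 have VE: "x \<in> E" if "x \<in> V" for x using V that by auto
 obtain C where C: "onb E C" by (rule onb_exists[OF sub order_refl])
 have contB: "continuous_on V (%x. B (S x) (R x))" if "lin_on E S" "lin_on E R" "!!x. x \<in> V ==> S x \<in> E & R x \<in> E" for S R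
 proof -
  have S: "continuous_on V (%x. B (S x) c)" if "lin_on E S" "c \<in> E" "!!x. x \<in> V ==> S x \<in> E" for S c
  proof -
   have "continuous_on E S" using C_on_cont[OF C_on_lin_on[OF that(1) sub]] .
   hence 1: "continuous_on V S" using V(2) continuous_on_subset by blast
   have 2: "continuous_on E (%x. B x c)" using C_on_cont[OF C_on_lin_on[OF B_lin1[OF that(2)] sub]] .
   show ?thesis by (rule continuous_on_compose2[OF 2 1]) (use that in auto)
  qed
  have eq: "B (S x) (R x) = (\<Sum>c\<in>C. B (S x) c * B (R x) c)" if "x \<in> V" for x
  proof -
   have Sx: "S x \<in> E" "R x \<in> E" using \<open>!!x. x \<in> V ==> S x \<in> E & R x \<in> E\<close> that by auto
   have "B (S x) (R x) = B (S x) (\<Sum>c\<in>C. B (R x) c *R c)" using onbD(4)[OF C Sx(2)] by simp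
   also have "\<dots> = (\<Sum>c\<in>C. B (S x) (B (R x) c *R c))" using onbD(1)[OF C] Sx by (intro B_sum) auto
   also have "\<dots> = (\<Sum>c\<in>C. B (S x) c * B (R x) c)"
    using onbD(1)[OF C] Sx by (intro sum.cong) (auto simp: B_simps subset_iff)
   finally show ?thesis .
  qed
  have "continuous_on V (%x. \<Sum>c\<in>C. B (S x) c * B (R x) c)"
   using onbD(1)[OF C] that by (intro continuous_on_sum continuous_on_mult S) auto
  thus ?thesis by (rule continuous_on_eq) (simp add: eq)
 qed
 have lid: "lin_on E (%x. x)" by (simp add: lin_on_def)
 define K where "K = V \<inter> sphere 0 1"
 have K1: "compact K" unfolding K_def using closed_subspace[OF V(1)] by (simp add: compact_sphere closed_Int_compact)
 have K2: "K ~= {}"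
 proof -
  obtain x where x: "x \<in> V" "x ~= 0" using V subspace_0 by blast
  hence "(1 / norm x) *R x \<in> K" unfolding K_def using V(1) by (auto intro: subspace_scale)
  thus ?thesis by blast
 qed
 have K3: "continuous_on K (%x. B (T x) x / B x x)"
 proof (intro continuous_on_divide)
  have KV: "K <= V" by (auto simp: K_def)
  show "continuous_on K (%x. B (T x) x)"
   by (rule continuous_on_subset[OF contB[OF T(1) lid] KV]) (use T(2) VE in simp)
  show "continuous_on K (%x. B x x)"
   by (rule continuous_on_subset[OF contB[OF lid lid] KV]) (use VE in simp)
  show "\<forall>x\<in>K. B x x ~= 0"
  proof
   fix x assume "x \<in> K"
   hence "x \<in> E" "x ~= 0" using VE by (auto simp: K_def)
   from B_pos[OF this] show "B x x ~= 0" by simp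
  qed
 qed
 from continuous_attains_sup[OF K1 K2 K3]
 obtain x where x: "x \<in> K" "!!y. y \<in> K ==> B (T y) y / B y y <= B (T x) x / B x x" by blast
 define q where "q = B (T x) x / B x x"
 have xV: "x \<in> V" "x ~= 0" using x(1) by (auto simp: K_def)
 have le: "B (T y) y <= q * B y y" if y: "y \<in> V" for y
 proof (cases "y = 0")
  case True
  thus ?thesis using B_simps(10)[of 0] lin_on_0[OF T(1) sub] by simp
 next
  case False
  let ?z = "(1 / norm y) *R y"
  have "?z \<in> K" unfolding K_def using y False V(1) by (auto intro: subspace_scale)
  hence "B (T ?z) ?z / B ?z ?z <= q" using x(2) q_def by simp
  moreover have "B (T ?z) ?z / B ?z ?z = B (T y) y / B y y"
   using False VE[OF y] VE[OF T(2)[OF y]] by (simp add: lin_on_scale[OF T(1)] B_simps)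
  moreover have "B y y > 0" using B_pos VE[OF y] False by auto
  ultimately show ?thesis by (simp add: pos_divide_le_eq)
 qed
 have qx: "B (T x) x = q * B x x" using B_pos[OF VE[OF xV(1)] xV(2)] by (simp add: q_def)
 have orth: "B (T x - q *R x) y = 0" if y: "y \<in> V" for y
 proof -
  define a where "a = 2 * B (T x - q *R x) y"
  define b where "b = B (T y) y - q * B y y"
  note m = VE[OF xV(1)] VE[OF y] VE[OF T(2)[OF xV(1)]] VE[OF T(2)[OF y]]
  have "a * t + b * t\<^sup>2 <= 0" for t
  proof -
   have "x + t *R y \<in> V" using xV y V(1) by (auto intro: subspace_add subspace_scale)
   from le[OF this] have "B (T x + t *R T y) (x + t *R y) <= q * B (x + t *R y) (x + t *R y)"
    using m by (simp add: lin_on_add[OF T(1)] lin_on_scale[OF T(1)])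
   thus ?thesis unfolding a_def b_def
    using m qx sym[OF y xV(1)] B_sym[OF m(1,2)] B_sym[OF m(3,2)] B_sym[OF m(4,1)]
    by (simp add: B_simps algebra_simps power2_eq_square)
  qed
  hence bd: "a * t <= \<bar>b\<bar> * t\<^sup>2" for t
   using mult_right_mono[of "- b" "\<bar>b\<bar>" "t\<^sup>2"] by (smt (verit) mult_minus_left zero_le_power2)
  have "a = 0"
  proof (rule ccontr)
   assume "a ~= 0"
   \<comment> \<open>The choice t = a / (|b| + 1) is small enough for the linear term to beat the
     quadratic one.\<close>
   have "a * (a / (\<bar>b\<bar> + 1)) <= \<bar>b\<bar> * (a / (\<bar>b\<bar> + 1))\<^sup>2" by (rule bd)
   hence "a\<^sup>2 / (\<bar>b\<bar> + 1) <= \<bar>b\<bar> / (\<bar>b\<bar> + 1) * (a\<^sup>2 / (\<bar>b\<bar> + 1))" by (simp add: power2_eq_square)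
   moreover have "\<bar>b\<bar> / (\<bar>b\<bar> + 1) * (a\<^sup>2 / (\<bar>b\<bar> + 1)) < 1 * (a\<^sup>2 / (\<bar>b\<bar> + 1))"
    using \<open>a ~= 0\<close> by (intro mult_strict_right_mono) auto
   ultimately show False by simp
  qed
  thus ?thesis by (simp add: a_def)
 qed
 have "T x - q *R x \<in> V" using xV T(2) V(1) by (auto intro: subspace_diff subspace_scale)
 hence "T x - q *R x = 0" using orth B_pos VE by force
 thus ?thesis using xV by auto
qed

text \<open>On a nonzero invariant subspace of least dimension every T is a scalar: an eigenspace of
  T inside it is invariant under the commuting operators, so by minimality it is everything.\<close>

lemma joint_eigenvector:
 assumes F: "!!T. T \<in> F ==> lin_on E T" "!!T x y. T \<in> F ==> x \<in> E ==> y \<in> E ==> B (T x) y = B x (T y)"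
   "!!S T x. S \<in> F ==> T \<in> F ==> x \<in> E ==> S (T x) = T (S x)"
  and V: "subspace V" "V <= E" "V ~= {0}" "!!T x. T \<in> F ==> x \<in> V ==> T x \<in> V"
 shows "\<exists>v\<in>V. v ~= 0 & (\<forall>T\<in>F. \<exists>c. T v = c *R v)"
proof -
 define Q where "Q W \<longleftrightarrow> subspace W & W <= V & W ~= {0} & (\<forall>T\<in>F. \<forall>x\<in>W. T x \<in> W)" for W
 have "Q V" using V by (auto simp: Q_def)
 then obtain W where W: "Q W" "!!W'. Q W' ==> dim W <= dim W'"
  using ex_has_least_nat[of Q V dim] by blast
 have WE: "W <= E" using W(1) V(2) by (auto simp: Q_def)
 have "\<exists>c. \<forall>v\<in>W. T v = c *R v" if T: "T \<in> F" for T
 proof -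
  obtain x q where x: "x \<in> W" "x ~= 0" "T x = q *R x"
   using quad_max_eigen[of W T] W(1) WE F(1)[OF T] F(2)[OF T] T unfolding Q_def by (metis subsetD)
  define W' where "W' = {v \<in> W. T v = q *R v}"
  have "Q W'"
   unfolding Q_def
  proof (intro conjI ballI)
   show "subspace W'"
    using W(1) WE unfolding W'_def Q_def subspace_def
    by (auto simp: lin_on_add[OF F(1)[OF T]] lin_on_scale[OF F(1)[OF T]] lin_on_0[OF F(1)[OF T] sub] scaleR_add_right subset_iff)
   show "W' <= V" "W' ~= {0}" using W(1) x by (auto simp: W'_def Q_def)
   fix S v assume S: "S \<in> F" and "v \<in> W'"
   hence v: "v \<in> W" "T v = q *R v" by (auto simp: W'_def)
   have vE: "v \<in> E" using v WE by auto
   have "T (S v) = S (q *R v)" using F(3)[OF T S vE] v(2) by simp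
   also have "\<dots> = q *R S v" by (rule lin_on_scale[OF F(1)[OF S] vE])
   finally show "S v \<in> W'" using v S W(1) by (auto simp: W'_def Q_def)
  qed
  hence "dim W <= dim W'" by (rule W(2))
  moreover have "subspace W" "subspace W'" "W' <= W" using W(1) \<open>Q W'\<close> by (auto simp: Q_def W'_def)
  ultimately have "W' = W" by (metis subspace_dim_equal)
  thus ?thesis by (auto simp: W'_def)
 qed
 moreover obtain v where "v \<in> W" "v ~= 0" using W(1) subspace_0 unfolding Q_def by blast
 moreover have "W <= V" using W(1) by (simp add: Q_def)
 ultimately show ?thesis by blast
qed

lemma orth_complement_span:
 assumes "J <= E" "!!x. x \<in> E ==> (!!v. v \<in> J ==> B x v = 0) ==> x = 0"
 shows "span J = E"
proof
 show sE: "span J <= E" using assms(1) sub by (simp add: span_minimal)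
 obtain C where C: "onb (span J) C" by (rule onb_exists[OF subspace_span sE])
 note C' = onbD[OF C]
 have CE: "c \<in> E" if "c \<in> C" for c using C'(1) sE that by auto
 show "E <= span J"
 proof
  fix x assume x: "x \<in> E"
  define p where "p = (\<Sum>c\<in>C. B x c *R c)"
  have pE: "p \<in> E" unfolding p_def using CE by (auto intro!: subspace_sum[OF sub])
  have pS: "p \<in> span J" unfolding p_def using C'(1) by (auto intro!: span_sum span_scale)
  have "x - p = 0"
  proof (rule assms(2))
   show "x - p \<in> E" using x pE by simp
   fix v assume "v \<in> J"
   hence vS: "v \<in> span J" by (rule span_base)
   have vE: "v \<in> E" using vS sE by auto
   have xc: "B (x - p) c = 0" if "c \<in> C" for c
   proof -
    have "B p c = B x c" unfolding p_def by (rule orthonormal_coeff) (use C' CE that in auto)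
    thus ?thesis using x pE CE[OF that] by (simp add: B_simps)
   qed
   have "B (x - p) v = B (x - p) (\<Sum>c\<in>C. B v c *R c)" using C'(4)[OF vS] by simp
   also have "\<dots> = (\<Sum>c\<in>C. B (x - p) (B v c *R c))" using CE x pE by (intro B_sum) auto
   also have "\<dots> = 0" using CE x pE xc by (intro sum.neutral) (auto simp: B_simps(6))
   finally show "B (x - p) v = 0" .
  qed
  thus "x \<in> span J" using pS by simp
 qed
qed

text \<open>The orthogonal complement of all joint eigenvectors is invariant. If it were nonzero it
  would contain a joint eigenvector, which is then orthogonal to itself.\<close>

lemma joint_eigenspaces_span:
 assumes F: "!!T. T \<in> F ==> lin_on E T" "!!T x y. T \<in> F ==> x \<in> E ==> y \<in> E ==> B (T x) y = B x (T y)"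
   "!!S T x. S \<in> F ==> T \<in> F ==> x \<in> E ==> S (T x) = T (S x)" "!!T x. T \<in> F ==> x \<in> E ==> T x \<in> E"
 shows "span {v \<in> E. \<forall>T\<in>F. \<exists>c. T v = c *R v} = E"
proof (rule orth_complement_span)
 let ?J = "{v \<in> E. \<forall>T\<in>F. \<exists>c. T v = c *R v}"
 define W where "W = {x \<in> E. \<forall>v\<in>?J. B x v = 0}"
 have W: "subspace W" "W <= E" unfolding W_def subspace_def by (auto simp: B_simps)
 have inv: "T x \<in> W" if "T \<in> F" "x \<in> W" for T x
  unfolding W_def
 proof (intro CollectI conjI ballI)
  show "T x \<in> E" using F(4) that by (auto simp: W_def)
  fix v assume v: "v \<in> ?J"
  then obtain c where c: "T v = c *R v" using \<open>T \<in> F\<close> by blast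
  have "B (T x) v = B x (T v)" using F(2)[OF that(1)] that v by (auto simp: W_def)
  also have "\<dots> = c * B x v" unfolding c using that v by (auto simp: W_def B_simps)
  finally show "B (T x) v = 0" using that v by (auto simp: W_def)
 qed
 have W0: "W = {0}"
 proof (rule ccontr)
  assume "W ~= {0}"
  have "\<exists>v\<in>W. v ~= 0 & (\<forall>T\<in>F. \<exists>c. T v = c *R v)"
   by (rule joint_eigenvector[of F]) (use F(1,2,3) W inv \<open>W ~= {0}\<close> in auto)
  then obtain w where "w \<in> W" "w ~= 0" "\<forall>T\<in>F. \<exists>c. T w = c *R w" by blast
  hence "B w w = 0" "w \<in> E" "w ~= 0" unfolding W_def by auto
  thus False using B_pos by force
 qed
 fix x assume "x \<in> E" "!!v. v \<in> ?J ==> B x v = 0"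
 hence "x \<in> W" by (simp add: W_def)
 thus "x = 0" using W0 by simp
qed auto

end

section \<open>Structure of the Lie algebra\<close>

locale iwasawa =
 fixes G :: "('a, 'e::euclidean_space) iwasawa_data" (structure)
 assumes S: "setting G"
begin

sublocale lie G using S by unfold_locales (simp add: setting_def)

abbreviation "br \<equiv> bracket G"
abbreviation "Bk \<equiv> killing G"
abbreviation "th \<equiv> cartan G"
abbreviation "rs \<equiv> root_space G"

lemma iw: "iwasawa_decomposition G" using S by (simp add: setting_def)

lemma th_props:
 shows "X \<in> L ==> th X \<in> L" "X \<in> L ==> th (th X) = X" "lin_on L th"
  "X \<in> L ==> Y \<in> L ==> th (br X Y) = br (th X) (th Y)" "X \<in> L ==> X ~= 0 ==> Bk X (th X) < 0"
 using iw unfolding iwasawa_decomposition_def cartan_involution_def lin_on_def by auto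

lemma L_in [simp, intro]:
 "X \<in> L ==> Y \<in> L ==> X + Y \<in> L" "X \<in> L ==> Y \<in> L ==> X - Y \<in> L" "X \<in> L ==> r *R X \<in> L"
 "X \<in> L ==> - X \<in> L" "0 \<in> L" "X \<in> L ==> Y \<in> L ==> br X Y \<in> L" "X \<in> L ==> th X \<in> L"
 using subL by (auto intro: subspace_add subspace_diff subspace_scale subspace_neg subspace_0 bracket_in th_props(1))

lemma th_simps:
 shows "X \<in> L ==> Y \<in> L ==> th (X + Y) = th X + th Y" "X \<in> L ==> th (r *R X) = r *R th X"
  "X \<in> L ==> Y \<in> L ==> th (X - Y) = th X - th Y" "X \<in> L ==> th (- X) = - th X"
 using lin_on_add[OF th_props(3)] lin_on_scale[OF th_props(3)] lin_on_diff[OF th_props(3) subL] lin_on_neg[OF th_props(3)] by auto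

lemma br_simps:
 shows "X \<in> L ==> Y \<in> L ==> Z \<in> L ==> br (X + Y) Z = br X Z + br Y Z" "X \<in> L ==> Z \<in> L ==> br (r *R X) Z = r *R br X Z"
  "X \<in> L ==> Y \<in> L ==> Z \<in> L ==> br (X - Y) Z = br X Z - br Y Z" "X \<in> L ==> Z \<in> L ==> br (- X) Z = - br X Z"
  "X \<in> L ==> Y \<in> L ==> Z \<in> L ==> br Z (X + Y) = br Z X + br Z Y" "X \<in> L ==> Z \<in> L ==> br Z (r *R X) = r *R br Z X"
  "X \<in> L ==> Y \<in> L ==> Z \<in> L ==> br Z (X - Y) = br Z X - br Z Y" "X \<in> L ==> Z \<in> L ==> br Z (- X) = - br Z X"
  "Z \<in> L ==> br Z 0 = 0" "Z \<in> L ==> br 0 Z = 0"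
 using lin_on_add[OF bracket_lin1] lin_on_scale[OF bracket_lin1] lin_on_diff[OF bracket_lin1 subL] lin_on_neg[OF bracket_lin1]
  lin_on_add[OF bracket_lin2] lin_on_scale[OF bracket_lin2] lin_on_diff[OF bracket_lin2 subL] lin_on_neg[OF bracket_lin2]
  lin_on_0[OF bracket_lin2 subL] lin_on_0[OF bracket_lin1 subL] by simp_all

lemma jac: "X \<in> L ==> Y \<in> L ==> Z \<in> L ==> br (br X Y) Z = br X (br Y Z) - br Y (br X Z)"
 using jacobi[of X Y Z] by (simp add: algebra_simps)

lemma ad_lin: "X \<in> L ==> Y \<in> L ==> lin_on L (%Z. br X (br Y Z))"
 by (rule lin_onI) (simp_all add: br_simps)

lemma killing_lin1: assumes "Y \<in> L" shows "lin_on L (%X. Bk X Y)"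
proof -
 have c: "trace_on L (%Z. br (X + r *R X') (br Y Z)) = trace_on L (%Z. br X (br Y Z) + r *R br X' (br Y Z))"
  if "X \<in> L" "X' \<in> L" for X X' r
  by (rule trace_on_cong[OF subL]) (use that assms in "simp add: br_simps")
 have l: "Bk (X + r *R X') Y = Bk X Y + r * Bk X' Y" if "X \<in> L" "X' \<in> L" for X X' r
  unfolding killing_def c[OF that] by (rule trace_on_lincomb[OF subL ad_lin _ ad_lin]) (use that assms in auto)
 show ?thesis by (rule lin_onI'[OF subL]) (simp add: l)
qed

lemma killing_sym: "X \<in> L ==> Y \<in> L ==> Bk X Y = Bk Y X"
 unfolding killing_def by (rule trace_on_commute[OF subL bracket_lin2 _ bracket_lin2]) auto

text \<open>For an automorphism \<sigma> with inverse \<tau>, \<open>br (\<sigma> X)\<close> is the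
  conjugate of \<open>br X\<close> by \<sigma>, and the trace does not see conjugation.\<close>

lemma killing_auto:
 assumes s: "lin_on L \<sigma>" "\<sigma> ` L <= L" and t: "lin_on L \<tau>" "\<tau> ` L <= L"
  and inv: "!!Z. Z \<in> L ==> \<sigma> (\<tau> Z) = Z" "!!Z. Z \<in> L ==> \<tau> (\<sigma> Z) = Z"
  and h: "!!X Y. X \<in> L ==> Y \<in> L ==> \<sigma> (br X Y) = br (\<sigma> X) (\<sigma> Y)" and X: "X \<in> L" "Y \<in> L"
 shows "Bk (\<sigma> X) (\<sigma> Y) = Bk X Y"
proof -
 have sl: "\<sigma> Z \<in> L" "\<tau> Z \<in> L" if "Z \<in> L" for Z using s t that by auto
 have "Bk (\<sigma> X) (\<sigma> Y) = trace_on L (%Z. \<sigma> (br X (br Y (\<tau> Z))))"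
  unfolding killing_def by (rule trace_on_cong[OF subL]) (use X in "simp add: h inv sl")
 also have "\<dots> = trace_on L (%Z. br X (br Y (\<tau> (\<sigma> Z))))"
 proof (rule trace_on_commute[OF subL s])
  show "lin_on L (%Z. br X (br Y (\<tau> Z)))"
   by (rule lin_onI) (use X in "simp_all add: lin_on_add[OF t(1)] lin_on_scale[OF t(1)] br_simps sl")
 qed (use X sl in auto)
 also have "\<dots> = Bk X Y" unfolding killing_def by (rule trace_on_cong[OF subL]) (simp add: inv)
 finally show ?thesis .
qed

lemma killing_Ad: assumes "g \<in> carrier G" "X \<in> L" "Y \<in> L" shows "Bk (Ad G g X) (Ad G g Y) = Bk X Y"
 by (rule killing_auto[where \<tau> = "Ad G (inv g)"])
  (use assms in "auto simp: Ad_lin Ad_in Ad_inv Ad_bracket")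

lemma killing_th: "X \<in> L ==> Y \<in> L ==> Bk (th X) (th Y) = Bk X Y"
 by (rule killing_auto[where \<tau> = th]) (auto simp: th_props)

text \<open>Both sides expand by the Jacobi identity; the outer terms match by cyclicity of the
  trace.\<close>

lemma killing_ad: assumes "X \<in> L" "Y \<in> L" "Z \<in> L" shows "Bk (br Z X) Y = - Bk X (br Z Y)"
proof -
 have l3: "lin_on L (%W. br A (br B (br C W)))" "(%W. br A (br B (br C W))) ` L <= L" if "A \<in> L" "B \<in> L" "C \<in> L" for A B C
  using that by (auto intro!: lin_onI simp: br_simps)
 have "Bk (br Z X) Y = trace_on L (%W. br Z (br X (br Y W)) + (-1) *R br X (br Z (br Y W)))"
  unfolding killing_def by (rule trace_on_cong[OF subL]) (use assms in "simp add: jac")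
 also have "\<dots> = trace_on L (%W. br Z (br X (br Y W))) - trace_on L (%W. br X (br Z (br Y W)))"
  by (subst trace_on_lincomb[OF subL l3 l3]) (use assms in auto)
 finally have 1: "Bk (br Z X) Y = trace_on L (%W. br Z (br X (br Y W))) - trace_on L (%W. br X (br Z (br Y W)))" .
 have "Bk X (br Z Y) = trace_on L (%W. br X (br Z (br Y W)) + (-1) *R br X (br Y (br Z W)))"
  unfolding killing_def by (rule trace_on_cong[OF subL]) (use assms in "simp add: jac br_simps")
 also have "\<dots> = trace_on L (%W. br X (br Z (br Y W))) - trace_on L (%W. br X (br Y (br Z W)))"
  by (subst trace_on_lincomb[OF subL l3 l3]) (use assms in auto)
 finally have 2: "Bk X (br Z Y) = trace_on L (%W. br X (br Z (br Y W))) - trace_on L (%W. br X (br Y (br Z W)))" .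
 have "trace_on L (%W. br Z (br X (br Y W))) = trace_on L (%W. br X (br Y (br Z W)))"
  by (rule trace_on_commute[OF subL bracket_lin2 _ ad_lin]) (use assms in auto)
 thus ?thesis using 1 2 by simp
qed

text \<open>The inner product for which brackets with elements of \<open>a\<close> are symmetric, so
  that they can be diagonalized together.\<close>

definition Bt :: "'e => 'e => real" where "Bt X Y = - Bk X (th Y)"

sublocale tt: inner_subspace L Bt
proof
 show "subspace L" by (rule subL)
 show "lin_on L (%X. Bt X Y)" if "Y \<in> L" for Y
  unfolding Bt_def by (rule lin_onI)
   (use lin_on_add[OF killing_lin1[of "th Y"]] lin_on_scale[OF killing_lin1[of "th Y"]] that in auto)
 show "Bt X Y = Bt Y X" if "X \<in> L" "Y \<in> L" for X Y
  using killing_th[of X "th Y"] killing_sym[of "th X" Y] that by (simp add: Bt_def th_props)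
 show "0 < Bt X X" if "X \<in> L" "X ~= 0" for X using th_props(5)[OF that] by (simp add: Bt_def)
qed

lemma Bk_Bt: "X \<in> L ==> Y \<in> L ==> Bk X Y = - Bt X (th Y)" by (simp add: Bt_def th_props)

lemma Bt_ad: assumes "X \<in> L" "Y \<in> L" "Z \<in> L" shows "Bt (br Z X) Y = - Bt X (br (th Z) Y)"
 using assms killing_ad[of X "th Y" Z] by (simp add: Bt_def th_props)

lemma Bt_th: "X \<in> L ==> Y \<in> L ==> Bt (th X) (th Y) = Bt X Y"
 by (simp add: Bt_def killing_th)

abbreviation "s \<equiv> ss G"
abbreviation "a \<equiv> aa G"
abbreviation "kl \<equiv> kk G"

lemma kl_eq: "kl = {X \<in> L. th X = X}" using iw by (simp add: iwasawa_decomposition_def)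

lemma sD: "X \<in> s ==> X \<in> L" "X \<in> s ==> th X = - X" by (auto simp: ss_def)

lemma a_props: "subspace a" "H \<in> a ==> H \<in> s" "H \<in> a ==> H \<in> L" "H \<in> a ==> H' \<in> a ==> br H H' = 0"
 using iw by (auto simp: iwasawa_decomposition_def abelian_subspace_def ss_def)

lemma sub_s: "subspace s"
 unfolding subspace_def ss_def using lin_on_0[OF th_props(3) subL] by (auto simp: th_simps)

sublocale si: inner_subspace s Bk
proof
 show "subspace s" by (rule sub_s)
 show "lin_on s (%X. Bk X Y)" if "Y \<in> s" for Y
  by (rule lin_on_subset[OF killing_lin1]) (use that sD in auto)
 show "Bk X Y = Bk Y X" if "X \<in> s" "Y \<in> s" for X Y using that sD killing_sym by auto
 show "0 < Bk X X" if "X \<in> s" "X ~= 0" for X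
  using tt.B_pos[of X] that sD[of X] by (simp add: Bk_Bt tt.B_simps)
qed

sublocale ai: inner_subspace a Bk
proof
 show "subspace a" by (rule a_props)
 show "lin_on a (%X. Bk X Y)" if "Y \<in> a" for Y
  by (rule lin_on_subset[OF killing_lin1]) (use that a_props in auto)
qed (use a_props si.B_sym si.B_pos in auto)

text \<open>Adding the line through Y to \<open>a\<close> gives an abelian subspace of
  \<open>s\<close>, and \<open>a\<close> is maximal among these.\<close>

lemma centralizer_s:
 assumes Y: "Y \<in> s" "!!H. H \<in> a ==> br H Y = 0" shows "Y \<in> a"
proof -
 define b where "b = {H + V | H V. H \<in> a & V \<in> span {Y}}"
 have YL: "Y \<in> L" using sD Y by auto
 have sb: "subspace b" unfolding b_def by (rule subspace_sums[OF a_props(1) subspace_span])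
 have ab: "br x y = 0" if xy: "x \<in> b" "y \<in> b" for x y
 proof -
  obtain H r where x: "x = H + r *R Y" "H \<in> a" using xy(1) by (auto simp: b_def span_singleton)
  obtain H' r' where y: "y = H' + r' *R Y" "H' \<in> a" using xy(2) by (auto simp: b_def span_singleton)
  have "br Y H' = 0" using bracket_anti[of Y H'] Y(2)[OF y(2)] YL a_props y by simp
  thus ?thesis using x y YL Y(2)[OF x(2)] a_props(3,4) by (simp add: br_simps bracket_self)
 qed
 have "a <= b" unfolding b_def using span_zero[of "{Y}"] by force
 moreover have "b <= s" using a_props(2) Y(1) sub_s by (auto simp: b_def span_singleton intro!: subspace_add subspace_scale)
 moreover have "abelian_subspace G b" using sb ab by (simp add: abelian_subspace_def)
 ultimately have "b = a" using iw unfolding iwasawa_decomposition_def by blast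
 moreover have "Y \<in> b" unfolding b_def using ai.in_E(5) span_base[of Y "{Y}"] by force
 ultimately show ?thesis by simp
qed

section \<open>Restricted root spaces\<close>

lemma rsD: "X \<in> rs \<alpha> ==> X \<in> L" "X \<in> rs \<alpha> ==> H \<in> a ==> br H X = \<alpha> H *R X"
 by (auto simp: root_space_def)

lemma rs_sub: "subspace (rs \<alpha>)"
 unfolding subspace_def root_space_def using a_props(3) by (auto simp: br_simps scaleR_add_right)

lemma Bt_aH: "H \<in> a ==> X \<in> L ==> Y \<in> L ==> Bt (br H X) Y = Bt X (br H Y)"
 using Bt_ad[of X Y H] a_props(2,3)[of H] sD(2)[of H] by (simp add: br_simps tt.B_simps)

lemma rs_orth:
 assumes "X \<in> rs \<alpha>" "Y \<in> rs \<beta>" "H \<in> a" "\<alpha> H ~= \<beta> H" shows "Bt X Y = 0"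
 using Bt_aH[OF assms(3) rsD(1)[OF assms(1)] rsD(1)[OF assms(2)]] rsD[OF assms(1)] rsD[OF assms(2)] assms
 by (simp add: tt.B_simps)

lemma th_rs: "X \<in> rs \<alpha> ==> th X \<in> rs (fscale (-1) \<alpha>)"
proof -
 assume X: "X \<in> rs \<alpha>"
 have "br H (th X) = fscale (-1) \<alpha> H *R th X" if H: "H \<in> a" for H
 proof -
  have "br H (th X) = - br (th H) (th X)" using H a_props sD(2)[of H] rsD(1)[OF X] by (simp add: br_simps)
  also have "\<dots> = - th (br H X)" using H a_props rsD(1)[OF X] by (simp add: th_props)
  finally show ?thesis using rsD[OF X] H by (simp add: th_simps fscale_def)
 qed
 thus ?thesis using rsD(1)[OF X] by (simp add: root_space_def)
qed

abbreviation "\<Sigma> \<equiv> roots G"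
abbreviation "reg H \<equiv> \<forall>\<alpha>\<in>\<Sigma>. \<alpha> H ~= 0"

lemma rootD: "\<alpha> \<in> \<Sigma> ==> \<alpha> \<in> dual_space a" "\<alpha> \<in> \<Sigma> ==> \<alpha> ~= 0" "\<alpha> \<in> \<Sigma> ==> rs \<alpha> ~= {0}"
 by (auto simp: roots_def)

lemma dual_a: "\<alpha> \<in> dual_space a ==> lin_on a \<alpha>" "\<alpha> \<in> dual_space a ==> H \<notin> a ==> \<alpha> H = 0"
 using dual_lin_on[OF a_props(1)] by (auto simp: dual_space_def)

lemma dual_scale: "\<alpha> \<in> dual_space a ==> fscale r \<alpha> \<in> dual_space a"
proof -
 assume \<alpha>: "\<alpha> \<in> dual_space a"
 have "lin_on a (fscale r \<alpha>)"
  using dual_a(1)[OF \<alpha>] unfolding lin_on_def fscale_def by (auto simp: algebra_simps)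
 moreover have "ext0 a (fscale r \<alpha>) = fscale r \<alpha>" using dual_a(2)[OF \<alpha>] by (auto simp: ext0_def fscale_def)
 ultimately show ?thesis using lin_on_dual[OF _ a_props(1)] by metis
qed

lemma dual_eqI: "\<alpha> \<in> dual_space a ==> \<beta> \<in> dual_space a ==> (!!H. H \<in> a ==> \<alpha> H = \<beta> H) ==> \<alpha> = \<beta>"
 using dual_a(2) by (metis ext)

lemma root_rs_dual: assumes "\<alpha> \<in> dual_space a" "\<alpha> ~= 0" "X \<in> rs \<alpha>" "X ~= 0" shows "\<alpha> \<in> \<Sigma>"
 using assms by (auto simp: roots_def)

lemma root_nonzero: assumes "\<alpha> \<in> \<Sigma>" obtains X where "X \<in> rs \<alpha>" "X ~= 0"
 using rootD(3)[OF assms] subspace_0[OF rs_sub] by blast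

lemma rs_orth_roots: "\<alpha> \<in> \<Sigma> ==> \<beta> \<in> \<Sigma> ==> \<alpha> ~= \<beta> ==> X \<in> rs \<alpha> ==> Y \<in> rs \<beta> ==> Bt X Y = 0"
 using rs_orth dual_eqI rootD(1) by metis

lemma root_neg: assumes "\<alpha> \<in> \<Sigma>" shows "fscale (-1) \<alpha> \<in> \<Sigma>"
proof -
 obtain X where X: "X \<in> rs \<alpha>" "X ~= 0" by (rule root_nonzero[OF assms])
 have "th X ~= 0" using X rsD(1)[OF X(1)] th_props(2)[of X] lin_on_0[OF th_props(3) subL] by auto
 moreover have "fscale (-1) \<alpha> ~= 0" using rootD(2)[OF assms] by (auto simp: fscale_def fun_eq_iff)
 ultimately show ?thesis using root_rs_dual[OF dual_scale[OF rootD(1)[OF assms]] _ th_rs[OF X(1)]] by blast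
qed

text \<open>Unit vectors chosen in distinct root spaces are orthonormal, so their number is bounded
  by the dimension.\<close>

lemma finite_roots: "finite \<Sigma>"
proof (rule ccontr)
 assume "infinite \<Sigma>"
 then obtain F where F: "F <= \<Sigma>" "finite F" "card F = Suc (DIM('e))" using infinite_arbitrarily_large by blast
 have "\<forall>\<alpha>\<in>F. \<exists>X. X \<in> rs \<alpha> & Bt X X = 1"
 proof
  fix \<alpha> assume "\<alpha> \<in> F"
  then obtain X where X: "X \<in> rs \<alpha>" "X ~= 0" using F root_nonzero by blast
  have p: "Bt X X > 0" by (rule tt.B_pos[OF rsD(1)[OF X(1)] X(2)])
  show "\<exists>X. X \<in> rs \<alpha> & Bt X X = 1"
   using X rs_sub rsD(1)[OF X(1)] p by (intro exI[of _ "(1 / sqrt (Bt X X)) *R X"]) (simp add: subspace_scale tt.B_simps)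
 qed
 then obtain x where x: "!!\<alpha>. \<alpha> \<in> F ==> x \<alpha> \<in> rs \<alpha>" "!!\<alpha>. \<alpha> \<in> F ==> Bt (x \<alpha>) (x \<alpha>) = 1" by metis
 have o: "Bt (x \<alpha>) (x \<beta>) = 0" if "\<alpha> \<in> F" "\<beta> \<in> F" "\<alpha> ~= \<beta>" for \<alpha> \<beta>
  by (rule rs_orth_roots[of \<alpha> \<beta>]) (use that F(1) x(1) in auto)
 have inj: "inj_on x F" using o x(2) by (fastforce intro: inj_onI)
 have "independent (x ` F)"
 proof (rule tt.orthonormal_independent)
  show "x ` F <= L" using x(1) rsD(1) by blast
  show "Bt b c = (if b = c then 1 else 0)" if "b \<in> x ` F" "c \<in> x ` F" for b c
   using that o x(2) by auto
 qed (use F in simp)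
 hence "card (x ` F) <= DIM('e)" by (rule independent_card_le)
 thus False using F card_image[OF inj] by simp
qed

abbreviation "g0 \<equiv> {X \<in> L. \<forall>H\<in>a. br H X = 0}"

text \<open>The root space decomposition in dual form. Joint eigenvectors of the brackets with
  \<open>a\<close> span \<open>L\<close>, and each lies in \<open>g0\<close> or in a root space
  according to whether its weight vanishes.\<close>

lemma orth_all:
 assumes x: "x \<in> L" "!!y. y \<in> g0 ==> Bt x y = 0" "!!\<alpha> y. \<alpha> \<in> \<Sigma> ==> y \<in> rs \<alpha> ==> Bt x y = 0"
 shows "x = 0"
proof -
 let ?J = "{v \<in> L. \<forall>T\<in>br ` a. \<exists>c. T v = c *R v}"
 have sp: "span ?J = L"
 proof (rule tt.joint_eigenspaces_span)
  fix S T X assume "S \<in> br ` a" "T \<in> br ` a" "X \<in> L"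
  thus "S (T X) = T (S X)" using jac[of _ _ X] a_props(3,4) by (auto simp: br_simps) (metis (no_types, lifting) br_simps(10) eq_iff_diff_eq_0)
 qed (use a_props Bt_aH bracket_lin2 in auto)
 have J: "Bt x v = 0" if v: "v \<in> ?J" for v
 proof (cases "v = 0")
  case True thus ?thesis using x tt.B_simps by simp
 next
  case False
  have vL: "v \<in> L" using v by simp
  define l where "l = (%H. Bt (br H v) v / Bt v v)"
  have vv: "Bt v v > 0" by (rule tt.B_pos[OF vL False])
  have lin: "lin_on a l" unfolding l_def
   by (rule lin_onI) (use a_props(3) vL in "simp_all add: br_simps tt.B_simps add_divide_distrib")
  have e: "br H v = ext0 a l H *R v" if H: "H \<in> a" for H
  proof -
   obtain c where c: "br H v = c *R v" using v H by blast
   thus ?thesis using vv vL H by (simp add: l_def tt.B_simps)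
  qed
  hence vr: "v \<in> rs (ext0 a l)" using vL by (simp add: root_space_def)
  show ?thesis
  proof (cases "ext0 a l = 0")
   case True
   hence "v \<in> g0" using e vL by (auto simp: fun_eq_iff)
   thus ?thesis by (rule x(2))
  next
   case False
   thus ?thesis using x(3) root_rs_dual[OF lin_on_dual[OF lin a_props(1)] _ vr \<open>v ~= 0\<close>] vr by blast
  qed
 qed
 define W where "W = {y \<in> L. Bt x y = 0}"
 have "subspace W" unfolding subspace_def W_def using x(1) by (auto simp: tt.B_simps)
 moreover have "?J <= W" using J by (auto simp: W_def)
 ultimately have "span ?J <= W" by (simp add: span_minimal)
 hence "Bt x x = 0" using sp x(1) by (auto simp: W_def)
 thus ?thesis using tt.B_pos[of x] x(1) by force
qed

lemma Hvec_props:
 assumes "\<alpha> \<in> dual_space a"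
 shows "Hvec G \<alpha> \<in> a" "H \<in> a ==> \<alpha> H = Bk (Hvec G \<alpha>) H" "\<alpha> ~= 0 ==> Hvec G \<alpha> ~= 0"
proof -
 obtain X where X: "X \<in> a" "!!y. y \<in> a ==> \<alpha> y = Bk X y" by (rule ai.riesz[OF dual_a(1)[OF assms]], rule that)
 have "Hvec G \<alpha> = X"
  unfolding Hvec_def
 proof (rule the_equality)
  fix H assume H: "H \<in> a & (\<forall>H'\<in>a. \<alpha> H' = Bk H H')"
  have "H - X = 0" by (rule ai.B_nondeg) (use H X in "auto simp: ai.B_simps")
  thus "H = X" by simp
 qed (use X in auto)
 thus 1: "Hvec G \<alpha> \<in> a" and 2: "H \<in> a ==> \<alpha> H = Bk (Hvec G \<alpha>) H" for H using X by auto
 show "Hvec G \<alpha> ~= 0" if "\<alpha> ~= 0"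
 proof
  assume "Hvec G \<alpha> = 0"
  hence "\<alpha> = 0" using 2 ai.B_simps(9) dual_a(2)[OF assms] by (metis ext zero_fun_apply)
  thus False using that by simp
 qed
qed

abbreviation "Hv \<equiv> Hvec G"
abbreviation "nrm \<alpha> \<equiv> Bk (Hvec G \<alpha>) (Hvec G \<alpha>)"

lemma nrm_pos: "\<alpha> \<in> dual_space a ==> \<alpha> ~= 0 ==> nrm \<alpha> > 0" "\<alpha> \<in> dual_space a ==> \<alpha> (Hv \<alpha>) = nrm \<alpha>"
 using Hvec_props(1)[of \<alpha>] Hvec_props(3)[of \<alpha>] ai.B_pos[of "Hv \<alpha>"] Hvec_props(2)[of \<alpha> "Hv \<alpha>"] by simp_all

lemma Hvec_eqI: "\<alpha> \<in> dual_space a ==> X \<in> a ==> (!!y. y \<in> a ==> \<alpha> y = Bk X y) ==> Hv \<alpha> = X"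
proof -
 assume a: "\<alpha> \<in> dual_space a" "X \<in> a" "!!y. y \<in> a ==> \<alpha> y = Bk X y"
 have "Hv \<alpha> - X = 0" by (rule ai.B_nondeg) (use a Hvec_props(1,2)[OF a(1)] in "auto simp: ai.B_simps")
 thus ?thesis by simp
qed

lemma Hvec_scale: "\<alpha> \<in> dual_space a ==> Hv (fscale r \<alpha>) = r *R Hv \<alpha>"
 by (rule Hvec_eqI) (use Hvec_props(1,2) in "auto simp: dual_scale ai.B_simps fscale_def[of r \<alpha>, THEN fun_cong]")

lemma rs_bracket:
 assumes "X \<in> rs \<alpha>" "Y \<in> rs \<beta>" shows "br X Y \<in> rs (%H. \<alpha> H + \<beta> H)"
proof -
 have "br H (br X Y) = (\<alpha> H + \<beta> H) *R br X Y" if "H \<in> a" for H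
  using jacobi[of H X Y] rsD[OF assms(1)] rsD[OF assms(2)] a_props(3)[OF that] that by (simp add: br_simps scaleR_add_left)
 thus ?thesis using rsD(1) assms by (simp add: root_space_def)
qed

lemma rs_th_bracket_g0: assumes "X \<in> rs \<alpha>" "Y \<in> rs \<alpha>" shows "br (th X) Y \<in> g0"
 using rs_bracket[OF th_rs[OF assms(1)] assms(2)] by (auto simp: root_space_def fscale_def)

text \<open>The bracket lies in \<open>s\<close> and commutes with \<open>a\<close>, hence lies in
  \<open>a\<close>; its pairing with H is determined by invariance of the Killing form.\<close>

lemma br_X_thX:
 assumes "\<alpha> \<in> dual_space a" "X \<in> rs \<alpha>" shows "br X (th X) = (- Bt X X) *R Hv \<alpha>"
proof -
 note XL = rsD(1)[OF assms(2)]
 let ?Y = "br X (th X)"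
 have Y0: "br (th X) X \<in> g0" by (rule rs_th_bracket_g0[OF assms(2,2)])
 have an: "br (th X) X = - ?Y" using bracket_anti[of "th X" X] XL by simp
 have "th ?Y = - ?Y" using an XL by (simp add: th_props)
 hence "?Y \<in> s" using XL by (simp add: ss_def)
 moreover have "br H ?Y = 0" if "H \<in> a" for H
 proof -
  have "br H (- ?Y) = 0" using Y0 that unfolding an by blast
  moreover have "br H (- ?Y) = - br H ?Y" using br_simps(8)[of ?Y H] XL a_props(3)[OF that] by simp
  ultimately show ?thesis by simp
 qed
 ultimately have Ya: "?Y \<in> a" by (rule centralizer_s)
 have "Bk ?Y H = (- Bt X X) * \<alpha> H" if H: "H \<in> a" for H
 proof -
  have "Bk ?Y H = Bk H ?Y" using Ya H by (rule ai.B_sym)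
  also have "\<dots> = - Bk (br X H) (th X)" using killing_ad[of H "th X" X] XL a_props(3)[OF H] by simp
  also have "br X H = - (\<alpha> H *R X)" using bracket_anti[of X H] XL a_props(3)[OF H] rsD(2)[OF assms(2) H] by simp
  finally show ?thesis
   using XL lin_on_neg[OF killing_lin1[of "th X"], of "\<alpha> H *R X"] lin_on_scale[OF killing_lin1[of "th X"], of X "\<alpha> H"]
   by (simp add: Bt_def)
 qed
 hence "?Y - (- Bt X X) *R Hv \<alpha> = 0"
  using Ya Hvec_props[OF assms(1)] by (intro ai.B_nondeg) (auto simp: ai.B_simps)
 thus ?thesis by (simp only: right_minus_eq)
qed

text \<open>The vectors \<open>ad(e)^n Y\<close> for a lowest weight vector \<open>Y\<close> of weight \<open>1 - 4 j\<close> (in units of \<open>\<alpha>\<close>)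
 satisfy \<open>ad(th e) Z (n + 1) = c (n + 1) (1 - 4 j + 2 n) Z n\<close>; the odd factor never vanishes, so the
 string never ends.\<close>

lemma four_not_root:
 assumes \<alpha>: "\<alpha> \<in> \<Sigma>" shows "fscale 4 \<alpha> \<notin> \<Sigma>"
proof
 let ?\<beta> = "fscale 4 \<alpha>"
 assume \<beta>: "?\<beta> \<in> \<Sigma>"
 note d = rootD(1)[OF \<alpha>] and db = rootD(1)[OF \<beta>]
 obtain e where e: "e \<in> rs ?\<beta>" "e ~= 0" by (rule root_nonzero[OF \<beta>])
 obtain Y where Y: "Y \<in> rs \<alpha>" "Y ~= 0" by (rule root_nonzero[OF \<alpha>])
 note eL = rsD(1)[OF e(1)]
 obtain H0 where H0: "H0 \<in> a" "\<alpha> H0 ~= 0" using rootD(2)[OF \<alpha>] dual_eqI[OF d, of 0] dual_scale[OF d, of 0] by (auto simp: fscale_def zero_fun_def)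
 have injf: "r = r'" if "fscale r \<alpha> = fscale r' \<alpha>" for r r' using fun_cong[OF that, of H0] H0 by (simp add: fscale_def)
 have step: "br e X \<in> rs (fscale (r + 4) \<alpha>)" "br (th e) X \<in> rs (fscale (r - 4) \<alpha>)" if "X \<in> rs (fscale r \<alpha>)" for X r
  using rs_bracket[OF e(1) that] rs_bracket[OF th_rs[OF e(1)] that] by (simp_all add: fscale_def algebra_simps)
 define f where "f n = (br (th e) ^^ n) Y" for n
 have f: "f n \<in> rs (fscale (1 - 4 * real n) \<alpha>)" for n
 proof (induction n)
  case 0 thus ?case using Y by (simp add: f_def fscale_def)
 next
  case (Suc n)
  thus ?case using step(2)[OF Suc] by (simp add: f_def algebra_simps)
 qed
 have "\<exists>n. f n = 0"
 proof (rule ccontr)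
  assume "\<nexists>n. f n = 0"
  hence "fscale (1 - 4 * real n) \<alpha> \<in> \<Sigma>" for n
  proof (intro root_rs_dual[OF dual_scale[OF d] _ f])
   have "real (4 * n) ~= real 1" unfolding of_nat_eq_iff by presburger
   hence "1 - 4 * real n ~= 0" by simp
   thus "fscale (1 - 4 * real n) \<alpha> ~= 0" using H0 by (auto simp: fscale_def fun_eq_iff)
  qed auto
  hence "range (%n. fscale (1 - 4 * real n) \<alpha>) <= \<Sigma>" by blast
  moreover have "inj (%n. fscale (1 - 4 * real n) \<alpha>)" by (rule injI) (use injf in force)
  ultimately show False using finite_roots finite_subset range_inj_infinite by blast
 qed
 then obtain m where m: "f m = 0" "!!i. i < m ==> f i ~= 0" using exists_least_iff[of "%n. f n = 0"] by blast
 then obtain j where j: "m = Suc j" using Y(2) by (cases m) (auto simp: f_def)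
 define Z where "Z n = (br e ^^ n) (f j)" for n
 have Z: "Z n \<in> rs (fscale (1 - 4 * real j + 4 * real n) \<alpha>)" for n
 proof (induction n)
  case 0 thus ?case using f[of j] by (simp add: Z_def)
 next
  case (Suc n)
  thus ?case using step(1)[OF Suc] by (simp add: Z_def algebra_simps)
 qed
 have ZL: "Z n \<in> L" for n using rsD(1)[OF Z] .
 have Z0: "br (th e) (Z 0) = 0" using m(1) by (simp add: Z_def j f_def)
 define q where "q = Bt e e * (4 * nrm \<alpha>)"
 have q0: "q > 0" using tt.B_pos[OF eL e(2)] nrm_pos(1)[OF d rootD(2)[OF \<alpha>]] by (simp add: q_def)
 have HZ: "br (br (th e) e) (Z n) = (q * (1 - 4 * real j + 4 * real n)) *R Z n" for n
 proof -
  have "br (th e) e = Bt e e *R (4 *R Hv \<alpha>)"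
   using br_X_thX[OF db e(1)] bracket_anti[of "th e" e] eL by (simp add: Hvec_scale[OF d])
  hence "br (br (th e) e) (Z n) = (Bt e e * 4) *R br (Hv \<alpha>) (Z n)"
   using ZL a_props(3)[OF Hvec_props(1)[OF d]] by (simp add: br_simps)
  also have "br (Hv \<alpha>) (Z n) = ((1 - 4 * real j + 4 * real n) * nrm \<alpha>) *R Z n"
   using rsD(2)[OF Z Hvec_props(1)[OF d]] by (simp add: fscale_def nrm_pos(2)[OF d])
  finally show ?thesis by (simp add: q_def mult.assoc mult.left_commute mult.commute)
 qed
 have key: "br (th e) (Z (Suc n)) = (q * (real n + 1) * (1 - 4 * real j + 2 * real n)) *R Z n" for n
 proof (induction n)
  case 0
  have "br (th e) (Z (Suc 0)) = br (br (th e) e) (Z 0) + br e (br (th e) (Z 0))"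
   using jacobi[of "th e" e "Z 0"] eL ZL[of 0] by (simp add: Z_def)
  thus ?case using Z0 HZ[of 0] eL by (simp add: br_simps)
 next
  case (Suc n)
  have "br (th e) (Z (Suc (Suc n))) = br (br (th e) e) (Z (Suc n)) + br e (br (th e) (Z (Suc n)))"
   using jacobi[of "th e" e "Z (Suc n)"] eL ZL[of "Suc n"] by (simp add: Z_def)
  also have "br e (br (th e) (Z (Suc n))) = (q * (real n + 1) * (1 - 4 * real j + 2 * real n)) *R Z (Suc n)"
   unfolding Suc using eL ZL[of n] by (simp add: br_simps Z_def)
  finally show ?case unfolding HZ by (simp only: scaleR_add_left[symmetric]) (simp add: algebra_simps)
 qed
 have norm: "Bt (Z (Suc n)) (Z (Suc n)) = - (q * (real n + 1) * (1 - 4 * real j + 2 * real n)) * Bt (Z n) (Z n)" for n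
 proof -
  have "Bt (br e (Z n)) (Z (Suc n)) = - Bt (Z n) (br (th e) (Z (Suc n)))" by (rule Bt_ad) (use eL ZL in auto)
  thus ?thesis unfolding key using ZL by (simp add: tt.B_simps Z_def)
 qed
 have ne: "Z n ~= 0" for n
 proof (induction n)
  case 0 thus ?case using m(2)[of j] j by (simp add: Z_def)
 next
  case (Suc n)
  have "real (1 + 2 * n) ~= real (4 * j)" unfolding of_nat_eq_iff by presburger
  hence "1 - 4 * real j + 2 * real n ~= 0" by simp
  hence "Bt (Z (Suc n)) (Z (Suc n)) ~= 0"
   unfolding norm using q0 tt.B_pos[OF ZL Suc] by auto
  thus ?case using tt.B_simps(9)[of 0] by auto
 qed
 \<comment> \<open>At n = 2 j the factor 1 - 4 j + 2 n equals 1, so the norm recursion gives a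
   nonzero vector of negative squared length.\<close>
 have "Bt (Z (Suc (2 * j))) (Z (Suc (2 * j))) > 0" by (rule tt.B_pos[OF ZL ne])
 moreover have "Bt (Z (Suc (2 * j))) (Z (Suc (2 * j))) < 0"
  unfolding norm using q0 tt.B_pos[OF ZL ne] by (auto intro!: mult_neg_pos mult_pos_pos)
 ultimately show False by simp
qed

end

context iwasawa
begin

section \<open>The compact group and the Weyl group\<close>

abbreviation "K \<equiv> Kgrp G"

lemma KD: "g \<in> K ==> g \<in> carrier G" "g \<in> K ==> Ad G g ` kl = kl"
 by (auto simp: Kgrp_def lie_normalizer_def)

lemma Ad_image_inv: assumes g: "g \<in> carrier G" "Ad G g ` V = V" "V <= L" shows "Ad G (inv g) ` V = V"
proof -
 have "Ad G (inv g) ` (Ad G g ` V) = (%x. x) ` V"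
  unfolding image_image by (rule image_cong[OF refl]) (use Ad_inv(1)[OF g(1)] g(3) in blast)
 thus ?thesis using g by simp
qed

lemma Ad_image_mult:
 assumes g: "g \<in> carrier G" "h \<in> carrier G" "Ad G g ` V = V" "Ad G h ` V = V" "V <= L" shows "Ad G (g \<otimes> h) ` V = V"
proof -
 have "Ad G g ` (Ad G h ` V) = Ad G (g \<otimes> h) ` V"
  unfolding image_image by (rule image_cong[OF refl]) (use Ad_mult[OF g(1,2)] g(5) in auto)
 thus ?thesis using g by simp
qed

lemma kl_L: "kl <= L" by (auto simp: kl_eq)

lemma K_grp: "\<one> \<in> K" "g \<in> K ==> inv g \<in> K" "g \<in> K ==> h \<in> K ==> g \<otimes> h \<in> K"
proof -
 have "Ad G \<one> ` kl = (%x. x) ` kl" by (rule image_cong[OF refl]) (use Ad_one kl_L in blast)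
 thus "\<one> \<in> K" by (simp add: Kgrp_def lie_normalizer_def)
 show "inv g \<in> K" if g: "g \<in> K"
  unfolding Kgrp_def lie_normalizer_def using Ad_image_inv[OF KD[OF g] kl_L] KD(1)[OF g] by simp
 show "g \<otimes> h \<in> K" if g: "g \<in> K" "h \<in> K"
  unfolding Kgrp_def lie_normalizer_def
  using Ad_image_mult[OF KD(1)[OF g(1)] KD(1)[OF g(2)] KD(2)[OF g(1)] KD(2)[OF g(2)] kl_L] KD(1)[OF g(1)] KD(1)[OF g(2)] by simp
qed

lemma kl_s_decomp:
 assumes "X \<in> L" shows "(1/2) *R (X + th X) \<in> kl" "(1/2) *R (X - th X) \<in> s" "X = (1/2) *R (X + th X) + (1/2) *R (X - th X)"
proof -
 show "(1/2) *R (X + th X) \<in> kl" "(1/2) *R (X - th X) \<in> s"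
  using assms by (simp_all add: kl_eq ss_def th_simps th_props add.commute scaleR_diff_right)
 have "(1/2) *R (X + th X) + (1/2) *R (X - th X) = (1/2) *R (X + X)" by (simp only: scaleR_add_right[symmetric]) simp
 thus "X = (1/2) *R (X + th X) + (1/2) *R (X - th X)" by (simp add: scaleR_2[symmetric])
qed

lemma kl_s_orth: "X \<in> kl ==> Y \<in> s ==> Bt X Y = 0"
 using Bt_th[of X Y] by (auto simp: kl_eq ss_def tt.B_simps)

text \<open>The Killing form is invariant and \<open>kl\<close> is orthogonal to \<open>s\<close>,
  so the \<open>kl\<close>-component U of the image satisfies Bk U U = 0; the form is definite on
  \<open>kl\<close>.\<close>

lemma Ad_K_s: assumes "k \<in> K" "X \<in> s" shows "Ad G k X \<in> s"
proof -
 note kc = KD(1)[OF assms(1)] and XL = sD(1)[OF assms(2)]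
 let ?Y = "Ad G k X"
 have YL: "?Y \<in> L" by (rule Ad_in[OF kc XL])
 define U where "U = (1/2) *R (?Y + th ?Y)"
 define V where "V = (1/2) *R (?Y - th ?Y)"
 have UV: "U \<in> kl" "V \<in> s" "?Y = U + V" using kl_s_decomp[OF YL] by (auto simp: U_def V_def)
 have uvL: "U \<in> L" "V \<in> L" using UV kl_L sD by auto
 obtain U' where U': "U' \<in> kl" "U = Ad G k U'" using UV(1) KD(2)[OF assms(1)] by blast
 have U'L: "U' \<in> L" using U' kl_L by auto
 have "Bk ?Y U = Bk X U'" unfolding U'(2) by (rule killing_Ad[OF kc XL U'L])
 also have "\<dots> = 0"
  using kl_s_orth[OF U'(1) assms(2)] killing_sym[OF XL U'L] Bk_Bt[OF U'L XL] sD(2)[OF assms(2)] U'L XL by (simp add: tt.B_simps)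
 finally have "Bk (U + V) U = 0" using UV by simp
 moreover have "Bk (U + V) U = Bk U U + Bk V U" using lin_on_add[OF killing_lin1] uvL by simp
 moreover have "Bk V U = 0" "Bk U U = - Bt U U"
  using kl_s_orth[OF UV(1,2)] killing_sym[OF uvL] Bk_Bt[OF uvL] sD(2)[OF UV(2)] uvL UV(1) by (auto simp: tt.B_simps Bk_Bt kl_eq)
 ultimately have "Bt U U = 0" by simp
 hence "U = 0" using tt.B_pos[OF uvL(1)] by force
 thus ?thesis using UV by simp
qed

lemma K_th: assumes "k \<in> K" "X \<in> L" shows "Ad G k (th X) = th (Ad G k X)"
proof -
 note kc = KD(1)[OF assms(1)] and d = kl_s_decomp[OF assms(2)]
 define U where "U = (1/2) *R (X + th X)"
 define V where "V = (1/2) *R (X - th X)"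
 have UV: "U \<in> kl" "V \<in> s" "X = U + V" "U \<in> L" "V \<in> L" using d kl_L sD by (auto simp: U_def V_def)
 have AU: "Ad G k U \<in> kl" using KD(2)[OF assms(1)] UV(1) by blast
 have AV: "Ad G k V \<in> s" by (rule Ad_K_s[OF assms(1) UV(2)])
 have "th X = U - V" using UV sD(2)[OF UV(2)] by (simp add: th_simps kl_eq)
 hence "Ad G k (th X) = Ad G k U - Ad G k V" using lin_on_diff[OF Ad_lin[OF kc] subL] UV by simp
 also have "\<dots> = th (Ad G k U + Ad G k V)" using AU sD[OF AV] by (simp add: th_simps kl_eq)
 also have "\<dots> = th (Ad G k X)" using lin_on_add[OF Ad_lin[OF kc]] UV by simp
 finally show ?thesis .
qed

lemma Bt_Ad: "k \<in> K ==> X \<in> L ==> Y \<in> L ==> Bt (Ad G k X) (Ad G k Y) = Bt X Y"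
 using killing_Ad[OF KD(1), of k X "th Y"] K_th[of k Y] by (simp add: Bt_def)

text \<open>The tool by which \<open>Ad\<close> along a one-parameter subgroup is computed: a
  candidate that solves the same linear equation with the same initial value is the right
  one.\<close>

lemma ad_ode_unique:
 assumes T: "T \<in> L" and y: "!!t. y t \<in> L" "!!t. (y hvd br T (y t)) (at t)"
  and z: "!!t. z t \<in> L" "!!t. (z hvd br T (z t)) (at t)" and eq: "y 0 = z 0"
 shows "y t = z t"
proof -
 obtain A where A: "linear A" "!!x. x \<in> L ==> A x = br T x" by (rule lin_on_extend[OF bracket_lin2[OF T] subL], rule that)
 obtain C where C: "!!x. norm (A x) <= C * norm x" using A(1) linear_bounded by blast
 have "(%t. y t - z t) t = 0"
 proof (rule linear_ode_unique[where u = "%t. y t - z t" and C = C and u' = "%t. A (y t - z t)"])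
  show "((%t. y t - z t) hvd A (y t - z t)) (at t)" for t
   using has_vector_derivative_diff[OF y(2)[of t] z(2)[of t]] A y(1) z(1) by (simp add: linear_diff)
 qed (use C eq in auto)
 thus ?thesis by simp
qed

text \<open>Since \<open>th T = T\<close>, applying \<open>th\<close> before or after
  \<open>Ad (ex T t)\<close> solves the same linear equation. So \<open>Ad (ex T t)\<close> commutes
  with \<open>th\<close> and preserves its fixed space.\<close>

lemma ex_K: assumes "T \<in> kl" shows "ex T t \<in> K"
proof -
 have TL: "T \<in> L" "th T = T" using assms by (auto simp: kl_eq)
 note p = ex_props[OF TL(1)]
 obtain A where A: "linear A" "!!x. x \<in> L ==> A x = th x" by (rule lin_on_extend[OF th_props(3) subL], rule that)
 have c: "th (Ad G (ex T t) X) = Ad G (ex T t) (th X)" if X: "X \<in> L" for X t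
 proof (rule ad_ode_unique[OF TL(1)])
  fix t
  show "((%t. Ad G (ex T t) (th X)) hvd br T (Ad G (ex T t) (th X))) (at t)"
   by (rule Ad_ops_deriv[OF ex_ops[OF TL(1)]]) (use X in auto)
  have "((%t. A (Ad G (ex T t) X)) hvd A (br T (Ad G (ex T t) X))) (at t)"
   by (rule bounded_linear.has_vector_derivative[OF _ Ad_ops_deriv[OF ex_ops[OF TL(1)] X]])
    (use A in "simp add: linear_conv_bounded_linear")
  thus "((%t. th (Ad G (ex T t) X)) hvd br T (th (Ad G (ex T t) X))) (at t)"
   using A(2) X TL p(1) by (simp add: Ad_in th_props)
 qed (use X p(1,3) in "auto simp: Ad_in Ad_one")
 have "Ad G (ex T t) ` kl <= kl" for t
 proof
  fix Y assume "Y \<in> Ad G (ex T t) ` kl"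
  then obtain X where X: "X \<in> L" "th X = X" "Y = Ad G (ex T t) X" by (auto simp: kl_eq)
  thus "Y \<in> kl" using c[OF X(1)] Ad_in[OF p(1) X(1)] by (simp add: kl_eq)
 qed
 note sub = this
 have "kl <= Ad G (ex T t) ` kl"
 proof
  fix X assume X: "X \<in> kl"
  hence "Ad G (ex T (- t)) X \<in> kl" using sub by blast
  moreover have "X = Ad G (ex T t) (Ad G (ex T (- t)) X)" using Ad_inv(2)[OF p(1)] p(7) X kl_L by auto
  ultimately show "X \<in> Ad G (ex T t) ` kl" by blast
 qed
 thus ?thesis using sub p(1) by (auto simp: Kgrp_def lie_normalizer_def)
qed

abbreviation "M \<equiv> Mgrp G"

lemma ex_A: "H \<in> a ==> ex H t \<in> Agrp G"
proof -
 assume H: "H \<in> a"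
 have "ex (t *R H) 1 = ex H t" using ex_scale[OF a_props(3)[OF H], of t 1] by simp
 moreover have "one_param_subgroup G (t *R H) (ex (t *R H))" using ex_ops a_props(3)[OF H] by auto
 ultimately show ?thesis
  unfolding Agrp_def analytic_subgroup_def using H by (metis (mono_tags, lifting) generate.incl mem_Collect_eq ai.in_E(3))
qed

text \<open>Commuting with the group generated by exponentials of \<open>a\<close> is the same as
  fixing \<open>a\<close> pointwise under \<open>Ad\<close>; one direction differentiates, the other
  exponentiates.\<close>

lemma M_iff: "m \<in> M \<longleftrightarrow> m \<in> K & (\<forall>H\<in>a. Ad G m H = H)"
proof
 assume m: "m \<in> M"
 hence mK: "m \<in> K" by (simp add: Mgrp_def)
 note mc = KD(1)[OF mK]
 have "Ad G m H = H" if H: "H \<in> a" for H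
 proof -
  note HL = a_props(3)[OF H] and p = ex_props[OF a_props(3)[OF H]]
  have "m \<otimes> ex H t \<otimes> inv m = ex H t" for t
   using m ex_A[OF H, of t] mc p(1) by (simp add: Mgrp_def m_assoc)
  hence "vel c1 (%t. m \<otimes> ex H t \<otimes> inv m) 0 H" using p(4) by simp
  thus ?thesis by (rule Ad_eqI[OF mc p(4,3)])
 qed
 thus "m \<in> K & (\<forall>H\<in>a. Ad G m H = H)" using mK by blast
next
 assume m: "m \<in> K & (\<forall>H\<in>a. Ad G m H = H)"
 hence mc: "m \<in> carrier G" using KD by blast
 have gen: "m \<otimes> \<gamma> 1 = \<gamma> 1 \<otimes> m" if "X \<in> a" "one_param_subgroup G X \<gamma>" for X \<gamma>
 proof -
  have "\<gamma> = ex X" using ex_eqI[OF that(2)] by simp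
  hence "m \<otimes> \<gamma> 1 \<otimes> inv m = \<gamma> 1" using ex_conj[OF a_props(3)[OF that(1)] mc] m that by simp
  hence "m \<otimes> \<gamma> 1 \<otimes> inv m \<otimes> m = \<gamma> 1 \<otimes> m" by simp
  thus ?thesis using mc ops_props(1)[OF that(2)] by (simp add: m_assoc)
 qed
 have "x \<in> carrier G & m \<otimes> x = x \<otimes> m" if "x \<in> Agrp G" for x
  using that unfolding Agrp_def analytic_subgroup_def
 proof (induction rule: generate.induct)
  case one thus ?case using mc by simp
 next
  case (incl h) thus ?case using gen ops_props(1) by blast
 next
  case (inv h)
  hence h: "h \<in> carrier G" "m \<otimes> h = h \<otimes> m" using gen ops_props(1) by blast+
  have "inv h \<otimes> m = inv h \<otimes> (m \<otimes> h) \<otimes> inv h" using h(1) mc by (simp add: m_assoc)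
  also have "\<dots> = inv h \<otimes> (h \<otimes> m) \<otimes> inv h" using h by simp
  also have "\<dots> = (inv h \<otimes> h) \<otimes> (m \<otimes> inv h)" using h(1) mc by (simp only: m_assoc m_closed inv_closed)
  also have "\<dots> = m \<otimes> inv h" using h(1) mc by simp
  finally show ?case using h(1) mc by simp
 next
  case (eng h1 h2)
  thus ?case using mc by (simp add: m_assoc[symmetric]) (simp add: m_assoc)
 qed
 thus "m \<in> M" using m by (simp add: Mgrp_def)
qed

lemma M_K: "m \<in> M ==> m \<in> K" by (simp add: M_iff)

lemma M_rs: assumes "m \<in> M" "X \<in> rs \<alpha>" shows "Ad G m X \<in> rs \<alpha>"
proof -
 have m: "m \<in> carrier G" "!!H. H \<in> a ==> Ad G m H = H" using assms(1) M_iff KD by auto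
 have "br H (Ad G m X) = \<alpha> H *R Ad G m X" if H: "H \<in> a" for H
  using Ad_bracket[OF m(1) a_props(3)[OF H] rsD(1)[OF assms(2)]] m(2)[OF H] rsD[OF assms(2)] H
  by (simp add: lin_on_scale[OF Ad_lin[OF m(1)]])
 thus ?thesis using Ad_in[OF m(1) rsD(1)[OF assms(2)]] by (simp add: root_space_def)
qed

text \<open>Fixing \<open>a\<close> is a closed condition inside the compact \<open>K\<close>;
  compactness provides the maximum in \<open>M_transitive\<close>.\<close>

lemma M_compact: "compactin TG M"
proof (rule closed_compactin)
 show "compactin TG K" using S by (simp add: setting_def)
 have haus: "Hausdorff_space TG" using lie by (auto simp: lie_group_def smooth_manifold_def)
 show "M <= K" using M_K by blast
 have "closedin TG {g \<in> topspace TG. Ad G g H \<in> {H}}" if "H \<in> a" for H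
  by (rule closedin_continuous_map_preimage[OF Ad_continuous[OF a_props(3)[OF that]]]) simp
 hence "closedin TG (\<Inter>H\<in>a. {g \<in> topspace TG. Ad G g H \<in> {H}})"
  using ai.in_E(5) by (intro closedin_Inter) auto
 moreover have "closedin TG K" using compactin_imp_closedin[OF haus] S by (simp add: setting_def)
 ultimately have "closedin TG (K \<inter> (\<Inter>H\<in>a. {g \<in> topspace TG. Ad G g H \<in> {H}}))" by blast
 moreover have "K \<inter> (\<Inter>H\<in>a. {g \<in> topspace TG. Ad G g H \<in> {H}}) = M"
  using KD(1) by (auto simp: M_iff top_carrier)
 ultimately show "closedin TG M" by simp
qed

text \<open>The centralizer of \<open>a\<close> is stable under \<open>th\<close>; its part in
  \<open>s\<close> is \<open>a\<close> by maximality, and its part in \<open>kl\<close> generates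
  elements of \<open>M\<close>.\<close>

lemma g0_decomp: assumes "X \<in> g0" shows "(1/2) *R (X + th X) \<in> kl \<inter> g0" "(1/2) *R (X - th X) \<in> a"
proof -
 have XL: "X \<in> L" using assms by simp
 have t0: "br H (th X) = 0" if H: "H \<in> a" for H
 proof -
  have "br H (th X) = - th (br H X)" using H a_props sD(2)[of H] XL by (simp add: br_simps th_props)
  thus ?thesis using assms H lin_on_0[OF th_props(3) subL] by simp
 qed
 show "(1/2) *R (X + th X) \<in> kl \<inter> g0"
  using kl_s_decomp(1)[OF XL] assms t0 a_props(3) by (auto simp: br_simps)
 show "(1/2) *R (X - th X) \<in> a"
  by (rule centralizer_s[OF kl_s_decomp(2)[OF XL]]) (use assms t0 a_props(3) XL in "auto simp: br_simps")
qed

text \<open>\<open>M\<close> acts transitively, up to sign, on spheres in root spaces: maximize \<open>Bt (Ad m E) E'\<close> over \<open>M\<close>.\<close>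

lemma M_transitive:
 assumes \<alpha>: "\<alpha> \<in> \<Sigma>" and E: "E \<in> rs \<alpha>" "E' \<in> rs \<alpha>" "Bt E E = Bt E' E'" "E ~= 0"
 shows "\<exists>m\<in>M. E' = Ad G m E \<or> E' = - Ad G m E"
proof -
 note EL = rsD(1)[OF E(1)] rsD(1)[OF E(2)] and d = rootD(1)[OF \<alpha>]
 obtain l where l: "linear l" "!!x. x \<in> L ==> l x = Bt x E'" by (rule lin_on_extend[OF tt.B_lin1[OF EL(2)] subL], rule that)
 have cm: "continuous_map TG euclidean (%m. l (Ad G m E))"
 proof -
  have "continuous_map euclidean euclidean l"
   using l(1) by (simp add: linear_continuous_on linear_conv_bounded_linear)
  from continuous_map_compose[OF Ad_continuous[OF EL(1)] this] show ?thesis by (simp add: o_def)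
 qed
 have "compactin euclidean ((%m. l (Ad G m E)) ` M)" by (rule image_compactin[OF M_compact cm])
 hence "compact ((%m. l (Ad G m E)) ` M)" by simp
 moreover have "\<one> \<in> M" using K_grp(1) Ad_one a_props(3) by (auto simp: M_iff)
 ultimately obtain m where m: "m \<in> M" "!!m'. m' \<in> M ==> l (Ad G m' E) <= l (Ad G m E)"
  using compact_attains_sup[of "(%m. l (Ad G m E)) ` M"] by blast
 note mK = M_K[OF m(1)] and mc = KD(1)[OF M_K[OF m(1)]]
 define F where "F = Ad G m E"
 have F: "F \<in> rs \<alpha>" "F \<in> L" unfolding F_def using M_rs[OF m(1) E(1)] rsD(1) by auto
 have FF: "Bt F F = Bt E E" unfolding F_def by (rule Bt_Ad[OF mK EL(1) EL(1)])
 have r: "Bt E E > 0" by (rule tt.B_pos[OF EL(1) E(4)])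
 \<comment> \<open>The first order condition at the maximum, along curves \<open>ex T t\<close> that
   stay in \<open>M\<close>.\<close>
 have tan: "Bt (br T F) E' = 0" if T: "T \<in> kl" "T \<in> g0" for T
 proof -
  have TL: "T \<in> L" using T kl_L by auto
  note p = ex_props[OF TL]
  have TM: "ex T t \<in> M" for t
  proof -
   have "Ad G (ex T t) H = H" if H: "H \<in> a" for H
   proof (rule ad_ode_unique[OF TL])
    have "br T H = 0" using bracket_anti[OF TL a_props(3)[OF H]] T(2) H by simp
    thus "((%t. H) hvd br T H) (at t)" for t by simp
    show "((%t. Ad G (ex T t) H) hvd br T (Ad G (ex T t) H)) (at t)" for t
     by (rule Ad_ops_deriv[OF ex_ops[OF TL] a_props(3)[OF H]])
   qed (use p(1,3) a_props(3)[OF H] in "auto simp: Ad_in Ad_one")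
   thus ?thesis using ex_K[OF T(1)] by (simp add: M_iff)
  qed
  have "((%t. l (Ad G (ex T t) F)) hvd l (br T (Ad G (ex T 0) F))) (at 0)"
   by (rule bounded_linear.has_vector_derivative[OF _ Ad_ops_deriv[OF ex_ops[OF TL] F(2)]])
    (use l in "simp add: linear_conv_bounded_linear")
  hence "((%t. l (Ad G (ex T t) F)) has_real_derivative Bt (br T F) E') (at 0)"
   using l(2) p(3) F TL Ad_one by (simp add: has_real_derivative_iff_has_vector_derivative)
  moreover have "l (Ad G (ex T t) F) <= l (Ad G (ex T 0) F)" for t
  proof -
   have "ex T t \<otimes> m \<in> M" using TM m(1) Ad_mult[OF p(1) mc a_props(3)] K_grp(3) by (auto simp: M_iff)
   from m(2)[OF this] show ?thesis using Ad_mult[OF p(1) mc EL(1)] p(3) F Ad_one by (simp add: F_def)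
  qed
  ultimately show ?thesis using DERIV_local_max[of _ _ 0 1] by fastforce
 qed
 define q where "q = Bt E' F / Bt E E"
 define Y where "Y = E' - q *R F"
 have Y: "Y \<in> rs \<alpha>" "Y \<in> L" unfolding Y_def using rs_sub E(2) F(1) rsD(1) by (auto intro!: subspace_diff subspace_scale F EL)
 have YF: "Bt Y F = 0" unfolding Y_def using EL F r FF by (simp add: tt.B_simps q_def)
 have orth: "Bt (br X F) Y = 0" if X: "X \<in> g0" for X
 proof -
  define T where "T = (1/2) *R (X + th X)"
  define H where "H = (1/2) *R (X - th X)"
  have TH: "T \<in> kl" "T \<in> g0" "H \<in> a" "X = T + H" using g0_decomp[OF X] kl_s_decomp(3)[of X] X by (auto simp: T_def H_def)
  have L': "T \<in> L" "H \<in> L" using TH a_props by auto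
  have "Bt (br T F) F = - Bt F (br T F)" using Bt_ad[of F F T] L' F TH by (simp add: kl_eq)
  hence "Bt (br T F) F = 0" using tt.B_sym[of F "br T F"] L' F by simp
  hence "Bt (br T F) Y = 0" unfolding Y_def using tan[OF TH(1,2)] L' F EL by (simp add: tt.B_simps)
  moreover have "Bt (br H F) Y = 0" using rsD(2)[OF F(1) TH(3)] YF tt.B_sym[of F Y] F Y by (simp add: tt.B_simps)
  ultimately show ?thesis unfolding TH(4) using L' F Y by (simp add: br_simps tt.B_simps)
 qed
 \<comment> \<open>The bracket lies in \<open>g0\<close>, and \<open>orth\<close> makes it
   orthogonal to all of \<open>g0\<close>, in particular to itself.\<close>
 have fY: "br (th F) Y = 0"
 proof -
  let ?W = "br (th F) Y"
  have W: "?W \<in> g0" by (rule rs_th_bracket_g0[OF F(1) Y(1)])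
  hence WL: "?W \<in> L" by simp
  have "Bt ?W ?W = - Bt (br F ?W) Y" using Bt_ad[of ?W Y F] WL F Y by simp
  also have "br F ?W = - br ?W F" by (rule bracket_anti[OF F(2) WL])
  finally have "Bt ?W ?W = 0" using orth[OF W] WL F Y by (simp add: tt.B_simps)
  thus ?thesis using tt.B_pos[OF WL] by force
 qed
 have "br (th F) (br F Y) = br (br (th F) F) Y + br F (br (th F) Y)" by (rule jacobi) (use F Y in auto)
 also have "br (th F) F = Bt F F *R Hv \<alpha>" using br_X_thX[OF d F(1)] bracket_anti[of "th F" F] F by simp
 finally have "br (th F) (br F Y) = (Bt F F * nrm \<alpha>) *R Y"
  using fY rsD(2)[OF Y(1) Hvec_props(1)[OF d]] Y F a_props(3)[OF Hvec_props(1)[OF d]] by (simp add: br_simps nrm_pos(2)[OF d])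
 \<comment> \<open>Y is killed by \<open>br (th F)\<close>, but the bracket of \<open>th F\<close>
   with F has a positive eigenvalue on it. This makes a squared norm a negative multiple of Bt Y Y,
   and so forces Y = 0.\<close>
 hence "Bt (br F Y) (br F Y) = - (Bt F F * nrm \<alpha>) * Bt Y Y"
  using Bt_ad[of Y "br F Y" F] F Y by (simp add: tt.B_simps)
 moreover have "Bt (br F Y) (br F Y) >= 0" using tt.B_pos[of "br F Y"] F Y tt.B_simps(9)[of 0] by (cases "br F Y = 0") auto
 moreover have "Bt F F * nrm \<alpha> > 0" using FF r nrm_pos(1)[OF d rootD(2)[OF \<alpha>]] by simp
 ultimately have "Bt Y Y <= 0" by (metis mult_minus_left mult_pos_pos neg_0_le_iff_le not_le)
 hence "Y = 0" using tt.B_pos[OF Y(2)] by force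
 hence E'F: "E' = q *R F" by (simp add: Y_def)
 hence "q\<^sup>2 = 1" using E(3) FF r F by (simp add: tt.B_simps power2_eq_square)
 hence "q = 1 \<or> q = -1" by (simp add: power2_eq_1_iff)
 thus ?thesis using E'F m(1) unfolding F_def by auto
qed

end

context iwasawa
begin

section \<open>Restricted roots and multiplicities\<close>

text \<open>\<open>pos_roots\<close> is defined through \<open>nn\<close>. Orthogonality of distinct
  root spaces shows that no further root space fits into \<open>nn\<close>, so it is the positive
  system of a regular element.\<close>

lemma pos_roots_obtain:
 obtains H0 where "H0 \<in> a" "!!\<alpha>. \<alpha> \<in> \<Sigma> ==> \<alpha> H0 ~= 0" "pos_roots G = {\<alpha> \<in> \<Sigma>. \<alpha> H0 > 0}"
proof -
 obtain P where P: "positive_system G P" "nn G = span (\<Union>\<alpha>\<in>P. rs \<alpha>)" using iw by (auto simp: iwasawa_decomposition_def)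
 obtain H0 where H0: "H0 \<in> a" "\<forall>\<alpha>\<in>\<Sigma>. \<alpha> H0 ~= 0" "P = {\<alpha> \<in> \<Sigma>. \<alpha> H0 > 0}" using P(1) by (auto simp: positive_system_def)
 have "\<alpha> \<in> P" if \<alpha>: "\<alpha> \<in> \<Sigma>" "rs \<alpha> <= nn G" for \<alpha>
 proof (rule ccontr)
  assume n: "\<alpha> \<notin> P"
  obtain X where X: "X \<in> rs \<alpha>" "X ~= 0" by (rule root_nonzero[OF \<alpha>(1)])
  define W where "W = {y \<in> L. Bt X y = 0}"
  note XL = rsD(1)[OF X(1)]
  have "subspace W" unfolding subspace_def W_def using XL by (auto simp: tt.B_simps)
  moreover have "(\<Union>\<beta>\<in>P. rs \<beta>) <= W"
  proof
   fix y assume "y \<in> (\<Union>\<beta>\<in>P. rs \<beta>)"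
   then obtain \<beta> where \<beta>: "\<beta> \<in> P" "y \<in> rs \<beta>" by blast
   have "Bt X y = 0" by (rule rs_orth_roots[OF \<alpha>(1) _ _ X(1) \<beta>(2)]) (use \<beta>(1) n H0(3) in auto)
   thus "y \<in> W" using rsD(1)[OF \<beta>(2)] by (simp add: W_def)
  qed
  ultimately have "nn G <= W" unfolding P(2) by (simp add: span_minimal)
  hence "Bt X X = 0" using X(1) \<alpha>(2) by (auto simp: W_def)
  thus False using tt.B_pos[OF XL X(2)] by simp
 qed
 moreover have "rs \<alpha> <= nn G" if "\<alpha> \<in> P" for \<alpha> unfolding P(2) using that by (auto intro: span_base)
 ultimately have "pos_roots G = {\<alpha> \<in> \<Sigma>. \<alpha> H0 > 0}" using H0(3) unfolding pos_roots_def by blast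
 thus ?thesis using H0 by (intro that[of H0]) auto
qed

definition H0 :: 'e where
 "H0 = (SOME H. H \<in> a & reg H & pos_roots G = {\<alpha> \<in> \<Sigma>. \<alpha> H > 0})"

lemma H0: "H0 \<in> a" "\<alpha> \<in> \<Sigma> ==> \<alpha> H0 ~= 0" "pos_roots G = {\<alpha> \<in> \<Sigma>. \<alpha> H0 > 0}"
proof -
 have "\<exists>H. H \<in> a & reg H & pos_roots G = {\<alpha> \<in> \<Sigma>. \<alpha> H > 0}" by (rule pos_roots_obtain) blast
 from someI_ex[OF this, folded H0_def]
 show "H0 \<in> a" "\<alpha> \<in> \<Sigma> ==> \<alpha> H0 ~= 0" "pos_roots G = {\<alpha> \<in> \<Sigma>. \<alpha> H0 > 0}" by auto
qed

lemma a_dense: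
 assumes "f \<in> Cinf a" "g \<in> Cinf a" "!!x. x \<in> a ==> reg x ==> f x = g x"
 shows "f = g"
 by (rule ai.agree_dense[where P = \<Sigma> and r = H0]) (simp_all add: assms H0 finite_roots dual_a(1)[OF rootD(1)])

section \<open>The normalizer of \<open>a\<close> in \<open>K\<close> and its action on
  roots\<close>

abbreviation "NK \<equiv> K \<inter> lie_normalizer G a"

lemma a_L: "a <= L" using a_props(3) by blast

lemma NKD: assumes "k \<in> NK" shows "k \<in> K" "k \<in> carrier G" "Ad G k ` a = a" "H \<in> a ==> Ad G k H \<in> a"
 using assms by (auto simp: lie_normalizer_def)

lemma NK_inv: assumes k: "k \<in> NK" shows "inv k \<in> NK"
 using Ad_image_inv[OF NKD(2)[OF k] NKD(3)[OF k] a_L] K_grp(2)[OF NKD(1)[OF k]] NKD(2)[OF k] by (simp add: lie_normalizer_def)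

lemma NK_mult: assumes k: "k \<in> NK" and l: "l \<in> NK" shows "k \<otimes> l \<in> NK"
 using Ad_image_mult[OF NKD(2)[OF k] NKD(2)[OF l] NKD(3)[OF k] NKD(3)[OF l] a_L] K_grp(3)[OF NKD(1)[OF k] NKD(1)[OF l]]
  NKD(2)[OF k] NKD(2)[OF l] by (simp add: lie_normalizer_def)

lemma M_NK: assumes "m \<in> M" shows "m \<in> NK"
proof -
 have "Ad G m ` a = (%x. x) ` a" by (rule image_cong[OF refl]) (use assms M_iff in blast)
 thus ?thesis using assms M_K KD(1) by (simp add: lie_normalizer_def)
qed

lemma Weyl_NK: assumes "w \<in> Weyl G" "k \<in> w" shows "k \<in> NK"
proof -
 obtain m l where "m \<in> M" "l \<in> NK" "k = m \<otimes> l"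
  using assms unfolding Weyl_def FactGroup_def RCOSETS_def r_coset_def by auto
 thus ?thesis using NK_mult[OF M_NK] by blast
qed

lemma M_conj: assumes "k \<in> NK" "m \<in> M" shows "inv k \<otimes> m \<otimes> k \<in> M"
proof -
 note k = NKD[OF assms(1)] and m = NKD[OF M_NK[OF assms(2)]] and ki = NKD[OF NK_inv[OF assms(1)]]
 have "Ad G (inv k \<otimes> m \<otimes> k) H = H" if H: "H \<in> a" for H
 proof -
  have "Ad G (inv k \<otimes> m \<otimes> k) H = Ad G (inv k) (Ad G m (Ad G k H))"
   using Ad_mult[OF m_closed[OF ki(2) m(2)] k(2) a_props(3)[OF H]] Ad_mult[OF ki(2) m(2) a_props(3)[OF k(4)[OF H]]] by simp
  also have "Ad G m (Ad G k H) = Ad G k H" using assms(2) k(4)[OF H] M_iff by blast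
  also have "Ad G (inv k) (Ad G k H) = H" by (rule Ad_inv(1)[OF k(2) a_props(3)[OF H]])
  finally show ?thesis .
 qed
 moreover have "inv k \<otimes> m \<otimes> k \<in> K" using K_grp(3)[OF K_grp(3)[OF ki(1) m(1)] k(1)] .
 ultimately show ?thesis by (simp add: M_iff)
qed

text \<open>The transpose of \<open>Ad g\<close> on functionals. With this convention root spaces
  move by \<open>Ad (inv g)\<close>.\<close>

definition rtr :: "'a => ('e => real) => 'e => real" where "rtr g \<alpha> = ext0 a (%H. \<alpha> (Ad G g H))"

lemma rtr_in: "H \<in> a ==> rtr g \<alpha> H = \<alpha> (Ad G g H)" by (simp add: rtr_def)

lemma fscale_simps [simp]: "fscale c (fscale d \<alpha>) = fscale (c * d) \<alpha>" "fscale 1 \<alpha> = \<alpha>"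
 by (simp_all add: fscale_def mult.assoc)

lemma fscale_inj: "c ~= 0 ==> fscale c \<alpha> = fscale c \<beta> \<longleftrightarrow> \<alpha> = \<beta>"
 by (auto simp: fscale_def fun_eq_iff)

lemma rtr_fscale: "rtr g (fscale c \<alpha>) = fscale c (rtr g \<alpha>)"
 by (auto simp: rtr_def fscale_def ext0_def)

lemma rtr_dual: assumes "g \<in> NK" "\<alpha> \<in> dual_space a" shows "rtr g \<alpha> \<in> dual_space a"
 unfolding rtr_def
proof (rule lin_on_dual[OF lin_onI a_props(1)])
 note A = Ad_lin[OF NKD(2)[OF assms(1)]] and l = dual_a(1)[OF assms(2)]
 show "\<alpha> (Ad G g (H + H')) = \<alpha> (Ad G g H) + \<alpha> (Ad G g H')" if "H \<in> a" "H' \<in> a" for H H'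
  using lin_on_add[OF A] lin_on_add[OF l] NKD(4)[OF assms(1)] a_props(3) that by simp
 show "\<alpha> (Ad G g (c *R H)) = c *R \<alpha> (Ad G g H)" if "H \<in> a" for H c
  using lin_on_scale[OF A] lin_on_scale[OF l] NKD(4)[OF assms(1)] a_props(3) that by simp
qed

lemma rtr_inv:
 assumes g: "g \<in> NK" and \<alpha>: "\<alpha> \<in> dual_space a"
 shows "rtr g (rtr (inv g) \<alpha>) = \<alpha>" "rtr (inv g) (rtr g \<alpha>) = \<alpha>"
proof -
 note gi = NK_inv[OF g]
 show "rtr g (rtr (inv g) \<alpha>) = \<alpha>"
  by (rule dual_eqI[OF rtr_dual[OF g rtr_dual[OF gi \<alpha>]] \<alpha>])
   (use NKD(4)[OF g] Ad_inv(1)[OF NKD(2)[OF g]] a_props(3) in "simp add: rtr_in")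
 show "rtr (inv g) (rtr g \<alpha>) = \<alpha>"
  by (rule dual_eqI[OF rtr_dual[OF gi rtr_dual[OF g \<alpha>]] \<alpha>])
   (use NKD(4)[OF gi] Ad_inv(2)[OF NKD(2)[OF g]] a_props(3) in "simp add: rtr_in")
qed

lemma rtr_rs: assumes g: "g \<in> NK" and X: "X \<in> rs \<alpha>" shows "Ad G (inv g) X \<in> rs (rtr g \<alpha>)"
proof -
 note gc = NKD(2)[OF g] and gi = NKD(2)[OF NK_inv[OF g]] and XL = rsD(1)[OF X]
 have "br H (Ad G (inv g) X) = rtr g \<alpha> H *R Ad G (inv g) X" if H: "H \<in> a" for H
 proof -
  have "H = Ad G (inv g) (Ad G g H)" using Ad_inv(1)[OF gc a_props(3)[OF H]] by simp
  hence "br H (Ad G (inv g) X) = Ad G (inv g) (br (Ad G g H) X)"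
   using Ad_bracket[OF gi a_props(3)[OF NKD(4)[OF g H]] XL] by simp
  thus ?thesis using rsD(2)[OF X NKD(4)[OF g H]] lin_on_scale[OF Ad_lin[OF gi] XL] H by (simp add: rtr_in)
 qed
 thus ?thesis using Ad_in[OF gi XL] by (simp add: root_space_def)
qed

lemma rtr_root: assumes g: "g \<in> NK" and \<alpha>: "\<alpha> \<in> \<Sigma>" shows "rtr g \<alpha> \<in> \<Sigma>"
proof -
 obtain X where X: "X \<in> rs \<alpha>" "X ~= 0" by (rule root_nonzero[OF \<alpha>])
 have "Ad G (inv g) X ~= 0"
 proof
  assume "Ad G (inv g) X = 0"
  hence "Ad G g 0 = X" using Ad_inv(2)[OF NKD(2)[OF g] rsD(1)[OF X(1)]] by simp
  thus False using X(2) lin_on_0[OF Ad_lin[OF NKD(2)[OF g]] subL] by simp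
 qed
 moreover have "rtr g \<alpha> ~= 0"
 proof
  assume "rtr g \<alpha> = 0"
  hence "\<alpha> = rtr (inv g) 0" using rtr_inv(2)[OF g rootD(1)[OF \<alpha>]] by simp
  thus False using rootD(2)[OF \<alpha>] by (auto simp: rtr_def ext0_def fun_eq_iff)
 qed
 ultimately show ?thesis using root_rs_dual[OF rtr_dual[OF g rootD(1)[OF \<alpha>]] _ rtr_rs[OF g X(1)]] by blast
qed

lemma dim_image_le_on:
 fixes T :: "'e => 'e"
 assumes "lin_on L T" "V <= T ` U" "U <= L" shows "dim V <= dim U"
proof -
 obtain A where A: "linear A" "!!x. x \<in> L ==> A x = T x" by (rule lin_on_extend[OF assms(1) subL], rule that)
 have "T ` U = A ` U" by (rule image_cong) (use A(2) assms(3) in auto)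
 hence "V <= A ` U" using assms by simp
 hence "dim V <= dim (A ` U)" by (rule dim_subset)
 also have "\<dots> <= dim U" by (rule dim_image_le[OF A(1)])
 finally show ?thesis .
qed

lemma rs_L: "rs \<alpha> <= L" using rsD(1) by blast

lemma rtr_dim: assumes g: "g \<in> NK" and \<alpha>: "\<alpha> \<in> dual_space a" shows "dim (rs (rtr g \<alpha>)) = dim (rs \<alpha>)"
proof -
 have le: "dim (rs (rtr g \<alpha>)) <= dim (rs \<alpha>)" if g: "g \<in> NK" and \<alpha>: "\<alpha> \<in> dual_space a" for g \<alpha>
 proof (rule dim_image_le_on[OF Ad_lin[OF NKD(2)[OF NK_inv[OF g]]] _ rs_L])
  show "rs (rtr g \<alpha>) <= Ad G (inv g) ` rs \<alpha>"
  proof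
   fix X assume X: "X \<in> rs (rtr g \<alpha>)"
   have "Ad G (inv (inv g)) X \<in> rs (rtr (inv g) (rtr g \<alpha>))" by (rule rtr_rs[OF NK_inv[OF g] X])
   hence "Ad G g X \<in> rs \<alpha>" using rtr_inv(2)[OF g \<alpha>] NKD(2)[OF g] by simp
   moreover have "X = Ad G (inv g) (Ad G g X)" using Ad_inv(1)[OF NKD(2)[OF g] rsD(1)[OF X]] by simp
   ultimately show "X \<in> Ad G (inv g) ` rs \<alpha>" by blast
  qed
 qed
 show ?thesis using le[OF g \<alpha>] le[OF NK_inv[OF g] rtr_dual[OF g \<alpha>]] rtr_inv(2)[OF g \<alpha>] by simp
qed

lemma neg_dim: "dim (rs (fscale (-1) \<alpha>)) = dim (rs \<alpha>)"
proof -
 have le: "dim (rs (fscale (-1) \<alpha>)) <= dim (rs \<alpha>)" for \<alpha>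
 proof (rule dim_image_le_on[OF th_props(3) _ rs_L])
  show "rs (fscale (-1) \<alpha>) <= th ` rs \<alpha>"
  proof
   fix X assume X: "X \<in> rs (fscale (-1) \<alpha>)"
   have "th X \<in> rs \<alpha>" using th_rs[OF X] by simp
   moreover have "X = th (th X)" using rsD(1)[OF X] th_props(2) by simp
   ultimately show "X \<in> th ` rs \<alpha>" by blast
  qed
 qed
 show ?thesis using le[of \<alpha>] le[of "fscale (-1) \<alpha>"] by simp
qed

lemma rtr_Hv: assumes g: "g \<in> NK" and \<alpha>: "\<alpha> \<in> dual_space a" shows "Hv (rtr g \<alpha>) = Ad G (inv g) (Hv \<alpha>)" "nrm (rtr g \<alpha>) = nrm \<alpha>"
proof -
 note gi = NK_inv[OF g] and H = Hvec_props(1)[OF \<alpha>]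
 show 1: "Hv (rtr g \<alpha>) = Ad G (inv g) (Hv \<alpha>)"
 proof (rule Hvec_eqI[OF rtr_dual[OF g \<alpha>] NKD(4)[OF gi H]])
  fix y assume y: "y \<in> a"
  have "Bk (Ad G (inv g) (Hv \<alpha>)) y = Bk (Ad G (inv g) (Hv \<alpha>)) (Ad G (inv g) (Ad G g y))"
   using Ad_inv(1)[OF NKD(2)[OF g] a_props(3)[OF y]] by simp
  also have "\<dots> = Bk (Hv \<alpha>) (Ad G g y)"
   by (rule killing_Ad[OF NKD(2)[OF gi] a_props(3)[OF H] a_props(3)[OF NKD(4)[OF g y]]])
  finally show "rtr g \<alpha> y = Bk (Ad G (inv g) (Hv \<alpha>)) y"
   using Hvec_props(2)[OF \<alpha> NKD(4)[OF g y]] y by (simp add: rtr_in)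
 qed
 show "nrm (rtr g \<alpha>) = nrm \<alpha>" unfolding 1 by (rule killing_Ad[OF NKD(2)[OF gi] a_props(3)[OF H] a_props(3)[OF H]])
qed

lemma refl_rtr:
 assumes g: "g \<in> NK" and \<alpha>: "\<alpha> \<in> dual_space a" and x: "x \<in> a"
 shows "refl G (rtr (inv g) \<alpha>) (Ad G g x) = Ad G g (refl G \<alpha> x)"
proof -
 note gi = NK_inv[OF g] and gc = NKD(2)[OF g]
 have ii: "inv (inv g) = g" using gc by simp
 have e: "rtr (inv g) \<alpha> (Ad G g x) = \<alpha> x" using rtr_in[OF NKD(4)[OF g x]] Ad_inv(1)[OF gc a_props(3)[OF x]] by simp
 show ?thesis
  unfolding refl_def e rtr_Hv(2)[OF gi \<alpha>] unfolding rtr_Hv(1)[OF gi \<alpha>] ii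
  using lin_on_diff[OF Ad_lin[OF gc] subL] lin_on_scale[OF Ad_lin[OF gc]] a_props(3)[OF x] a_props(3)[OF Hvec_props(1)[OF \<alpha>]] by simp
qed

lemma refl_neg: "\<alpha> \<in> dual_space a ==> refl G (fscale (-1) \<alpha>) x = refl G \<alpha> x"
 unfolding refl_def by (simp add: Hvec_scale) (use Hvec_props(1)[of \<alpha>] ai.B_simps in "simp add: fscale_def")

section \<open>The reduced system \<open>R1\<close> and its multiplicities\<close>

lemma R_sys_iff: "\<beta> \<in> R_sys G \<longleftrightarrow> fscale (1/2) \<beta> \<in> \<Sigma>"
proof
 assume "fscale (1/2) \<beta> \<in> \<Sigma>"
 moreover have "\<beta> = fscale 2 (fscale (1/2) \<beta>)" by simp
 ultimately show "\<beta> \<in> R_sys G" unfolding R_sys_def by blast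
qed (auto simp: R_sys_def)

text \<open>In terms of \<Sigma>, half of \<beta> is a root that is not twice another root.\<close>

lemma R1_iff: "\<beta> \<in> R1 G \<longleftrightarrow> fscale (1/2) \<beta> \<in> \<Sigma> & fscale (1/4) \<beta> \<notin> \<Sigma>"
proof -
 have "\<beta> \<in> fscale 2 ` R_sys G \<longleftrightarrow> fscale (1/4) \<beta> \<in> \<Sigma>"
 proof
  assume "fscale (1/4) \<beta> \<in> \<Sigma>"
  hence "fscale (1/2) \<beta> \<in> R_sys G" by (simp add: R_sys_iff)
  moreover have "\<beta> = fscale 2 (fscale (1/2) \<beta>)" by simp
  ultimately show "\<beta> \<in> fscale 2 ` R_sys G" by blast
 qed (auto simp: R_sys_iff)
 thus ?thesis by (simp add: R1_def R_sys_iff)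
qed

lemma R1_root: "\<beta> \<in> R1 G ==> fscale (1/2) \<beta> \<in> \<Sigma>" by (simp add: R1_iff)

lemma R1_dual: assumes "\<beta> \<in> R1 G" shows "\<beta> \<in> dual_space a" "\<beta> ~= 0"
proof -
 have e: "\<beta> = fscale 2 (fscale (1/2) \<beta>)" by simp
 show "\<beta> \<in> dual_space a" by (subst e, rule dual_scale[OF rootD(1)[OF R1_root[OF assms]]])
 show "\<beta> ~= 0" using rootD(2)[OF R1_root[OF assms]] by (auto simp: fscale_def fun_eq_iff)
qed

lemma R1_finite: "finite (R1 G)" using finite_roots by (simp add: R1_def R_sys_def)

lemma R1_neg: assumes "\<beta> \<in> R1 G" shows "fscale (-1) \<beta> \<in> R1 G"
proof -
 have "fscale (1/4) \<beta> \<in> \<Sigma>" if "fscale (-1/4) \<beta> \<in> \<Sigma>" using root_neg[OF that] by simp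
 moreover have "fscale (-1/2) \<beta> \<in> \<Sigma>" using root_neg[of "fscale (1/2) \<beta>"] R1_root[OF assms] by simp
 ultimately show ?thesis using assms unfolding R1_iff by auto
qed

lemma rtr_root_iff: "g \<in> NK ==> \<alpha> \<in> dual_space a ==> rtr g \<alpha> \<in> \<Sigma> \<longleftrightarrow> \<alpha> \<in> \<Sigma>"
 using rtr_root[of g \<alpha>] rtr_root[OF NK_inv, of g "rtr g \<alpha>"] rtr_inv(2)[of g \<alpha>] by auto

lemma R1_rtr: assumes "g \<in> NK" "\<beta> \<in> R1 G" shows "rtr g \<beta> \<in> R1 G"
 using assms(2) rtr_root_iff[OF assms(1) dual_scale[OF R1_dual(1)[OF assms(2)]]]
 unfolding R1_iff rtr_fscale[symmetric] by simp

lemma m0_rtr: assumes "g \<in> NK" "\<beta> \<in> R1 G" shows "m0 G (rtr g \<beta>) = m0 G \<beta>"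
 using rtr_root_iff[OF assms(1) R1_dual(1)[OF assms(2)]]
  rtr_dim[OF assms(1) R1_dual(1)[OF assms(2)]] rtr_dim[OF assms(1) dual_scale[OF R1_dual(1)[OF assms(2)]]]
 unfolding m0_def R_sys_iff by (simp add: rtr_fscale[symmetric])

lemma m0_neg: "m0 G (fscale (-1) \<beta>) = m0 G \<beta>"
proof -
 have r: "fscale (-1) \<beta> \<in> \<Sigma> \<longleftrightarrow> \<beta> \<in> \<Sigma>" using root_neg[of \<beta>] root_neg[of "fscale (-1) \<beta>"] by auto
 have d: "dim (rs (fscale (-1/2) \<beta>)) = dim (rs (fscale (1/2) \<beta>))" using neg_dim[of "fscale (1/2) \<beta>"] by simp
 show ?thesis unfolding m0_def R_sys_iff using r d neg_dim[of \<beta>] by simp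
qed

lemma R1_pos_eq: "R1_pos G = {\<beta> \<in> R1 G. \<beta> H0 > 0}"
proof -
 have "\<beta> \<in> fscale 2 ` pos_roots G \<longleftrightarrow> \<beta> H0 > 0" if "\<beta> \<in> R1 G" for \<beta>
 proof
  assume "\<beta> H0 > 0"
  hence "fscale (1/2) \<beta> \<in> pos_roots G" unfolding H0(3) using R1_root[OF that] by (simp add: fscale_def)
  moreover have "\<beta> = fscale 2 (fscale (1/2) \<beta>)" by simp
  ultimately show "\<beta> \<in> fscale 2 ` pos_roots G" by blast
 next
  assume "\<beta> \<in> fscale 2 ` pos_roots G"
  thus "\<beta> H0 > 0" unfolding H0(3) by (auto simp: fscale_def)
 qed
 thus ?thesis unfolding R1_pos_def by blast
qed

text \<open>The normalizer permutes \<open>R1\<close> but not its positive half. Passing to the full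
  sum makes invariance arguments possible.\<close>

lemma sum_R1_even:
 fixes t :: "('e => real) => complex"
 assumes "!!\<beta>. \<beta> \<in> R1 G ==> t (fscale (-1) \<beta>) = t \<beta>"
 shows "(\<Sum>\<beta>\<in>R1 G. t \<beta>) = 2 * (\<Sum>\<beta>\<in>R1_pos G. t \<beta>)"
proof -
 note P = R1_pos_eq
 have nz: "\<beta> H0 ~= 0" if "\<beta> \<in> R1 G" for \<beta> using H0(2)[OF R1_root[OF that]] by (simp add: fscale_def)
 have U: "R1 G = R1_pos G \<union> fscale (-1) ` R1_pos G"
 proof
  show "R1 G <= R1_pos G \<union> fscale (-1) ` R1_pos G"
  proof
   fix \<beta> assume b: "\<beta> \<in> R1 G"
   show "\<beta> \<in> R1_pos G \<union> fscale (-1) ` R1_pos G"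
   proof (cases "\<beta> H0 > 0")
    case False
    hence "fscale (-1) \<beta> \<in> R1_pos G" unfolding P using R1_neg[OF b] nz[OF b] by (simp add: fscale_def)
    moreover have "\<beta> = fscale (-1) (fscale (-1) \<beta>)" by simp
    ultimately show ?thesis by blast
   qed (use b P in simp)
  qed
  show "R1_pos G \<union> fscale (-1) ` R1_pos G <= R1 G" unfolding P using R1_neg by auto
 qed
 have fin: "finite (R1_pos G)" using R1_finite by (simp add: P)
 have "(\<Sum>\<beta>\<in>R1 G. t \<beta>) = (\<Sum>\<beta>\<in>R1_pos G. t \<beta>) + (\<Sum>\<beta>\<in>fscale (-1) ` R1_pos G. t \<beta>)"
  by (subst U, rule sum.union_disjoint) (use fin in "auto simp: P fscale_def")
 also have "(\<Sum>\<beta>\<in>fscale (-1) ` R1_pos G. t \<beta>) = (\<Sum>\<beta>\<in>R1_pos G. t \<beta>)"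
  by (subst sum.reindex) (use assms in "auto intro!: inj_onI sum.cong simp: fscale_inj P")
 finally show ?thesis by simp
qed

text \<open>Since \<open>4\<alpha>\<close> is never a root, the positive roots are the indivisible ones and their doubles.\<close>

lemma sum_pos_roots:
 fixes t :: "('e => real) => complex"
 assumes t: "!!\<alpha>. \<alpha> \<in> \<Sigma> ==> t (fscale 2 \<alpha>) = t \<alpha>"
 shows "(\<Sum>\<alpha>\<in>pos_roots G. of_nat (dim (rs \<alpha>)) * t \<alpha>) = (\<Sum>\<beta>\<in>R1_pos G. of_real (2 * m0 G \<beta>) * t \<beta>)"
proof -
 define I where "I = {\<alpha> \<in> pos_roots G. fscale (1/2) \<alpha> \<notin> \<Sigma>}"
 define I2 where "I2 = {\<alpha> \<in> I. fscale 2 \<alpha> \<in> \<Sigma>}"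
 have fin: "finite (pos_roots G)" using finite_roots by (simp add: pos_roots_def)
 hence finI: "finite I" "finite I2" by (simp_all add: I_def I2_def)
 have I\<Sigma>: "\<alpha> \<in> \<Sigma>" if "\<alpha> \<in> I" for \<alpha> using that by (simp add: I_def pos_roots_def)
 have U: "pos_roots G = I \<union> fscale 2 ` I2"
 proof
  show "pos_roots G <= I \<union> fscale 2 ` I2"
  proof
   fix \<alpha> assume p: "\<alpha> \<in> pos_roots G"
   show "\<alpha> \<in> I \<union> fscale 2 ` I2"
   proof (cases "fscale (1/2) \<alpha> \<in> \<Sigma>")
    case True
    have "fscale (1/4) \<alpha> \<notin> \<Sigma>" using four_not_root[of "fscale (1/4) \<alpha>"] p by (auto simp: pos_roots_def)
    hence "fscale (1/2) \<alpha> \<in> I2" using True p by (simp add: I2_def I_def H0(3)) (simp add: fscale_def)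
    moreover have "\<alpha> = fscale 2 (fscale (1/2) \<alpha>)" by simp
    ultimately show ?thesis by blast
   qed (use p in "simp add: I_def")
  qed
  show "I \<union> fscale 2 ` I2 <= pos_roots G" by (auto simp: I_def I2_def H0(3)) (simp add: fscale_def)
 qed
 have R: "R1_pos G = fscale 2 ` I"
 proof
  show "fscale 2 ` I <= R1_pos G" unfolding R1_pos_def by (auto simp: R1_iff I_def pos_roots_def)
  show "R1_pos G <= fscale 2 ` I"
  proof
   fix \<beta> assume "\<beta> \<in> R1_pos G"
   then obtain \<alpha> where \<alpha>: "\<beta> = fscale 2 \<alpha>" "\<alpha> \<in> pos_roots G" "\<beta> \<in> R1 G" unfolding R1_pos_def by blast
   hence "\<alpha> \<in> I" by (simp add: I_def R1_iff)
   thus "\<beta> \<in> fscale 2 ` I" using \<alpha> by blast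
  qed
 qed
 have "(\<Sum>\<alpha>\<in>pos_roots G. of_nat (dim (rs \<alpha>)) * t \<alpha>) =
  (\<Sum>\<alpha>\<in>I. of_nat (dim (rs \<alpha>)) * t \<alpha>) + (\<Sum>\<alpha>\<in>fscale 2 ` I2. of_nat (dim (rs \<alpha>)) * t \<alpha>)"
  by (subst U, rule sum.union_disjoint) (use finI in "auto simp: I_def I2_def pos_roots_def")
 also have "(\<Sum>\<alpha>\<in>fscale 2 ` I2. of_nat (dim (rs \<alpha>)) * t \<alpha>) = (\<Sum>\<alpha>\<in>I2. of_nat (dim (rs (fscale 2 \<alpha>))) * t \<alpha>)"
  by (subst sum.reindex) (use t I\<Sigma> in "auto intro!: inj_onI sum.cong simp: fscale_inj I2_def")
 also have "\<dots> = (\<Sum>\<alpha>\<in>I. if fscale 2 \<alpha> \<in> \<Sigma> then of_nat (dim (rs (fscale 2 \<alpha>))) * t \<alpha> else 0)"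
  unfolding I2_def by (rule sum.inter_filter[OF finI(1)])
 \<comment> \<open>By definition 2 m0(2\<alpha>) is the dimension of the root space of \<alpha>,
   increased by that of 2\<alpha> if 2\<alpha> is a root: the multiplicities along a ray add
   up.\<close>
 also have "(\<Sum>\<alpha>\<in>I. of_nat (dim (rs \<alpha>)) * t \<alpha>) + (\<Sum>\<alpha>\<in>I. if fscale 2 \<alpha> \<in> \<Sigma> then of_nat (dim (rs (fscale 2 \<alpha>))) * t \<alpha> else 0)
   = (\<Sum>\<alpha>\<in>I. of_real (2 * m0 G (fscale 2 \<alpha>)) * t (fscale 2 \<alpha>))"
  unfolding sum.distrib[symmetric]
  by (rule sum.cong[OF refl]) (use t I\<Sigma> in "auto simp: m0_def R_sys_iff algebra_simps")
 also have "\<dots> = (\<Sum>\<beta>\<in>R1_pos G. of_real (2 * m0 G \<beta>) * t \<beta>)"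
  unfolding R by (subst sum.reindex) (auto intro!: inj_onI simp: fscale_inj)
 finally show ?thesis .
qed

end

section \<open>An orthonormal basis of \<open>s\<close> and representatives of the
  reflections\<close>

context iwasawa
begin

text \<open>For a unit root vector c the vectors c and \<open>th c\<close> are orthogonal of length
  1, so 1 / sqrt 2 normalizes their difference.\<close>

definition us :: "'e => 'e" where "us c = (1 / sqrt 2) *R (c - th c)"

lemma us_s: "c \<in> L ==> us c \<in> s"
 using subspace_scale[OF sub_s kl_s_decomp(2), of c "2 / sqrt 2"] by (simp add: us_def)

lemma Bk_s: "x \<in> s ==> y \<in> s ==> Bk x y = Bt x y"
 using Bk_Bt[of x y] sD[of x] sD[of y] by (simp add: tt.B_simps)

lemma sum_scale_onb:
 assumes "x \<in> s" and J: "finite C" "C <= s"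
  and on: "!!b c. b \<in> C ==> c \<in> C ==> Bk b c = (if b = c then 1 else 0)"
  and full: "!!x. x \<in> s ==> (!!b. b \<in> C ==> Bk x b = 0) ==> x = 0"
 shows "(\<Sum>c\<in>C. Bk x c *R c) = x"
proof -
 define y where "y = (\<Sum>c\<in>C. Bk x c *R c)"
 have y: "y \<in> s" unfolding y_def by (rule subspace_sum[OF sub_s]) (use J subspace_scale[OF sub_s] in blast)
 have "x - y = 0"
 proof (rule full)
  show "x - y \<in> s" using assms(1) y subspace_diff[OF sub_s] by blast
  fix b assume b: "b \<in> C"
  have "Bk y b = Bk x b" unfolding y_def by (rule si.orthonormal_coeff[OF J on b])
  thus "Bk (x - y) b = 0" using assms(1) y b J(2) by (simp add: si.B_simps subset_iff)
 qed
 thus ?thesis by (simp add: y_def)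
qed

text \<open>The decomposition of \<open>s\<close> into \<open>a\<close> and the spaces of c -
  \<open>th c\<close> for positive root vectors c. A basis enters the Laplacian through sums over
  it, hence the form of the second conclusion.\<close>

lemma s_onb:
 assumes Ca: "ai.onb a Ca" and Cr: "!!\<alpha>. \<alpha> \<in> pos_roots G ==> tt.onb (rs \<alpha>) (Cr \<alpha>)"
 obtains C where "si.onb s C"
  "!!F::'e => complex. (\<Sum>b\<in>C. F b) = (\<Sum>b\<in>Ca. F b) + (\<Sum>\<alpha>\<in>pos_roots G. \<Sum>c\<in>Cr \<alpha>. F (us c))"
proof -
 let ?P = "pos_roots G"
 define J where "J = Sigma ?P Cr"
 define U where "U = (%(\<alpha>::'e => real, c). us c) ` J"
 have finP: "finite ?P" using finite_roots by (simp add: pos_roots_def)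
 note Cad = ai.onbD[OF Ca]
 have Crd: "Cr \<alpha> <= rs \<alpha>" "finite (Cr \<alpha>)" "b \<in> Cr \<alpha> ==> c \<in> Cr \<alpha> ==> Bt b c = (if b = c then 1 else 0)"
  "x \<in> rs \<alpha> ==> (\<Sum>c\<in>Cr \<alpha>. Bt x c *R c) = x" if "\<alpha> \<in> ?P" for \<alpha> b c x
  using tt.onbD[OF Cr[OF that]] by auto
 have finJ: "finite J" unfolding J_def using finP Crd(2) by auto
 have Jr: "\<alpha> \<in> \<Sigma>" "\<alpha> H0 > 0" "c \<in> rs \<alpha>" "c \<in> L" "us c \<in> s" if "(\<alpha>, c) \<in> J" for \<alpha> c
  using that Crd(1) H0(3) rsD(1) us_s unfolding J_def by blast+
 have uu: "Bk (us c) (us c') = (if (\<alpha>, c) = (\<alpha>', c') then 1 else 0)" if j: "(\<alpha>, c) \<in> J" "(\<alpha>', c') \<in> J" for \<alpha> c \<alpha>' c'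
 proof -
  note p = Jr[OF j(1)] and q = Jr[OF j(2)]
  have "Bt c (th c') = 0"
   by (rule rs_orth[OF p(3) th_rs[OF q(3)] H0(1)]) (use p(2) q(2) in "simp add: fscale_def")
  moreover have "Bt (th c) c' = 0"
   by (rule rs_orth[OF th_rs[OF p(3)] q(3) H0(1)]) (use p(2) q(2) in "simp add: fscale_def")
  moreover have "Bt (th c) (th c') = Bt c c'" by (rule Bt_th[OF p(4) q(4)])
  ultimately have "Bt (c - th c) (c' - th c') = 2 * Bt c c'" using p(4) q(4) by (simp add: tt.B_simps)
  moreover have h: "Bt ((1 / sqrt 2) *R w) ((1 / sqrt 2) *R w') = Bt w w' / 2" if "w \<in> L" "w' \<in> L" for w w'
   using that by (simp add: tt.B_simps)
  ultimately have "Bk (us c) (us c') = Bt c c'"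
   unfolding Bk_s[OF p(5) q(5)] unfolding us_def using h[of "c - th c" "c' - th c'"] p(4) q(4) by simp
  also have "\<dots> = (if (\<alpha>, c) = (\<alpha>', c') then 1 else 0)"
  proof (cases "\<alpha> = \<alpha>'")
   case True
   thus ?thesis using j Crd(3) unfolding J_def by auto
  next
   case False
   thus ?thesis using rs_orth_roots[OF p(1) q(1) _ p(3) q(3)] by simp
  qed
  finally show ?thesis .
 qed
 have Hu: "Bk H (us c) = 0" if "H \<in> a" "(\<alpha>, c) \<in> J" for H \<alpha> c
 proof -
  note p = Jr[OF that(2)]
  have H: "H \<in> rs (%_. 0)" using a_props(3,4) that(1) by (simp add: root_space_def)
  have "Bt H c = 0" by (rule rs_orth[OF H p(3) H0(1)]) (use p(2) in simp)
  moreover have "Bt H (th c) = 0" by (rule rs_orth[OF H th_rs[OF p(3)] H0(1)]) (use p(2) in "simp add: fscale_def")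
  ultimately show ?thesis unfolding Bk_s[OF a_props(2)[OF that(1)] p(5)]
   using p(4) a_props(3)[OF that(1)] by (simp add: us_def tt.B_simps)
 qed
 have inj: "inj_on (%(\<alpha>::'e => real, c). us c) J"
 proof (rule inj_onI)
  fix x y assume xy: "x \<in> J" "y \<in> J" "(%(\<alpha>::'e => real, c). us c) x = (%(\<alpha>::'e => real, c). us c) y"
  obtain \<alpha> c \<alpha>' c' where e: "x = (\<alpha>, c)" "y = (\<alpha>', c')" by (metis surj_pair)
  have "Bk (us c) (us c') = 1" using uu[of \<alpha> c \<alpha> c] xy unfolding e by simp
  thus "x = y" using uu[of \<alpha> c \<alpha>' c'] xy unfolding e by (simp split: if_splits)
 qed
 define C where "C = Ca \<union> U"
 have Ca0: "b \<in> a" if "b \<in> Ca" for b using Cad(1) that by blast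
 have disj: "Ca \<inter> U = {}"
 proof (rule ccontr)
  assume "Ca \<inter> U ~= {}"
  then obtain \<alpha> c where u: "us c \<in> Ca" "(\<alpha>, c) \<in> J" unfolding U_def by auto
  thus False using Hu[OF Ca0[OF u(1)] u(2)] Cad(3)[OF u(1) u(1)] by simp
 qed
 have finC: "finite C" using Cad(2) finJ by (simp add: C_def U_def)
 have Cs: "C <= s" using Ca0 a_props(2) Jr(5) by (auto simp: C_def U_def)
 have on: "Bk b c = (if b = c then 1 else 0)" if bc: "b \<in> C" "c \<in> C" for b c
 proof (cases "b \<in> Ca"; cases "c \<in> Ca")
  assume "b \<in> Ca" "c \<in> Ca" thus ?thesis using Cad(3) by simp
 next
  assume h: "b \<in> Ca" "c \<notin> Ca"
  then obtain \<alpha> d where d: "c = us d" "(\<alpha>, d) \<in> J" using bc(2) by (auto simp: C_def U_def)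
  thus ?thesis using Hu[OF Ca0[OF h(1)] d(2)] h by auto
 next
  assume h: "b \<notin> Ca" "c \<in> Ca"
  then obtain \<alpha> d where d: "b = us d" "(\<alpha>, d) \<in> J" using bc(1) by (auto simp: C_def U_def)
  thus ?thesis using Hu[OF Ca0[OF h(2)] d(2)] si.B_sym[OF Jr(5)[OF d(2)] a_props(2)[OF Ca0[OF h(2)]]] h by auto
 next
  assume h: "b \<notin> Ca" "c \<notin> Ca"
  then obtain \<alpha> d \<alpha>' d' where d: "b = us d" "(\<alpha>, d) \<in> J" "c = us d'" "(\<alpha>', d') \<in> J" using bc by (auto simp: C_def U_def)
  have "b = c \<longleftrightarrow> (\<alpha>, d) = (\<alpha>', d')" using inj_onD[OF inj, of "(\<alpha>, d)" "(\<alpha>', d')"] d by auto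
  thus ?thesis using uu[OF d(2,4)] d(1,3) by simp
 qed
 have "si.onb s C"
  unfolding si.onb_def
 proof (intro conjI ballI)
  fix b c assume "b \<in> C" "c \<in> C" thus "Bk b c = (if b = c then 1 else 0)" by (rule on)
 next
  fix x assume x: "x \<in> s"
  show "(\<Sum>c\<in>C. Bk x c *R c) = x"
  proof (rule sum_scale_onb[OF x finC Cs])
   fix b c assume "b \<in> C" "c \<in> C" thus "Bk b c = (if b = c then 1 else 0)" by (rule on)
  next
   fix x assume x: "x \<in> s" and o: "!!b. b \<in> C ==> Bk x b = 0"
   have xL: "x \<in> L" using x sD by blast
   have oa: "Bt x H = 0" if H: "H \<in> a" for H
   proof -
    have "Bt x H = Bk x (\<Sum>c\<in>Ca. Bk H c *R c)" using Cad(4)[OF H] Bk_s[OF x a_props(2)[OF H]] by simp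
    also have "\<dots> = Bk (\<Sum>c\<in>Ca. Bk H c *R c) x"
     by (rule si.B_sym[OF x]) (use Cad(4)[OF H] a_props(2)[OF H] in simp)
    also have "\<dots> = (\<Sum>c\<in>Ca. Bk (Bk H c *R c) x)" by (rule si.B_sum) (use Ca0 a_props(2) x subspace_scale[OF sub_s] in auto)
    also have "\<dots> = 0"
    proof (rule sum.neutral, rule ballI)
     fix c assume c: "c \<in> Ca"
     have cs: "c \<in> s" using Ca0[OF c] a_props(2) by blast
     show "Bk (Bk H c *R c) x = 0" using o[of c] si.B_sym[OF x cs] c x cs by (simp add: C_def si.B_simps)
    qed
    finally show ?thesis .
   qed
   have ok: "Bt x T = 0" if "T \<in> kl" for T
    using kl_s_orth[OF that x] tt.B_sym[OF xL] that kl_L by auto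
   have op: "Bt x z = 0" if \<alpha>: "\<alpha> \<in> ?P" and z: "z \<in> rs \<alpha>" for \<alpha> z
   proof -
    \<comment> \<open>x lies in \<open>s\<close>, so it is orthogonal to c + \<open>th c\<close> in
      \<open>kl\<close>. Together with orthogonality to c - \<open>th c\<close> this gives
      orthogonality to c.\<close>
    have c0: "Bt x c = 0" if c: "c \<in> Cr \<alpha>" for c
    proof -
     have j: "(\<alpha>, c) \<in> J" using \<alpha> c by (simp add: J_def)
     have "us c \<in> C" using j unfolding C_def U_def by force
     hence "Bt x (us c) = 0" using o Bk_s[OF x Jr(5)[OF j]] by simp
     hence "Bt x (c - th c) = 0" using xL Jr(4)[OF j] by (simp add: us_def tt.B_simps)
     moreover have "Bt x (c + th c) = 0"
      by (rule ok) (use Jr(4)[OF j] in "simp add: kl_eq th_simps th_props add.commute")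
     ultimately show ?thesis using xL Jr(4)[OF j] by (simp add: tt.B_simps)
    qed
    have zL: "z \<in> L" using rsD(1)[OF z] .
    have cL: "c \<in> L" if "c \<in> Cr \<alpha>" for c using Crd(1)[OF \<alpha>] rsD(1) that by blast
    have "Bt x z = Bt z x" by (rule tt.B_sym[OF xL zL])
    also have "\<dots> = Bt (\<Sum>c\<in>Cr \<alpha>. Bt z c *R c) x" using Crd(4)[OF \<alpha> z] by simp
    also have "\<dots> = (\<Sum>c\<in>Cr \<alpha>. Bt (Bt z c *R c) x)" by (rule tt.B_sum) (use cL xL in auto)
    also have "\<dots> = 0"
    proof (rule sum.neutral, rule ballI)
     fix c assume c: "c \<in> Cr \<alpha>"
     show "Bt (Bt z c *R c) x = 0" using c0[OF c] tt.B_sym[OF xL cL[OF c]] xL cL[OF c] by (simp add: tt.B_simps)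
    qed
    finally show ?thesis .
   qed
   show "x = 0"
   proof (rule orth_all[OF xL])
    fix y assume y: "y \<in> g0"
    define T where "T = (1/2) *R (y + th y)"
    define H where "H = (1/2) *R (y - th y)"
    have TH: "T \<in> kl" "H \<in> a" "y = T + H" using g0_decomp[OF y] kl_s_decomp(3)[of y] y by (auto simp: T_def H_def)
    hence "T \<in> L" "H \<in> L" using kl_L a_L by auto
    thus "Bt x y = 0" unfolding TH(3) using ok[OF TH(1)] oa[OF TH(2)] xL by (simp add: tt.B_simps)
   next
    fix \<alpha> y assume \<alpha>: "\<alpha> \<in> \<Sigma>" "y \<in> rs \<alpha>"
    show "Bt x y = 0"
    proof (cases "\<alpha> H0 > 0")
     case True
     thus ?thesis using op[of \<alpha> y] \<alpha> H0(3) by simp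
    next
     case False
     have "fscale (-1) \<alpha> \<in> ?P" unfolding H0(3) using root_neg[OF \<alpha>(1)] False H0(2)[OF \<alpha>(1)] by (simp add: fscale_def)
     hence "Bt x (th y) = 0" by (rule op[OF _ th_rs[OF \<alpha>(2)]])
     moreover have "Bt (th x) (th y) = Bt x y" by (rule Bt_th[OF xL rsD(1)[OF \<alpha>(2)]])
     ultimately show ?thesis using sD(2)[OF x] xL rsD(1)[OF \<alpha>(2)] by (simp add: tt.B_simps)
    qed
   qed
  qed
 qed (use finC Cs in auto)
 moreover have "(\<Sum>b\<in>C. F b) = (\<Sum>b\<in>Ca. F b) + (\<Sum>\<alpha>\<in>?P. \<Sum>c\<in>Cr \<alpha>. F (us c))" for F :: "'e => complex"
 proof -
  have "(\<Sum>b\<in>C. F b) = (\<Sum>b\<in>Ca. F b) + (\<Sum>b\<in>U. F b)"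
   unfolding C_def by (rule sum.union_disjoint[OF Cad(2) _ disj]) (use finJ in "simp add: U_def")
  also have "(\<Sum>b\<in>U. F b) = (\<Sum>(\<alpha>, c)\<in>J. F (us c))"
   unfolding U_def by (subst sum.reindex[OF inj]) (simp add: case_prod_beta o_def)
  also have "\<dots> = (\<Sum>\<alpha>\<in>?P. \<Sum>c\<in>Cr \<alpha>. F (us c))"
   unfolding J_def by (rule sum.Sigma[symmetric]) (use finP Crd(2) in auto)
  finally show ?thesis .
 qed
 ultimately show ?thesis by (rule that)
qed

text \<open>The relations of the rank one subalgebra attached to E. They govern the rotation by
  \<open>ex (Zvec G \<alpha>)\<close> and the second derivative along E -
  \<open>th E\<close>.\<close>

lemma Z_brackets:
 assumes \<alpha>: "\<alpha> \<in> dual_space a" and E: "E \<in> rs \<alpha>"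
 shows "E + th E \<in> kl" "E - th E \<in> s" "H \<in> a ==> br (E + th E) H = (- \<alpha> H) *R (E - th E)"
  "br (E + th E) (E - th E) = (2 * Bt E E) *R Hv \<alpha>"
proof -
 note EL = rsD(1)[OF E]
 show "E + th E \<in> kl" using EL by (simp add: kl_eq th_simps th_props add.commute)
 show "E - th E \<in> s" using EL by (simp add: ss_def th_simps th_props)
 show "br (E + th E) H = (- \<alpha> H) *R (E - th E)" if H: "H \<in> a"
 proof -
  have "br (E + th E) H = - br H (E + th E)" by (rule bracket_anti) (use EL a_props(3)[OF H] in auto)
  also have "br H (E + th E) = \<alpha> H *R E - \<alpha> H *R th E"
   using rsD(2)[OF E H] rsD(2)[OF th_rs[OF E] H] EL a_props(3)[OF H] by (simp add: br_simps fscale_def)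
  finally show ?thesis by (simp add: scaleR_diff_right)
 qed
 have "br (E + th E) (E - th E) = br (th E) E - br E (th E)" using EL by (simp add: br_simps bracket_self)
 also have "br (th E) E = - br E (th E)" by (rule bracket_anti) (use EL in auto)
 also have "br E (th E) = (- Bt E E) *R Hv \<alpha>" by (rule br_X_thX[OF \<alpha> E])
 finally show "br (E + th E) (E - th E) = (2 * Bt E E) *R Hv \<alpha>"
  by (simp add: scaleR_add_left[symmetric] del: scaleR_add_left)
qed

lemma rootvec_props:
 assumes "\<alpha> \<in> \<Sigma>" shows "rootvec G \<alpha> \<in> rs \<alpha>" "Bt (rootvec G \<alpha>) (rootvec G \<alpha>) = 2 / nrm \<alpha>"
 using S assms by (auto simp: setting_def Bt_def)

lemma Zvec_kl: "\<alpha> \<in> \<Sigma> ==> Zvec G \<alpha> \<in> kl" "\<alpha> \<in> \<Sigma> ==> Zvec G \<alpha> \<in> L"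
 using Z_brackets(1)[OF rootD(1) rootvec_props(1)] kl_L by (auto simp: Zvec_def)

text \<open>A representative in \<open>K\<close> of the reflection in \<alpha>; the time pi / 2
  corresponds to a half turn.\<close>

definition kr :: "('e => real) => 'a" where "kr \<alpha> = ex (Zvec G \<alpha>) (pi / 2)"

text \<open>In the plane spanned by \<open>H\<^sub>\<alpha>\<close> and \<open>E\<^sub>\<alpha> - \<theta> E\<^sub>\<alpha>\<close>, \<open>exp (t Z\<^sub>\<alpha>)\<close> acts as the rotation by the angle \<open>2 t\<close>.\<close>

lemma kr_props:
 assumes \<alpha>: "\<alpha> \<in> \<Sigma>" shows "kr \<alpha> \<in> NK" "H \<in> a ==> Ad G (kr \<alpha>) H = refl G \<alpha> H"
proof -
 note d = rootD(1)[OF \<alpha>] and rv = rootvec_props[OF \<alpha>] and ZL = Zvec_kl(2)[OF \<alpha>]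
 define X where "X = rootvec G \<alpha> - th (rootvec G \<alpha>)"
 let ?Z = "Zvec G \<alpha>" and ?n = "nrm \<alpha>"
 note zb = Z_brackets[OF d rv(1), folded Zvec_def X_def]
 have n: "?n > 0" by (rule nrm_pos(1)[OF d rootD(2)[OF \<alpha>]])
 have ZX: "br ?Z X = (4 / ?n) *R Hv \<alpha>" using zb(4) unfolding rv(2) by simp
 have XL: "X \<in> L" using zb(2) sD by blast
 note Ha = Hvec_props(1)[OF d]
 note HL = a_props(3)[OF Ha]
 show A: "Ad G (kr \<alpha>) H = refl G \<alpha> H" if H: "H \<in> a" for H
 proof -
  define q where "q = \<alpha> H / ?n"
  define H' where "H' = H - q *R Hv \<alpha>"
  \<comment> \<open>H' is the component of H on which \<alpha> vanishes and stays fixed; the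
    component along \<open>Hv \<alpha>\<close> rotates. The coefficient of X is dictated by the two
    brackets with Z.\<close>
  define y where "y t = H' + q *R (cos (2 * t) *R Hv \<alpha> - (?n / 2 * sin (2 * t)) *R X)" for t
  have H'a: "H' \<in> a" unfolding H'_def using H Ha by simp
  have "\<alpha> H' = 0" unfolding H'_def
   using lin_on_diff[OF dual_a(1)[OF d] a_props(1) H, of "q *R Hv \<alpha>"] lin_on_scale[OF dual_a(1)[OF d] Ha] Ha n nrm_pos(2)[OF d]
   by (simp add: q_def)
  hence b': "br ?Z H' = 0" using zb(3)[OF H'a] by simp
  have bH: "br ?Z (Hv \<alpha>) = (- ?n) *R X" using zb(3)[OF Ha] nrm_pos(2)[OF d] by simp
  have yL: "y t \<in> L" for t unfolding y_def using a_props(3)[OF H'a] HL XL by simp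
  have yd: "(y hvd br ?Z (y t)) (at t)" for t
  proof -
   have "br ?Z (y t) = q *R (cos (2 * t) *R br ?Z (Hv \<alpha>) - (?n / 2 * sin (2 * t)) *R br ?Z X)"
    unfolding y_def using a_props(3)[OF H'a] HL XL ZL b' by (simp add: br_simps)
   also have "\<dots> = q *R ((- (2 * sin (2 * t))) *R Hv \<alpha> - (?n / 2 * (2 * cos (2 * t))) *R X)"
    unfolding bH ZX using n by (simp add: algebra_simps)
   finally show ?thesis
    unfolding y_def by (auto intro!: derivative_eq_intros simp: algebra_simps)
  qed
  have "Ad G (ex ?Z (pi / 2)) H = y (pi / 2)"
  proof (rule ad_ode_unique[OF ZL])
   show "Ad G (ex ?Z t) H \<in> L" for t by (rule Ad_in[OF ex_props(1)[OF ZL] a_props(3)[OF H]])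
   show "((%t. Ad G (ex ?Z t) H) hvd br ?Z (Ad G (ex ?Z t) H)) (at t)" for t
    by (rule Ad_ops_deriv[OF ex_ops[OF ZL] a_props(3)[OF H]])
   show "y t \<in> L" for t by (rule yL)
   show "(y hvd br ?Z (y t)) (at t)" for t by (rule yd)
   show "Ad G (ex ?Z 0) H = y 0"
    using ex_props(3)[OF ZL] Ad_one[OF a_props(3)[OF H]] by (simp add: y_def H'_def)
  qed
  also have "\<dots> = refl G \<alpha> H" by (simp add: y_def H'_def q_def refl_def algebra_simps) (simp add: scaleR_2 scaleR_add_left[symmetric])
  finally show ?thesis by (simp add: kr_def)
 qed
 have rr: "refl G \<alpha> H \<in> a" "refl G \<alpha> (refl G \<alpha> H) = H" if H: "H \<in> a" for H
 proof -
  show "refl G \<alpha> H \<in> a" unfolding refl_def using H Ha by simp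
  have "\<alpha> (refl G \<alpha> H) = - \<alpha> H" unfolding refl_def
   using lin_on_diff[OF dual_a(1)[OF d] a_props(1) H] lin_on_scale[OF dual_a(1)[OF d] Ha] Ha n nrm_pos(2)[OF d] by simp
  thus "refl G \<alpha> (refl G \<alpha> H) = H" by (simp add: refl_def)
 qed
 have K: "kr \<alpha> \<in> K" unfolding kr_def by (rule ex_K[OF Zvec_kl(1)[OF \<alpha>]])
 have "Ad G (kr \<alpha>) ` a = a"
 proof
  show "Ad G (kr \<alpha>) ` a <= a" using A rr(1) by auto
  show "a <= Ad G (kr \<alpha>) ` a"
  proof
   fix H assume H: "H \<in> a"
   have "H = Ad G (kr \<alpha>) (refl G \<alpha> H)" using A[OF rr(1)[OF H]] rr(2)[OF H] by simp
   thus "H \<in> Ad G (kr \<alpha>) ` a" using rr(1)[OF H] by blast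
  qed
 qed
 thus "kr \<alpha> \<in> NK" using K KD(1)[OF K] by (simp add: lie_normalizer_def)
qed

end

section \<open>Differentiated representations\<close>

lemma hvd_quotient:
 fixes f :: "real => 'v::real_normed_vector"
 assumes "(f hvd v) (at 0)"
 shows "((%h. (1 / h) *R (f h - f 0)) \<longlongrightarrow> v) (at 0)"
proof -
 have "(%h. norm (f (0 + h) - f 0 - h *R v) / norm h) \<midarrow>0\<rightarrow> 0"
  using assms unfolding has_vector_derivative_def has_derivative_at by blast
 moreover have "\<forall>\<^sub>F h in at 0. norm (f (0 + h) - f 0 - h *R v) / norm h = norm ((1 / h) *R (f h - f 0) - v)"
 proof (rule eventually_at_filter[THEN iffD2], rule always_eventually, intro allI impI)
  fix h :: real assume h: "h ~= 0"
  have "(1 / h) *R (f h - f 0) - v = (1 / h) *R (f h - f 0 - h *R v)" using h by (simp add: scaleR_diff_right)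
  thus "norm (f (0 + h) - f 0 - h *R v) / norm h = norm ((1 / h) *R (f h - f 0) - v)" by simp
 qed
 ultimately have "((%h. norm ((1 / h) *R (f h - f 0) - v)) \<longlongrightarrow> 0) (at 0)"
  by (rule Lim_transform_eventually)
 thus ?thesis by (simp add: tendsto_norm_zero_iff LIM_zero_iff)
qed

text \<open>The vectors with differentiable orbit form a closed subspace, and it contains the averages
 of the orbits over short intervals, which tend to the given vector.\<close>

lemma one_parameter_group_differentiable:
 fixes U :: "real => 'v::euclidean_space => 'v"
 assumes lin: "!!t. linear (U t)" and U0: "!!v. U 0 v = v" and hom: "!!s t v. U (s + t) v = U s (U t v)"
  and cont: "!!v. continuous_on UNIV (%t. U t v)"
 shows "\<exists>w. ((%t. U t v) hvd w) (at 0)"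
proof -
 define D where "D = {v. \<exists>w. ((%t. U t v) hvd w) (at 0)}"
 have "subspace D"
  unfolding subspace_def
 proof (intro conjI ballI allI)
  show "0 \<in> D" unfolding D_def using linear_0[OF lin] by (auto intro!: exI[of _ 0])
  show "x + y \<in> D" if "x \<in> D" "y \<in> D" for x y
  proof -
   obtain w w' where "((%t. U t x) hvd w) (at 0)" "((%t. U t y) hvd w') (at 0)"
    using \<open>x \<in> D\<close> \<open>y \<in> D\<close> unfolding D_def by blast
   from has_vector_derivative_add[OF this] show ?thesis unfolding D_def by (auto simp: linear_add[OF lin])
  qed
  show "c *R x \<in> D" if "x \<in> D" for c x
  proof -
   obtain w where "((%t. U t x) hvd w) (at 0)" using \<open>x \<in> D\<close> unfolding D_def by blast
   hence "((%t. c *R U t x) hvd c *R w) (at 0)"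
    by (rule bounded_linear.has_vector_derivative[OF bounded_linear_scaleR_right])
   thus ?thesis unfolding D_def by (auto simp: linear_scale[OF lin])
  qed
 qed
 hence cl: "closed D" by (rule closed_subspace)
 \<comment> \<open>The lower limit -1 leaves room to differentiate the primitive at 0 from both
   sides.\<close>
 define F where "F x = integral {-1..x} (%t. U t v)" for x :: real
 have F: "(F hvd U x v) (at x)" if "-1 < x" "x < 3" for x
 proof -
  have "(F hvd U x v) (at x within {-1..3})"
   unfolding F_def by (rule integral_has_vector_derivative) (use that continuous_on_subset[OF cont] in auto)
  thus ?thesis using at_within_Icc_at[of "-1" x 3] that by simp
 qed
 \<comment> \<open>Applying \<open>U h\<close> shifts the interval of integration by h, which moves
   the dependence on h into the end points, where F is differentiable.\<close>
 have avg: "F b - F 0 \<in> D" if b: "0 < b" "b < 1" for b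
 proof -
  have e: "U h (F b - F 0) = F (h + b) - F h" if h: "\<bar>h\<bar> < 1" for h
  proof -
   have i0: "((%t. U t v) has_integral F b - F 0) {0..b}"
    by (rule fundamental_theorem_of_calculus, use b in simp, rule has_vector_derivative_at_within, rule F) (use b in auto)
   have "((%t. U h (U t v)) has_integral U h (F b - F 0)) {0..b}"
    using has_integral_linear[OF i0, of "U h"] lin by (simp add: o_def linear_conv_bounded_linear)
   moreover have "((%t. U h (U t v)) has_integral F (h + b) - F (h + 0)) {0..b}"
   proof (rule fundamental_theorem_of_calculus)
    fix t assume t: "t \<in> {0..b}"
    have "((%t. h + t) hvd 1) (at t)" by (auto intro!: derivative_eq_intros)
    moreover have "(F hvd U (h + t) v) (at (h + t))" by (rule F) (use t b h in auto)
    ultimately have "(F o (%t. h + t) hvd 1 *R U (h + t) v) (at t)" by (rule vector_diff_chain_at)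
    thus "((%t. F (h + t)) hvd U h (U t v)) (at t within {0..b})"
     by (simp add: o_def hom has_vector_derivative_at_within)
   qed (use b in simp)
   ultimately have "U h (F b - F 0) = F (h + b) - F (h + 0)" by (rule has_integral_unique)
   thus ?thesis by simp
  qed
  have "((%h. F (h + b)) hvd U b v) (at 0)"
  proof -
   have "((%h. h + b) hvd 1) (at 0)" by (auto intro!: derivative_eq_intros)
   moreover have "(F hvd U b v) (at (0 + b))" using F[of b] b by simp
   ultimately have "(F o (%h. h + b) hvd 1 *R U b v) (at 0)" by (rule vector_diff_chain_at)
   thus ?thesis by (simp add: o_def)
  qed
  from has_vector_derivative_diff[OF this F[of 0]]
  have d: "((%h. F (h + b) - F h) hvd U b v - U 0 v) (at 0)" by simp
  have "\<forall>\<^sub>F h in nhds 0. F (h + b) - F h = U h (F b - F 0)"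
   by (rule eventually_nhds_metric[THEN iffD2]) (use e in "auto intro!: exI[of _ 1] simp: dist_real_def")
  from hvd_cong[OF this d] show ?thesis unfolding D_def by (intro CollectI exI)
 qed
 have "((%h. (1 / h) *R (F h - F 0)) \<longlongrightarrow> v) (at_right 0)"
  by (rule tendsto_within_subset[OF hvd_quotient]) (use F[of 0] U0 in auto)
 moreover have "\<forall>\<^sub>F h in at_right 0. (1 / h) *R (F h - F 0) \<in> D"
 proof (rule eventually_mono[OF eventually_at_right_real[OF zero_less_one]])
  fix h :: real assume "h \<in> {0<..<1}"
  thus "(1 / h) *R (F h - F 0) \<in> D" by (intro subspace_scale[OF \<open>subspace D\<close>] avg) auto
 qed
 ultimately have "v \<in> D" by (rule Lim_in_closed_set[OF cl, rotated 2]) simp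
 thus ?thesis by (simp add: D_def)
qed

section \<open>Hermitian linear algebra\<close>

lemma hermitian_simps:
 "hermitian (v + v') w = hermitian v w + hermitian v' w" "hermitian v (w + w') = hermitian v w + hermitian v w'"
 "hermitian (c *s v) w = c * hermitian v w" "hermitian v (c *s w) = cnj c * hermitian v w"
 "hermitian 0 w = 0" "hermitian v 0 = 0" "hermitian (- v) w = - hermitian v w" "hermitian v (- w) = - hermitian v w"
 by (simp_all add: hermitian_def sum.distrib sum_distrib_left sum_negf algebra_simps)

lemma scaleR_vec: "r *R (v :: complex^'n) = cplx r *s v"
 by (simp add: vec_eq_iff) (simp add: scaleR_conv_of_real)

lemma hermitian_pos: "hermitian v v = 0 ==> v = 0"
proof -
 assume "hermitian v v = 0"
 hence "cplx (\<Sum>i\<in>UNIV. (cmod (v $ i))\<^sup>2) = 0" unfolding hermitian_def complex_norm_square[symmetric] by simp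
 hence "(\<Sum>i\<in>UNIV. (cmod (v $ i))\<^sup>2) = 0" using of_real_eq_0_iff by blast
 thus "v = 0" by (simp add: sum_nonneg_eq_0_iff vec_eq_iff)
qed

lemma hermitian_linear: "linear (%v. hermitian v w)" "linear (hermitian v)"
 by (rule linearI; simp add: hermitian_simps scaleR_vec scaleR_conv_of_real)+

lemma hermitian_inner: "v \<bullet> w = Re (hermitian v w)"
 by (simp add: inner_vec_def hermitian_def inner_complex_def)

text \<open>The real orthogonal complement of a complex subspace is also its Hermitian complement:
  testing against i z as well as z removes the imaginary part.\<close>

lemma hermitian_complement:
 assumes X: "vec.subspace X"
 obtains x y where "x \<in> X" "v = x + y" "!!z. z \<in> X ==> hermitian z y = 0"
proof -
 have X': "subspace X" using X unfolding subspace_def vec.subspace_def scaleR_vec by blast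
 obtain x y where xy: "x \<in> span X" "!!z. z \<in> span X ==> orthogonal y z" "v = x + y"
  by (rule orthogonal_subspace_decomp_exists[of X v]) (rule that; simp)
 have re: "Re (hermitian z y) = 0" if "z \<in> X" for z
  using xy(2)[of z] that span_base[of z X] hermitian_inner[of z y] by (simp add: orthogonal_def inner_commute)
 have "hermitian z y = 0" if z: "z \<in> X" for z
 proof (rule complex_eqI)
  have "\<i> *s z \<in> X" using X z by (simp add: vec.subspace_def)
  thus "Im (hermitian z y) = Im 0" using re by (force simp: hermitian_simps)
 qed (use re z in simp)
 moreover have "x \<in> X" using xy(1) X' span_eq_iff by blast
 ultimately show ?thesis using xy(3) that by blast
qed

lemma hermitian_riesz:
 fixes l :: "complex^'n => complex"
 assumes l: "!!v w. l (v + w) = l v + l w" "!!c v. l (c *s v) = c * l v"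
 obtains y where "!!v. l v = hermitian v y"
proof
 fix v :: "complex^'n"
 have l0: "l 0 = 0" using l(2)[of 0 0] by simp
 have s: "l (\<Sum>i\<in>I. c i *s axis i 1) = (\<Sum>i\<in>I. c i * l (axis i 1))" for I c
  by (induction I rule: infinite_finite_induct) (simp_all add: l l0)
 have "v = (\<Sum>i\<in>UNIV. v $ i *s axis i 1)" by (rule basis_expansion[symmetric])
 hence "l v = (\<Sum>i\<in>UNIV. v $ i * l (axis i 1))" using s[of "%i. v $ i" UNIV] by simp
 thus "l v = hermitian v (\<chi> i. cnj (l (axis i 1)))" by (simp add: hermitian_def)
qed

section \<open>Unitary representations of \<open>K\<close> and their derivatives\<close>

locale krep = iwasawa G for G :: "('a, 'e::euclidean_space) iwasawa_data" (structure) +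
 fixes \<pi> :: "('a, 'n::finite) rep"
 assumes pi: "\<pi> \<in> K_hat G"
begin

lemma pi_add: "k \<in> K ==> \<pi> k (v + w) = \<pi> k v + \<pi> k w"
 and pi_scale: "k \<in> K ==> \<pi> k (c *s v) = c *s \<pi> k v"
 and pi_one: "\<pi> \<one> v = v"
 and pi_mult: "k \<in> K ==> l \<in> K ==> \<pi> (k \<otimes> l) v = \<pi> k (\<pi> l v)"
 and pi_herm: "k \<in> K ==> hermitian (\<pi> k v) (\<pi> k w) = hermitian v w"
 using pi unfolding K_hat_def by (auto simp: Vector_Spaces.linear_iff)

lemma pi_linear: "k \<in> K ==> linear (\<pi> k)"
 by (rule linearI) (simp_all add: pi_add pi_scale scaleR_vec)

lemma pi_inv: assumes "k \<in> K" shows "\<pi> k (\<pi> (inv k) v) = v" "\<pi> (inv k) (\<pi> k v) = v"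
 using pi_mult[OF assms K_grp(2)[OF assms]] pi_mult[OF K_grp(2)[OF assms] assms] KD(1)[OF assms] pi_one by (metis r_inv, metis l_inv)

lemma pi_herm_inv: assumes "k \<in> K" shows "hermitian (\<pi> k v) w = hermitian v (\<pi> (inv k) w)"
 using pi_herm[OF assms, of v "\<pi> (inv k) w"] pi_inv(1)[OF assms] by simp

lemma pi_ex_continuous: assumes Z: "Z \<in> kl" shows "continuous_on UNIV (%t. \<pi> (ex Z t) v)"
proof -
 have ZL: "Z \<in> L" using Z kl_L by blast
 have "continuous_map euclidean (subtopology TG K) (ex Z)"
  by (rule continuous_map_into_subtopology[OF ex_props(8)[OF ZL]]) (use ex_K[OF Z] in blast)
 moreover have "continuous_map (subtopology TG K) euclidean (%k. \<pi> k v)" using pi by (simp add: K_hat_def)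
 ultimately have "continuous_map euclidean euclidean ((%k. \<pi> k v) o ex Z)" by (rule continuous_map_compose)
 thus ?thesis by (simp add: o_def)
qed

abbreviation "dr \<equiv> drep G \<pi>"

text \<open>The definite description in \<open>drep\<close> denotes: one-parameter subgroups are
  unique, and their orbits are differentiable by
  \<open>one_parameter_group_differentiable\<close>.\<close>

lemma drep_hvd0: assumes Z: "Z \<in> kl" shows "((%t. \<pi> (ex Z t) v) hvd dr Z v) (at 0)"
proof -
 have ZL: "Z \<in> L" using Z kl_L by blast
 obtain w where w: "((%t. \<pi> (ex Z t) v) hvd w) (at 0)"
  using one_parameter_group_differentiable[of "%t. \<pi> (ex Z t)" v] pi_linear[OF ex_K[OF Z]] pi_ex_continuous[OF Z]
   ex_props(2,3)[OF ZL] pi_one pi_mult[OF ex_K[OF Z] ex_K[OF Z]] by auto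
 have "dr Z v = w"
  unfolding drep_def
 proof (rule the_equality)
  show "\<exists>\<gamma>. one_param_subgroup G Z \<gamma> & ((%t. \<pi> (\<gamma> t) v) hvd w) (at 0)" using ex_ops[OF ZL] w by blast
  fix w' assume "\<exists>\<gamma>. one_param_subgroup G Z \<gamma> & ((%t. \<pi> (\<gamma> t) v) hvd w') (at 0)"
  then obtain \<gamma> where g: "one_param_subgroup G Z \<gamma>" "((%t. \<pi> (\<gamma> t) v) hvd w') (at 0)" by blast
  have "((%t. \<pi> (ex Z t) v) hvd w') (at 0)" using g(2) ex_eqI[OF g(1)] by simp
  thus "w' = w" using vector_derivative_unique_at w by blast
 qed
 thus ?thesis using w by simp
qed

lemma drep_eqI: "Z \<in> kl ==> ((%t. \<pi> (ex Z t) v) hvd w) (at 0) ==> dr Z v = w"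
 using drep_hvd0 vector_derivative_unique_at by blast

lemma drep_add: "Z \<in> kl ==> dr Z (v + w) = dr Z v + dr Z w"
 using has_vector_derivative_add[OF drep_hvd0[of Z v] drep_hvd0[of Z w]]
 by (intro drep_eqI) (simp_all add: pi_add ex_K)

lemma drep_cscale: assumes "Z \<in> kl" shows "dr Z (c *s v) = c *s dr Z v"
proof (rule drep_eqI[OF assms])
 have "linear (%v::complex^'n. c *s v)" by (rule linearI) (simp_all add: scaleR_vec vec.scale_right_distrib mult.commute)
 hence "((%t. c *s \<pi> (ex Z t) v) hvd c *s dr Z v) (at 0)"
  by (intro bounded_linear.has_vector_derivative[OF _ drep_hvd0[OF assms]]) (simp add: linear_conv_bounded_linear)
 thus "((%t. \<pi> (ex Z t) (c *s v)) hvd c *s dr Z v) (at 0)" using pi_scale ex_K[OF assms] by simp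
qed

lemma drep_linear: "Z \<in> kl ==> linear (dr Z)"
 by (rule linearI) (simp_all add: drep_add drep_cscale scaleR_vec)

lemma kl_sub: "subspace kl"
 unfolding subspace_def kl_eq using lin_on_0[OF th_props(3) subL] by (auto simp: th_simps)

lemma drep_scale: assumes Z: "Z \<in> kl" shows "dr (r *R Z) v = r *R dr Z v"
proof (rule drep_eqI[OF subspace_scale[OF kl_sub Z]])
 have ZL: "Z \<in> L" using Z kl_L by blast
 have "((%t::real. r * t) hvd r) (at 0)" by (auto intro!: derivative_eq_intros)
 moreover have "((%t. \<pi> (ex Z t) v) hvd dr Z v) (at (r * 0))" using drep_hvd0[OF Z] by simp
 ultimately have "((%t. \<pi> (ex Z t) v) o (%t. r * t) hvd r *R dr Z v) (at 0)" by (rule vector_diff_chain_at)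
 thus "((%t. \<pi> (ex (r *R Z) t) v) hvd r *R dr Z v) (at 0)" by (simp add: o_def ex_scale[OF ZL])
qed

lemma drep_conj: assumes Z: "Z \<in> kl" and k: "k \<in> K" shows "dr (Ad G k Z) (\<pi> k v) = \<pi> k (dr Z v)"
proof (rule drep_eqI)
 have ZL: "Z \<in> L" using Z kl_L by blast
 note kc = KD(1)[OF k]
 show "Ad G k Z \<in> kl" using KD(2)[OF k] Z by blast
 have "((%t. \<pi> k (\<pi> (ex Z t) v)) hvd \<pi> k (dr Z v)) (at 0)"
  by (rule bounded_linear.has_vector_derivative[OF _ drep_hvd0[OF Z]]) (use pi_linear[OF k] in "simp add: linear_conv_bounded_linear")
 moreover have "\<pi> (ex (Ad G k Z) t) (\<pi> k v) = \<pi> k (\<pi> (ex Z t) v)" for t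
 proof -
  have e: "ex (Ad G k Z) t = k \<otimes> ex Z t \<otimes> inv k" using ex_conj[OF ZL kc] by simp
  show ?thesis unfolding e
   by (simp add: pi_mult[OF K_grp(3)[OF k ex_K[OF Z]] K_grp(2)[OF k]] pi_mult[OF k ex_K[OF Z]] pi_inv(2)[OF k])
 qed
 ultimately show "((%t. \<pi> (ex (Ad G k Z) t) (\<pi> k v)) hvd \<pi> k (dr Z v)) (at 0)" by simp
qed

lemma drep_hvd:
 assumes Z: "Z \<in> kl" shows "((%t. \<pi> (ex Z t) v) hvd dr Z (\<pi> (ex Z t) v)) (at t)"
proof -
 have ZL: "Z \<in> L" using Z kl_L by blast
 have "((%x. x - t) hvd 1) (at t)" by (auto intro!: derivative_eq_intros)
 moreover have "((%s. \<pi> (ex Z s) (\<pi> (ex Z t) v)) hvd dr Z (\<pi> (ex Z t) v)) (at (t - t))"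
  using drep_hvd0[OF Z] by simp
 ultimately have "((%s. \<pi> (ex Z s) (\<pi> (ex Z t) v)) o (%x. x - t) hvd 1 *R dr Z (\<pi> (ex Z t) v)) (at t)"
  by (rule vector_diff_chain_at)
 moreover have "\<pi> (ex Z (x - t)) (\<pi> (ex Z t) v) = \<pi> (ex Z x) v" for x
  using pi_mult[OF ex_K[OF Z] ex_K[OF Z], symmetric] ex_props(2)[OF ZL, of "x - t" t] by simp
 ultimately show ?thesis by (simp add: o_def)
qed

lemma drep_skew: assumes Z: "Z \<in> kl" shows "hermitian (dr Z v) w = - hermitian v (dr Z w)"
proof -
 have ZL: "Z \<in> L" using Z kl_L by blast
 have "((%t. hermitian (\<pi> (ex Z t) v) w) hvd hermitian (dr Z v) w) (at 0)"
  by (rule bounded_linear.has_vector_derivative[OF _ drep_hvd0[OF Z]])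
   (use hermitian_linear(1) in "simp add: linear_conv_bounded_linear")
 moreover have "((%t. hermitian v (\<pi> (ex ((-1) *R Z) t) w)) hvd hermitian v (dr ((-1) *R Z) w)) (at 0)"
  by (rule bounded_linear.has_vector_derivative[OF _ drep_hvd0[OF subspace_scale[OF kl_sub Z]]])
   (use hermitian_linear(2) in "simp add: linear_conv_bounded_linear")
 moreover have "hermitian v (\<pi> (ex ((-1) *R Z) t) w) = hermitian (\<pi> (ex Z t) v) w" for t
  unfolding pi_herm_inv[OF ex_K[OF Z]] ex_scale[OF ZL] using ex_props(7)[OF ZL, of t] by simp
 ultimately have "hermitian (dr Z v) w = hermitian v (dr ((-1) *R Z) w)" using vector_derivative_unique_at by fastforce
 thus ?thesis unfolding drep_scale[OF Z] by (simp add: scaleR_vec hermitian_simps)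
qed

definition zop :: "'e => complex^'n => complex^'n" where "zop Z v = dr Z (dr Z (dr Z v) + 4 *s v)"

lemma Zop_zop: "Zop G \<pi> \<alpha> v = zop (Zvec G \<alpha>) v" by (simp add: Zop_def zop_def Let_def)

lemma zop_skew: assumes Z: "Z \<in> kl" shows "hermitian (zop Z v) w = - hermitian v (zop Z w)"
 unfolding zop_def
 by (simp add: drep_skew[OF Z] hermitian_simps drep_add[OF Z] drep_cscale[OF Z])

lemma zop_linear: assumes Z: "Z \<in> kl" shows "zop Z (v + w) = zop Z v + zop Z w" "zop Z (c *s v) = c *s zop Z v"
 by (simp_all add: zop_def drep_add[OF Z] drep_cscale[OF Z] vec.scale_right_distrib mult.commute)

text \<open>If \<open>Z\<^sup>3 v = -4 Z v\<close>, then \<open>exp (t Z) v = v + (sin (2t) / 2) Z v + ((1 - cos (2t)) / 4) Z\<^sup>2 v\<close>.\<close>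

lemma zop_zero_square:
 assumes Z: "Z \<in> kl" and v: "zop Z v = 0"
 shows "dr Z (dr Z v) = (-2) *s (v - \<pi> (ex Z (pi / 2)) v)"
proof -
 have ZL: "Z \<in> L" using Z kl_L by blast
 note lin = drep_linear[OF Z]
 define p where "p t = v + (sin (2 * t) / 2) *R dr Z v + ((1 - cos (2 * t)) / 4) *R dr Z (dr Z v)" for t
 have "dr Z (dr Z (dr Z v)) + 4 *s dr Z v = 0" using v by (simp add: zop_def drep_add[OF Z] drep_cscale[OF Z])
 hence Z3: "dr Z (dr Z (dr Z v)) = (-4) *R dr Z v" by (simp add: scaleR_vec eq_neg_iff_add_eq_0)
 have pd: "(p hvd dr Z (p t)) (at t)" for t
 proof -
  have h: "x + y + ((1 - c) / 4) *R ((-4) *R x) = c *R x + y" for x y :: "complex^'n" and c :: real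
  proof -
   have "(1 - c) / 4 * (- 4) = c - 1" by (simp add: field_simps)
   thus ?thesis by (simp only: scaleR_scaleR) (simp add: scaleR_left_diff_distrib)
  qed
  have "dr Z (p t) = cos (2 * t) *R dr Z v + (sin (2 * t) / 2) *R dr Z (dr Z v)"
   unfolding p_def linear_add[OF lin] linear_scale[OF lin] Z3 by (rule h)
  thus ?thesis unfolding p_def by (auto intro!: derivative_eq_intros)
 qed
 obtain C where C: "!!x. norm (dr Z x) <= C * norm x" using lin linear_bounded by blast
 have "(%t. \<pi> (ex Z t) v - p t) (pi / 2) = 0"
 proof (rule linear_ode_unique[where u' = "%t. dr Z (\<pi> (ex Z t) v - p t)" and C = C])
  show "((%t. \<pi> (ex Z t) v - p t) hvd dr Z (\<pi> (ex Z t) v - p t)) (at t)" for t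
   using has_vector_derivative_diff[OF drep_hvd[OF Z] pd] by (simp add: linear_diff[OF lin])
  show "\<pi> (ex Z 0) v - p 0 = 0" using ex_props(3)[OF ZL] pi_one by (simp add: p_def)
 qed (rule C)
 hence "\<pi> (ex Z (pi / 2)) v = v + (1 / 2) *R dr Z (dr Z v)" by (simp add: p_def)
 hence "v - \<pi> (ex Z (pi / 2)) v = (- 1 / 2) *R dr Z (dr Z v)" by simp
 thus ?thesis by (simp add: scaleR_vec vec.scale_scale)
qed

end

section \<open>Conjugation of the vectors Z by \<open>M\<close> and by the normalizer\<close>

context iwasawa
begin

text \<open>\<open>M_transitive\<close> after rescaling. It shows that the operators do not depend
  in an essential way on the choice of the root vectors.\<close>

lemma Z_transitive:
 assumes \<beta>: "\<beta> \<in> \<Sigma>" and E: "E \<in> rs \<beta>" "E ~= 0"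
 obtains m r where "m \<in> M" "r\<^sup>2 = Bt E E * nrm \<beta> / 2" "E + th E = r *R Ad G m (Zvec G \<beta>)"
proof -
 note rv = rootvec_props[OF \<beta>] and EL = rsD(1)[OF E(1)]
 note rvL = rsD(1)[OF rv(1)]
 have n: "nrm \<beta> > 0" by (rule nrm_pos(1)[OF rootD(1)[OF \<beta>] rootD(2)[OF \<beta>]])
 have EE: "Bt E E > 0" by (rule tt.B_pos[OF EL E(2)])
 \<comment> \<open>Scales E to the length of the chosen root vector, whose squared length is 2 / nrm
   \<beta>.\<close>
 define q where "q = sqrt (Bt E E * nrm \<beta> / 2)"
 have q: "q\<^sup>2 = Bt E E * nrm \<beta> / 2" using n EE by (simp add: q_def)
 have q0: "q ~= 0" using n EE by (simp add: q_def)
 define F where "F = (1 / q) *R E"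
 have F: "F \<in> rs \<beta>" "E = q *R F" using E(1) rs_sub subspace_scale q0 by (auto simp: F_def)
 note FL = rsD(1)[OF F(1)]
 have "Bt F F = Bt E E / q\<^sup>2" using EL by (simp add: F_def tt.B_simps power2_eq_square)
 also have "\<dots> = 2 / nrm \<beta>" unfolding q using n EE by simp
 finally have FF: "Bt (rootvec G \<beta>) (rootvec G \<beta>) = Bt F F" using rv(2) by simp
 have rv0: "rootvec G \<beta> ~= 0" using FF tt.B_simps(9)[OF tt.in_E(5)] rv(2) n by auto
 obtain m where m: "m \<in> M" "F = Ad G m (rootvec G \<beta>) \<or> F = - Ad G m (rootvec G \<beta>)"
  using M_transitive[OF \<beta> rv(1) F(1) FF rv0] by blast
 note mK = M_K[OF m(1)]
 note mc = KD(1)[OF mK]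
 obtain c :: real where c: "c\<^sup>2 = 1" "F = c *R Ad G m (rootvec G \<beta>)"
 proof (cases "F = Ad G m (rootvec G \<beta>)")
  case True thus ?thesis by (intro that[of 1]) auto
 next
  case False thus ?thesis using m(2) by (intro that[of "-1"]) auto
 qed
 have "F + th F = c *R Ad G m (Zvec G \<beta>)"
  unfolding c(2) Zvec_def using Ad_in[OF mc rvL] K_th[OF mK rvL] lin_on_add[OF Ad_lin[OF mc] rvL th_props(1)[OF rvL]]
  by (simp add: th_simps scaleR_add_right)
 hence "E + th E = (q * c) *R Ad G m (Zvec G \<beta>)"
  unfolding F(2) using FL by (simp add: th_simps scaleR_add_right[symmetric])
 moreover have "(q * c)\<^sup>2 = Bt E E * nrm \<beta> / 2" using q c(1) by (simp add: power_mult_distrib)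
 ultimately show ?thesis using that m(1) by blast
qed

text \<open>The root vectors are not chosen equivariantly, so transport by k matches them only up to
  \<open>M\<close> and a sign. Both are harmless on \<open>M\<close>-fixed vectors, where Z enters
  through an odd polynomial whose zeros are sought.\<close>

lemma Zvec_conj:
 assumes \<alpha>: "\<alpha> \<in> \<Sigma>" and k: "k \<in> NK"
 obtains m r where "m \<in> M" "r\<^sup>2 = (1::real)" "Zvec G \<alpha> = r *R Ad G (k \<otimes> m) (Zvec G (rtr k \<alpha>))"
proof -
 note rv = rootvec_props[OF \<alpha>] and d = rootD(1)[OF \<alpha>] and kc = NKD(2)[OF k] and ki = NK_inv[OF k]
 note rvL = rsD(1)[OF rv(1)]
 define E where "E = Ad G (inv k) (rootvec G \<alpha>)"
 have E: "E \<in> rs (rtr k \<alpha>)" unfolding E_def by (rule rtr_rs[OF k rv(1)])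
 have n: "nrm \<alpha> > 0" by (rule nrm_pos(1)[OF d rootD(2)[OF \<alpha>]])
 have EE: "Bt E E = 2 / nrm \<alpha>" unfolding E_def using Bt_Ad[OF NKD(1)[OF ki] rvL rvL] rv(2) by simp
 have E0: "E ~= 0" using EE tt.B_simps(9)[OF tt.in_E(5)] n by auto
 obtain m r where m: "m \<in> M" "r\<^sup>2 = Bt E E * nrm (rtr k \<alpha>) / 2" "E + th E = r *R Ad G m (Zvec G (rtr k \<alpha>))"
  by (rule Z_transitive[OF rtr_root[OF k \<alpha>] E E0], rule that)
 note mc = KD(1)[OF M_K[OF m(1)]]
 have "E + th E = Ad G (inv k) (Zvec G \<alpha>)"
  unfolding E_def Zvec_def using K_th[OF NKD(1)[OF ki] rvL] lin_on_add[OF Ad_lin[OF NKD(2)[OF ki]] rvL th_props(1)[OF rvL]] by simp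
 hence "Zvec G \<alpha> = Ad G k (r *R Ad G m (Zvec G (rtr k \<alpha>)))"
  using Ad_inv(2)[OF kc Zvec_kl(2)[OF \<alpha>]] m(3) by simp
 also have "\<dots> = r *R Ad G (k \<otimes> m) (Zvec G (rtr k \<alpha>))"
  using lin_on_scale[OF Ad_lin[OF kc] Ad_in[OF mc]] Ad_mult[OF kc mc] Zvec_kl(2)[OF rtr_root[OF k \<alpha>]] by simp
 finally have "Zvec G \<alpha> = r *R Ad G (k \<otimes> m) (Zvec G (rtr k \<alpha>))" .
 moreover have "r\<^sup>2 = 1" using m(2) EE rtr_Hv(2)[OF k d] n by simp
 ultimately show ?thesis using that m(1) by blast
qed

end

section \<open>Single-petaled and double-petaled vectors\<close>

context krep
begin

abbreviation "VMs \<equiv> VM G \<pi>"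
abbreviation "VS \<equiv> VM_single G \<pi>"
abbreviation "VD \<equiv> VM_double G \<pi>"
abbreviation "Zsq \<alpha> v \<equiv> dr (Zvec G \<alpha>) (dr (Zvec G \<alpha>) v)"
abbreviation "rad \<Phi> v f H \<alpha> \<equiv> der a (Hv \<alpha>) f H / of_real (\<alpha> H) +
 of_real (nrm \<alpha> / 4) * \<Phi> (Zsq \<alpha> v) H / of_real ((\<alpha> H)\<^sup>2)"

lemma VM_iff: "v \<in> VMs \<longleftrightarrow> (\<forall>m\<in>M. \<pi> m v = v)" by (simp add: VM_def)

lemma VS_iff: "v \<in> VS \<longleftrightarrow> v \<in> VMs & (\<forall>\<alpha>\<in>\<Sigma>. zop (Zvec G \<alpha>) v = 0)"
 by (simp add: VM_single_def Zop_zop)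

lemma pi0: "k \<in> K ==> \<pi> k 0 = 0" using pi_scale[of k 0 0] by simp

lemma VM_sub: "v \<in> VMs ==> w \<in> VMs ==> v + w \<in> VMs" "v \<in> VMs ==> c *s v \<in> VMs" "0 \<in> VMs"
 by (auto simp: VM_iff pi_add pi_scale M_K pi0)

lemma zop_0: "Z \<in> kl ==> zop Z 0 = 0" using zop_linear(2)[of Z 0 0] by simp

lemma VS_sub: "v \<in> VS ==> w \<in> VS ==> v + w \<in> VS" "v \<in> VS ==> c *s v \<in> VS" "0 \<in> VS"
 by (simp_all add: VS_iff VM_sub zop_linear zop_0 Zvec_kl)

lemma VS_VM: "v \<in> VS ==> v \<in> VMs" by (simp add: VS_iff)

lemma VM_NK: assumes k: "k \<in> NK" and v: "v \<in> VMs" shows "\<pi> k v \<in> VMs"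
 unfolding VM_iff
proof
 fix m assume m: "m \<in> M"
 note kK = NKD(1)[OF k] and kc = NKD(2)[OF k] and mK = M_K[OF m] and mc = KD(1)[OF M_K[OF m]]
 have m': "inv k \<otimes> m \<otimes> k \<in> M" by (rule M_conj[OF k m])
 have "m \<otimes> k = k \<otimes> (inv k \<otimes> m \<otimes> k)" using kc mc by (simp add: m_assoc[symmetric])
 hence "\<pi> m (\<pi> k v) = \<pi> k (\<pi> (inv k \<otimes> m \<otimes> k) v)"
  using pi_mult[OF mK kK, of v] pi_mult[OF kK M_K[OF m'], of v] by simp
 thus "\<pi> m (\<pi> k v) = \<pi> k v" using m' v by (simp add: VM_iff)
qed

lemma drep_scaled_conj:
 assumes Z: "Z \<in> kl" and k: "k \<in> K" and e: "Z' = r *R Ad G k Z"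
 shows "dr Z' (\<pi> k v) = r *R \<pi> k (dr Z v)"
proof -
 have "Ad G k Z \<in> kl" using KD(2)[OF k] Z by blast
 thus ?thesis unfolding e by (simp add: drep_scale drep_conj[OF Z k])
qed

lemma VS_NK: assumes k: "k \<in> NK" and v: "v \<in> VS" shows "\<pi> k v \<in> VS"
 unfolding VS_iff
proof (intro conjI ballI)
 show "\<pi> k v \<in> VMs" by (rule VM_NK[OF k VS_VM[OF v]])
 fix \<alpha> assume \<alpha>: "\<alpha> \<in> \<Sigma>"
 obtain m r where m: "m \<in> M" "r\<^sup>2 = (1::real)" "Zvec G \<alpha> = r *R Ad G (k \<otimes> m) (Zvec G (rtr k \<alpha>))"
  by (rule Zvec_conj[OF \<alpha> k], rule that)
 let ?Z = "Zvec G (rtr k \<alpha>)" and ?g = "k \<otimes> m"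
 note gK = K_grp(3)[OF NKD(1)[OF k] M_K[OF m(1)]] and \<beta> = rtr_root[OF k \<alpha>]
 note Zk = Zvec_kl(1)[OF \<beta>]
 have gv: "\<pi> k v = \<pi> ?g v" using pi_mult[OF NKD(1)[OF k] M_K[OF m(1)]] VS_VM[OF v] m(1) by (simp add: VM_iff)
 have r2: "cplx r * cplx r = 1" using m(2) by (simp add: power2_eq_square flip: of_real_mult)
 have dr: "dr (Zvec G \<alpha>) (\<pi> ?g w) = of_real r *s \<pi> ?g (dr ?Z w)" for w
  using drep_scaled_conj[OF Zk gK m(3), of w] by (simp add: scaleR_vec)
 note lin = drep_cscale[OF Zvec_kl(1)[OF \<alpha>]] pi_scale[OF gK] pi_add[OF gK]
 have "Zsq \<alpha> (\<pi> ?g v) + 4 *s \<pi> ?g v = \<pi> ?g (dr ?Z (dr ?Z v) + 4 *s v)"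
  by (simp add: dr lin r2)
 hence "zop (Zvec G \<alpha>) (\<pi> k v) = of_real r *s \<pi> ?g (zop ?Z v)"
  unfolding zop_def gv by (simp only: dr)
 also have "zop ?Z v = 0" using v \<beta> by (simp add: VS_iff)
 finally show "zop (Zvec G \<alpha>) (\<pi> k v) = 0" using pi0[OF gK] by simp
qed

text \<open>The span before intersection with the \<open>M\<close>-fixed vectors; it is stable under
  \<open>M\<close>, which lets \<open>VM_decomp\<close> split fixed vectors.\<close>

definition XD :: "(complex^'n) set" where
 "XD = vec.span {\<pi> m (zop (Zvec G \<alpha>) v) | \<alpha> m v. \<alpha> \<in> \<Sigma> & m \<in> M}"

lemma VD_eq: "VD = VMs \<inter> XD"
 unfolding VM_double_def XD_def Zop_zop by simp

lemma XD_stable: assumes m: "m \<in> M" and x: "x \<in> XD" shows "\<pi> m x \<in> XD"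
 using x unfolding XD_def
proof (induction rule: vec.span_induct_alt)
 case base
 thus ?case unfolding pi0[OF M_K[OF m]] by (rule vec.span_zero)
next
 case (step c x y)
 then obtain \<alpha> m' v where h: "x = \<pi> m' (zop (Zvec G \<alpha>) v)" "\<alpha> \<in> \<Sigma>" "m' \<in> M" by blast
 have mm: "m \<otimes> m' \<in> M"
  using m h(3) K_grp(3) Ad_mult[OF KD(1)[OF M_K[OF m]] KD(1)[OF M_K[OF h(3)]] a_props(3)] by (simp add: M_iff)
 have "\<pi> m x = \<pi> (m \<otimes> m') (zop (Zvec G \<alpha>) v)" unfolding h(1) using pi_mult[OF M_K[OF m] M_K[OF h(3)]] by simp
 hence "\<pi> m x \<in> vec.span {\<pi> m (zop (Zvec G \<alpha>) v) | \<alpha> m v. \<alpha> \<in> \<Sigma> & m \<in> M}"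
  using h(2) mm by (intro vec.span_base) blast
 thus ?case unfolding pi_add[OF M_K[OF m]] pi_scale[OF M_K[OF m]] by (intro vec.span_add vec.span_scale step(2))
qed

text \<open>\<open>zop Z\<close> is skew-Hermitian, so its range is orthogonal to its kernel, and
  \<open>M\<close> acts unitarily fixing y.\<close>

lemma VS_XD: assumes y: "y \<in> VS" and x: "x \<in> XD" shows "hermitian x y = 0"
 using x unfolding XD_def
proof (induction rule: vec.span_induct_alt)
 case (step c x z)
 then obtain \<alpha> m v where h: "x = \<pi> m (zop (Zvec G \<alpha>) v)" "\<alpha> \<in> \<Sigma>" "m \<in> M" by blast
 have "\<pi> (inv m) y = y" using pi_inv(2)[OF M_K[OF h(3)], of y] VS_VM[OF y] h(3) by (simp add: VM_iff)
 hence "hermitian x y = 0"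
  unfolding h(1) pi_herm_inv[OF M_K[OF h(3)]] using zop_skew[OF Zvec_kl(1)[OF h(2)]] y h(2) by (simp add: VS_iff hermitian_simps)
 thus ?case using step by (simp add: hermitian_simps)
qed (simp add: hermitian_simps)

text \<open>Orthogonal projection to \<open>XD\<close>. Stability of \<open>XD\<close> makes both
  components \<open>M\<close>-fixed. The remainder y is orthogonal to \<open>zop (zop y)\<close>, so
  by skewness \<open>zop y\<close> has norm zero.\<close>

lemma VM_decomp: assumes v: "v \<in> VMs" obtains x y where "x \<in> VD" "y \<in> VS" "v = x + y"
proof -
 have sub: "vec.subspace XD" unfolding XD_def by (rule vec.subspace_span)
 obtain x y where xy: "x \<in> XD" "v = x + y" "!!z. z \<in> XD ==> hermitian z y = 0"
  by (rule hermitian_complement[OF sub], rule that)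
 have inv_xy: "\<pi> m x = x & \<pi> m y = y" if m: "m \<in> M" for m
 proof -
  note mK = M_K[OF m]
  have im: "inv m \<in> M" using m K_grp(2)[OF mK] Ad_inv(1)[OF KD(1)[OF mK] a_props(3)] by (simp add: M_iff)
  define z where "z = \<pi> m x - x"
  have e: "z = y - \<pi> m y" using v m pi_add[OF mK, of x y] unfolding z_def xy(2) by (simp add: VM_iff algebra_simps)
  have z: "z \<in> XD" unfolding z_def by (rule vec.subspace_diff[OF sub XD_stable[OF m xy(1)] xy(1)])
  have "hermitian z (\<pi> m y) = hermitian (\<pi> (inv m) z) y" using pi_herm_inv[OF M_K[OF im], of z y] KD(1)[OF mK] by simp
  also have "\<dots> = 0" by (rule xy(3)[OF XD_stable[OF im z]])
  finally have "hermitian z (y - \<pi> m y) = 0" using xy(3)[OF z] hermitian_simps(2)[of z y "- \<pi> m y"] by (simp add: hermitian_simps)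
  hence "z = 0" unfolding e[symmetric] by (rule hermitian_pos)
  thus ?thesis using e unfolding z_def by simp
 qed
 have xV: "x \<in> VMs" "y \<in> VMs" using inv_xy by (auto simp: VM_iff)
 have "zop (Zvec G \<alpha>) y = 0" if \<alpha>: "\<alpha> \<in> \<Sigma>" for \<alpha>
 proof -
  let ?Z = "Zvec G \<alpha>"
  have one: "\<one> \<in> M" using K_grp(1) Ad_one a_props(3) by (auto simp: M_iff)
  have "\<pi> \<one> (zop ?Z (zop ?Z y)) \<in> XD" unfolding XD_def by (rule vec.span_base) (use \<alpha> one in blast)
  hence "hermitian (zop ?Z (zop ?Z y)) y = 0" using xy(3) pi_one by simp
  hence "hermitian (zop ?Z y) (zop ?Z y) = 0" using zop_skew[OF Zvec_kl(1)[OF \<alpha>], of "zop ?Z y" y] by simp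
  thus ?thesis by (rule hermitian_pos)
 qed
 thus ?thesis using that[of x y] xy xV by (simp add: VD_eq VS_iff)
qed

end

lemma C_on_directions_subset: "C_on k E U f ==> E' <= E ==> C_on k E' U f"
 by (induction k arbitrary: f) auto

section \<open>The radial part of the Laplacian\<close>

context iwasawa
begin

text \<open>The degenerate case without reflections, in which the Dunkl operators on
  \<open>s\<close> are the derivatives and \<open>sym_hom\<close> gives
  \<open>partial\<close>.\<close>

sublocale ds: dunkl_space s Bk "{}" "%_. 0" "%_. 0"
 by unfold_locales auto

lemma ds_D: "ds.D = der s"
proof (intro ext)
 fix \<xi> f x show "ds.D \<xi> f x = der s \<xi> f x" by (simp add: ds.D_def deriv_op_def ext0_def)
qed

lemma ds_Lap: "f \<in> Cinf s ==> ds.Lap C f = (%x. \<Sum>b\<in>C. der s b (der s b f) x)"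
 by (simp add: ds.Lap_in ds_D)

sublocale da: dunkl_data a Bk "R1_pos G" "m0 G" Hv
proof
 show "finite (R1_pos G)" using R1_finite by (simp add: R1_pos_def)
 have d: "\<alpha> \<in> dual_space a" "\<alpha> ~= 0" if "\<alpha> \<in> R1_pos G" for \<alpha> using R1_dual that by (auto simp: R1_pos_def)
 show "Hv \<alpha> \<in> a" "Hv \<alpha> ~= 0" if "\<alpha> \<in> R1_pos G" for \<alpha> using Hvec_props(1,3) d[OF that] by auto
 show "\<alpha> x = Bk (Hv \<alpha>) x" if "\<alpha> \<in> R1_pos G" "x \<in> a" for \<alpha> x by (rule Hvec_props(2)[OF d(1)[OF that(1)] that(2)])
qed

lemma da_rf: "da.rf = refl G"
 by (intro ext) (simp add: da.rf_def refl_def)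

lemma da_qt: "da.qt = refl_quot G"
 by (intro ext) (simp add: da.qt_def refl_quot_def da_rf)

lemma da_D: "da.D = dunkl1 G"
 by (intro ext) (simp add: da.D_def dunkl1_def da_qt)

lemma a_s: "a <= s" using a_props(2) by blast

lemma gamma0_Cinf: "f \<in> Cinf s ==> gamma0 G f \<in> Cinf a"
 unfolding gamma0_def by (rule Cinf_ext0[OF a_props(1)]) (rule C_on_directions_subset[OF C_on_subset[OF Cinf_C a_s] a_s])

lemma gamma0_in [simp]: "H \<in> a ==> gamma0 G f H = f H" by (simp add: gamma0_def)

lemma gamma0_deriv:
 assumes f: "f \<in> Cinf s" and \<xi>: "\<xi> \<in> a" shows "gamma0 G (der s \<xi> f) = der a \<xi> (gamma0 G f)"
proof (rule Cinf_eqI)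
 show "gamma0 G (der s \<xi> f) \<in> Cinf a" by (rule gamma0_Cinf[OF deriv_op_Cinf[OF sub_s f a_props(2)[OF \<xi>]]])
 show "der a \<xi> (gamma0 G f) \<in> Cinf a" by (rule deriv_op_Cinf[OF a_props(1) gamma0_Cinf[OF f] \<xi>])
 fix x assume x: "x \<in> a"
 have "((%t. f (x + t *R \<xi>)) hvd der s \<xi> f x) (at 0)"
  by (rule deriv_op_hvd[OF sub_s f a_props(2)[OF \<xi>] a_props(2)[OF x]])
 moreover have "(%t. f (x + t *R \<xi>)) = (%t. gamma0 G f (x + t *R \<xi>))" using x \<xi> by simp
 ultimately have "((%t. gamma0 G f (x + t *R \<xi>)) hvd der s \<xi> f x) (at 0)" by simp
 thus "gamma0 G (der s \<xi> f) x = der a \<xi> (gamma0 G f) x"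
  using deriv_op_eqI[OF a_props(1) gamma0_Cinf[OF f] x] x by simp
qed

lemma refl_invol:
 assumes "\<alpha> \<in> \<Sigma>" "H \<in> a" shows "refl G \<alpha> H \<in> a" "Ad G (inv (kr \<alpha>)) H = refl G \<alpha> H"
proof -
 note k = kr_props[OF assms(1)] and d = rootD(1)[OF assms(1)]
 show r: "refl G \<alpha> H \<in> a" using NKD(4)[OF k(1) assms(2)] k(2)[OF assms(2)] by simp
 have n: "nrm \<alpha> > 0" by (rule nrm_pos(1)[OF d rootD(2)[OF assms(1)]])
 have "\<alpha> (refl G \<alpha> H) = - \<alpha> H"
  unfolding refl_def using lin_on_diff[OF dual_a(1)[OF d] a_props(1) assms(2)] lin_on_scale[OF dual_a(1)[OF d] Hvec_props(1)[OF d]]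
   Hvec_props(1)[OF d] n nrm_pos(2)[OF d] by simp
 hence "refl G \<alpha> (refl G \<alpha> H) = H" by (simp add: refl_def)
 hence "H = Ad G (kr \<alpha>) (refl G \<alpha> H)" using k(2)[OF r] by simp
 thus "Ad G (inv (kr \<alpha>)) H = refl G \<alpha> H" using Ad_inv(1)[OF NKD(2)[OF k(1)] a_props(3)[OF r]] by simp
qed

end

section \<open>K-equivariant maps and the second derivatives along root directions\<close>

context krep
begin

abbreviation "HK \<equiv> Hom_K G \<pi>"

lemma HKD:
 assumes "\<Phi> \<in> HK"
 shows "\<Phi> v \<in> Cinf s" "\<Phi> (v + w) x = \<Phi> v x + \<Phi> w x" "\<Phi> (c *s v) x = c * \<Phi> v x"
  "k \<in> K ==> x \<in> s ==> \<Phi> (\<pi> k v) x = \<Phi> v (Ad G (inv k) x)"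
 using assms by (auto simp: Hom_K_def clinear_Cinf_def fun_act_def)

lemma HK_linear: "\<Phi> \<in> HK ==> linear (%v. \<Phi> v x)"
 by (rule linearI) (simp_all add: HKD(2,3) scaleR_vec scaleR_conv_of_real)

lemma HK_scaleR: "\<Phi> \<in> HK ==> \<Phi> (r *R v) x = of_real r * \<Phi> v x"
 by (simp add: HKD(3) scaleR_vec)

text \<open>Differentiate \<open>\<Phi> v (Ad (ex Z t) y) = \<Phi> (\<pi> (ex Z (- t)) v) y\<close> at \<open>t = 0\<close>.\<close>

lemma HK_deriv:
 assumes \<Phi>: "\<Phi> \<in> HK" and Z: "Z \<in> kl" and y: "y \<in> s"
 shows "br Z y \<in> s" "der s (br Z y) (\<Phi> v) y = - \<Phi> (dr Z v) y"
proof -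
 have ZL: "Z \<in> L" and yL: "y \<in> L" using Z kl_L y sD by auto
 note exK = ex_K[OF Z]
 have c: "((%t. Ad G (ex Z t) y) hvd br Z y) (at 0)"
  using Ad_ops_deriv[OF ex_ops[OF ZL] yL, of 0] ex_props(3)[OF ZL] Ad_one[OF yL] by simp
 have cs: "Ad G (ex Z t) y \<in> s" for t by (rule Ad_K_s[OF exK y])
 note d = deriv_op_curve[OF sub_s HKD(1)[OF \<Phi>] c cs]
 show "br Z y \<in> s" by (rule d(1))
 have "((%t. \<Phi> v (Ad G (ex Z t) y)) hvd der s (br Z y) (\<Phi> v) y) (at 0)"
  using d(2)[of v] ex_props(3)[OF ZL] Ad_one[OF yL] by simp
 moreover have "\<Phi> v (Ad G (ex Z t) y) = \<Phi> (\<pi> (ex ((-1) *R Z) t) v) y" for t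
 proof -
  have "\<Phi> (\<pi> (inv (ex Z t)) v) y = \<Phi> v (Ad G (ex Z t) y)"
   using HKD(4)[OF \<Phi> K_grp(2)[OF exK] y] KD(1)[OF exK] by simp
  thus ?thesis unfolding ex_scale[OF ZL] using ex_props(7)[OF ZL, of t] by simp
 qed
 moreover have "((%t. \<Phi> (\<pi> (ex ((-1) *R Z) t) v) y) hvd \<Phi> (dr ((-1) *R Z) v) y) (at 0)"
  by (rule bounded_linear.has_vector_derivative[OF _ drep_hvd0[OF subspace_scale[OF kl_sub Z]]])
   (use HK_linear[OF \<Phi>] in "simp add: linear_conv_bounded_linear")
 ultimately have "der s (br Z y) (\<Phi> v) y = \<Phi> (dr ((-1) *R Z) v) y" using vector_derivative_unique_at by fastforce
 also have "\<dots> = - \<Phi> (dr Z v) y" unfolding drep_scale[OF Z] HK_scaleR[OF \<Phi>] by simp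
 finally show "der s (br Z y) (\<Phi> v) y = - \<Phi> (dr Z v) y" .
qed

text \<open>\<open>HK_deriv\<close> is applied on the line H + t X, where the bracket with Z is
  -\<alpha>(H) X + t W with W a multiple of \<open>Hv \<alpha>\<close>. Differentiating this
  identity at t = 0 yields the second derivative along X, and the identity at t = 0 removes the
  remaining first derivative.\<close>

lemma HK_deriv2:
 assumes \<Phi>: "\<Phi> \<in> HK" and \<alpha>: "\<alpha> \<in> \<Sigma>" and E: "E \<in> rs \<alpha>" and H: "H \<in> a" "\<alpha> H ~= 0"
 shows "der s (E - th E) (der s (E - th E) (\<Phi> v)) H =
  of_real (2 * Bt E E) * der s (Hv \<alpha>) (\<Phi> v) H / of_real (\<alpha> H) + \<Phi> (dr (E + th E) (dr (E + th E) v)) H / of_real ((\<alpha> H)\<^sup>2)"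
proof -
 define X where "X = E - th E"
 define Z where "Z = E + th E"
 note zb = Z_brackets[OF rootD(1)[OF \<alpha>] E, folded X_def Z_def]
 note Ha = Hvec_props(1)[OF rootD(1)[OF \<alpha>]]
 have sets: "X \<in> s" "H \<in> s" "Hv \<alpha> \<in> s" "Z \<in> L" "H \<in> L" "X \<in> L" using zb(1,2) a_props H(1) Ha kl_L sD by auto
 define W where "W = (2 * Bt E E) *R Hv \<alpha>"
 have W: "W \<in> s" unfolding W_def using sets si.in_E by auto
 have ys: "H + t *R X \<in> s" for t using sets si.in_E by auto
 note F = HKD(1)[OF \<Phi>]
 let ?F = "\<Phi> v"
 have DX: "der s X ?F \<in> Cinf s" by (rule deriv_op_Cinf[OF sub_s F sets(1)])
 have DW: "der s W ?F \<in> Cinf s" by (rule deriv_op_Cinf[OF sub_s F W])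
 have first: "der s ((- \<alpha> H) *R X + t *R W) (\<Phi> u) (H + t *R X) = - \<Phi> (dr Z u) (H + t *R X)" for t u
 proof -
  have "br Z (H + t *R X) = (- \<alpha> H) *R X + t *R W"
   using zb(3)[OF H(1)] zb(4) sets by (simp add: br_simps W_def)
  thus ?thesis using HK_deriv(2)[OF \<Phi> zb(1) ys, of t u] by simp
 qed
 have eq: "- of_real (\<alpha> H) * der s X ?F (H + t *R X) + of_real t * der s W ?F (H + t *R X) = - \<Phi> (dr Z v) (H + t *R X)" for t
 proof -
  have "der s ((- \<alpha> H) *R X + t *R W) ?F (H + t *R X) =
   der s ((- \<alpha> H) *R X) ?F (H + t *R X) + der s (t *R W) ?F (H + t *R X)"
   by (rule deriv_op_dir_linear(1)[OF sub_s F subspace_scale[OF sub_s sets(1)] subspace_scale[OF sub_s W]])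
  thus ?thesis
   unfolding first[of t v] deriv_op_dir_linear(2)[OF sub_s F sets(1) sets(1)] deriv_op_dir_linear(2)[OF sub_s F W W] by simp
 qed
 have "((%t. - of_real (\<alpha> H) * der s X ?F (H + t *R X) + of_real t * der s W ?F (H + t *R X)) hvd
   - of_real (\<alpha> H) * der s X (der s X ?F) H + (of_real 0 * der s X (der s W ?F) H + of_real 1 * der s W ?F (H + 0 *R X))) (at 0)"
  by (intro has_vector_derivative_add has_vector_derivative_mult_right deriv_op_hvd[OF sub_s DX sets(1,2)]
    has_vector_derivative_mult has_vector_derivative_of_real deriv_op_hvd[OF sub_s DW sets(1,2)]) (auto intro!: derivative_eq_intros)
 moreover have "((%t. - \<Phi> (dr Z v) (H + t *R X)) hvd - der s X (\<Phi> (dr Z v)) H) (at 0)"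
  by (intro has_vector_derivative_minus deriv_op_hvd[OF sub_s F sets(1,2)])
 ultimately have A: "- of_real (\<alpha> H) * der s X (der s X ?F) H + der s W ?F H = - der s X (\<Phi> (dr Z v)) H"
  unfolding eq using vector_derivative_unique_at by fastforce
 have B: "of_real (\<alpha> H) * der s X (\<Phi> (dr Z v)) H = \<Phi> (dr Z (dr Z v)) H"
  using first[of 0 "dr Z v"] deriv_op_dir_linear(2)[OF sub_s F sets(1) sets(1), of "- \<alpha> H" "dr Z v" H] by simp
 have W': "der s W ?F H = of_real (2 * Bt E E) * der s (Hv \<alpha>) ?F H"
  unfolding W_def by (rule deriv_op_dir_linear(2)[OF sub_s F sets(3,3)])
 have a0: "cplx (\<alpha> H) ~= 0" using H(2) by simp
 have "of_real (\<alpha> H) * der s X (der s X ?F) H = der s W ?F H + der s X (\<Phi> (dr Z v)) H"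
  using A by (simp add: algebra_simps eq_neg_iff_add_eq_0 add_eq_0_iff)
 hence "der s X (der s X ?F) H = der s W ?F H / of_real (\<alpha> H) + der s X (\<Phi> (dr Z v)) H / of_real (\<alpha> H)"
  using a0 by (simp add: field_simps)
 also have "der s X (\<Phi> (dr Z v)) H = \<Phi> (dr Z (dr Z v)) H / of_real (\<alpha> H)" using B a0 by (simp add: field_simps)
 finally show ?thesis unfolding W' X_def Z_def by (simp add: power2_eq_square)
qed

text \<open>By \<open>Z_transitive\<close> the vector c + \<open>th c\<close> is r times an
  \<open>M\<close>-conjugate of the chosen Z. The conjugating element fixes both v and H, so only
  r^2 = nrm \<alpha> / 2 remains.\<close>

lemma Z_square_unit:
 assumes \<Phi>: "\<Phi> \<in> HK" and \<alpha>: "\<alpha> \<in> \<Sigma>" and c: "c \<in> rs \<alpha>" "Bt c c = 1" and v: "v \<in> VMs" and H: "H \<in> a"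
 shows "\<Phi> (dr (c + th c) (dr (c + th c) v)) H = of_real (nrm \<alpha> / 2) * \<Phi> (Zsq \<alpha> v) H"
proof -
 have c0: "c ~= 0" using c(2) tt.B_simps(9)[OF tt.in_E(5)] by auto
 obtain m r where m: "m \<in> M" "r\<^sup>2 = Bt c c * nrm \<alpha> / 2" "c + th c = r *R Ad G m (Zvec G \<alpha>)"
  by (rule Z_transitive[OF \<alpha> c(1) c0], rule that)
 let ?Z = "Zvec G \<alpha>"
 note mK = M_K[OF m(1)]
 have dr: "dr (c + th c) (\<pi> m w) = of_real r *s \<pi> m (dr ?Z w)" for w
  using drep_scaled_conj[OF Zvec_kl(1)[OF \<alpha>] mK m(3), of w] by (simp add: scaleR_vec)
 have ck: "c + th c \<in> kl" by (rule Z_brackets(1)[OF rootD(1)[OF \<alpha>] c(1)])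
 have "dr (c + th c) (dr (c + th c) v) = dr (c + th c) (dr (c + th c) (\<pi> m v))" using v m(1) by (simp add: VM_iff)
 also have "\<dots> = of_real (r * r) *s \<pi> m (dr ?Z (dr ?Z v))" by (simp add: dr drep_cscale[OF ck])
 also have "r * r = nrm \<alpha> / 2" using m(2) c(2) by (simp add: power2_eq_square)
 finally have "\<Phi> (dr (c + th c) (dr (c + th c) v)) H = of_real (nrm \<alpha> / 2) * \<Phi> (\<pi> m (dr ?Z (dr ?Z v))) H"
  by (simp add: HKD(3)[OF \<Phi>])
 also have "\<Phi> (\<pi> m (dr ?Z (dr ?Z v))) H = \<Phi> (dr ?Z (dr ?Z v)) (Ad G (inv m) H)" by (rule HKD(4)[OF \<Phi> mK a_props(2)[OF H]])
 also have "Ad G (inv m) H = H"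
 proof -
  have "Ad G m H = H" using m(1) H M_iff by blast
  thus ?thesis using Ad_inv(1)[OF KD(1)[OF mK] a_props(3)[OF H]] by simp
 qed
 finally show ?thesis .
qed

text \<open>The Laplacian is summed over the basis of \<open>s_onb\<close>. All vectors of one root
  space contribute equally, which produces the factor dim.\<close>

lemma Lap_radial:
 assumes Ca: "ai.onb a Ca"
 obtains C where "si.onb s C"
  "!!\<Phi> v H. \<Phi> \<in> HK ==> v \<in> VMs ==> H \<in> a ==> reg H ==>
   ds.Lap C (\<Phi> v) H = (\<Sum>b\<in>Ca. der a b (der a b (gamma0 G (\<Phi> v))) H) +
    (\<Sum>\<alpha>\<in>pos_roots G. of_nat (dim (rs \<alpha>)) * (rad \<Phi> v (gamma0 G (\<Phi> v)) H \<alpha>))"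
proof -
 have "\<exists>C. tt.onb (rs \<alpha>) C" for \<alpha> using tt.onb_exists[OF rs_sub rs_L] by metis
 then obtain Cr where Cr: "!!\<alpha>. tt.onb (rs \<alpha>) (Cr \<alpha>)" by metis
 obtain C where C: "si.onb s C"
  "!!F::'e => complex. (\<Sum>b\<in>C. F b) = (\<Sum>b\<in>Ca. F b) + (\<Sum>\<alpha>\<in>pos_roots G. \<Sum>c\<in>Cr \<alpha>. F (us c))"
  by (rule s_onb[OF Ca Cr], rule that)
 show ?thesis
 proof (rule that[OF C(1)])
  fix \<Phi> v H assume \<Phi>: "\<Phi> \<in> HK" and v: "v \<in> VMs" and H: "H \<in> a" and reg: "reg H"
  note F = HKD(1)[OF \<Phi>]
  have 1: "der s b (der s b (\<Phi> v)) H = der a b (der a b (gamma0 G (\<Phi> v))) H" if b: "b \<in> Ca" for b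
  proof -
   have ba: "b \<in> a" using b ai.onbD(1)[OF Ca] by blast
   have "gamma0 G (der s b (der s b (\<Phi> v))) = der a b (der a b (gamma0 G (\<Phi> v)))"
    by (simp add: gamma0_deriv[OF F ba] gamma0_deriv[OF deriv_op_Cinf[OF sub_s F a_props(2)[OF ba]] ba])
   from fun_cong[OF this, of H] show ?thesis using H by simp
  qed
  have 2: "der s (us c) (der s (us c) (\<Phi> v)) H = rad \<Phi> v (gamma0 G (\<Phi> v)) H \<alpha>"
   if \<alpha>: "\<alpha> \<in> \<Sigma>" and c: "c \<in> Cr \<alpha>" for \<alpha> c
  proof -
   have cr: "c \<in> rs \<alpha>" "Bt c c = 1" using tt.onbD(1,3)[OF Cr] c by auto
   define X where "X = c - th c"
   have X: "X \<in> s" unfolding X_def by (rule Z_brackets(2)[OF rootD(1)[OF \<alpha>] cr(1)])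
   let ?q = "cplx (1 / sqrt 2)"
   have Ha: "Hv \<alpha> \<in> a" by (rule Hvec_props(1)[OF rootD(1)[OF \<alpha>]])
   have u: "der s (us c) f = (%x. ?q * der s X f x)" if "f \<in> Cinf s" for f
    unfolding us_def X_def[symmetric] by (rule ext) (rule deriv_op_dir_linear(2)[OF sub_s that X X])
   have DX: "der s X (\<Phi> v) \<in> Cinf s" by (rule deriv_op_Cinf[OF sub_s F X])
   have "der s (us c) (der s (us c) (\<Phi> v)) H = ?q * (?q * der s X (der s X (\<Phi> v)) H)"
    unfolding u[OF F] u[OF Cinf_scale[OF sub_s DX]] by (simp only: deriv_op_scale[OF sub_s DX X a_props(2)[OF H]])
   \<comment> \<open>Two normalizations 1 / sqrt 2 give 1/2; with the nrm \<alpha> / 2 of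
     \<open>Z_square_unit\<close> this is the origin of nrm \<alpha> / 4.\<close>
   also have "\<dots> = (1/2) * der s X (der s X (\<Phi> v)) H"
    by (simp add: mult.assoc[symmetric] flip: of_real_mult)
   also have "der s X (der s X (\<Phi> v)) H = 2 * der s (Hv \<alpha>) (\<Phi> v) H / of_real (\<alpha> H) +
     of_real (nrm \<alpha> / 2) * \<Phi> (Zsq \<alpha> v) H / of_real ((\<alpha> H)\<^sup>2)"
    using HK_deriv2[OF \<Phi> \<alpha> cr(1) H bspec[OF reg \<alpha>], of v] Z_square_unit[OF \<Phi> \<alpha> cr v H] cr(2) by (simp add: X_def)
   also have "der s (Hv \<alpha>) (\<Phi> v) H = der a (Hv \<alpha>) (gamma0 G (\<Phi> v)) H"
    using fun_cong[OF gamma0_deriv[OF F[of v] Ha], of H] H by simp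
   finally show ?thesis by (simp add: distrib_left)
  qed
  have "ds.Lap C (\<Phi> v) H = (\<Sum>b\<in>Ca. der s b (der s b (\<Phi> v)) H) +
   (\<Sum>\<alpha>\<in>pos_roots G. \<Sum>c\<in>Cr \<alpha>. der s (us c) (der s (us c) (\<Phi> v)) H)"
   unfolding ds_Lap[OF F] by (rule C(2))
  also have "(\<Sum>b\<in>Ca. der s b (der s b (\<Phi> v)) H) = (\<Sum>b\<in>Ca. der a b (der a b (gamma0 G (\<Phi> v))) H)"
   by (rule sum.cong[OF refl 1])
  also have "(\<Sum>\<alpha>\<in>pos_roots G. \<Sum>c\<in>Cr \<alpha>. der s (us c) (der s (us c) (\<Phi> v)) H) =
   (\<Sum>\<alpha>\<in>pos_roots G. of_nat (dim (rs \<alpha>)) * (rad \<Phi> v (gamma0 G (\<Phi> v)) H \<alpha>))"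
  proof (rule sum.cong[OF refl])
   fix \<alpha> assume "\<alpha> \<in> pos_roots G"
   hence \<alpha>: "\<alpha> \<in> \<Sigma>" by (simp add: pos_roots_def)
   have "(\<Sum>c\<in>Cr \<alpha>. der s (us c) (der s (us c) (\<Phi> v)) H) =
    (\<Sum>c\<in>Cr \<alpha>. rad \<Phi> v (gamma0 G (\<Phi> v)) H \<alpha>)"
    by (rule sum.cong[OF refl 2[OF \<alpha>]])
   thus "(\<Sum>c\<in>Cr \<alpha>. der s (us c) (der s (us c) (\<Phi> v)) H) =
    of_nat (dim (rs \<alpha>)) * (rad \<Phi> v (gamma0 G (\<Phi> v)) H \<alpha>)"
    using tt.onb_card[OF Cr rs_sub rs_L] by simp
  qed
  finally show "ds.Lap C (\<Phi> v) H = (\<Sum>b\<in>Ca. der a b (der a b (gamma0 G (\<Phi> v))) H) +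
    (\<Sum>\<alpha>\<in>pos_roots G. of_nat (dim (rs \<alpha>)) * (rad \<Phi> v (gamma0 G (\<Phi> v)) H \<alpha>))" .
 qed
qed

end

section \<open>Equivariance of the operators\<close>

context iwasawa
begin

lemma dunkl_regular:
 assumes f: "f \<in> Cinf a" and x: "x \<in> a" "reg x"
 shows "dunkl1 G \<xi> f x = der a \<xi> f x +
  (\<Sum>\<beta>\<in>R1_pos G. of_real (m0 G \<beta> * \<beta> \<xi>) * ((f x - f (refl G \<beta> x)) / of_real (\<beta> x)))"
proof -
 have "refl_quot G \<beta> f x = (f x - f (refl G \<beta> x)) / of_real (\<beta> x)" if b: "\<beta> \<in> R1_pos G" for \<beta>
 proof -
  have "\<beta> x ~= 0" using bspec[OF x(2) R1_root[of \<beta>]] b by (simp add: R1_pos_def fscale_def)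
  moreover have "of_real (\<beta> x) * refl_quot G \<beta> f x = f x - f (refl G \<beta> x)"
   using da.qt_props(2)[OF b f x(1)] by (simp add: da_qt da_rf)
  ultimately show ?thesis by (simp add: field_simps)
 qed
 thus ?thesis using da.D_in[OF f, of \<xi> x] by (simp add: da_D da_qt)
qed

text \<open>At regular points the difference terms are explicit. The sum over positive roots is half
  the sum over \<open>R1\<close>, which \<open>rtr\<close> permutes while preserving
  multiplicities.\<close>

lemma dunkl_equiv:
 assumes k: "k \<in> NK" and \<xi>: "\<xi> \<in> a" and f: "f \<in> Cinf a"
 shows "dunkl1 G \<xi> (ext0 a (%x. f (Ad G k x))) = ext0 a (%x. dunkl1 G (Ad G k \<xi>) f (Ad G k x))"
proof -
 note kc = NKD(2)[OF k] and ki = NK_inv[OF k]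
 have lT: "lin_on a (Ad G k)" by (rule lin_on_subset[OF Ad_lin[OF kc] a_L])
 note Ta = NKD(4)[OF k]
 let ?g = "ext0 a (%x. f (Ad G k x))"
 have g: "?g \<in> Cinf a" by (rule Cinf_comp[OF a_props(1) lT Ta f])
 show ?thesis
 proof (rule a_dense)
  show "dunkl1 G \<xi> ?g \<in> Cinf a" using da.D_Cinf[OF \<xi> g] by (simp add: da_D)
  show "ext0 a (%x. dunkl1 G (Ad G k \<xi>) f (Ad G k x)) \<in> Cinf a"
   using Cinf_comp[OF a_props(1) lT Ta da.D_Cinf[OF Ta[OF \<xi>] f]] by (simp add: da_D)
  fix x assume x: "x \<in> a" and xr: "reg x"
  define y where "y = Ad G k x"
  have y: "y \<in> a" "reg y"
   using Ta[OF x] bspec[OF xr rtr_root[OF k]] rtr_in[OF x] by (auto simp: y_def)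
  define t' where "t' \<beta> = cplx (m0 G \<beta> * \<beta> (Ad G k \<xi>)) * ((f y - f (refl G \<beta> y)) / of_real (\<beta> y))" for \<beta>
  define t where "t \<beta> = cplx (m0 G \<beta> * \<beta> \<xi>) * ((?g x - ?g (refl G \<beta> x)) / of_real (\<beta> x))" for \<beta>
  have ra: "refl G \<beta> x \<in> a" if "\<beta> \<in> R1 G" for \<beta>
   unfolding refl_def using x Hvec_props(1)[OF R1_dual(1)[OF that]] by simp
  have tt': "t \<beta> = t' (rtr (inv k) \<beta>)" if b: "\<beta> \<in> R1 G" for \<beta>
  proof -
   have e: "rtr (inv k) \<beta> (Ad G k z) = \<beta> z" if "z \<in> a" for z
    using rtr_in[OF Ta[OF that]] Ad_inv(1)[OF kc a_props(3)[OF that]] by simp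
   show ?thesis
    unfolding t_def t'_def m0_rtr[OF ki b] e[OF \<xi>] unfolding y_def e[OF x] refl_rtr[OF k R1_dual(1)[OF b] x]
    using x ra[OF b] by simp
  qed
  have neg: "t \<beta> = t (fscale (-1) \<beta>)" "t' \<beta> = t' (fscale (-1) \<beta>)" if b: "\<beta> \<in> R1 G" for \<beta>
   unfolding t_def t'_def m0_neg refl_neg[OF R1_dual(1)[OF b]] by (simp_all add: fscale_def)
  have bij: "bij_betw (rtr (inv k)) (R1 G) (R1 G)"
   by (rule bij_betw_byWitness[where f' = "rtr k"])
    (use R1_rtr[OF k] R1_rtr[OF ki] rtr_inv[OF k] R1_dual(1) in auto)
  have "2 * (\<Sum>\<beta>\<in>R1_pos G. t \<beta>) = (\<Sum>\<beta>\<in>R1 G. t \<beta>)" by (rule sum_R1_even[symmetric]) (simp add: neg(1)[symmetric])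
  also have "\<dots> = (\<Sum>\<beta>\<in>R1 G. t' (rtr (inv k) \<beta>))" by (rule sum.cong[OF refl tt'])
  also have "\<dots> = (\<Sum>\<beta>\<in>R1 G. t' \<beta>)" by (rule sum.reindex_bij_betw[OF bij])
  also have "\<dots> = 2 * (\<Sum>\<beta>\<in>R1_pos G. t' \<beta>)" by (rule sum_R1_even) (simp add: neg(2)[symmetric])
  finally have "(\<Sum>\<beta>\<in>R1_pos G. t \<beta>) = (\<Sum>\<beta>\<in>R1_pos G. t' \<beta>)" by simp
  moreover have "der a \<xi> ?g x = der a (Ad G k \<xi>) f y"
   unfolding y_def by (rule deriv_op_comp[OF a_props(1) lT Ta f \<xi> x])
  ultimately have "dunkl1 G \<xi> ?g x = dunkl1 G (Ad G k \<xi>) f y"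
   unfolding dunkl_regular[OF g x xr] dunkl_regular[OF f y] t_def t'_def by simp
  thus "dunkl1 G \<xi> ?g x = ext0 a (%x. dunkl1 G (Ad G k \<xi>) f (Ad G k x)) x" using x by (simp add: y_def)
 qed
qed

lemma refl_scale: "\<alpha> \<in> dual_space a ==> r ~= 0 ==> refl G (fscale r \<alpha>) x = refl G \<alpha> x"
 unfolding refl_def Hvec_scale using Hvec_props(1)[of \<alpha>] by (simp add: ai.B_simps fscale_def)

text \<open>The reflection in \<beta> of \<open>R1\<close> agrees with that in the root \<beta> / 2,
  which \<open>kr\<close> realizes inside the normalizer; so the axiom is an instance of
  \<open>dunkl_equiv\<close>.\<close>

sublocale dl: dunkl_space a Bk "R1_pos G" "m0 G" Hv
proof
 fix \<beta> \<xi> f assume b: "\<beta> \<in> R1_pos G" and \<xi>: "\<xi> \<in> a" and f: "f \<in> Cinf a"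
 have b1: "\<beta> \<in> R1 G" using b by (simp add: R1_pos_def)
 define \<alpha> where "\<alpha> = fscale (1/2) \<beta>"
 have \<alpha>: "\<alpha> \<in> \<Sigma>" unfolding \<alpha>_def by (rule R1_root[OF b1])
 have rf: "refl G \<beta> x = Ad G (kr \<alpha>) x" if "x \<in> a" for x
  using refl_scale[OF R1_dual(1)[OF b1], of "1/2" x] kr_props(2)[OF \<alpha> that] by (simp add: \<alpha>_def)
 note k = kr_props(1)[OF \<alpha>]
 have rho: "da.rho \<beta> h = ext0 a (%x. h (Ad G (kr \<alpha>) x))" for h
  by (auto simp: da.rho_def da_rf rf ext0_def)
 have ra: "refl G \<beta> \<xi> \<in> a" using NKD(4)[OF k \<xi>] rf[OF \<xi>] by simp
 have "Ad G (kr \<alpha>) (refl G \<beta> \<xi>) = \<xi>"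
  using da.rf_rf[OF b \<xi>] rf[OF ra] by (simp add: da_rf)
 thus "da.D (da.rf \<beta> \<xi>) (da.rho \<beta> f) = da.rho \<beta> (da.D \<xi> f)"
  unfolding rho da_D da_rf using dunkl_equiv[OF k ra f] by simp
qed

lemma partial_char: "sym_char s Bk (der s) (partial G)"
 using ds.sym_hom_is_char by (simp add: partial_def ds_D)

lemma dunkl_char: "sym_char a Bk (dunkl1 G) (dunkl G)"
 using dl.sym_hom_is_char by (simp add: dunkl_def da_D)

lemma dunkl_fun_act:
 assumes k: "k \<in> NK" and p: "p \<in> Pol a" "fun_act G a k p = p" and f: "f \<in> Cinf a"
 shows "dunkl G p (fun_act G a k f) = fun_act G a k (dunkl G p f)"
proof -
 note ki = NK_inv[OF k]
 have "\<exists>x\<in>a. Ad G (inv k) x = y" if "y \<in> a" for y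
  using NKD(4)[OF k that] Ad_inv(1)[OF NKD(2)[OF k] a_props(3)[OF that]] by blast
 moreover have "Bk (Ad G (inv k) x) (Ad G (inv k) y) = Bk x y" if "x \<in> a" "y \<in> a" for x y
  by (rule killing_Ad[OF NKD(2)[OF ki] a_props(3)[OF that(1)] a_props(3)[OF that(2)]])
 ultimately have "\<forall>f\<in>Cinf a. dunkl G (ext0 a (%x. p (Ad G (inv k) x))) (ext0 a (%x. f (Ad G (inv k) x))) = ext0 a (%x. dunkl G p f (Ad G (inv k) x))"
  using ai.sym_char_equiv[OF dunkl_char lin_on_subset[OF Ad_lin[OF NKD(2)[OF ki]] a_L] NKD(4)[OF ki] _ _ dunkl_equiv[OF ki] p(1)] by blast
 thus ?thesis using p(2) f by (simp add: fun_act_def)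
qed

lemma partial_fun_act:
 assumes k: "k \<in> K" and p: "p \<in> Pol s" "fun_act G s k p = p" and f: "f \<in> Cinf s"
 shows "partial G p (fun_act G s k f) = fun_act G s k (partial G p f)"
proof -
 note ki = K_grp(2)[OF k]
 note lin = lin_on_subset[OF Ad_lin[OF KD(1)[OF ki]], of s]
 have sL: "s <= L" using sD by blast
 have 1: "\<exists>x\<in>s. Ad G (inv k) x = y" if "y \<in> s" for y
  using Ad_K_s[OF k that] Ad_inv(1)[OF KD(1)[OF k] sD(1)[OF that]] by blast
 have 2: "Bk (Ad G (inv k) x) (Ad G (inv k) y) = Bk x y" if "x \<in> s" "y \<in> s" for x y
  by (rule killing_Ad[OF KD(1)[OF ki] sD(1)[OF that(1)] sD(1)[OF that(2)]])
 have 3: "der s X (ext0 s (%x. f (Ad G (inv k) x))) = ext0 s (%x. der s (Ad G (inv k) X) f (Ad G (inv k) x))"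
  if X: "X \<in> s" and f: "f \<in> Cinf s" for X f
 proof (rule Cinf_eqI)
  show "der s X (ext0 s (%x. f (Ad G (inv k) x))) \<in> Cinf s"
   by (rule deriv_op_Cinf[OF sub_s Cinf_comp[OF sub_s lin[OF sL] Ad_K_s[OF ki] f] X])
  show "ext0 s (%x. der s (Ad G (inv k) X) f (Ad G (inv k) x)) \<in> Cinf s"
   by (rule Cinf_comp[OF sub_s lin[OF sL] Ad_K_s[OF ki] deriv_op_Cinf[OF sub_s f Ad_K_s[OF ki X]]])
  fix x assume "x \<in> s"
  thus "der s X (ext0 s (%x. f (Ad G (inv k) x))) x = ext0 s (%x. der s (Ad G (inv k) X) f (Ad G (inv k) x)) x"
   using deriv_op_comp[OF sub_s lin[OF sL] Ad_K_s[OF ki] f X] by simp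
 qed
 have "\<forall>f\<in>Cinf s. partial G (ext0 s (%x. p (Ad G (inv k) x))) (ext0 s (%x. f (Ad G (inv k) x))) = ext0 s (%x. partial G p f (Ad G (inv k) x))"
  using si.sym_char_equiv[OF partial_char lin[OF sL] Ad_K_s[OF ki] 1 2 3 p(1)] by blast
 thus ?thesis using p(2) f by (simp add: fun_act_def)
qed

text \<open>The Laplacian is the operator of the quadratic form \<open>Bk x x\<close>. Since this
  polynomial is invariant under \<open>K\<close>, equivariance of the Laplacian becomes a case of
  \<open>partial_fun_act\<close>.\<close>

lemma Lap_partial:
 assumes C: "si.onb s C"
 obtains p where "p \<in> Pol s" "!!x. x \<in> s ==> p x = of_real (Bk x x)" "!!f. f \<in> Cinf s ==> ds.Lap C f = partial G p f"
proof -
 note Cd = si.onbD[OF C]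
 let ?p = "%F x. \<Sum>b\<in>F. si.xf b x * si.xf b x"
 note ch = si.sym_charD[OF partial_char]
 have "?p F \<in> Pol s & (\<forall>f\<in>Cinf s. partial G (?p F) f = (%x. \<Sum>b\<in>F. der s b (der s b f) x))" if "finite F" "F <= C" for F
  using that
 proof (induction F rule: finite_induct)
  case empty
  have e: "?p {} = ext0 s (%_. 0)" by (auto simp: ext0_def)
  show ?case unfolding e using Pol.intros(1)[of s 0] ch(3)[of _ 0] by simp
 next
  case (insert b F)
  have bs: "b \<in> s" using insert Cd(1) by auto
  have e: "?p (insert b F) = si.xf b * si.xf b + ?p F" using insert by (auto simp: fun_eq_iff)
  have IH: "?p F \<in> Pol s" "!!f. f \<in> Cinf s ==> partial G (?p F) f = (%x. \<Sum>b\<in>F. der s b (der s b f) x)" using insert by auto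
  note xP = si.xf_Pol[OF bs]
  note xx = Pol.intros(4)[OF xP xP]
  have "partial G (si.xf b * si.xf b + ?p F) f = (%x. \<Sum>b\<in>insert b F. der s b (der s b f) x)" if f: "f \<in> Cinf s" for f
   unfolding ch(4)[OF xx IH(1)] ch(5)[OF xP xP] ch(6)[OF bs] IH(2)[OF f] using insert by simp
  thus ?case unfolding e using Pol.intros(3)[OF xx IH(1)] by blast
 qed
 from this[OF Cd(2) order_refl] have P: "?p C \<in> Pol s" "!!f. f \<in> Cinf s ==> ds.Lap C f = partial G (?p C) f"
  by (auto simp: ds_Lap)
 have "?p C x = of_real (Bk x x)" if x: "x \<in> s" for x
 proof -
  have bs: "b \<in> s" if "b \<in> C" for b using that Cd(1) by blast
  have "Bk x x = Bk (\<Sum>b\<in>C. Bk x b *R b) x" using Cd(4)[OF x] by simp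
  also have "\<dots> = (\<Sum>b\<in>C. Bk (Bk x b *R b) x)" by (rule si.B_sum) (use bs x si.in_E in auto)
  also have "\<dots> = (\<Sum>b\<in>C. Bk b x * Bk b x)"
   by (rule sum.cong[OF refl]) (use bs x si.B_sym in "simp add: si.B_simps")
  finally show ?thesis using x by simp
 qed
 thus ?thesis using that P by blast
qed

lemma gamma0_Pol: "p \<in> Pol s ==> gamma0 G p \<in> Pol a"
proof (induction rule: Pol.induct)
 case (1 c)
 have "gamma0 G (ext0 s (%_. c)) = ext0 a (%_. c)" using a_s by (auto simp: gamma0_def ext0_def fun_eq_iff subset_iff)
 thus ?case using Pol.intros(1) by metis
next
 case (2 l)
 have l: "lin_on s l" using dual_lin_on[OF sub_s 2] by blast
 have "ext0 a l \<in> dual_space a" by (rule lin_on_dual[OF lin_on_subset[OF l a_s] a_props(1)])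
 moreover have "gamma0 G (%x. cplx (l x)) = (%x. cplx (ext0 a l x))" by (auto simp: gamma0_def ext0_def)
 ultimately show ?case using Pol.intros(2) by metis
next
 case (3 p q)
 have "gamma0 G (p + q) = gamma0 G p + gamma0 G q" by (auto simp: gamma0_def ext0_def)
 thus ?case using Pol.intros(3)[OF 3(3,4)] by (simp only:)
next
 case (4 p q)
 have "gamma0 G (p * q) = gamma0 G p * gamma0 G q" by (auto simp: gamma0_def ext0_def)
 thus ?case using Pol.intros(4)[OF 4(3,4)] by (simp only:)
qed

end

section \<open>The two Laplacians generate the two algebras of operators\<close>

lemma End_0: "T \<in> End_Cinf E ==> subspace E ==> T 0 = 0"
 using End_sum1[of T E "{}::nat set" "%_ x. 0"] by (simp add: zero_fun_def)

context krep
begin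

definition K_equivariant :: "('e fn => 'e fn) => bool" where
 "K_equivariant T \<longleftrightarrow> T \<in> End_Cinf s & (\<forall>k\<in>K. \<forall>f\<in>Cinf s. T (fun_act G s k f) = fun_act G s k (T f))"

lemma fun_act_Cinf: "k \<in> K ==> f \<in> Cinf s ==> fun_act G s k f \<in> Cinf s"
 unfolding fun_act_def
 by (rule Cinf_comp[OF sub_s lin_on_subset[OF Ad_lin[OF KD(1)[OF K_grp(2)]]] Ad_K_s[OF K_grp(2)]]) (use sD in auto)

lemma HK_comp: assumes T: "K_equivariant T" and \<Phi>: "\<Phi> \<in> HK" shows "T o \<Phi> \<in> HK"
proof -
 have TE: "T \<in> End_Cinf s" using T by (simp add: K_equivariant_def)
 note TE' = TE[unfolded End_Cinf_def, simplified]
 have h: "\<Phi> (v + w) = \<Phi> v + \<Phi> w" "\<Phi> (c *s v) = (%x. c * \<Phi> v x)" for v w c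
  using HKD(2,3)[OF \<Phi>] by auto
 have "\<Phi> (\<pi> k v) = fun_act G s k (\<Phi> v)" if "k \<in> K" for k v using \<Phi> that by (simp add: Hom_K_def)
 thus ?thesis
  using TE' HKD(1)[OF \<Phi>] h T unfolding Hom_K_def clinear_Cinf_def K_equivariant_def by simp
qed

abbreviation "HK22 \<equiv> Hom_K_22 G \<pi>"

lemma VD_sub: "0 \<in> VD" "v \<in> VD ==> v \<in> VMs" "v \<in> VD ==> v \<in> XD"
 using VM_sub(3) vec.span_zero by (auto simp: VD_eq XD_def)

lemma HK22_iff: "\<Phi> \<in> HK22 \<longleftrightarrow> \<Phi> \<in> HK & (\<forall>v\<in>VD. gamma0 G (\<Phi> v) = (%x. 0))"
proof -
 have "Gamma0 G \<pi> \<Phi> v = gamma0 G (\<Phi> v)" if "v \<in> VD" for v using VD_sub(2)[OF that] by (simp add: Gamma0_def)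
 moreover have "VD ~= {}" using VD_sub(1) by blast
 ultimately show ?thesis unfolding Hom_K_22_def zero_fun_def by (auto simp: image_def)
qed

lemma HK22_square:
 assumes \<Phi>: "\<Phi> \<in> HK22" and v: "v \<in> VD" and \<alpha>: "\<alpha> \<in> \<Sigma>" and H: "H \<in> a"
 shows "\<Phi> (Zsq \<alpha> v) H = 0"
proof -
 have \<Phi>K: "\<Phi> \<in> HK" using \<Phi> HK22_iff by blast
 let ?Z = "Zvec G \<alpha>"
 note Zk = Zvec_kl(1)[OF \<alpha>] and Hs = a_props(2)[OF H]
 obtain y where y: "!!w. \<Phi> w H = hermitian w y"
  by (rule hermitian_riesz[of "%w. \<Phi> w H"]) (use HKD(2,3)[OF \<Phi>K] that in auto)
 \<comment> \<open>The group \<open>M\<close> fixes H, so the functional represented by y is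
   invariant under it.\<close>
 have "y \<in> VMs"
  unfolding VM_iff
 proof
  fix m assume m: "m \<in> M"
  note mK = M_K[OF m]
  note mc = KD(1)[OF mK]
  have "hermitian w (\<pi> m y) = hermitian w y" for w
  proof -
   have "hermitian w (\<pi> m y) = hermitian (\<pi> (inv m) w) y" using pi_herm_inv[OF K_grp(2)[OF mK], of w y] mc by simp
   also have "\<dots> = \<Phi> w (Ad G m H)" using HKD(4)[OF \<Phi>K K_grp(2)[OF mK] Hs, of w] y mc by simp
   also have "\<dots> = hermitian w y" using m H M_iff y by simp
   finally show ?thesis .
  qed
  hence "hermitian (\<pi> m y - y) (\<pi> m y - y) = 0"
   using hermitian_simps(2)[of "\<pi> m y - y" "\<pi> m y" "- y"] by (simp add: hermitian_simps(8))
  from hermitian_pos[OF this] show "\<pi> m y = y" by simp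
 qed
 then obtain d e where de: "d \<in> VD" "e \<in> VS" "y = d + e" by (rule VM_decomp)
 \<comment> \<open>Evaluation at H kills double-petaled vectors, in particular the double-petaled
   component of y itself; as the two components are orthogonal, that component is zero.\<close>
 have "hermitian d y = 0"
 proof -
  have "gamma0 G (\<Phi> d) H = 0" using \<Phi> de(1) HK22_iff by simp
  thus ?thesis using H y by simp
 qed
 hence "hermitian d d = 0" using VS_XD[OF de(2) VD_sub(3)[OF de(1)]] by (simp add: de(3) hermitian_simps(2))
 hence "d = 0" by (rule hermitian_pos)
 hence yS: "y \<in> VS" using de by simp
 have "\<Phi> (dr ?Z (dr ?Z v)) H = hermitian v (dr ?Z (dr ?Z y))"
  unfolding y by (simp add: drep_skew[OF Zk])
 also have "dr ?Z (dr ?Z y) = (-2) *s (y - \<pi> (kr \<alpha>) y)"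
  unfolding kr_def by (rule zop_zero_square[OF Zk]) (use yS \<alpha> in "simp add: VS_iff")
 also have "hermitian v \<dots> = -2 * (hermitian v y - hermitian v (\<pi> (kr \<alpha>) y))"
  unfolding hermitian_simps(4) using hermitian_simps(2)[of v y "- \<pi> (kr \<alpha>) y"] by (simp add: hermitian_simps(8))
 also have "\<dots> = 0"
  using VS_XD[OF yS VD_sub(3)[OF v]] VS_XD[OF VS_NK[OF kr_props(1)[OF \<alpha>] yS] VD_sub(3)[OF v]] by simp
 finally show ?thesis .
qed

text \<open>S is the radial part of T. The quantification over all equivariant maps, together with
  equivariance of T, allows further operators to be applied, since T o \<Phi> is again such a
  map.\<close>

definition radial :: "('e fn => 'e fn) => ('e fn => 'e fn) => bool" where
 "radial T S \<longleftrightarrow> K_equivariant T & S \<in> End_Cinf a \<and>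
   (\<forall>\<Phi>\<in>HK. \<forall>v\<in>VS. gamma0 G (T (\<Phi> v)) = S (gamma0 G (\<Phi> v))) \<and>
   (\<forall>\<Phi>\<in>HK22. \<forall>v\<in>VD. gamma0 G (T (\<Phi> v)) = (%x. 0))"

lemma radial_HK22: assumes "radial T S" "\<Phi> \<in> HK22" shows "T o \<Phi> \<in> HK22"
proof -
 have "\<forall>v\<in>VD. gamma0 G (T (\<Phi> v)) = (%x. 0)" using assms unfolding radial_def by blast
 moreover have "T o \<Phi> \<in> HK" by (rule HK_comp) (use assms HK22_iff in "auto simp: radial_def")
 ultimately show ?thesis by (simp add: HK22_iff)
qed

lemma radialD:
 assumes "radial T S"
 shows "\<Phi> \<in> HK ==> v \<in> VS ==> gamma0 G (T (\<Phi> v)) = S (gamma0 G (\<Phi> v))"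
  "\<Phi> \<in> HK22 ==> v \<in> VD ==> gamma0 G (T (\<Phi> v)) = (%x. 0)"
 using assms unfolding radial_def by blast+

lemma radial_mop:
 assumes p: "p \<in> Cinf s" "!!k. k \<in> K ==> fun_act G s k p = p" shows "radial (mop s p) (mop a (gamma0 G p))"
proof -
 have "mop s p (fun_act G s k f) = fun_act G s k (mop s p f)" if k: "k \<in> K" and f: "f \<in> Cinf s" for k f
 proof -
  have "(%x. p x * fun_act G s k f x) = (%x. fun_act G s k p x * fun_act G s k f x)" using p(2)[OF k] by simp
  also have "\<dots> = fun_act G s k (%x. p x * f x)" by (auto simp: fun_act_def ext0_def)
  finally show ?thesis using f fun_act_Cinf[OF k f] by simp
 qed
 hence "K_equivariant (mop s p)" using mop_End[OF sub_s p(1)] by (simp add: K_equivariant_def)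
 moreover have "gamma0 G (mop s p (\<Phi> v)) = mop a (gamma0 G p) (gamma0 G (\<Phi> v))" if "\<Phi> \<in> HK" for \<Phi> v
  using HKD(1)[OF that, of v] gamma0_Cinf by (auto simp: gamma0_def ext0_def)
 moreover have "gamma0 G (mop s p (\<Phi> v)) = (%x. 0)" if "\<Phi> \<in> HK22" "v \<in> VD" for \<Phi> v
 proof
  fix x
  have h: "\<Phi> \<in> HK" "gamma0 G (\<Phi> v) x = 0" using that HK22_iff by auto
  thus "gamma0 G (mop s p (\<Phi> v)) x = 0" using HKD(1)[OF h(1), of v] by (auto simp: gamma0_def ext0_def)
 qed
 ultimately show ?thesis unfolding radial_def using mop_End[OF a_props(1) gamma0_Cinf[OF p(1)]] by simp
qed

text \<open>For a product of operators the hypothesis on the outer one is used for the map obtained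
  from \<Phi> by the inner one; it preserves both classes of maps.\<close>

lemma radial_adop:
 assumes L: "radial A B" and T: "radial T S" shows "radial (adop s A T) (adop a B S)"
proof -
 have AE: "A \<in> End_Cinf s" "T \<in> End_Cinf s" "B \<in> End_Cinf a" "S \<in> End_Cinf a" "K_equivariant A" "K_equivariant T"
  using L T by (auto simp: radial_def K_equivariant_def)
 have "adop s A T (fun_act G s k f) = fun_act G s k (adop s A T f)" if k: "k \<in> K" and f: "f \<in> Cinf s" for k f
 proof -
  note Af = End_CinfD(1)[OF AE(1) f] End_CinfD(1)[OF AE(2) f]
  have "A (T (fun_act G s k f)) = fun_act G s k (A (T f))" "T (A (fun_act G s k f)) = fun_act G s k (T (A f))"
   using AE(5,6) k f Af by (simp_all add: K_equivariant_def)
  thus ?thesis using f fun_act_Cinf[OF k f] by (simp add: fun_act_def) (auto simp: ext0_def)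
 qed
 hence eq: "K_equivariant (adop s A T)" using adop_End[OF sub_s AE(1,2)] by (simp add: K_equivariant_def)
 have g: "gamma0 G (adop s A T (\<Phi> v)) x = (1/2) * gamma0 G (A ((T o \<Phi>) v)) x + (-1/2) * gamma0 G (T ((A o \<Phi>) v)) x"
  if "\<Phi> \<in> HK" for \<Phi> v x
  using HKD(1)[OF that, of v] by (simp add: gamma0_def ext0_def)
 have "gamma0 G (adop s A T (\<Phi> v)) = adop a B S (gamma0 G (\<Phi> v))" if \<Phi>: "\<Phi> \<in> HK" and v: "v \<in> VS" for \<Phi> v
 proof -
  have "gamma0 G (A ((T o \<Phi>) v)) = B (S (gamma0 G (\<Phi> v)))" "gamma0 G (T ((A o \<Phi>) v)) = S (B (gamma0 G (\<Phi> v)))"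
   unfolding radialD(1)[OF L HK_comp[OF AE(6) \<Phi>] v] radialD(1)[OF T HK_comp[OF AE(5) \<Phi>] v]
   by (simp_all add: radialD(1)[OF L \<Phi> v] radialD(1)[OF T \<Phi> v])
  thus ?thesis using g[OF \<Phi>] gamma0_Cinf[OF HKD(1)[OF \<Phi>]] by (simp add: fun_eq_iff)
 qed
 moreover have "gamma0 G (adop s A T (\<Phi> v)) = (%x. 0)" if \<Phi>: "\<Phi> \<in> HK22" and v: "v \<in> VD" for \<Phi> v
 proof
  fix x
  have "gamma0 G (A ((T o \<Phi>) v)) x = 0" "gamma0 G (T ((A o \<Phi>) v)) x = 0"
   unfolding radialD(2)[OF L radial_HK22[OF T \<Phi>] v] radialD(2)[OF T radial_HK22[OF L \<Phi>] v] by simp_all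
  thus "gamma0 G (adop s A T (\<Phi> v)) x = 0" using g[of \<Phi> v x] \<Phi> HK22_iff by simp
 qed
 ultimately show ?thesis unfolding radial_def using eq adop_End[OF a_props(1) AE(3,4)] by simp
qed

lemma radial_adop_pow:
 assumes "radial A B" "radial T S" shows "radial ((adop s A ^^ d) T) ((adop a B ^^ d) S)"
 by (induction d) (simp_all add: assms radial_adop)

text \<open>The base case. The radial formula over the positive roots is rewritten as a sum over
  \<open>R1\<close> and compared with \<open>Lap_explicit\<close> at regular points.\<close>

lemma radial_Lap:
 obtains C Ca where "si.onb s C" "ai.onb a Ca" "radial (ds.Lap C) (dl.Lap Ca)"
proof -
 obtain Ca where Ca: "ai.onb a Ca" by (rule ai.onb_exists[OF a_props(1) order_refl])
 obtain C where C: "si.onb s C" and LC: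
  "!!\<Phi> v H. \<Phi> \<in> HK ==> v \<in> VMs ==> H \<in> a ==> reg H ==>
   ds.Lap C (\<Phi> v) H = (\<Sum>b\<in>Ca. der a b (der a b (gamma0 G (\<Phi> v))) H) +
    (\<Sum>\<alpha>\<in>pos_roots G. of_nat (dim (rs \<alpha>)) * (rad \<Phi> v (gamma0 G (\<Phi> v)) H \<alpha>))"
  by (rule Lap_radial[OF Ca], rule that)
 have LE: "ds.Lap C \<in> End_Cinf s" by (rule ds.Lap_End[OF si.onbD(1)[OF C]])
 have Cas: "Ca <= a" by (rule ai.onbD(1)[OF Ca])
 have LaE: "dl.Lap Ca \<in> End_Cinf a" by (rule dl.Lap_End[OF Cas])
 obtain p where p: "p \<in> Pol s" "!!x. x \<in> s ==> p x = of_real (Bk x x)" "!!f. f \<in> Cinf s ==> ds.Lap C f = partial G p f"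
  by (rule Lap_partial[OF C], rule that)
 have pk: "fun_act G s k p = p" if k: "k \<in> K" for k
 proof
  fix x
  note ki = K_grp(2)[OF k]
  show "fun_act G s k p x = p x"
  proof (cases "x \<in> s")
   case True
   thus ?thesis
    using p(2)[OF True] p(2)[OF Ad_K_s[OF ki True]] killing_Ad[OF KD(1)[OF ki] sD(1)[OF True] sD(1)[OF True]] by (simp add: fun_act_def)
  next
   case False
   thus ?thesis using Cinf_out[OF si.Pol_Cinf[OF p(1)]] by (simp add: fun_act_def)
  qed
 qed
 have eq: "K_equivariant (ds.Lap C)"
  unfolding K_equivariant_def using LE partial_fun_act[OF _ p(1) pk] p(3) fun_act_Cinf by simp
 have zero: "der a b (%x. 0) x = 0" if "b \<in> a" "x \<in> a" for b x
  using deriv_op_scale[OF a_props(1) Cinf_zero[OF a_props(1)] that, of 0] by simp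
 have S: "gamma0 G (ds.Lap C (\<Phi> v)) = dl.Lap Ca (gamma0 G (\<Phi> v))" if \<Phi>: "\<Phi> \<in> HK" and v: "v \<in> VS" for \<Phi> v
 proof (rule a_dense)
  note f = gamma0_Cinf[OF HKD(1)[OF \<Phi>, of v]]
  show "gamma0 G (ds.Lap C (\<Phi> v)) \<in> Cinf a" by (rule gamma0_Cinf[OF End_CinfD(1)[OF LE HKD(1)[OF \<Phi>]]])
  show "dl.Lap Ca (gamma0 G (\<Phi> v)) \<in> Cinf a" by (rule End_CinfD(1)[OF LaE f])
  fix x assume x: "x \<in> a" and xr: "reg x"
  let ?f = "gamma0 G (\<Phi> v)"
  define t where "t \<alpha> = der a (Hv \<alpha>) ?f x / of_real (\<alpha> x) - of_real (nrm \<alpha> / 2) * (?f x - ?f (refl G \<alpha> x)) / of_real ((\<alpha> x)\<^sup>2)" for \<alpha>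
  \<comment> \<open>Doubling \<alpha> scales its vector and its values by 2 and its norm by 4, so
    both terms are unchanged; roots on one ray thus share a summand.\<close>
  have t2: "t (fscale 2 \<alpha>) = t \<alpha>" if \<alpha>: "\<alpha> \<in> \<Sigma>" for \<alpha>
  proof -
   note d = rootD(1)[OF \<alpha>]
   have "nrm (fscale 2 \<alpha>) = 4 * nrm \<alpha>" unfolding Hvec_scale[OF d] using Hvec_props(1)[OF d] by (simp add: ai.B_simps)
   moreover have "der a (Hv (fscale 2 \<alpha>)) ?f x = 2 * der a (Hv \<alpha>) ?f x"
    unfolding Hvec_scale[OF d] using deriv_op_dir_linear(2)[OF a_props(1) f Hvec_props(1)[OF d] Hvec_props(1)[OF d]] by simp
   moreover have "fscale 2 \<alpha> x = 2 * \<alpha> x" by (simp add: fscale_def)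
   ultimately show ?thesis unfolding t_def refl_scale[OF d, of 2, simplified] using bspec[OF xr \<alpha>] by (simp add: power2_eq_square field_simps)
  qed
  \<comment> \<open>The -2 of \<open>zop_zero_square\<close> turns nrm \<alpha> / 4 into -nrm
    \<alpha> / 2, the coefficient of the difference term.\<close>
  have summand: "rad \<Phi> v ?f x \<alpha> = t \<alpha>" if \<alpha>: "\<alpha> \<in> \<Sigma>" for \<alpha>
  proof -
   have "Zsq \<alpha> v = (-2) *s (v - \<pi> (kr \<alpha>) v)"
    unfolding kr_def by (rule zop_zero_square[OF Zvec_kl(1)[OF \<alpha>]]) (use v \<alpha> in "simp add: VS_iff")
   also have "\<dots> = (-2) *s v + 2 *s \<pi> (kr \<alpha>) v" by (simp add: vec_eq_iff algebra_simps)
   finally have "\<Phi> (Zsq \<alpha> v) x = -2 * \<Phi> v x + 2 * \<Phi> (\<pi> (kr \<alpha>) v) x"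
    by (simp only: HKD(2,3)[OF \<Phi>])
   also have "\<Phi> (\<pi> (kr \<alpha>) v) x = \<Phi> v (refl G \<alpha> x)"
    using HKD(4)[OF \<Phi> NKD(1)[OF kr_props(1)[OF \<alpha>]] a_props(2)[OF x]] refl_invol(2)[OF \<alpha> x] by simp
   finally have e: "\<Phi> (Zsq \<alpha> v) x = -2 * (?f x - ?f (refl G \<alpha> x))"
    using x refl_invol(1)[OF \<alpha> x] by (simp add: algebra_simps)
   have "cplx (nrm \<alpha> / 4) * (-2 * (?f x - ?f (refl G \<alpha> x))) = - (of_real (nrm \<alpha> / 2) * (?f x - ?f (refl G \<alpha> x)))"
    by (simp add: field_simps)
   thus ?thesis unfolding t_def e by simp
  qed
  have "gamma0 G (ds.Lap C (\<Phi> v)) x = (\<Sum>b\<in>Ca. der a b (der a b ?f) x) + (\<Sum>\<alpha>\<in>pos_roots G. of_nat (dim (rs \<alpha>)) * t \<alpha>)"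
  proof -
   have "(\<Sum>\<alpha>\<in>pos_roots G. of_nat (dim (rs \<alpha>)) * (rad \<Phi> v ?f x \<alpha>)) = (\<Sum>\<alpha>\<in>pos_roots G. of_nat (dim (rs \<alpha>)) * t \<alpha>)"
    by (rule sum.cong[OF refl]) (use summand in "simp add: pos_roots_def")
   thus ?thesis using LC[OF \<Phi> VS_VM[OF v] x xr] x by simp
  qed
  also have "(\<Sum>\<alpha>\<in>pos_roots G. of_nat (dim (rs \<alpha>)) * t \<alpha>) = (\<Sum>\<beta>\<in>R1_pos G. of_real (2 * m0 G \<beta>) * t \<beta>)"
   by (rule sum_pos_roots) (rule t2)
  also have "(\<Sum>b\<in>Ca. der a b (der a b ?f) x) + \<dots> = dl.Lap Ca ?f x"
  proof -
   have e: "dl.Lap Ca ?f x = (\<Sum>b\<in>Ca. der a b (der a b ?f) x) +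
    (\<Sum>\<beta>\<in>R1_pos G. of_real (2 * m0 G \<beta>) * (der a (Hv \<beta>) ?f x / of_real (\<beta> x) -
     of_real (nrm \<beta> / 2) * (?f x - ?f (da.rf \<beta> x)) / of_real ((\<beta> x)\<^sup>2)))"
   proof (rule dl.Lap_explicit[OF Ca x _ f])
    show "\<beta> x ~= 0" if "\<beta> \<in> R1_pos G" for \<beta> using bspec[OF xr R1_root[of \<beta>]] that by (simp add: R1_pos_def fscale_def)
   qed
   show ?thesis unfolding e t_def da_rf by simp
  qed
  finally show "gamma0 G (ds.Lap C (\<Phi> v)) x = dl.Lap Ca ?f x" .
 qed
 \<comment> \<open>The restriction to \<open>a\<close> vanishes, so all derivatives along
   \<open>a\<close> drop out and only the terms treated by \<open>HK22_square\<close> are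
   left.\<close>
 have Dd: "gamma0 G (ds.Lap C (\<Phi> v)) = (%x. 0)" if \<Phi>: "\<Phi> \<in> HK22" and v: "v \<in> VD" for \<Phi> v
 proof (rule a_dense)
  have \<Phi>K: "\<Phi> \<in> HK" and f0: "gamma0 G (\<Phi> v) = (%x. 0)" using \<Phi> v HK22_iff by auto
  show "gamma0 G (ds.Lap C (\<Phi> v)) \<in> Cinf a" by (rule gamma0_Cinf[OF End_CinfD(1)[OF LE HKD(1)[OF \<Phi>K]]])
  show "(%x. 0) \<in> Cinf a" by (rule Cinf_zero[OF a_props(1)])
  fix x assume x: "x \<in> a" and xr: "reg x"
  have d0: "der a b (%x. 0) = (%x. 0)" if "b \<in> a" for b
   by (rule Cinf_eqI[OF deriv_op_Cinf[OF a_props(1) Cinf_zero[OF a_props(1)] that] Cinf_zero[OF a_props(1)]]) (use zero that in auto)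
  have "(\<Sum>b\<in>Ca. der a b (der a b (%x. 0)) x) = 0"
   by (rule sum.neutral) (use d0 Cas in auto)
  moreover have "(\<Sum>\<alpha>\<in>pos_roots G. of_nat (dim (rs \<alpha>)) * (rad \<Phi> v (%x. 0) x \<alpha>)) = 0"
  proof (rule sum.neutral, rule ballI)
   fix \<alpha> assume "\<alpha> \<in> pos_roots G"
   hence \<alpha>: "\<alpha> \<in> \<Sigma>" by (simp add: pos_roots_def)
   show "of_nat (dim (rs \<alpha>)) * (rad \<Phi> v (%x. 0) x \<alpha>) = 0"
    using zero[OF Hvec_props(1)[OF rootD(1)[OF \<alpha>]] x] HK22_square[OF \<Phi> v \<alpha> x] by simp
  qed
  ultimately show "gamma0 G (ds.Lap C (\<Phi> v)) x = 0"
   using LC[OF \<Phi>K VD_sub(2)[OF v] x xr] x f0 by simp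
 qed
 have "radial (ds.Lap C) (dl.Lap Ca)" unfolding radial_def using eq LaE S Dd by blast
 thus ?thesis by (rule that[OF C Ca])
qed

lemma radial_partial:
 assumes \<Delta>: "\<Delta> \<in> S_s_K G" shows "radial (partial G \<Delta>) (dunkl G (gamma0 G \<Delta>))"
proof -
 have P: "\<Delta> \<in> Pol s" and inv: "!!k. k \<in> K ==> fun_act G s k \<Delta> = \<Delta>" using \<Delta> by (auto simp: S_s_K_def)
 obtain q n where hd: "hdec s \<Delta> q n" using hdec_exists[OF sub_s P] by blast
 have qC: "q d \<in> Cinf s" for d using polh_Cinf[OF _ sub_s] hd by (auto simp: hdec_def)
 \<comment> \<open>The group acts linearly and so preserves degrees; uniqueness of homogeneous
   components makes each of them invariant, as \<open>radial_mop\<close> demands.\<close>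
 have qk: "fun_act G s k (q d) = q d" if k: "k \<in> K" for k d
 proof -
  note ki = K_grp(2)[OF k]
  have "hdec s (ext0 s (%x. \<Delta> (Ad G (inv k) x))) (%d. ext0 s (%x. q d (Ad G (inv k) x))) n"
   by (rule hdec_comp[OF hd Ad_K_s[OF ki] lin_on_subset[OF Ad_lin[OF KD(1)[OF ki]]]]) (use sD in auto)
  hence "hdec s \<Delta> (%d. fun_act G s k (q d)) n" using inv[OF k] by (simp add: fun_act_def)
  from hdec_unique[OF sub_s this hd] show ?thesis by (rule fun_cong)
 qed
 have hda: "hdec a (gamma0 G \<Delta>) (%d. gamma0 G (q d)) n"
  using hdec_comp[OF hd, of a "%x. x"] a_s unfolding gamma0_def by (auto simp: lin_on_def)
 obtain C Ca where C: "si.onb s C" "ai.onb a Ca" "radial (ds.Lap C) (dl.Lap Ca)" by (rule radial_Lap)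
 define T where "T d = (adop s (ds.Lap C) ^^ d) (mop s (q d))" for d
 define S where "S d = (adop a (dl.Lap Ca) ^^ d) (mop a (gamma0 G (q d)))" for d
 have r: "radial (T d) (S d)" for d unfolding T_def S_def by (rule radial_adop_pow[OF C(3) radial_mop[OF qC qk]])
 have pT: "partial G \<Delta> f x = (\<Sum>d\<le>n. (1 / fact d) * T d f x)" for f x
  using ds.sym_hom_formula[OF C(1) P hd] by (simp add: partial_def ds_D T_def)
 have dS: "dunkl G (gamma0 G \<Delta>) f x = (\<Sum>d\<le>n. (1 / fact d) * S d f x)" for f x
  using dl.sym_hom_formula[OF C(2) gamma0_Pol[OF P] hda] by (simp add: dunkl_def da_D S_def)
 have g: "gamma0 G (partial G \<Delta> f) x = (\<Sum>d\<le>n. (1 / fact d) * gamma0 G (T d f) x)" for f x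
  by (cases "x \<in> a") (simp_all add: pT gamma0_def)
 have "K_equivariant (partial G \<Delta>)"
  unfolding K_equivariant_def using si.sym_charD(1)[OF partial_char P] partial_fun_act[OF _ P inv] by simp
 moreover have "dunkl G (gamma0 G \<Delta>) \<in> End_Cinf a" by (rule ai.sym_charD(1)[OF dunkl_char gamma0_Pol[OF P]])
 moreover have "gamma0 G (partial G \<Delta> (\<Phi> v)) = dunkl G (gamma0 G \<Delta>) (gamma0 G (\<Phi> v))" if "\<Phi> \<in> HK" "v \<in> VS" for \<Phi> v
  using r that by (intro ext) (simp add: g dS radial_def)
 moreover have "gamma0 G (partial G \<Delta> (\<Phi> v)) = (%x. 0)" if "\<Phi> \<in> HK22" "v \<in> VD" for \<Phi> v
  using r that by (intro ext) (simp add: g radial_def)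
 ultimately show ?thesis unfolding radial_def by blast
qed

text \<open>One statement for both \<open>VM\<close> and \<open>VM_single\<close>. All
  representatives of Weyl group elements lie in the normalizer, so equivariance under it
  suffices.\<close>

lemma Hom_W_comp:
 assumes \<Phi>: "\<Phi> \<in> HK" and U: "U <= VMs" "!!v w. v \<in> U ==> w \<in> U ==> v + w \<in> U" "!!c v. v \<in> U ==> c *s v \<in> U"
   "!!k v. k \<in> NK ==> v \<in> U ==> \<pi> k v \<in> U"
  and S: "S \<in> End_Cinf a" "!!k f. k \<in> NK ==> f \<in> Cinf a ==> S (fun_act G a k f) = fun_act G a k (S f)"
 shows "S o ext0 U (gamma0 G o \<Phi>) \<in> Hom_W G \<pi> U"
proof -
 have gC: "gamma0 G (\<Phi> v) \<in> Cinf a" for v by (rule gamma0_Cinf[OF HKD(1)[OF \<Phi>]])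
 have add: "gamma0 G (\<Phi> (v + w)) = gamma0 G (\<Phi> v) + gamma0 G (\<Phi> w)" for v w
  by (auto simp: gamma0_def ext0_def HKD(2)[OF \<Phi>])
 have scale: "gamma0 G (\<Phi> (c *s v)) = (%x. c * gamma0 G (\<Phi> v) x)" for c v
  by (auto simp: gamma0_def ext0_def HKD(3)[OF \<Phi>])
 have act: "gamma0 G (\<Phi> (\<pi> k v)) = fun_act G a k (gamma0 G (\<Phi> v))" if k: "k \<in> NK" for k v
 proof
  fix x
  show "gamma0 G (\<Phi> (\<pi> k v)) x = fun_act G a k (gamma0 G (\<Phi> v)) x"
   using HKD(4)[OF \<Phi> NKD(1)[OF k] a_props(2)] NKD(4)[OF NK_inv[OF k]] by (simp add: gamma0_def ext0_def fun_act_def)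
 qed
 note SE = S(1)[unfolded End_Cinf_def, simplified]
 have "S o ext0 U (gamma0 G o \<Phi>) \<in> clinear_Cinf U a"
  unfolding clinear_Cinf_def using SE gC End_0[OF S(1) a_props(1)] U(2,3) by (simp add: add scale)
 moreover have "(S o ext0 U (gamma0 G o \<Phi>)) (\<pi> k v) = fun_act G a k ((S o ext0 U (gamma0 G o \<Phi>)) v)" if "k \<in> NK" "v \<in> U" for k v
  using that U(4)[OF that] S(2)[OF that(1) gC] act[OF that(1)] by simp
 ultimately show ?thesis unfolding Hom_W_def using Weyl_NK by simp
qed

end

theorem theorem3p4:
  fixes G :: "('a, 'e::euclidean_space) iwasawa_data"
    and \<pi> :: "('a, 'n::finite) rep"
    and \<Delta> :: "'e \<Rightarrow> complex"
    and \<Phi> :: "complex^'n \<Rightarrow> 'e \<Rightarrow> complex"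
  assumes "setting G"
    and "\<pi> \<in> K_hat_M G"
    and "\<Delta> \<in> S_s_K G"
    and "\<Phi> \<in> Hom_K G \<pi>"
  shows
    "(partial G \<Delta> \<circ> \<Phi> \<in> Hom_K G \<pi> \<and>
      dunkl G (gamma0 G \<Delta>) \<circ> Gamma0 G \<pi> \<Phi> \<in> Hom_W G \<pi> (VM G \<pi>) \<and>
      dunkl G (gamma0 G \<Delta>) \<circ> Gamma0_tilde G \<pi> \<Phi> \<in> Hom_W G \<pi> (VM_single G \<pi>) \<and>
      Gamma0_tilde G \<pi> (partial G \<Delta> \<circ> \<Phi>) = dunkl G (gamma0 G \<Delta>) \<circ> Gamma0_tilde G \<pi> \<Phi>)
   \<and> (\<Phi> \<in> Hom_K_22 G \<pi> \<longrightarrow>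
      partial G \<Delta> \<circ> \<Phi> \<in> Hom_K_22 G \<pi> \<and>
      Gamma0 G \<pi> (partial G \<Delta> \<circ> \<Phi>) = dunkl G (gamma0 G \<Delta>) \<circ> Gamma0 G \<pi> \<Phi>)
   \<and> (\<pi> \<in> K_hat_sp G \<longrightarrow>
      Gamma0 G \<pi> (partial G \<Delta> \<circ> \<Phi>) = dunkl G (gamma0 G \<Delta>) \<circ> Gamma0 G \<pi> \<Phi>)"
proof -
 interpret krep G \<pi> by unfold_locales (use assms in "auto simp: K_hat_M_def")
 have \<Phi>: "\<Phi> \<in> HK" by fact
 let ?T = "partial G \<Delta>" and ?S = "dunkl G (gamma0 G \<Delta>)"
 have rad: "radial ?T ?S" by (rule radial_partial) fact
 have P: "\<Delta> \<in> Pol s" and inv: "!!k. k \<in> K ==> fun_act G s k \<Delta> = \<Delta>" using assms(3) by (auto simp: S_s_K_def)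
 have SE: "?S \<in> End_Cinf a" and TK: "K_equivariant ?T" using rad by (auto simp: radial_def)
 \<comment> \<open>Outside the submodule the restricted maps are extended by 0, and S must preserve
   this value.\<close>
 note S0 = End_0[OF SE a_props(1)]
 have ginv: "fun_act G a k (gamma0 G \<Delta>) = gamma0 G \<Delta>" if k: "k \<in> NK" for k
 proof
  fix x
  show "fun_act G a k (gamma0 G \<Delta>) x = gamma0 G \<Delta> x"
   using fun_cong[OF inv[OF NKD(1)[OF k]], of x] NKD(4)[OF NK_inv[OF k], of x] a_props(2)[of x]
   by (cases "x \<in> a") (simp_all add: fun_act_def gamma0_def ext0_def)
 qed
 note SW = dunkl_fun_act[OF _ gamma0_Pol[OF P] ginv]
 have 1: "?T o \<Phi> \<in> HK" by (rule HK_comp[OF TK \<Phi>])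
 have 2: "?S o Gamma0 G \<pi> \<Phi> \<in> Hom_W G \<pi> VMs"
  unfolding Gamma0_def by (rule Hom_W_comp[OF \<Phi> order_refl]) (use VM_sub VM_NK SE SW in auto)
 have 3: "?S o Gamma0_tilde G \<pi> \<Phi> \<in> Hom_W G \<pi> VS"
  unfolding Gamma0_tilde_def by (rule Hom_W_comp[OF \<Phi>]) (use VS_VM VS_sub VS_NK SE SW in auto)
 have 4: "Gamma0_tilde G \<pi> (?T o \<Phi>) = ?S o Gamma0_tilde G \<pi> \<Phi>"
 proof
  fix v show "Gamma0_tilde G \<pi> (?T o \<Phi>) v = (?S o Gamma0_tilde G \<pi> \<Phi>) v"
   using rad \<Phi> S0 by (cases "v \<in> VS") (simp_all add: Gamma0_tilde_def radial_def)
 qed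
 have 5: "?T o \<Phi> \<in> HK22 & Gamma0 G \<pi> (?T o \<Phi>) = ?S o Gamma0 G \<pi> \<Phi>" if \<Phi>2: "\<Phi> \<in> HK22"
 proof (intro conjI ext)
  show T2: "?T o \<Phi> \<in> HK22" by (rule radial_HK22[OF rad \<Phi>2])
  fix v x
  \<comment> \<open>A double-petaled summand does not change the restriction to \<open>a\<close>, so
    both sides are computed on the single-petaled component.\<close>
  have split: "gamma0 G (\<Psi> v) = gamma0 G (\<Psi> w)" if \<Psi>: "\<Psi> \<in> HK22" and u: "u \<in> VD" "v = u + w" for \<Psi> u w
  proof
   fix x
   have "\<Psi> \<in> HK" "gamma0 G (\<Psi> u) x = 0" using \<Psi> u(1) HK22_iff by auto
   thus "gamma0 G (\<Psi> v) x = gamma0 G (\<Psi> w) x" unfolding u(2) by (simp add: gamma0_def ext0_def HKD(2) split: if_splits)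
  qed
  show "Gamma0 G \<pi> (?T o \<Phi>) v x = (?S o Gamma0 G \<pi> \<Phi>) v x"
  proof (cases "v \<in> VMs")
   case True
   then obtain u w where uw: "u \<in> VD" "w \<in> VS" "v = u + w" by (rule VM_decomp)
   have "gamma0 G ((?T o \<Phi>) v) = ?S (gamma0 G (\<Phi> v))"
    unfolding split[OF T2 uw(1,3)] split[OF \<Phi>2 uw(1,3)] using rad \<Phi> uw(2) by (simp add: radial_def)
   thus ?thesis using True by (simp add: Gamma0_def)
  qed (simp add: Gamma0_def S0)
 qed
 have 6: "Gamma0 G \<pi> (?T o \<Phi>) = ?S o Gamma0 G \<pi> \<Phi>" if "\<pi> \<in> K_hat_sp G"
  using 4 that unfolding Gamma0_tilde_def Gamma0_def K_hat_sp_def by simp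
 show ?thesis using 1 2 3 4 5 6 by blast
qed

end
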